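(* Let $\theta>0$, let $D_N\subset\frac1N\mathbb{Z}^2$ be such that both $D_N$ and $\frac1N\mathbb{Z}^2\setminus D_N$ are non-empty, and fix $z\in D_N$ and $a>0$. For any bounded measurable admissible function $F$, $$\mathbb{E}\left[F(\mathcal{L}_{D_N}^\theta)\,\mathcal{M}_a^N(\{z\})\right]=\frac{q_N(z)^\theta\log N}{N^2\,\Gamma(\theta)}\int_a^{+\infty}\rho^{\theta-1}\frac{c_0^\rho}{N^{\rho-a}}\,\mathrm{CR}_N(z,D_N)^\rho\ \mathbb{E}\left[F\big(\mathcal{L}_{D_N\setminus\{z\}}^\theta\cup\{\Xi_{N,a_i}^z,\ i\ge1\}\big)\right]d\rho,$$ where on the right-hand side $\mathcal{L}_{D_N\setminus\{z\}}^\theta$ and $\{\Xi_{N,a_i}^z,\ i\ge1\}$ are independent, $(a_i)_{i\ge1}$ is a Poisson–Dirichlet partition $\mathrm{PD}(0,\theta)$ of $[0,\rho]$, and the $\Xi_{N,a_i}^z$ are conditionally independent given $(a_i)_{i\ge1}$.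
   Context: $N\ge2$ is an integer. Let $X^{(N)}$ be the continuous-time simple random walk on $\frac1N\mathbb{Z}^2$ with exponential holding times of mean $\frac1{4N^2}$. For a subset $E\subset\frac1N\mathbb{Z}^2$: $p_E(t,z,w)=N^2\,\mathbb{P}^z(X_t^{(N)}=w,\ X^{(N)}\text{ has not left }E\text{ by time }t)$; $G_E(z,w)=\int_0^\infty p_E(t,z,w)dt$; $\mathbb{P}_{E,t}^{z,w}$ is the law of $(X_s^{(N)})_{0\le s\le t}$ from $z$ conditioned on $X_t^{(N)}=w$ and on staying in $E$; $\mu_E^{z,w}=\int_0^\infty\mathbb{P}_{E,t}^{z,w}\,p_E(t,z,w)dt$; $\mu_E^{\rm loop}=\frac1{N^2}\sum_{z\in E}\int_0^\infty\mathbb{P}_{E,t}^{z,z}\,p_E(t,z,z)\frac{dt}t$; and the random walk loop soup $\mathcal{L}_E^\theta$ is a Poisson point process with intensity $\theta\mu_E^{\rm loop}$. For a path $\wp$ of duration $T(\wp)$, $\ell_z(\wp)=N^2\int_0^{T(\wp)}\mathbf{1}_{\{\wp(t)=z\}}dt$. The measure $\mathcal{M}_a^N$ is defined by $$\mathcal{M}_a^N(\{z\})=\frac{(\log N)^{1-\theta}}{N^{2-a}}\,\mathbf{1}\Big\{\sum_{\wp\in\mathcal{L}_{D_N}^\theta}\ell_z(\wp)\ge\tfrac{1}{2\pi}a(\log N)^2\Big\}.$$ $c_0=2\sqrt2\,e^{\gamma_{\rm EM}}$ with $\gamma_{\rm EM}$ the Euler–Mascheroni constant, $\mathrm{CR}_N(z,D_N)=Nc_0^{-1}e^{-(\log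 N)^2/(2\pi G_{D_N}(z,z))}$, $q_N(z)=\frac{\log N}{2\pi G_{D_N}(z,z)}$. Excursion measure: $\check\mu_{D_N}^{z,z}=\sum\mu_{D_N\setminus\{z\}}^{z',w'}$, the sum being over $z',w'\in D_N\setminus\{z\}$ with $|z'-z|=|w'-z|=\frac1N$; to each path one adds an initial jump from $z$ to $z'$ and a final jump from $w'$ to $z$ (no time spent at $z$). $\tilde\mu_{D_N}^{z,z}=(\frac1{2\pi}\log N)^2\check\mu_{D_N}^{z,z}$. For $\alpha>0$, $\Xi_{N,\alpha}^z$ is the random loop in $D_N$ obtained by concatenating a Poisson point process of excursions from $z$ to $z$ of intensity $2\pi\alpha\,\tilde\mu_{D_N}^{z,z}$ and having local time at $z$ equal to $\ell_z(\Xi_{N,\alpha}^z)=\frac1{2\pi}\alpha(\log N)^2$. Loops are considered unrooted, and a function $F$ of collections of loops is admissible if it does not depend on the order of the excursions away from $z$ in the loops visiting $z$. A $\mathrm{PD}(0,\theta)$ partition of $[0,\rho]$ is $\rho$ times a Poisson–Dirichlet sequence of parameter $\theta$. *)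

theory Defs
  imports "HOL-Probability.Probability"
begin

text \<open>A collection of points is a countable multiset, encoded by its multiplicity function;
  \<open>collection_of I X\<close> is the collection \<open>{X i, i \<in> I}\<close>, repetitions counted.\<close>

type_synonym 'a collection = "'a \<Rightarrow> enat"

definition collection_of :: "nat set \<Rightarrow> (nat \<Rightarrow> 'a) \<Rightarrow> 'a collection" where
  "collection_of I X = (\<lambda>x. if finite {i\<in>I. X i = x} then enat (card {i\<in>I. X i = x}) else \<infinity>)"

definition collection_union :: "'a collection \<Rightarrow> 'a collection \<Rightarrow> 'a collection" where
  "collection_union C C' = (\<lambda>x. C x + C' x)"

definition collection_sum :: "('a \<Rightarrow> ennreal) \<Rightarrow> 'a collection \<Rightarrow> ennreal" where
  "collection_sum f C = (\<integral>\<^sup>+x. ennreal_of_enat (C x) * f x \<partial>count_space UNIV)"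

definition npoints :: "'a collection \<Rightarrow> 'a set \<Rightarrow> ennreal" where
  "npoints C B = collection_sum (indicator B) C"

definition collections :: "'a measure \<Rightarrow> 'a collection set" where
  "collections S = {C. countable {x. C x \<noteq> 0} \<and> {x. C x \<noteq> 0} \<subseteq> space S}"

definition collection_space :: "'a measure \<Rightarrow> 'a collection measure" where
  "collection_space S = sigma (collections S)
     {(\<lambda>C. npoints C B) -` U \<inter> collections S | B U. B \<in> sets S \<and> U \<in> sets borel}"

definition poisson_point_process ::
    "'w measure \<Rightarrow> ('w \<Rightarrow> 'a collection) \<Rightarrow> 'a measure \<Rightarrow> bool" where
  "poisson_point_process M \<eta> \<mu> \<longleftrightarrow>
     prob_space M \<and> \<eta> \<in> M \<rightarrow>\<^sub>M collection_space \<mu> \<and>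
     (\<forall>B\<in>sets \<mu>. emeasure \<mu> B < \<infinity> \<longrightarrow>
        (\<forall>k::nat. measure M {\<omega>\<in>space M. npoints (\<eta> \<omega>) B = of_nat k}
           = exp (- measure \<mu> B) * measure \<mu> B ^ k / fact k)) \<and>
     (\<forall>B\<in>sets \<mu>. emeasure \<mu> B = \<infinity> \<longrightarrow> (AE \<omega> in M. npoints (\<eta> \<omega>) B = \<infinity>)) \<and>
     (\<forall>(n::nat) B. (\<forall>i<n. B i \<in> sets \<mu>) \<and> disjoint_family_on B {..<n} \<longrightarrow>
        prob_space.indep_vars M (\<lambda>_. borel) (\<lambda>i \<omega>. npoints (\<eta> \<omega>) (B i)) {..<n})"

definition beta_density :: "real \<Rightarrow> real \<Rightarrow> real \<Rightarrow> real" where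
  "beta_density p q y =
     indicator {0<..<1} y * y powr (p - 1) * (1 - y) powr (q - 1) / Beta p q"

definition stick_breaking :: "(nat \<Rightarrow> real) \<Rightarrow> nat \<Rightarrow> real" where
  "stick_breaking y n = y n * (\<Prod>i<n. 1 - y i)"

text \<open>Decreasing rearrangement of a positive sequence tending to 0.\<close>

definition ranked :: "(nat \<Rightarrow> real) \<Rightarrow> nat \<Rightarrow> real" where
  "ranked x n = Sup {t. 0 < t \<and> n < card {i. t \<le> x i}}"

text \<open>The Pitman--Yor definition of \<open>PD(\<alpha>,\<theta>)\<close> for \<open>\<alpha> = 0\<close>: the ranked sequence of stick
  lengths, with independent \<open>Beta(1,\<theta>)\<close> breaking fractions.\<close>

definition poisson_dirichlet :: "real \<Rightarrow> (nat \<Rightarrow> real) measure" where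
  "poisson_dirichlet \<theta> =
     distr (\<Pi>\<^sub>M i\<in>UNIV. density lborel (\<lambda>y. ennreal (beta_density 1 \<theta> y)))
       (\<Pi>\<^sub>M i\<in>UNIV. borel) (\<lambda>y. ranked (stick_breaking y))"

definition PD_partition :: "real \<Rightarrow> real \<Rightarrow> 'w measure \<Rightarrow> ('w \<Rightarrow> nat \<Rightarrow> real) \<Rightarrow> bool" where
  "PD_partition \<theta> \<rho> M A \<longleftrightarrow>
     A \<in> M \<rightarrow>\<^sub>M (\<Pi>\<^sub>M i\<in>UNIV. borel) \<and>
     distr M (\<Pi>\<^sub>M i\<in>UNIV. borel) A
       = distr (poisson_dirichlet \<theta>) (\<Pi>\<^sub>M i\<in>UNIV. borel) (\<lambda>p i. \<rho> * p i)"

text \<open>Given the sequence \<open>A\<close>, the variables \<open>X i\<close> are independent and \<open>X i\<close> has the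
  law \<open>Q (A i)\<close>.\<close>

definition cond_indep_with_laws ::
    "'w measure \<Rightarrow> ('w \<Rightarrow> nat \<Rightarrow> real) \<Rightarrow> 'b measure \<Rightarrow> (real \<Rightarrow> 'b measure)
      \<Rightarrow> (nat \<Rightarrow> 'w \<Rightarrow> 'b) \<Rightarrow> bool" where
  "cond_indep_with_laws M A S Q X \<longleftrightarrow>
     (\<forall>i. X i \<in> M \<rightarrow>\<^sub>M S) \<and>
     (\<forall>U \<in> sets (\<Pi>\<^sub>M i\<in>UNIV. borel). \<forall>(n::nat) B. (\<forall>i<n. B i \<in> sets S) \<longrightarrow>
        emeasure M {\<omega>\<in>space M. A \<omega> \<in> U \<and> (\<forall>i<n. X i \<omega> \<in> B i)}
          = (\<integral>\<^sup>+\<omega>. indicator U (A \<omega>) * (\<Prod>i<n. emeasure (Q (A \<omega> i)) (B i)) \<partial>M))"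

definition independent_rvs ::
    "'w measure \<Rightarrow> 'a measure \<Rightarrow> ('w \<Rightarrow> 'a) \<Rightarrow> 'b measure \<Rightarrow> ('w \<Rightarrow> 'b) \<Rightarrow> bool" where
  "independent_rvs M S X T Y \<longleftrightarrow>
     X \<in> M \<rightarrow>\<^sub>M S \<and> Y \<in> M \<rightarrow>\<^sub>M T \<and>
     prob_space.indep_set M {X -` A \<inter> space M | A. A \<in> sets S} {Y -` B \<inter> space M | B. B \<in> sets T}"

type_synonym point = "real \<times> real"

definition grid :: "nat \<Rightarrow> point set" where
  "grid N = {(of_int i / of_nat N, of_int j / of_nat N) | i j. True}"

text \<open>A path is its duration \<open>T\<close> together with a function which is frozen outside \<open>[0,T]\<close>.
  The set \<open>J\<close> of jump times below makes the function right-continuous and piecewise constant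
  with finitely many jumps, none of them outside \<open>(0,T]\<close>.\<close>

type_synonym path = "real \<times> (real \<Rightarrow> point)"

definition step_paths :: "nat \<Rightarrow> path set" where
  "step_paths N = {(T, f). 0 < T \<and> range f \<subseteq> grid N \<and>
     (\<exists>J. finite J \<and> J \<subseteq> {0<..T} \<and> (\<forall>s t. s \<le> t \<and> {s<..t} \<inter> J = {} \<longrightarrow> f s = f t))}"

definition path_space :: "nat \<Rightarrow> path measure" where
  "path_space N = restrict_space (borel \<Otimes>\<^sub>M (\<Pi>\<^sub>M t\<in>UNIV. count_space (grid N))) (step_paths N)"

definition steps :: "nat \<Rightarrow> point set" where
  "steps N = {(1 / real N, 0), (- 1 / real N, 0), (0, 1 / real N), (0, - 1 / real N)}"

text \<open>The walk is driven by an i.i.d. sequence of pairs (step, holding time).\<close>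

definition walk_source :: "nat \<Rightarrow> (nat \<Rightarrow> point \<times> real) measure" where
  "walk_source N = (\<Pi>\<^sub>M i\<in>UNIV. uniform_count_measure (steps N) \<Otimes>\<^sub>M
     density lborel (\<lambda>h. ennreal (exponential_density (4 * (real N)\<^sup>2) h)))"

definition jump_time :: "(nat \<Rightarrow> point \<times> real) \<Rightarrow> nat \<Rightarrow> real" where
  "jump_time \<omega> k = (\<Sum>i\<le>k. snd (\<omega> i))"

definition walk :: "point \<Rightarrow> (nat \<Rightarrow> point \<times> real) \<Rightarrow> real \<Rightarrow> point" where
  "walk x \<omega> t = x + (\<Sum>i<card {k. jump_time \<omega> k \<le> t}. fst (\<omega> i))"

text \<open>The walk on \<open>[0,t]\<close>; on the null event of infinitely many jumps before \<open>t\<close> it is replaced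
  by a constant path, so that every sample gives an element of \<^const>\<open>step_paths\<close>.\<close>

definition walk_path :: "point \<Rightarrow> real \<Rightarrow> (nat \<Rightarrow> point \<times> real) \<Rightarrow> path" where
  "walk_path x t \<omega> = (t, \<lambda>s. if finite {k. jump_time \<omega> k \<le> t}
                            then walk x \<omega> (max 0 (min s t)) else x)"

definition walk_law :: "nat \<Rightarrow> point \<Rightarrow> real \<Rightarrow> path measure" where
  "walk_law N x t = distr (walk_source N) (path_space N) (walk_path x t)"

definition staying :: "nat \<Rightarrow> point set \<Rightarrow> point \<Rightarrow> path set" where
  "staying N E w = {(T, f) \<in> step_paths N. f T = w \<and> (\<forall>s\<in>{0..T}. f s \<in> E)}"

definition heat_kernel :: "nat \<Rightarrow> point set \<Rightarrow> real \<Rightarrow> point \<Rightarrow> point \<Rightarrow> real" where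
  "heat_kernel N E t x w = (real N)\<^sup>2 * measure (walk_law N x t) (staying N E w)"

definition green :: "nat \<Rightarrow> point set \<Rightarrow> point \<Rightarrow> point \<Rightarrow> real" where
  "green N E x w = (LBINT t=0..\<infinity>. heat_kernel N E t x w)"

definition bridge_law :: "nat \<Rightarrow> point set \<Rightarrow> real \<Rightarrow> point \<Rightarrow> point \<Rightarrow> path measure" where
  "bridge_law N E t x w = uniform_measure (walk_law N x t) (staying N E w)"

definition path_measure :: "nat \<Rightarrow> point set \<Rightarrow> point \<Rightarrow> point \<Rightarrow> path measure" where
  "path_measure N E x w = measure_of (space (path_space N)) (sets (path_space N))
     (\<lambda>B. \<integral>\<^sup>+t\<in>{0<..}. emeasure (bridge_law N E t x w) B
            * ennreal (heat_kernel N E t x w) \<partial>lborel)"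

definition rooted_loop_measure :: "nat \<Rightarrow> point set \<Rightarrow> path measure" where
  "rooted_loop_measure N E = measure_of (space (path_space N)) (sets (path_space N))
     (\<lambda>B. ennreal (1 / (real N)\<^sup>2) *
        (\<integral>\<^sup>+x. (\<integral>\<^sup>+t\<in>{0<..}. emeasure (bridge_law N E t x x) B
            * ennreal (heat_kernel N E t x x / t) \<partial>lborel) \<partial>count_space E))"

definition path_local_time :: "nat \<Rightarrow> point \<Rightarrow> path \<Rightarrow> real" where
  "path_local_time N z = (\<lambda>(T, f). (real N)\<^sup>2 * (LBINT t=0..T. indicator {t. f t = z} t))"

text \<open>An unrooted loop is the set of all its rootings.\<close>

type_synonym loop = "path set"

definition rooted_loops :: "nat \<Rightarrow> path set" where
  "rooted_loops N = {(T, f) \<in> step_paths N. f T = f 0}"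

definition reroot :: "real \<Rightarrow> path \<Rightarrow> path" where
  "reroot s = (\<lambda>(T, f). (T, \<lambda>t. let u = max 0 (min t T) + s in f (if u < T then u else u - T)))"

definition unroot :: "path \<Rightarrow> loop" where
  "unroot p = {reroot s p | s. 0 \<le> s \<and> s < fst p}"

definition loop_space :: "nat \<Rightarrow> loop measure" where
  "loop_space N = sigma (unroot ` rooted_loops N)
     {A. A \<subseteq> unroot ` rooted_loops N \<and>
         {p \<in> rooted_loops N. unroot p \<in> A} \<in> sets (path_space N)}"

definition loop_measure :: "nat \<Rightarrow> point set \<Rightarrow> loop measure" where
  "loop_measure N E =
     distr (restrict_space (rooted_loop_measure N E) (rooted_loops N)) (loop_space N) unroot"

definition loop_soup ::
    "nat \<Rightarrow> real \<Rightarrow> point set \<Rightarrow> 'w measure \<Rightarrow> ('w \<Rightarrow> loop collection) \<Rightarrow> bool" where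
  "loop_soup N \<theta> E M L \<longleftrightarrow>
     poisson_point_process M L (scale_measure (ennreal \<theta>) (loop_measure N E))"

text \<open>The choice of the rooting is immaterial.\<close>

definition loop_local_time :: "nat \<Rightarrow> point \<Rightarrow> loop \<Rightarrow> real" where
  "loop_local_time N z l = path_local_time N z (SOME p. p \<in> l)"

definition thick_points_measure ::
    "nat \<Rightarrow> real \<Rightarrow> real \<Rightarrow> point set \<Rightarrow> loop collection \<Rightarrow> point measure" where
  "thick_points_measure N \<theta> a D C = point_measure D (\<lambda>z. ennreal (
     ln (real N) powr (1 - \<theta>) / real N powr (2 - a) *
     (if collection_sum (\<lambda>l. ennreal (loop_local_time N z l)) C
           \<ge> ennreal (a * (ln (real N))\<^sup>2 / (2 * pi)) then 1 else 0)))"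

definition c0 :: real where
  "c0 = 2 * sqrt 2 * exp euler_mascheroni"

definition CR :: "nat \<Rightarrow> point \<Rightarrow> point set \<Rightarrow> real" where
  "CR N z D = real N / c0 * exp (- (ln (real N))\<^sup>2 / (2 * pi * green N D z z))"

definition qN :: "nat \<Rightarrow> point set \<Rightarrow> point \<Rightarrow> real" where
  "qN N D z = ln (real N) / (2 * pi * green N D z z)"

text \<open>An excursion from \<open>z\<close> to \<open>z\<close> spends no time at \<open>z\<close>. Its final jump to \<open>z\<close> is the value at the
  final time; its initial jump from \<open>z\<close> is an instantaneous one at time \<open>0\<close> and hence invisible
  in a right-continuous path, until the excursion is inserted into a loop.\<close>

definition close_excursion :: "point \<Rightarrow> path \<Rightarrow> path" where
  "close_excursion z = (\<lambda>(T, f). (T, \<lambda>t. if t < T then f t else z))"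

definition excursions :: "nat \<Rightarrow> point \<Rightarrow> path set" where
  "excursions N z = {(T, f) \<in> step_paths N. (\<forall>t\<in>{0..<T}. f t \<noteq> z) \<and> f T = z}"

definition neighbours :: "nat \<Rightarrow> point set \<Rightarrow> point \<Rightarrow> point set" where
  "neighbours N D z = {x \<in> D - {z}. norm (x - z) = 1 / real N}"

definition excursion_measure :: "nat \<Rightarrow> point set \<Rightarrow> point \<Rightarrow> path measure" where
  "excursion_measure N D z = measure_of (space (path_space N)) (sets (path_space N))
     (\<lambda>B. \<Sum>x\<in>neighbours N D z. \<Sum>w\<in>neighbours N D z.
        emeasure (distr (path_measure N (D - {z}) x w) (path_space N) (close_excursion z)) B)"

definition normalized_excursion_measure :: "nat \<Rightarrow> point set \<Rightarrow> point \<Rightarrow> path measure" where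
  "normalized_excursion_measure N D z =
     scale_measure (ennreal ((ln (real N) / (2 * pi))\<^sup>2)) (excursion_measure N D z)"

text \<open>In \<open>insert_excursions z s \<tau> [(u\<^sub>1, e\<^sub>1), \<dots>, (u\<^sub>k, e\<^sub>k)]\<close> a clock measuring the time spent
  at \<open>z\<close> outside the \<open>e\<^sub>i\<close> runs from \<open>s\<close> to \<open>\<tau>\<close>, and \<open>e\<^sub>i\<close> is inserted when it shows \<open>u\<^sub>i\<close>.\<close>

definition path_append :: "path \<Rightarrow> path \<Rightarrow> path" where
  "path_append = (\<lambda>(S, f) (T, g). (S + T, \<lambda>t. if t < S then f t else g (t - S)))"

fun insert_excursions :: "point \<Rightarrow> real \<Rightarrow> real \<Rightarrow> (real \<times> path) list \<Rightarrow> path" where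
  "insert_excursions z s \<tau> [] = (\<tau> - s, \<lambda>_. z)"
| "insert_excursions z s \<tau> ((u, e) # ps) =
     path_append (u - s, \<lambda>_. z) (path_append e (insert_excursions z u \<tau> ps))"

text \<open>The second loop has the excursions of the first one in another order, the periods spent
  at \<open>z\<close> being the same. Rooting a loop inside one of its visits to \<open>z\<close> puts it in this form.\<close>

definition excursion_reordering :: "nat \<Rightarrow> point \<Rightarrow> loop \<Rightarrow> loop \<Rightarrow> bool" where
  "excursion_reordering N z l l' \<longleftrightarrow>
     (\<exists>\<tau> us es es'. 0 < \<tau> \<and> sorted_wrt (<) us \<and> set us \<subseteq> {0<..<\<tau>} \<and> length us = length es \<and>
        set es \<subseteq> excursions N z \<and> mset es' = mset es \<and>
        l = unroot (insert_excursions z 0 \<tau> (zip us es)) \<and>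
        l' = unroot (insert_excursions z 0 \<tau> (zip us es')))"

definition admissible :: "nat \<Rightarrow> point \<Rightarrow> (loop collection \<Rightarrow> real) \<Rightarrow> bool" where
  "admissible N z F \<longleftrightarrow>
     (\<forall>I X Y. (\<forall>i\<in>I. X i \<in> space (loop_space N) \<and> Y i \<in> space (loop_space N) \<and>
                     (X i = Y i \<or> excursion_reordering N z (X i) (Y i)))
        \<longrightarrow> F (collection_of I X) = F (collection_of I Y))"

text \<open>The Poisson point process of excursions used to build \<open>\<Xi>\<^sub>N\<^sub>,\<^sub>\<alpha>\<close>: each excursion carries the
  position, in \<open>(0,\<alpha>)\<close>, at which it occurs on the local time scale. The excursions themselves
  have intensity \<open>2\<pi>\<alpha>\<close> times the normalized excursion measure.\<close>

definition Xi_intensity :: "nat \<Rightarrow> point set \<Rightarrow> point \<Rightarrow> real \<Rightarrow> (real \<times> path) measure" where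
  "Xi_intensity N D z \<alpha> = restrict_space lborel {0<..<\<alpha>} \<Otimes>\<^sub>M
     scale_measure (ennreal (2 * pi)) (normalized_excursion_measure N D z)"

text \<open>Time spent at \<open>z\<close> corresponding to a local time \<open>\<alpha> (log N)\<^sup>2 / (2\<pi>)\<close>.\<close>

definition holding :: "nat \<Rightarrow> real \<Rightarrow> real" where
  "holding N \<alpha> = \<alpha> * (ln (real N))\<^sup>2 / (2 * pi) / (real N)\<^sup>2"

text \<open>The list \<open>ps\<close> enumerates \<open>C\<close> in the order of the positions; if there are infinitely many
  points or if positions coincide (null events) the excursions are discarded.\<close>

definition Xi_loop :: "nat \<Rightarrow> point \<Rightarrow> real \<Rightarrow> (real \<times> path) collection \<Rightarrow> loop" where
  "Xi_loop N z \<alpha> C =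
     (let ordered = (\<lambda>ps. sorted_wrt (\<lambda>p p'. fst p < fst p') ps \<and>
                          C = (\<lambda>p. if p \<in> set ps then 1 else 0));
          ps = (if \<exists>ps. ordered ps then THE ps. ordered ps else [])
      in unroot (insert_excursions z 0 (holding N \<alpha>) (map (\<lambda>(u, e). (holding N u, e)) ps)))"

end

theory Submission
  imports Defs "HOL-Real_Asymp.Real_Asymp"
begin
text \<open>Cutting a loop that visits \<open>z\<close> at its visits shows that the loop measure is that of \<open>D - {z}\<close> plus the
 integral over \<open>a > 0\<close> of \<open>exp (- r a) / a\<close> times the law of \<open>Xi\<close> with parameter \<open>a\<close>. Hence the Laplace functional
 of the soup factors, and the factor of the loops through \<open>z\<close> is \<open>exp (- theta * (integral of exp (- r a) (1 - g a) / a))\<close>.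
 Stick breaking shows that a Poisson--Dirichlet partition of a Gamma-distributed mass has the same functional.
 Inserting powers of \<open>exp (- local time)\<close>, which determine a finite measure, restricts the identity to the event
 that the local time exceeds the threshold, and Laplace functionals determine the laws of collections.\<close>

\<comment> \<open>The spaces \<open>P a\<close> and \<open>M' \<rho>\<close> are given separately
  for each parameter and are unrelated to one another, so measurability in the parameter cannot be
  read off from them. It is recovered by moving the laws to fixed spaces: the excursion loop becomes
  a series of integrals over ordered tuples (\<open>Qn\<close>), and the mixture over
  \<open>\<rho>\<close> is controlled through Laplace functionals. Path measures are graded by the
  number of jumps. The pieces are finite, so that Fubini applies, and each decomposition of a path
  becomes an induction on that number. Since all durations are integrated, cutting off an initial
  piece leaves Lebesgue measure behind. The constants come from one number: the excursion measure
  has total mass \<open>mE\<close>, four times the probability of returning to \<open>z\<close>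
  before leaving \<open>D\<close>. It is below 4 because some grid point lies outside
  \<open>D\<close>. Then the Green function at \<open>z\<close> is \<open>1 / (4 - mE)\<close>, the
  local time in units of \<open>cN\<close> has a Gamma law with rate
  \<open>rr = cN * (4 - mE)\<close>, and \<open>exp (- (rr * \<rho>))\<close> is the power
  \<open>\<rho>\<close> of \<open>c0 * CR N z D / N\<close>.\<close>
syntax "_NI" :: "pttrn => ennreal => 'a measure => ennreal" ("(NI _. _; _)" [60,61] 110)
translations "NI x. f; M" == "CONST nn_integral M (%x. f)"
abbreviation "bm M == borel_measurable M"
abbreviation "papp == path_append"
abbreviation "PS == path_space"
abbreviation "src == walk_source"
abbreviation "SP == step_paths"
abbreviation "csum == collection_sum"
notation pair_measure (infixr "**" 80)
notation measurable (infixr "->M" 60)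

section \<open>Step paths as a measurable space\<close>

lemma countable_grid: "countable (grid N)"
proof -
 have "grid N = (%(i, j). (of_int i / of_nat N, of_int j / of_nat N)) ` (UNIV :: (int \<times> int) set)"
  by (auto simp: grid_def)
 then show ?thesis by simp
qed

lemma steps_subset_grid: "steps N \<subseteq> grid N"
proof -
 have "(of_int i / real N, of_int j / real N) : grid N" for i j :: int
  by (auto simp: grid_def)
 from this[of 1 0] this[of "-1" 0] this[of 0 1] this[of 0 "-1"] show ?thesis
  by (auto simp: steps_def)
qed

lemma grid_add: "x : grid N ==> y : grid N ==> x + y : grid N"
proof -
 assume "x : grid N" "y : grid N"
 then obtain i j k l where "x = (of_int i / of_nat N, of_int j / of_nat N)"
   "y = (of_int k / of_nat N, of_int l / of_nat N)" by (auto simp: grid_def)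
 then have "x + y = (of_int (i + k) / of_nat N, of_int (j + l) / of_nat N)"
  by (simp add: add_divide_distrib)
 then show ?thesis unfolding grid_def by blast
qed

lemma grid_add_steps: "x : grid N ==> s : steps N ==> x + s : grid N"
 using grid_add steps_subset_grid by blast

lemma path_eqI:
 fixes p q :: path
 shows "fst p = fst q ==> (!!t. snd p t = snd q t) ==> p = q"
 by (rule prod_eqI) auto

lemma step_pathsI:
 assumes "0 < fst p" "!!t. snd p t : grid N" "finite J" "J \<subseteq> {0<..fst p}"
  "!!s t. s <= t ==> {s<..t} \<inter> J = {} ==> snd p s = snd p t"
 shows "p : SP N"
 unfolding step_paths_def mem_Collect_eq case_prod_unfold
 using assms by (intro conjI exI[of _ J]) auto

lemma step_pathsE:
 assumes "p : SP N"
 obtains J where "0 < fst p" "!!t. snd p t : grid N" "finite J" "J \<subseteq> {0<..fst p}"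
  "!!s t. s <= t ==> {s<..t} \<inter> J = {} ==> snd p s = snd p t"
proof -
 obtain T f where p: "p = (T, f)" by (cases p)
 with assms obtain J where "0 < T" "range f \<subseteq> grid N" "finite J" "J \<subseteq> {0<..T}"
  and J: "ALL s t. s <= t & {s<..t} \<inter> J = {} --> f s = f t"
  unfolding step_paths_def by blast
 then show ?thesis using J by (intro that[of J]) (auto simp: p)
qed

lemma step_paths_pos: "p : SP N ==> 0 < fst p"
 by (auto simp: step_paths_def)

lemma step_paths_grid: "p : SP N ==> snd p t : grid N"
 by (auto simp: step_paths_def)

lemma step_paths_grid': "(T, f) : SP N ==> f t : grid N"
 by (auto simp: step_paths_def)

lemma step_paths_frozen_neg:
 assumes "p : SP N" "t <= 0" shows "snd p t = snd p 0"
proof -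
 obtain J where J: "J \<subseteq> {0<..fst p}"
  "!!s t. s <= t ==> {s<..t} \<inter> J = {} ==> snd p s = snd p t"
  using assms by (elim step_pathsE) auto
 show ?thesis using assms(2) J(1) by (intro J(2)) auto
qed

lemma step_paths_frozen_end:
 assumes "p : SP N" "fst p <= t" shows "snd p t = snd p (fst p)"
proof -
 obtain J where J: "J \<subseteq> {0<..fst p}"
  "!!s t. s <= t ==> {s<..t} \<inter> J = {} ==> snd p s = snd p t"
  using assms by (elim step_pathsE) auto
 show ?thesis using assms(2) J(1) by (intro J(2)[symmetric]) auto
qed

lemma step_paths_right_constant:
 assumes "p : SP N"
 obtains d where "d > 0" "!!s. t <= s ==> s < t + d ==> snd p s = snd p t"
proof -
 obtain J where J: "finite J"
  "!!s t. s <= t ==> {s<..t} \<inter> J = {} ==> snd p s = snd p t"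
  using assms by (elim step_pathsE) auto
 define d where "d = Min (insert 1 ((%j. j - t) ` {j\<in>J. t < j}))"
 have "d > 0" using J(1) by (auto simp: d_def)
 moreover have "snd p s = snd p t" if "t <= s" "s < t + d" for s
 proof (rule J(2)[OF that(1), symmetric])
  { fix j assume "j : J" "t < j"
   then have "d <= j - t" using J(1) by (auto simp: d_def intro!: Min_le) }
  then show "{t<..s} \<inter> J = {}" using that by force
 qed
 ultimately show ?thesis using that by blast
qed

lemma space_path_space [simp]: "space (PS N) = SP N"
 by (auto simp: path_space_def space_restrict_space space_pair_measure space_PiM step_paths_def)

lemma measurable_path_spaceI:
 assumes "!!x. x : space X ==> g x : SP N"
  and "(%x. fst (g x)) : bm X"
  and "!!t. (%x. snd (g x) t) : X ->M count_space (grid N)"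
 shows "g : X ->M PS N"
 unfolding path_space_def
proof (rule measurable_restrict_space2)
 have "(%x. (fst (g x), snd (g x))) : X ->M borel ** (\<Pi>\<^sub>M t\<in>UNIV. count_space (grid N))"
  using assms by (intro measurable_Pair measurable_PiM_single') (auto dest: step_paths_grid)
 then show "g : X ->M borel ** (\<Pi>\<^sub>M t\<in>UNIV. count_space (grid N))" by simp
qed (use assms in auto)

lemma measurable_duration [measurable]: "fst : bm (PS N)"
 unfolding path_space_def by (intro measurable_restrict_space1 measurable_fst)

lemma measurable_eval_fixed: "(%p. snd p t) : PS N ->M count_space (grid N)"
 unfolding path_space_def by (intro measurable_restrict_space1) measurable

lemma measurable_count_spaceI:
 assumes "countable A" "!!x. x : space M ==> f x : A" "!!a. a : A ==> {x\<in>space M. f x = a} : sets M"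
 shows "f : M ->M count_space A"
proof -
 have "f -` {a} \<inter> space M = {x\<in>space M. f x = a}" for a by auto
 then show ?thesis using assms by (subst measurable_count_space_eq_countable) auto
qed

text \<open>Each fixed coordinate is measurable by construction, but here the time varies.
  Right-continuity helps: the value at \<open>t\<close> is the eventual value at the times
  \<open>r m t\<close>, which range over a countable set.\<close>

lemma measurable_eval: "(%(t, p). snd p t) : borel ** PS N ->M count_space (grid N)"
proof (rule measurable_count_spaceI[OF countable_grid])
 let ?M = "borel ** PS N"
 fix g assume "g : grid N"
 \<comment> \<open>The first point of the mesh 1/(m+1) strictly to the right of \<open>t\<close>;
   the approach from the right is what right-constancy exploits.\<close>
 define r where "r m t = (of_int \<lfloor>real (Suc m) * t\<rfloor> + 1) / real (Suc m)" for m and t :: real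
 have r: "t < r m t & r m t <= t + 1 / real (Suc m)" for m t
 proof -
  have "real (Suc m) * t < of_int \<lfloor>real (Suc m) * t\<rfloor> + 1"
   "of_int \<lfloor>real (Suc m) * t\<rfloor> + 1 <= real (Suc m) * t + 1" by linarith+
  then show ?thesis unfolding r_def
   by (simp add: field_simps del: of_nat_Suc)
 qed
 have ev: "EX m0. \<forall>m\<ge>m0. snd p (r m t) = snd p t" if p: "p : SP N" for t p
 proof -
  obtain d where d: "d > 0" "!!s. t <= s ==> s < t + d ==> snd p s = snd p t"
   using step_paths_right_constant[OF p] by metis
  obtain m0 where m0: "1 / real (Suc m0) < d" using d(1) nat_approx_posE by blast
  show ?thesis
  proof (intro exI[of _ m0] allI impI d(2))
   fix m assume "m0 <= m"
   then have "1 / real (Suc m) <= 1 / real (Suc m0)" by (simp add: frac_le)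
   then show "t <= r m t" "r m t < t + d" using r[of t m] m0 by linarith+
  qed
 qed
 have [measurable]: "(%x. snd (snd x) (r m (fst x))) : ?M ->M count_space (grid N)" for m
  unfolding r_def
 proof (rule measurable_compose_countable[where f="%i x. snd (snd x) ((of_int i + 1) / real (Suc m))" and g="%x. \<lfloor>real (Suc m) * fst x\<rfloor>"])
  fix i
  show "(%x. snd (snd x) ((of_int i + 1) / real (Suc m))) : ?M ->M count_space (grid N)"
   by (rule measurable_compose[OF measurable_snd measurable_eval_fixed])
 qed measurable
 have "{x : space ?M. (case x of (t, p) => snd p t) = g}
   = {x : space ?M. EX m0. \<forall>m\<ge>m0. snd (snd x) (r m (fst x)) = g}"
 proof (intro Collect_cong conj_cong refl)
  fix x :: "real \<times> path" assume "x : space ?M"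
  then have "snd x : SP N" by (auto simp: space_pair_measure)
  from ev[OF this, of "fst x"] obtain m0
   where m0: "!!m. m \<ge> m0 ==> snd (snd x) (r m (fst x)) = snd (snd x) (fst x)" by blast
  have "snd (snd x) (fst x) = g \<longleftrightarrow> (EX m0. \<forall>m\<ge>m0. snd (snd x) (r m (fst x)) = g)"
  proof
   assume "EX m0. \<forall>m\<ge>m0. snd (snd x) (r m (fst x)) = g"
   then obtain m1 where "!!m. m \<ge> m1 ==> snd (snd x) (r m (fst x)) = g" by blast
   from this[of "max m0 m1"] m0[of "max m0 m1"] show "snd (snd x) (fst x) = g" by simp
  qed (use m0 in blast)
  then show "((case x of (t, p) => snd p t) = g) =
     (EX m0. \<forall>m\<ge>m0. snd (snd x) (r m (fst x)) = g)"
   by (simp add: case_prod_unfold)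
 qed
 also have "... : sets ?M" using \<open>g : grid N\<close> by measurable
 finally show "{x : space ?M. (case x of (t, p) => snd p t) = g} : sets ?M" .
qed (auto simp: space_pair_measure step_paths_grid')

lemma measurable_eval' [measurable (raw)]:
 assumes "f : bm X" "g : X ->M PS N"
 shows "(%x. snd (g x) (f x)) : X ->M count_space (grid N)"
 using measurable_compose[OF measurable_Pair[OF assms] measurable_eval] by simp

lemma pred_eval_in [measurable (raw)]:
 assumes "f : bm X" "g : X ->M PS N"
 shows "Measurable.pred X (%x. snd (g x) (f x) : A)"
proof -
 have "(%x. snd (g x) (f x)) -` (A \<inter> grid N) \<inter> space X : sets X"
  by (rule measurable_sets[OF measurable_eval'[OF assms]]) simp
 also have "(%x. snd (g x) (f x)) -` (A \<inter> grid N) \<inter> space X = {x\<in>space X. snd (g x) (f x) : A}"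
  using step_paths_grid measurable_space[OF assms(2)] by fastforce
 finally show ?thesis by (simp add: pred_def)
qed

lemma pred_eval_eq [measurable (raw)]:
 assumes "f : bm X" "g : X ->M PS N"
 shows "Measurable.pred X (%x. snd (g x) (f x) = w)"
 using pred_eval_in[OF assms, of "{w}"] by simp

text \<open>Paths have positive duration, so a nonpositive \<open>h\<close> receives the dummy
  duration 1; this keeps \<open>hold x\<close> measurable on the whole line. Only positive arguments
  carry mass later.\<close>

definition hold :: "point => real => path" where
 "hold x h = (if 0 < h then h else 1, %_. x)"

lemma hold_path_step: "x : grid N ==> hold x h : SP N"
 by (rule step_pathsI[where J="{}"]) (auto simp: hold_def)

lemma measurable_hold_path [measurable]: "x : grid N ==> hold x : borel ->M PS N"
 by (rule measurable_path_spaceI) (auto simp: hold_path_step, auto simp: hold_def)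

lemma path_append_simps [simp]:
 "fst (papp p q) = fst p + fst q"
 "snd (papp p q) t = (if t < fst p then snd p t else snd q (t - fst p))"
 by (cases p; cases q; simp add: path_append_def)+

lemma path_append_step:
 assumes "p : SP N" "q : SP N"
 shows "papp p q : SP N"
proof -
 obtain J where J: "0 < fst p" "finite J" "J \<subseteq> {0<..fst p}"
  "!!s t. s <= t ==> {s<..t} \<inter> J = {} ==> snd p s = snd p t"
  using assms(1) by (elim step_pathsE) auto
 obtain K where K: "0 < fst q" "finite K" "K \<subseteq> {0<..fst q}"
  "!!s t. s <= t ==> {s<..t} \<inter> K = {} ==> snd q s = snd q t"
  using assms(2) by (elim step_pathsE) auto
 let ?L = "J \<union> {fst p} \<union> (%k. k + fst p) ` K"
 show ?thesis
 proof (rule step_pathsI[where J = ?L])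
  fix s t :: real assume st: "s <= t" "{s<..t} \<inter> ?L = {}"
  show "snd (papp p q) s = snd (papp p q) t"
  proof (cases "s < fst p")
   case True
   then have "t < fst p" using st by fastforce
   moreover have "snd p s = snd p t" using st by (intro J) auto
   ultimately show ?thesis using True by simp
  next
   case False
   moreover have "snd q (s - fst p) = snd q (t - fst p)"
   proof (rule K(4))
    show "{s - fst p<..t - fst p} \<inter> K = {}"
    proof (rule ccontr)
     assume "~ ?thesis"
     then obtain k where "k : K" "s < k + fst p" "k + fst p <= t" by force
     then show False using st by fastforce
    qed
   qed (use st in simp)
   ultimately show ?thesis using st by simp
  qed
 next
  show "?L \<subseteq> {0<..fst (papp p q)}" using J(1,3) K(1,3) by force
 qed (use J(1,2) K(1,2) step_paths_grid[OF assms(1)] step_paths_grid[OF assms(2)] in auto)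
qed

lemma measurable_path_append [measurable (raw)]:
 assumes [measurable]: "f : X ->M PS N" "g : X ->M PS N"
 shows "(%x. papp (f x) (g x)) : X ->M PS N"
proof (rule measurable_path_spaceI)
 fix x assume "x : space X"
 then show "papp (f x) (g x) : SP N"
  using measurable_space[OF assms(1)] measurable_space[OF assms(2)] by (intro path_append_step) auto
next
 fix t
 show "(%x. snd (papp (f x) (g x)) t) : X ->M count_space (grid N)"
  unfolding path_append_simps by measurable
qed simp

lemma path_append_assoc:
 assumes "0 < fst b" 
 shows "papp (papp a b) c = papp a (papp b c)"
 using assms by (intro path_eqI) (auto simp: algebra_simps)

lemma path_append_hold: "0 < g ==> 0 < h ==> papp (hold x g) (hold x h) = hold x (g + h)"
 by (intro path_eqI) (auto simp: hold_def)

lemma fst_hold_path [simp]: "0 < h ==> fst (hold x h) = h"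
 and snd_hold_path [simp]: "snd (hold x h) t = x"
 by (auto simp: hold_def)

text \<open>Staying in \<open>E\<close> is a condition at uncountably many times. A step path is
  constant just after each time, so each of its values already occurs at a rational time, and the
  event becomes measurable.\<close>

lemma staying_iff:
 assumes "p : SP N"
 shows "p : staying N E w \<longleftrightarrow> snd p (fst p) = w & (\<forall>s\<in>\<rat>. snd p s : E) & snd p (fst p) : E"
proof
 assume st: "p : staying N E w"
 then have E: "snd p s : E" if "0 <= s" "s <= fst p" for s
  using that by (auto simp: staying_def)
 have "0 < fst p" using assms step_paths_pos by blast
 then have "snd p s : E" for s
  using E[of s] E[of 0] E[of "fst p"] step_paths_frozen_neg[OF assms, of s]
   step_paths_frozen_end[OF assms, of s] by (cases "s <= 0"; cases "s \<ge> fst p") auto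
 then show "snd p (fst p) = w & (\<forall>s\<in>\<rat>. snd p s : E) & snd p (fst p) : E"
  using st by (auto simp: staying_def)
next
 assume *: "snd p (fst p) = w & (\<forall>s\<in>\<rat>. snd p s : E) & snd p (fst p) : E"
 have "snd p s : E" for s
 proof -
  obtain d where d: "d > 0" "!!u. s <= u ==> u < s + d ==> snd p u = snd p s"
   using step_paths_right_constant[OF assms] by metis
  obtain u where "u : \<rat>" "s < u" "u < s + d" using Rats_dense_in_real[of s "s + d"] d(1) by auto
  then show ?thesis using d(2)[of u] * by force
 qed
 then show "p : staying N E w" using * assms by (cases p) (auto simp: staying_def)
qed

lemma sets_staying [measurable]: "staying N E w : sets (PS N)"
proof -
 have "staying N E w = {p : space (PS N).
   snd p (fst p) = w & (\<forall>s\<in>\<rat>. snd p s : E) & snd p (fst p) : E}"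
 proof (rule set_eqI)
  fix p show "p : staying N E w \<longleftrightarrow> p : {p : space (PS N).
   snd p (fst p) = w & (\<forall>s\<in>\<rat>. snd p s : E) & snd p (fst p) : E}"
   using staying_iff[of p N E w] by (cases "p : SP N") (auto simp: staying_def)
 qed
 also have "... : sets (PS N)"
 proof -
  have [measurable]: "Measurable.pred (PS N) (%p. \<forall>s\<in>\<rat>. snd p s : E)"
   unfolding Rats_def ball_simps by measurable
  show ?thesis by measurable
 qed
 finally show ?thesis .
qed

section \<open>Unrooted loops and the time spent at a point\<close>

lemma rooted_loops_iff: "p : rooted_loops N \<longleftrightarrow> p : SP N & snd p (fst p) = snd p 0"
 by (cases p) (auto simp: rooted_loops_def)

lemma sets_rooted_loops [measurable]: "rooted_loops N : sets (PS N)"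
proof -
 have "rooted_loops N = (\<Union>g\<in>grid N. {p : space (PS N). snd p (fst p) = g & snd p 0 = g})"
  by (auto simp: rooted_loops_iff step_paths_grid')
 also have "... : sets (PS N)"
  by (intro sets.countable_UN'' countable_grid) measurable
 finally show ?thesis .
qed

lemma reroot_simps [simp]:
 "fst (reroot s p) = fst p"
 "snd (reroot s p) t = (let u = max 0 (min t (fst p)) + s in snd p (if u < fst p then u else u - fst p))"
 by (simp_all only: reroot_def case_prod_unfold fst_conv snd_conv)

text \<open>Rerooting is a rotation, so starting points add modulo the duration. The inner clamping
  of time is inactive because rotated times stay in \<open>[0, T)\<close>.\<close>

lemma reroot_reroot:
 assumes "0 <= a" "a < fst p" "0 <= s" "s < fst p"
 shows "reroot a (reroot s p) = reroot (if a + s < fst p then a + s else a + s - fst p) p"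
proof (rule path_eqI)
 fix t
 define c where "c = max 0 (min t (fst p))"
 have c: "0 <= c" "c <= fst p" using assms by (auto simp: c_def)
 define v where "v = (if c + a < fst p then c + a else c + a - fst p)"
 have v: "0 <= v" "v < fst p" using c assms by (auto simp: v_def)
 then have m: "max 0 (min v (fst p)) = v" by auto
 define b where "b = (if a + s < fst p then a + s else a + s - fst p)"
 have "(if v + s < fst p then v + s else v + s - fst p) = (if c + b < fst p then c + b else c + b - fst p)"
  using c assms by (auto simp: v_def b_def)
 then show "snd (reroot a (reroot s p)) t = snd (reroot (if a + s < fst p then a + s else a + s - fst p) p) t"
  unfolding reroot_simps Let_def b_def[symmetric] c_def[symmetric] v_def[symmetric] m by (rule arg_cong)
qed simp

lemma unroot_reroot:
 assumes "0 <= s" "s < fst p"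
 shows "unroot (reroot s p) = unroot p"
proof
 show "unroot (reroot s p) \<subseteq> unroot p"
 proof
  fix q assume "q : unroot (reroot s p)"
  then obtain a where a: "0 <= a" "a < fst p" "q = reroot a (reroot s p)" by (auto simp: unroot_def)
  then have "q = reroot (if a + s < fst p then a + s else a + s - fst p) p"
   using assms by (simp add: reroot_reroot)
  moreover have "0 <= (if a + s < fst p then a + s else a + s - fst p)"
   "(if a + s < fst p then a + s else a + s - fst p) < fst p" using a assms by auto
  ultimately show "q : unroot p" unfolding unroot_def by blast
 qed
 show "unroot p \<subseteq> unroot (reroot s p)"
 proof
  fix q assume "q : unroot p"
  then obtain b where b: "0 <= b" "b < fst p" "q = reroot b p" by (auto simp: unroot_def)
  define a where "a = (if s <= b then b - s else b - s + fst p)"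
  have a: "0 <= a" "a < fst p" using b assms by (auto simp: a_def)
  have "b = (if a + s < fst p then a + s else a + s - fst p)" using b assms by (auto simp: a_def)
  then have "q = reroot a (reroot s p)" using a assms b by (simp add: reroot_reroot)
  then show "q : unroot (reroot s p)" unfolding unroot_def using a by auto
 qed
qed

text \<open>Rerooting the concatenation at its junction produces the concatenation in the other
  order. The end of \<open>p\<close> has to match the start of \<open>q\<close> because the values
  at and after the final time are compared too.\<close>

lemma unroot_append_swap:
 assumes "p : SP N" "q : SP N"
  and "snd p (fst p) = snd q 0" "snd q (fst q) = snd p 0"
 shows "unroot (papp p q) = unroot (papp q p)"
proof -
 have pos: "0 < fst p" "0 < fst q" using assms step_paths_pos by auto
 have "reroot (fst p) (papp p q) = papp q p"
 proof (rule path_eqI)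
  fix t
  consider "t <= 0" | "0 < t" "t < fst q" | "fst q <= t" "t < fst p + fst q" | "fst p + fst q <= t" by linarith
  then show "snd (reroot (fst p) (papp p q)) t = snd (papp q p) t"
  proof cases
   case 1
   then show ?thesis using pos step_paths_frozen_neg[OF assms(2), of t] by (simp add: Let_def)
  next
   case 4
   then have m: "max 0 (min t (fst p + fst q)) = fst p + fst q" using pos by simp
   show ?thesis using 4 pos assms(3) step_paths_frozen_end[OF assms(1), of "t - fst q"]
    by (simp add: Let_def m)
  next
   case 2
   then show ?thesis using pos by (simp add: Let_def)
  next
   case 3
   then have m: "max 0 (min t (fst p + fst q)) = t" using pos by simp
   show ?thesis using 3 pos by (simp add: Let_def m)
  qed
 qed (simp add: add.commute)
 then show ?thesis using unroot_reroot[of "fst p" "papp p q"] pos by simp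
qed

lemma reroot_0:
 assumes "p : rooted_loops N"
 shows "reroot 0 p = p"
proof (rule path_eqI)
 fix t
 from assms have p: "p : SP N" "snd p (fst p) = snd p 0" by (auto simp: rooted_loops_iff)
 have "0 < fst p" using p step_paths_pos by auto
 then show "snd (reroot 0 p) t = snd p t"
  using step_paths_frozen_neg[OF p(1), of t] step_paths_frozen_end[OF p(1), of t] p(2)
  by (cases "t <= 0"; cases "fst p <= t") (auto simp: Let_def)
qed simp

lemma unroot_self: "p : rooted_loops N ==> p : unroot p"
 using reroot_0[of p N] step_paths_pos[of p N] unfolding unroot_def rooted_loops_iff by force

text \<open>The generating family consists of all sets with measurable preimage under
  \<open>unroot\<close>; it is already closed under complements and countable unions, so generation
  adds nothing.\<close>

lemma sets_loop_space:
 "A : sets (loop_space N) \<longleftrightarrow>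
   A \<subseteq> unroot ` rooted_loops N & {p : rooted_loops N. unroot p : A} : sets (PS N)"
proof -
 let ?O = "unroot ` rooted_loops N"
 let ?S = "{A. A \<subseteq> ?O & {p : rooted_loops N. unroot p : A} : sets (PS N)}"
 have "sigma_algebra ?O ?S"
  unfolding sigma_algebra_iff2
 proof (intro conjI ballI allI impI)
  fix B assume B: "B : ?S"
  have "{p : rooted_loops N. unroot p : ?O - B} = rooted_loops N - {p : rooted_loops N. unroot p : B}" by auto
  also have "... : sets (PS N)" using B by (intro sets.Diff sets_rooted_loops) auto
  finally show "?O - B : ?S" by blast
 next
  fix A :: "nat => loop set" assume A: "range A \<subseteq> ?S"
  have "{p : rooted_loops N. unroot p : (\<Union>i. A i)} = (\<Union>i. {p : rooted_loops N. unroot p : A i})" by auto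
  also have "... : sets (PS N)" using A by (intro sets.countable_UN) blast
  finally show "(\<Union>i. A i) : ?S" using A by blast
 qed auto
 then have "sets (sigma ?O ?S) = ?S" by (subst sets_measure_of) (auto simp: sigma_algebra.sigma_sets_eq)
 then show ?thesis by (simp add: loop_space_def)
qed

lemma space_loop_space [simp]: "space (loop_space N) = unroot ` rooted_loops N"
 unfolding loop_space_def by (intro space_measure_of) auto

lemma rooted_loops_Int [simp]: "rooted_loops N \<inter> SP N = rooted_loops N"
 by (auto simp: rooted_loops_iff)

lemma measurable_unroot [measurable]:
 "unroot : restrict_space (PS N) (rooted_loops N) ->M loop_space N"
proof (rule measurableI)
 fix A assume A: "A : sets (loop_space N)"
 have "unroot -` A \<inter> space (restrict_space (PS N) (rooted_loops N)) = {p : rooted_loops N. unroot p : A}"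
  by (auto simp: space_restrict_space rooted_loops_iff)
 also have "... : sets (restrict_space (PS N) (rooted_loops N))"
  using A sets_rooted_loops by (subst sets_restrict_space_iff) (auto simp: sets_loop_space)
 finally show "unroot -` A \<inter> space (restrict_space (PS N) (rooted_loops N))
  : sets (restrict_space (PS N) (rooted_loops N))" .
qed (auto simp: space_restrict_space)

text \<open>Universal property of the quotient: the sigma-algebra on loops is the finest one for
  which \<open>unroot\<close> is measurable.\<close>

lemma measurable_loop_spaceI:
 assumes "(%p. g (unroot p)) : restrict_space (PS N) (rooted_loops N) ->M S"
 shows "g : loop_space N ->M S"
proof (rule measurableI)
 fix x assume "x : space (loop_space N)"
 then show "g x : space S" using measurable_space[OF assms]
  by (auto simp: space_restrict_space rooted_loops_iff)
next
 fix A assume "A : sets S"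
 from measurable_sets[OF assms this]
 have "{p : rooted_loops N. g (unroot p) : A} : sets (restrict_space (PS N) (rooted_loops N))"
  by (rule back_subst[where P="%x. x : _"]) (auto simp: space_restrict_space rooted_loops_iff)
 then have "{p : rooted_loops N. g (unroot p) : A} : sets (PS N)"
  by (subst (asm) sets_restrict_space_iff) auto
 moreover have "{p : rooted_loops N. unroot p : g -` A \<inter> space (loop_space N)} = {p : rooted_loops N. g (unroot p) : A}"
  by auto
 ultimately show "g -` A \<inter> space (loop_space N) : sets (loop_space N)"
  by (subst sets_loop_space) auto
qed

text \<open>Time at \<open>z\<close> as an extended nonnegative number. The half-open window makes
  it exactly additive under concatenation and blind to the closing point of an excursion.\<close>

definition occ :: "point => path => ennreal" where
 "occ z p = (NI t. indicator {0..<fst p} t * indicator {z} (snd p t);lborel)"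

lemma measurable_occ [measurable]: "occ z : bm (PS N)"
proof -
 have "(%p. NI t. indicator {y. 0 <= snd y & snd y < fst (fst y) & snd (fst y) (snd y) = z} (p, t);lborel)
  : bm (PS N)"
  by measurable
 also have "(%p. NI t. indicator {y. 0 <= snd y & snd y < fst (fst y) & snd (fst y) (snd y) = z} (p, t);lborel) = occ z"
  unfolding occ_def by (intro ext nn_integral_cong) (auto simp: indicator_def)
 finally show ?thesis .
qed

lemma occ_hold_path: "0 < h ==> occ z (hold x h) = (if x = z then ennreal h else 0)"
 by (auto simp: occ_def)

lemma measurable_step_path_indicator [measurable]:
 "p : SP N ==> (%t. indicator {z} (snd p t) :: ennreal) : bm borel"
proof -
 assume "p : SP N"
 then have [measurable]: "(%_. p) : borel ->M PS N" by simp
 have "Measurable.pred borel (%t. snd p t = z)" by measurable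
 then have "(%t. indicator {t. snd p t = z} t :: ennreal) : bm borel" by simp
 then show ?thesis by (rule measurable_cong[THEN iffD1, rotated]) (auto simp: indicator_def)
qed

lemma nn_integral_shift: "f : bm borel ==>
  (NI t. f (t + c);lborel) = (NI t. f t;lborel)" for c :: real and f :: "real => ennreal"
 using nn_integral_real_affine[of f 1 c] by (simp add: add.commute)

lemma occ_append:
 assumes p[measurable]: "p : SP N" and q[measurable]: "q : SP N"
 shows "occ z (papp p q) = occ z p + occ z q"
proof -
 let ?f = "%t. indicator {0..<fst p} t * indicator {z} (snd p t) :: ennreal"
 let ?g = "%t. indicator {0..<fst q} t * indicator {z} (snd q t) :: ennreal"
 have pos: "0 < fst p" "0 < fst q" using p q step_paths_pos by auto
 have "occ z (papp p q) = (NI t. ?f t + ?g (t - fst p);lborel)"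
  unfolding occ_def using pos by (intro nn_integral_cong) (auto simp: indicator_def)
 also have "... = (NI t. ?f t;lborel) + (NI t. ?g (t - fst p);lborel)"
  using measurable_compose[OF _ measurable_step_path_indicator[OF q], of "%t. t - fst p" lborel z]
   measurable_step_path_indicator[OF p, of z]
  by (intro nn_integral_add) auto
 also have "(NI t. ?g (t - fst p);lborel) = (NI t. ?g t;lborel)"
  using nn_integral_shift[of ?g "- fst p"] by simp
 finally show ?thesis by (simp add: occ_def)
qed

text \<open>The rotation moves \<open>[s, T)\<close> to the front and \<open>[0, s)\<close> to the
  back, each by a translation. This is what makes the choice of a representative in
  \<open>loop_local_time\<close> harmless.\<close>

lemma occ_reroot:
 assumes p[measurable]: "p : SP N" and s: "0 <= s" "s < fst p"
 shows "occ z (reroot s p) = occ z p"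
proof -
 let ?f = "%t. indicator {0..<s} t * indicator {z} (snd p t) :: ennreal"
 let ?g = "%t. indicator {s..<fst p} t * indicator {z} (snd p t) :: ennreal"
 have "occ z (reroot s p) = (NI t. ?f (t + (s - fst p)) + ?g (t + s);lborel)"
  unfolding occ_def using s
  by (intro nn_integral_cong) (auto simp: indicator_def Let_def algebra_simps)
 also have "... = (NI t. ?f (t + (s - fst p));lborel) + (NI t. ?g (t + s);lborel)"
  using measurable_compose[OF _ measurable_step_path_indicator[OF p], of "%t. t + (s - fst p)" lborel z]
    measurable_compose[OF _ measurable_step_path_indicator[OF p], of "%t. t + s" lborel z]
  by (intro nn_integral_add) auto
 also have "... = (NI t. ?f t;lborel) + (NI t. ?g t;lborel)"
  by (intro arg_cong2[where f=plus] nn_integral_shift) measurable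
 also have "... = (NI t. ?f t + ?g t;lborel)"
  by (intro nn_integral_add[symmetric]) measurable
 also have "... = occ z p"
  unfolding occ_def using s by (intro nn_integral_cong) (auto simp: indicator_def)
 finally show ?thesis .
qed

lemma occ_le: "occ z p <= ennreal (fst p)"
proof -
 have "occ z p <= (NI t. indicator {0..<fst p} t;lborel)"
  unfolding occ_def by (intro nn_integral_mono) (auto simp: indicator_def)
 also have "... <= ennreal (fst p)" by (cases "0 <= fst p") auto
 finally show ?thesis .
qed

lemma path_local_time_occ:
 assumes pos: "0 < fst p" and [measurable]: "(%t. indicator {z} (snd p t) :: ennreal) : bm borel"
 shows "ennreal (path_local_time N z p) = ennreal ((real N)\<^sup>2) * occ z p"
  and "0 <= path_local_time N z p"
proof -
 have "(%t. enn2real (indicator {z} (snd p t)) :: real) : bm borel" by measurable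
 moreover have "(%t. enn2real (indicator {z} (snd p t))) = (indicator {t. snd p t = z} :: real => real)"
  by (auto simp: indicator_def fun_eq_iff)
 ultimately have m: "(indicator {t. snd p t = z} :: real => real) : bm borel" by simp
 have "path_local_time N z p = (real N)\<^sup>2 * (\<integral>t. indicator ({0<..<fst p} \<inter> {t. snd p t = z}) t \<partial>lborel)"
  using pos by (simp add: path_local_time_def interval_lebesgue_integral_def set_lebesgue_integral_def
    case_prod_unfold indicator_inter_arith zero_ereal_def)
 also have "(\<integral>t. indicator ({0<..<fst p} \<inter> {t. snd p t = z}) t \<partial>lborel)
   = enn2real (NI t. ennreal (indicator ({0<..<fst p} \<inter> {t. snd p t = z}) t);lborel)"
  using m by (intro integral_eq_nn_integral) (auto simp: indicator_inter_arith)
 also have "(NI t. ennreal (indicator ({0<..<fst p} \<inter> {t. snd p t = z}) t);lborel) = occ z p"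
  unfolding occ_def
 proof (rule nn_integral_cong_AE)
  show "AE t in lborel. ennreal (indicator ({0<..<fst p} \<inter> {t. snd p t = z}) t)
    = indicator {0..<fst p} t * indicator {z} (snd p t)"
   using AE_lborel_singleton[of 0] by eventually_elim (auto simp: indicator_def)
 qed
 finally have *: "path_local_time N z p = (real N)\<^sup>2 * enn2real (occ z p)" .
 then show "0 <= path_local_time N z p" by simp
 show "ennreal (path_local_time N z p) = ennreal ((real N)\<^sup>2) * occ z p"
  using occ_le[of z p] by (simp add: * ennreal_mult ennreal_enn2real top.not_eq_extremum le_less_trans)
qed

lemma loop_local_time_unroot:
 assumes "p : rooted_loops N"
 shows "ennreal (loop_local_time N z (unroot p)) = ennreal ((real N)\<^sup>2) * occ z p"
proof -
 have p: "p : SP N" using assms by (simp add: rooted_loops_iff)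
 have "(SOME q. q : unroot p) : unroot p"
  using unroot_self[OF assms] by (rule someI)
 then obtain s where s: "0 <= s" "s < fst p" and q: "(SOME q. q : unroot p) = reroot s p"
  by (auto simp: unroot_def)
 have pos: "0 < fst (reroot s p)" using s by simp
 define g where "g t = (let u = max 0 (min t (fst p)) + s in if u < fst p then u else u - fst p)" for t
 have "g : bm borel" unfolding g_def Let_def by measurable
 from measurable_compose[OF this measurable_step_path_indicator[OF p]]
 have "(%t. indicator {z} (snd (reroot s p) t) :: ennreal) : bm borel"
  unfolding reroot_simps g_def Let_def .
 from path_local_time_occ(1)[OF pos this] show ?thesis
  using occ_reroot[OF p s] by (simp add: loop_local_time_def q)
qed

section \<open>The walk and its driving sequence\<close>

locale grid_walk =
 fixes N :: nat
 assumes N: "2 <= N"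
begin

text \<open>The exponential law of rate 4 N^2 without its normalising constant. A completed holding
  period followed by a given step then weighs N^2 times \<open>expm\<close>, and the last,
  interrupted period weighs exactly \<open>expm\<close>, since the tail of the law is the same
  exponential.\<close>

definition expm :: "real measure" where
 "expm = density lborel (%h. ennreal (indicator {0<..} h * exp (- (4 * (real N)\<^sup>2) * h)))"

lemma N_pos: "0 < real N" "0 < (real N)\<^sup>2" "0 < 4 * (real N)\<^sup>2"
 using N by auto

lemma sets_expm [simp, measurable_cong]: "sets expm = sets borel"
 and space_expm [simp]: "space expm = UNIV"
 by (simp_all add: expm_def)

lemma nn_integral_expm: "f : bm borel ==>
  (NI h. f h;expm) = (NI h. ennreal (indicator {0<..} h * exp (- (4 * (real N)\<^sup>2) * h)) * f h;lborel)"
 unfolding expm_def by (subst nn_integral_density) auto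

lemma AE_expm: "AE h in expm. 0 < h"
 unfolding expm_def by (subst AE_density) (auto simp: indicator_def)

lemma nn_integral_exp_tail:
 assumes "0 < c"
 shows "(NI h. ennreal (exp (- c * h)) * indicator {a..} h;lborel) = ennreal (exp (- c * a) / c)"
proof -
 have "(NI h. ennreal (exp (- c * h)) * indicator {a..} h;lborel) = ennreal (0 - (- exp (- c * a) / c))"
 proof (rule nn_integral_FTC_atLeast)
  show "DERIV (%h. - exp (- c * h) / c) x :> exp (- c * x)" for x
   using assms by (auto intro!: derivative_eq_intros)
  show "((%h. - exp (- c * h) / c) \<longlongrightarrow> 0) at_top"
   using assms by real_asymp
 qed auto
 then show ?thesis by simp
qed

lemma emeasure_expm_tail: "0 <= t ==> emeasure expm {t<..} = ennreal (exp (- (4 * (real N)\<^sup>2) * t) / (4 * (real N)\<^sup>2))"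
proof -
 assume t: "0 <= t"
 have "emeasure expm {t<..} = (NI h. indicator {t<..} h;expm)" by simp
 also have "... = (NI h. ennreal (indicator {0<..} h * exp (- (4 * (real N)\<^sup>2) * h)) * indicator {t<..} h;lborel)"
  by (subst nn_integral_expm) auto
 also have "... = (NI h. ennreal (exp (- (4 * (real N)\<^sup>2) * h)) * indicator {t..} h;lborel)"
 proof (rule nn_integral_cong_AE)
  show "AE h in lborel. ennreal (indicator {0<..} h * exp (- (4 * (real N)\<^sup>2) * h)) * indicator {t<..} h
   = ennreal (exp (- (4 * (real N)\<^sup>2) * h)) * indicator {t..} h"
   using AE_lborel_singleton[of t] by eventually_elim (use t in \<open>auto simp: indicator_def\<close>)
 qed
 finally show ?thesis using nn_integral_exp_tail[OF N_pos(3)] by simp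
qed

lemma emeasure_expm_UNIV: "emeasure expm UNIV = ennreal (1 / (4 * (real N)\<^sup>2))"
proof -
 have "AE h in expm. h : {0<..} \<longleftrightarrow> h : UNIV" using AE_expm by auto
 then have "emeasure expm UNIV = emeasure expm {0<..}"
  by (intro emeasure_eq_AE) auto
 then show ?thesis using emeasure_expm_tail[of 0] by simp
qed

lemma finite_measure_expm: "finite_measure expm"
 by (rule finite_measureI) (simp add: emeasure_expm_UNIV)

lemma finite_steps [simp]: "finite (steps N)" by (simp add: steps_def)

lemma card_steps: "card (steps N) = 4"
 using N_pos by (simp add: steps_def)

definition step_hold :: "(point \<times> real) measure" where
 "step_hold = uniform_count_measure (steps N) \<Otimes>\<^sub>M
   density lborel (%h. ennreal (exponential_density (4 * (real N)\<^sup>2) h))"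

lemma walk_source_eq: "src N = (\<Pi>\<^sub>M i\<in>UNIV. step_hold)"
 by (simp add: walk_source_def step_hold_def)

lemma prob_space_step_hold: "prob_space step_hold"
proof -
 interpret A: prob_space "uniform_count_measure (steps N)"
  by (rule prob_space_uniform_count_measure) (auto simp: steps_def)
 interpret B: prob_space "density lborel (%h. ennreal (exponential_density (4 * (real N)\<^sup>2) h))"
  by (rule prob_space_exponential_density[OF N_pos(3)])
 interpret pair_prob_space "uniform_count_measure (steps N)"
  "density lborel (%h. ennreal (exponential_density (4 * (real N)\<^sup>2) h))" ..
 show ?thesis unfolding step_hold_def by (rule prob_space_axioms)
qed

lemma sequence_space_step_hold: "sequence_space step_hold"
proof -
 interpret prob_space step_hold by (rule prob_space_step_hold)
 show ?thesis by unfold_locales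
qed

lemma prob_space_walk_source: "prob_space (src N)"
proof -
 interpret sequence_space step_hold by (rule sequence_space_step_hold)
 show ?thesis unfolding walk_source_eq by (rule prob_space_axioms)
qed

lemma nn_integral_step_hold:
 assumes "!!s. s : steps N ==> (%h. g (s, h)) : bm borel"
 shows "(NI y. g y;step_hold) = (\<Sum>s\<in>steps N. NI h. ennreal ((real N)\<^sup>2) * g (s, h);expm)"
proof -
 let ?D = "density lborel (%h. ennreal (exponential_density (4 * (real N)\<^sup>2) h))"
 interpret B: prob_space ?D
  by (rule prob_space_exponential_density[OF N_pos(3)])
 have g: "g : bm step_hold"
  unfolding step_hold_def
 proof (subst measurable_cong_sets[OF sets_pair_measure_cong[OF refl] refl])
  show "sets ?D = sets borel" by simp
  show "g : bm (uniform_count_measure (steps N) ** borel)"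
  proof -
   have "(%y. g (fst y, snd y)) : bm (uniform_count_measure (steps N) ** borel)"
   proof (rule measurable_compose_countable'[where f="%s y. g (s, snd y)" and g=fst and I="steps N"])
    show "(%y. g (s, snd y)) : bm (uniform_count_measure (steps N) ** borel)" if "s : steps N" for s
     by (rule measurable_compose[OF measurable_snd assms[OF that]])
    have "fst : uniform_count_measure (steps N) ** borel ->M uniform_count_measure (steps N)" by simp
    then show "fst : uniform_count_measure (steps N) ** borel ->M count_space (steps N)"
     using measurable_cong_sets[OF refl, of "uniform_count_measure (steps N)" "count_space (steps N)"]
      by (simp add: sets_uniform_count_measure)
   qed (simp add: countable_finite)
   then show ?thesis by simp
  qed
 qed
 have "(NI y. g y;step_hold) = (NI s. NI h. g (s, h);?D;uniform_count_measure (steps N))"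
  using g unfolding step_hold_def by (simp add: B.nn_integral_fst)
 also have "... = (\<Sum>s\<in>steps N. ennreal (1 / 4) * NI h. g (s, h);?D)"
  unfolding uniform_count_measure_def by (subst nn_integral_point_measure_finite) (auto simp: card_steps)
 also have "... = (\<Sum>s\<in>steps N. NI h. ennreal ((real N)\<^sup>2) * g (s, h);expm)"
 proof (rule sum.cong[OF refl])
  fix s assume "s : steps N"
  note [measurable] = assms[OF this]
  have "ennreal (1 / 4) * (NI h. g (s, h);?D)
   = (NI h. ennreal (1/4) * (ennreal (exponential_density (4 * (real N)\<^sup>2) h) * g (s, h));lborel)"
   by (subst nn_integral_density) (auto simp: nn_integral_cmult)
  also have "... = (NI h. ennreal (indicator {0<..} h * exp (- (4 * (real N)\<^sup>2) * h)) * (ennreal ((real N)\<^sup>2) * g (s, h));lborel)"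
  proof (rule nn_integral_cong_AE)
   show "AE h in lborel. ennreal (1/4) * (ennreal (exponential_density (4 * (real N)\<^sup>2) h) * g (s, h))
    = ennreal (indicator {0<..} h * exp (- (4 * (real N)\<^sup>2) * h)) * (ennreal ((real N)\<^sup>2) * g (s, h))"
    using AE_lborel_singleton[of 0]
   proof eventually_elim
    fix h :: real assume "h ~= 0"
    have "ennreal (1/4) * ennreal (exponential_density (4 * (real N)\<^sup>2) h)
     = ennreal (indicator {0<..} h * exp (- (4 * (real N)\<^sup>2) * h)) * ennreal ((real N)\<^sup>2)"
     using \<open>h ~= 0\<close> by (simp add: exponential_density_def ennreal_mult[symmetric] mult_ac)
    then show "ennreal (1/4) * (ennreal (exponential_density (4 * (real N)\<^sup>2) h) * g (s, h))
    = ennreal (indicator {0<..} h * exp (- (4 * (real N)\<^sup>2) * h)) * (ennreal ((real N)\<^sup>2) * g (s, h))"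
     by (simp add: mult.assoc[symmetric])
   qed
  qed
  also have "... = (NI h. ennreal ((real N)\<^sup>2) * g (s, h);expm)"
   by (subst nn_integral_expm) auto
  finally show "ennreal (1 / 4) * (NI h. g (s, h);?D) = (NI h. ennreal ((real N)\<^sup>2) * g (s, h);expm)" .
 qed
 finally show ?thesis .
qed

text \<open>An independent identically distributed sequence is its first entry followed by an
  independent copy of itself: the Markov property at the first jump.\<close>

lemma nn_integral_walk_source_first:
 assumes [measurable]: "f : bm (src N)"
 shows "(NI w. f w;src N) = (NI y. NI w. f (case_nat y w);src N;step_hold)"
proof -
 interpret sequence_space step_hold by (rule sequence_space_step_hold)
 have [measurable]: "f : bm S" using assms by (simp add: walk_source_eq)
 have "(NI w. f w;S) = (NI w. f w;distr (step_hold ** S) S (%(s, w). case_nat s w))"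
  by (simp add: PiM_iter)
 also have "... = (NI y. f (case y of (s, w) => case_nat s w);(step_hold ** S))"
  by (subst nn_integral_distr) auto
 also have "... = (NI y. NI w. f (case_nat y w);S;step_hold)"
  by (subst nn_integral_fst[symmetric]) auto
 finally show ?thesis by (simp add: walk_source_eq)
qed

lemma measurable_holding [measurable]: "(%w. snd (w i)) : bm (src N)"
proof -
 have "(%w. snd (w i)) : src N ->M density lborel (%h. ennreal (exponential_density (4 * (real N)\<^sup>2) h))"
  unfolding walk_source_def by measurable
 then show ?thesis by simp
qed

lemma measurable_step [measurable]: "(%w. fst (w i)) : src N ->M count_space (steps N)"
proof -
 have "(%w. fst (w i)) : src N ->M uniform_count_measure (steps N)"
  unfolding walk_source_def by measurable
 moreover have "sets (uniform_count_measure (steps N)) = sets (count_space (steps N))"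
  by (simp add: sets_uniform_count_measure)
 ultimately show ?thesis using measurable_cong_sets[OF refl] by blast
qed

lemma measurable_jump_time [measurable]: "(%w. jump_time w k) : bm (src N)"
 unfolding jump_time_def by measurable

lemma measurable_skeleton:
 assumes "x : grid N"
 shows "(%w. x + (\<Sum>i<n. fst (w i))) : src N ->M count_space (grid N)"
proof (induction n)
 case 0 then show ?case using assms by simp
next
 case (Suc n)
 note [measurable] = Suc
 show ?case
 proof (rule measurable_count_spaceI[OF countable_grid])
  fix w assume w: "w : space (src N)"
  show "x + (\<Sum>i<Suc n. fst (w i)) : grid N"
   using measurable_space[OF Suc w] measurable_space[OF measurable_step w, of n]
   by (auto simp: add.assoc[symmetric] intro!: grid_add_steps)
 next
  fix g assume "g : grid N"
  have "{w : space (src N). x + (\<Sum>i<Suc n. fst (w i)) = g}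
   = (\<Union>s\<in>steps N. ((%w. fst (w n)) -` ({s} \<inter> steps N) \<inter> space (src N))
     \<inter> ((%w. x + (\<Sum>i<n. fst (w i))) -` ({g - s} \<inter> grid N) \<inter> space (src N)))"
   (is "?L = ?R")
  proof
   show "?L \<subseteq> ?R"
   proof
    fix w assume "w : ?L"
    then show "w : ?R"
     using measurable_space[OF Suc, of w] measurable_space[OF measurable_step, of w n]
     by (auto simp: algebra_simps)
   qed
   show "?R \<subseteq> ?L"
   proof
    fix w assume "w : ?R"
    then obtain s where *: "fst (w n) = s" "x + (\<Sum>i<n. fst (w i)) = g - s" "w : space (src N)"
     by blast
    have "x + (\<Sum>i<Suc n. fst (w i)) = (x + (\<Sum>i<n. fst (w i))) + s"
     using *(1) by (simp add: add.assoc)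
    then show "w : ?L" using * by simp
   qed
  qed
  also have "... : sets (src N)" 
   by (rule sets.finite_UN[OF finite_steps], rule sets.Int, rule measurable_sets[OF measurable_step], simp,
     rule measurable_sets[OF Suc], simp)
  finally show "{w : space (src N). x + (\<Sum>i<Suc n. fst (w i)) = g} : sets (src N)" .
 qed
qed

text \<open>\<open>walk_path\<close> makes sense for positive durations; replacing the other values
  of \<open>t\<close> by 1 allows joint measurability in \<open>(t, w)\<close> to be stated over the
  whole line.\<close>

definition wpath :: "point => real => (nat => point \<times> real) => path" where
 "wpath x t w = walk_path x (if 0 < t then t else 1) w"

lemma wpath_step_paths:
 assumes "x : grid N" "w : space (src N)"
 shows "wpath x t w : SP N"
proof -
 define T where "T = (if 0 < t then t else 1)"
 have T: "0 < T" by (simp add: T_def)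
 show ?thesis
 proof (cases "finite {k. jump_time w k <= T}")
  case False
  then show ?thesis using assms T
   by (intro step_pathsI[where J="{}"]) (auto simp: wpath_def walk_path_def T_def)
 next
  case True
  let ?J = "jump_time w ` {k. jump_time w k <= T} \<inter> {0<..T}"
  show ?thesis
  proof (rule step_pathsI[where J="?J"])
   show "snd (wpath x t w) u : grid N" for u
    using measurable_space[OF measurable_skeleton[OF assms(1)] assms(2)] assms(1)
    by (auto simp: wpath_def walk_path_def walk_def)
   fix s u :: real assume *: "s <= u" "{s<..u} \<inter> ?J = {}"
   let ?s = "max 0 (min s T)" and ?u = "max 0 (min u T)"
   have "jump_time w k <= ?s \<longleftrightarrow> jump_time w k <= ?u" for k
   proof -
    have "~ (?s < jump_time w k & jump_time w k <= ?u)"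
    proof
     assume **: "?s < jump_time w k & jump_time w k <= ?u"
     then have "jump_time w k : ?J" "jump_time w k : {s<..u}" using T
      by (auto simp: max_def min_def split: if_splits)
     then show False using * by blast
    qed
    then show ?thesis using *(1) by (auto simp: max_def min_def split: if_splits)
   qed
   then have "walk x w ?s = walk x w ?u" by (simp add: walk_def)
   then show "snd (wpath x t w) s = snd (wpath x t w) u"
    using True by (simp add: wpath_def walk_path_def T_def)
  qed (use T True in \<open>auto simp: wpath_def walk_path_def T_def\<close>)
 qed
qed

lemma measurable_wpath [measurable]:
 assumes x: "x : grid N"
 shows "(%(t, w). wpath x t w) : borel ** src N ->M PS N"
proof (rule measurable_path_spaceI)
 fix y :: "real \<times> (nat => point \<times> real)" assume "y : space (borel ** src N)"
 then show "(case y of (t, w) => wpath x t w) : SP N"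
  using wpath_step_paths[OF x] by (auto simp: space_pair_measure)
next
 have "(%y. fst (case y of (t, w) => wpath x t w)) = (%y. if 0 < fst y then fst y else 1)"
  by (auto simp: wpath_def walk_path_def fun_eq_iff)
 also have "... : bm (borel ** src N)" by measurable
 finally show "(%y. fst (case y of (t, w) => wpath x t w)) : bm (borel ** src N)" .
next
 fix u
 let ?T = "%y. if 0 < fst y then fst y else 1 :: real"
 have [measurable]: "(%y. x + (\<Sum>i<n. fst (snd y i))) : borel ** src N ->M count_space (grid N)" for n
  by (rule measurable_compose[OF measurable_snd measurable_skeleton[OF x]])
 have [measurable]: "(%y. walk x (snd y) (max 0 (min u (?T y)))) : borel ** src N ->M count_space (grid N)"
  unfolding walk_def
  by (rule measurable_compose_countable[where f="%n y. x + (\<Sum>i<n. fst (snd y i))" and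
     g="%y. card {k. jump_time (snd y) k <= max 0 (min u (?T y))}"]) measurable
 have "(%y. snd (case y of (t, w) => wpath x t w) u)
   = (%y. if finite {k. jump_time (snd y) k <= ?T y} then walk x (snd y) (max 0 (min u (?T y))) else x)"
  by (auto simp: wpath_def walk_path_def fun_eq_iff)
 also have "... : borel ** src N ->M count_space (grid N)"
 proof (rule measurable_If)
  have "Measurable.pred (borel ** src N) (%y. finite {k. jump_time (snd y) k <= ?T y})"
   by (rule measurable_finite) measurable
  then show "{y : space (borel ** src N). finite {k. jump_time (snd y) k <= ?T y}}
   : sets (borel ** src N)" by (simp add: pred_def)
 qed (use x in simp_all)
 finally show "(%y. snd (case y of (t, w) => wpath x t w) u) : borel ** src N ->M count_space (grid N)" .
qed

lemma measurable_wpath' [measurable (raw)]: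
 assumes "x : grid N" "f : bm X" "g : X ->M src N"
 shows "(%y. wpath x (f y) (g y)) : X ->M PS N"
 using measurable_compose[OF measurable_Pair[OF assms(2,3)] measurable_wpath[OF assms(1)]] by simp


text \<open>An event of full measure on which the replacement path inside \<open>walk_path\<close>
  never occurs.\<close>

definition good_source :: "(nat => point \<times> real) => bool" where
 "good_source w \<longleftrightarrow> (ALL i. 0 < snd (w i)) & (ALL t. finite {k. jump_time w k <= t})"

lemma jump_time_case_nat:
 "jump_time (case_nat y w) 0 = snd y" "jump_time (case_nat y w) (Suc k) = snd y + jump_time w k"
 unfolding jump_time_def sum.atMost_Suc_shift by simp_all

lemma measurable_case_nat_source [measurable (raw)]:
 assumes "f : X ->M step_hold" "g : X ->M src N"
 shows "(%y. case_nat (f y) (g y)) : X ->M src N"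
 using assms unfolding walk_source_eq by measurable

lemma measurable_snd_step_hold [measurable]: "snd : bm step_hold"
proof -
 have "snd : step_hold ->M density lborel (%h. ennreal (exponential_density (4 * (real N)\<^sup>2) h))"
  unfolding step_hold_def by measurable
 then show ?thesis by simp
qed

lemma AE_holding_pos: "AE w in src N. ALL i. 0 < snd (w i)"
proof (subst AE_all_countable, rule allI)
 fix i
 interpret sequence_space step_hold by (rule sequence_space_step_hold)
 have "(NI y. indicator {y. ~ 0 < snd y} y;step_hold) = 0"
 proof (subst nn_integral_step_hold)
  show "(\<Sum>s\<in>steps N. NI h. ennreal ((real N)\<^sup>2) * indicator {y. ~ 0 < snd y} (s, h);expm) = 0"
  proof (rule sum.neutral, rule ballI)
   fix s :: point
   have "(NI h. ennreal ((real N)\<^sup>2) * indicator {y. ~ 0 < snd y} (s, h);expm) = (NI h. 0;expm)"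
    using AE_expm by (intro nn_integral_cong_AE) (auto simp: indicator_def)
   then show "(NI h. ennreal ((real N)\<^sup>2) * indicator {y. ~ 0 < snd y} (s, h);expm) = 0" by simp
  qed
 next
  fix s :: point
  have "(indicator {h. ~ 0 < h} :: real => ennreal) : bm borel" by measurable
  then show "(%h::real. indicator {y. ~ 0 < snd y} (s, h) :: ennreal) : bm borel"
   by (rule measurable_cong[THEN iffD1, rotated]) (simp add: indicator_def)
 qed
 moreover have "(%y. indicator {y. ~ 0 < snd y} y :: ennreal) : bm step_hold" by measurable
 ultimately have "AE y in step_hold. indicator {y. ~ 0 < snd y} y = (0 :: ennreal)"
  by (simp add: nn_integral_0_iff_AE)
 then have "AE y in step_hold. 0 < snd y" by eventually_elim (auto simp: indicator_def split: if_splits)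
 then have *: "eventually (%y. 0 < snd y) (ae_filter (distr S step_hold (%w. w i)))"
  by (simp only: PiM_component[OF UNIV_I, of i])
 then show "AE w in src N. 0 < snd (w i)"
  unfolding walk_source_eq by (rule AE_distrD[rotated]) simp
qed

lemma nn_integral_expm_exp: "(NI h. ennreal (exp (- h));expm) = ennreal (1 / (4 * (real N)\<^sup>2 + 1))"
proof -
 have "(NI h. ennreal (exp (- h));expm)
  = (NI h. ennreal (indicator {0<..} h * exp (- (4 * (real N)\<^sup>2) * h)) * ennreal (exp (- h));lborel)"
  by (subst nn_integral_expm) auto
 also have "... = (NI h. ennreal (exp (- (4 * (real N)\<^sup>2 + 1) * h)) * indicator {0..} h;lborel)"
 proof (rule nn_integral_cong_AE)
  show "AE h in lborel. ennreal (indicator {0<..} h * exp (- (4 * (real N)\<^sup>2) * h)) * ennreal (exp (- h))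
   = ennreal (exp (- (4 * (real N)\<^sup>2 + 1) * h)) * indicator {0..} h"
   using AE_lborel_singleton[of 0]
   by eventually_elim (auto simp: indicator_def ennreal_mult[symmetric] exp_add[symmetric] algebra_simps)
 qed
 also have "... = ennreal (1 / (4 * (real N)\<^sup>2 + 1))"
  using nn_integral_exp_tail[of "4 * (real N)\<^sup>2 + 1" 0] N_pos by simp
 finally show ?thesis .
qed

lemma nn_integral_step_hold_exp:
 "(NI y. ennreal (exp (- snd y));step_hold) = ennreal (4 * (real N)\<^sup>2 / (4 * (real N)\<^sup>2 + 1))"
proof -
 have "(NI y. ennreal (exp (- snd y));step_hold)
  = (\<Sum>s\<in>steps N. NI h. ennreal ((real N)\<^sup>2) * ennreal (exp (- h));expm)"
  by (subst nn_integral_step_hold) auto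
 also have "(NI h. ennreal ((real N)\<^sup>2) * ennreal (exp (- h));expm) = ennreal ((real N)\<^sup>2 / (4 * (real N)\<^sup>2 + 1))"
  by (subst nn_integral_cmult) (auto simp: nn_integral_expm_exp ennreal_mult[symmetric])
 also have "(\<Sum>s\<in>steps N. ennreal ((real N)\<^sup>2 / (4 * (real N)\<^sup>2 + 1))) = ennreal (\<Sum>s\<in>steps N. (real N)\<^sup>2 / (4 * (real N)\<^sup>2 + 1))"
  by (rule sum_ennreal) simp
 finally show ?thesis by (simp add: card_steps)
qed

lemma nn_integral_exp_jump_time:
 "(NI w. ennreal (exp (- jump_time w k));src N)
   = ennreal (4 * (real N)\<^sup>2 / (4 * (real N)\<^sup>2 + 1)) ^ Suc k"
proof (induction k)
 interpret W: prob_space "src N" by (rule prob_space_walk_source)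
 {
  case 0
  show ?case
   by (subst nn_integral_walk_source_first)
    (auto simp: jump_time_case_nat nn_integral_step_hold_exp W.emeasure_space_1)
 next
  case (Suc k)
  have "(NI w. ennreal (exp (- jump_time w (Suc k)));src N)
   = (NI y. NI w. ennreal (exp (- snd y)) * ennreal (exp (- jump_time w k));src N;step_hold)"
   by (subst nn_integral_walk_source_first)
    (auto simp: jump_time_case_nat ennreal_mult[symmetric] exp_add[symmetric] algebra_simps)
  also have "... = (NI y. ennreal (exp (- snd y)) * ennreal (4 * (real N)\<^sup>2 / (4 * (real N)\<^sup>2 + 1)) ^ Suc k;step_hold)"
   by (subst nn_integral_cmult) (auto simp: Suc)
  also have "... = ennreal (4 * (real N)\<^sup>2 / (4 * (real N)\<^sup>2 + 1)) ^ Suc (Suc k)"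
   by (subst nn_integral_multc) (auto simp: nn_integral_step_hold_exp mult_ac)
  finally show ?case .
 }
qed

text \<open>Non-explosion: \<open>exp (- jump_time w k)\<close> has expectation r^(k+1), where r < 1
  is the Laplace transform of one holding time at 1. The series therefore has finite expectation,
  and almost surely its terms tend to 0.\<close>

lemma AE_good_source: "AE w in src N. good_source w"
proof -
 define r where "r = 4 * (real N)\<^sup>2 / (4 * (real N)\<^sup>2 + 1)"
 have "0 < 4 * (real N)\<^sup>2 + 1" using N_pos(3) by linarith
 then have r: "0 <= r" "r < 1" by (simp_all add: r_def divide_less_eq)
 have "(NI w. (\<Sum>k. ennreal (exp (- jump_time w k)));src N) = (\<Sum>k. ennreal (r ^ Suc k))"
  using r by (subst nn_integral_suminf) (auto simp: nn_integral_exp_jump_time r_def[symmetric] ennreal_power simp del: power_Suc)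
 also have "... < \<infinity>"
  using r by (subst suminf_ennreal2) (auto intro!: summable_mult summable_geometric)
 finally have "AE w in src N. (\<Sum>k. ennreal (exp (- jump_time w k))) ~= \<infinity>"
  by (intro nn_integral_noteq_infinite) auto
 with AE_holding_pos show ?thesis
 proof eventually_elim
  case (elim w)
  have "summable (%k. exp (- jump_time w k))"
   using elim(2) by (intro summable_suminf_not_top) auto
  then have lim: "(%k. exp (- jump_time w k)) \<longlonglongrightarrow> 0" by (rule summable_LIMSEQ_zero)
  have "finite {k. jump_time w k <= t}" for t
  proof -
   have "\<forall>\<^sub>F k in sequentially. exp (- jump_time w k) < exp (- t)"
    using lim by (rule order_tendstoD) simp
   then obtain k0 where "!!k. k \<ge> k0 ==> t < jump_time w k"
    by (auto simp: eventually_sequentially)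
   then have "{k. jump_time w k <= t} \<subseteq> {..<k0}" by (auto simp: not_le[symmetric])
   then show ?thesis using finite_subset by blast
  qed
  then show ?case using elim by (auto simp: good_source_def)
 qed
qed

definition njumps :: "real => (nat => point \<times> real) => nat" where
 "njumps t w = card {k. jump_time w k <= t}"

lemma measurable_njumps [measurable (raw)]:
 assumes [measurable]: "f : bm X" "g : X ->M src N"
 shows "(%y. njumps (f y) (g y)) : X ->M count_space UNIV"
 unfolding njumps_def by measurable

lemma good_source_jump_pos: "good_source w ==> 0 < jump_time w k"
 by (auto simp: good_source_def jump_time_def intro!: sum_pos)

lemma jump_times_case_nat:
 assumes "good_source w" "0 < snd y"
 shows "{k. jump_time (case_nat y w) k <= t} =
  (if snd y <= t then insert 0 (Suc ` {k. jump_time w k <= t - snd y}) else {})" (is "?L = ?R")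
proof (rule set_eqI)
 fix k
 show "k : ?L \<longleftrightarrow> k : ?R"
 proof (cases k)
  case 0 then show ?thesis by (auto simp: jump_time_case_nat)
 next
  case (Suc j)
  then show ?thesis using good_source_jump_pos[OF assms(1), of j]
   by (auto simp: jump_time_case_nat algebra_simps)
 qed
qed

lemma good_source_case_nat:
 assumes "good_source w" "0 < snd y" shows "good_source (case_nat y w)"
 using assms unfolding good_source_def jump_times_case_nat[OF assms]
 by (auto split: nat.split)

lemma njumps_case_nat:
 assumes "good_source w" "0 < snd y"
 shows "njumps t (case_nat y w) = (if snd y <= t then Suc (njumps (t - snd y) w) else 0)"
 using assms(1) unfolding njumps_def jump_times_case_nat[OF assms]
 by (auto simp: card_image good_source_def)

lemma walk_case_nat:
 assumes "good_source w" "0 < snd y"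
 shows "walk x (case_nat y w) t = (if snd y <= t then walk (x + fst y) w (t - snd y) else x)"
proof -
 have "(\<Sum>i<Suc n. fst (case_nat y w i)) = fst y + (\<Sum>i<n. fst (w i))" for n
  by (subst sum.lessThan_Suc_shift) simp
 then show ?thesis
  unfolding walk_def njumps_def[symmetric] njumps_case_nat[OF assms]
  by (simp add: add.assoc)
qed

lemma wpath_case_nat_gt:
 assumes "good_source w" "0 < snd y" "0 < t" "t < snd y"
 shows "wpath x t (case_nat y w) = hold x t"
proof (rule path_eqI)
 fix u
 have "~ snd y <= max 0 (min u t)" using assms by auto
 then have "walk x (case_nat y w) (max 0 (min u t)) = x"
  using walk_case_nat[OF assms(1,2)] by metis
 then show "snd (wpath x t (case_nat y w)) u = snd (hold x t) u"
  using assms(3) by (simp add: wpath_def walk_path_def)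
qed (use assms in \<open>simp add: wpath_def walk_path_def\<close>)

text \<open>Equality of \<open>t\<close> with the first holding time is left out: the remainder
  would have duration 0, which \<open>wpath\<close> replaces by 1. This is a single value of
  \<open>t\<close>, negligible under Lebesgue measure.\<close>

lemma wpath_case_nat_less:
 assumes "good_source w" "0 < snd y" "snd y < t"
 shows "wpath x t (case_nat y w) = papp (hold x (snd y)) (wpath (x + fst y) (t - snd y) w)"
proof (rule path_eqI)
 fix u
 have fin: "finite {k. jump_time (case_nat y w) k <= t}" "finite {k. jump_time w k <= t - snd y}"
  using good_source_case_nat[OF assms(1,2)] assms(1) by (auto simp: good_source_def)
 have *: "max 0 (min u t) - snd y = max 0 (min (u - snd y) (t - snd y))" if "~ u < snd y"
  using that assms by (auto simp: max_def min_def)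
 have "max 0 (min u t) < snd y \<longleftrightarrow> u < snd y" using assms by auto
 then show "snd (wpath x t (case_nat y w)) u
   = snd (papp (hold x (snd y)) (wpath (x + fst y) (t - snd y) w)) u"
  using assms fin * by (auto simp: wpath_def walk_path_def walk_case_nat not_le[symmetric])
qed (use assms in \<open>simp add: wpath_def walk_path_def\<close>)

lemma append_hold_staying_iff:
 assumes "x : grid N" "0 < h" "p : SP N"
 shows "papp (hold x h) p : staying N E w \<longleftrightarrow> x : E & p : staying N E w"
proof -
 let ?q = "papp (hold x h) p"
 have q: "?q : SP N" using assms by (intro path_append_step hold_path_step)
 have pos: "0 < fst p" using assms step_paths_pos by auto
 have "?q : staying N E w \<longleftrightarrow> snd ?q (fst ?q) = w & (\<forall>s\<in>{0..fst ?q}. snd ?q s : E)"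
  using q by (auto simp: staying_def case_prod_unfold simp del: path_append_simps)
 also have "... \<longleftrightarrow> snd p (fst p) = w & x : E & (\<forall>s\<in>{0..fst p}. snd p s : E)"
 proof -
  have "(\<forall>s\<in>{0..fst ?q}. snd ?q s : E) \<longleftrightarrow> x : E & (\<forall>s\<in>{0..fst p}. snd p s : E)"
  proof safe
   assume *: "\<forall>s\<in>{0..fst ?q}. snd ?q s : E"
   from bspec[OF *, of 0] show "x : E" using assms pos by simp
   fix s assume "s : {0..fst p}"
   with bspec[OF *, of "s + h"] show "snd p s : E" using assms by simp
  qed (use assms in auto)
  then show ?thesis using assms pos by auto
 qed
 also have "... \<longleftrightarrow> x : E & p : staying N E w"
  using assms(3) by (auto simp: staying_def case_prod_unfold)
 finally show ?thesis .
qed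

lemma hold_staying_iff:
 assumes "x : grid N" "0 < h"
 shows "hold x h : staying N E w \<longleftrightarrow> x : E & x = w"
proof -
 have "EX s. 0 <= s & s <= h" using assms(2) by (intro exI[of _ 0]) simp
 then show ?thesis
  using assms hold_path_step[OF assms(1), of h] by (simp add: staying_def case_prod_unfold) blast
qed

end

section \<open>Path measures graded by the number of jumps\<close>

context grid_walk
begin

sublocale source: prob_space "src N"
 by (rule prob_space_walk_source)

sublocale expm: finite_measure expm
 by (rule finite_measure_expm)

sublocale time_source: pair_sigma_finite "lborel :: real measure" "src N" ..

lemma measurable_Pair_step_hold:
 assumes "s : steps N" shows "Pair s : borel ->M step_hold"
 unfolding step_hold_def
 by (intro measurable_Pair measurable_const measurable_ident_sets)
  (use assms in \<open>simp_all add: space_uniform_count_measure\<close>)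

lemma measurable_case_nat_hold [measurable (raw)]:
 assumes "s : steps N" "f : bm X" "g : X ->M src N"
 shows "(%y. case_nat (s, f y) (g y)) : X ->M src N"
 by (intro measurable_case_nat_source assms(3) measurable_compose[OF assms(2) measurable_Pair_step_hold[OF assms(1)]])

text \<open>\<open>path_measure N E x w\<close> without its factor N^2, restricted to paths with
  exactly \<open>n\<close> jumps. The grading yields finite measures, which Fubini needs, and a
  parameter for induction.\<close>

definition PM :: "point set => nat => point => point => path measure" where
 "PM E n x w = distr (density (lborel ** src N)
   (%y. if 0 < fst y & njumps (fst y) (snd y) = n & wpath x (fst y) (snd y) : staying N E w then 1 else 0))
   (PS N) (%y. wpath x (fst y) (snd y))"

lemma sets_PM [simp, measurable_cong]: "sets (PM E n x w) = sets (PS N)"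
 and space_PM [simp]: "space (PM E n x w) = SP N"
 by (simp_all add: PM_def)

lemma nn_integral_PM:
 assumes [measurable]: "x : grid N" "f : bm (PS N)"
 shows "(NI p. f p;PM E n x w) = (NI t. NI v. (if 0 < t & njumps t v = n & wpath x t v : staying N E w
   then f (wpath x t v) else 0);src N;lborel)"
proof -
 have "(NI p. f p;PM E n x w) = (NI y. (if 0 < fst y & njumps (fst y) (snd y) = n & wpath x (fst y) (snd y) : staying N E w
   then 1 else 0) * f (wpath x (fst y) (snd y));(lborel ** src N))"
  unfolding PM_def by (subst nn_integral_distr, measurable, subst nn_integral_density, measurable)
 also have "... = (NI y. (if 0 < fst y & njumps (fst y) (snd y) = n & wpath x (fst y) (snd y) : staying N E w
   then f (wpath x (fst y) (snd y)) else 0);(lborel ** src N))"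
  by (intro nn_integral_cong) auto
 also have "... = (NI t. NI v. (if 0 < t & njumps t v = n & wpath x t v : staying N E w
   then f (wpath x t v) else 0);src N;lborel)"
  by (subst source.nn_integral_fst[symmetric], measurable) (simp cong: if_cong)
 finally show ?thesis .
qed

lemma nn_integral_PM_first:
 assumes x: "x : grid N" and f[measurable]: "f : bm (PS N)"
 shows "(NI p. f p;PM E n x w) = (\<Sum>s\<in>steps N. NI h. ennreal ((real N)\<^sup>2) *
  (NI v. NI t. (if 0 < t & njumps t (case_nat (s, h) v) = n & wpath x t (case_nat (s, h) v) : staying N E w
   then f (wpath x t (case_nat (s, h) v)) else 0);lborel;src N);expm)"
proof -
 note [measurable] = x
 define G where "G t v = (if 0 < t & njumps t v = n & wpath x t v : staying N E w
   then f (wpath x t v) else 0)" for t v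
 have [measurable]: "(%y. G (a y) (b y)) : bm Y"
  if [measurable]: "a : bm Y" "b : Y ->M src N" for a b and Y :: "'y measure"
  unfolding G_def by measurable
 have "(NI p. f p;PM E n x w) = (NI t. NI v. G t v;src N;lborel)"
  unfolding G_def by (rule nn_integral_PM[OF x f])
 also have "... = (NI v. NI t. G t v;lborel;src N)"
  by (rule time_source.Fubini'[symmetric]) measurable
 also have "... = (NI y. NI v. NI t. G t (case_nat y v);lborel;src N;step_hold)"
  by (rule nn_integral_walk_source_first) measurable
 also have "... = (\<Sum>s\<in>steps N. NI h. ennreal ((real N)\<^sup>2) *
  (NI v. NI t. G t (case_nat (s, h) v);lborel;src N);expm)"
  by (rule nn_integral_step_hold) measurable
 finally show ?thesis unfolding G_def .
qed

text \<open>Decomposition at the first jump. As every duration has Lebesgue weight, the time left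
  after a first holding period \<open>h\<close> has Lebesgue weight again, by translation.\<close>

lemma nn_integral_PM_Suc:
 assumes x: "x : grid N" and f[measurable]: "f : bm (PS N)"
 shows "(NI p. f p;PM E (Suc n) x w) = (if x : E then \<Sum>s\<in>steps N. ennreal ((real N)\<^sup>2) *
  (NI h. NI p. f (papp (hold x h) p);PM E n (x + s) w;expm) else 0)"
proof -
 note [measurable] = x
 have "(NI h. ennreal ((real N)\<^sup>2) *
  (NI v. NI t. (if 0 < t & njumps t (case_nat (s, h) v) = Suc n & wpath x t (case_nat (s, h) v) : staying N E w
   then f (wpath x t (case_nat (s, h) v)) else 0);lborel;src N);expm)
  = (if x : E then ennreal ((real N)\<^sup>2) * (NI h. NI p. f (papp (hold x h) p);PM E n (x + s) w;expm) else 0)"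
  if s: "s : steps N" for s
 proof -
  have xs[measurable]: "x + s : grid N" using x s by (rule grid_add_steps)
  define g where "g h t v = (if 0 < t & njumps t v = n & wpath (x + s) t v : staying N E w
    then f (papp (hold x h) (wpath (x + s) t v)) else 0)" for h t v
  have [measurable]: "(%y. g h (a y) (b y)) : bm Y"
   if [measurable]: "a : bm Y" "b : Y ->M src N" for a b h and Y :: "'y measure"
   unfolding g_def by measurable
  have "(NI v. NI t. (if 0 < t & njumps t (case_nat (s, h) v) = Suc n & wpath x t (case_nat (s, h) v) : staying N E w
   then f (wpath x t (case_nat (s, h) v)) else 0);lborel;src N)
   = (if x : E then (NI p. f (papp (hold x h) p);PM E n (x + s) w) else 0)" if h: "0 < h" for h
  proof -
   have "(NI v. NI t. (if 0 < t & njumps t (case_nat (s, h) v) = Suc n & wpath x t (case_nat (s, h) v) : staying N E w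
    then f (wpath x t (case_nat (s, h) v)) else 0);lborel;src N)
    = (NI v. NI t. (if x : E then g h (t + - h) v else 0);lborel;src N)"
   proof (rule nn_integral_cong_AE)
    show "AE v in src N. (NI t. (if 0 < t & njumps t (case_nat (s, h) v) = Suc n & wpath x t (case_nat (s, h) v) : staying N E w
     then f (wpath x t (case_nat (s, h) v)) else 0);lborel) = (NI t. (if x : E then g h (t + - h) v else 0);lborel)"
     using AE_good_source AE_space
    proof eventually_elim
     case (elim v)
     show ?case
     proof (rule nn_integral_cong_AE)
      show "AE t in lborel. (if 0 < t & njumps t (case_nat (s, h) v) = Suc n & wpath x t (case_nat (s, h) v) : staying N E w
       then f (wpath x t (case_nat (s, h) v)) else 0) = (if x : E then g h (t + - h) v else 0)"
       using AE_lborel_singleton[of h]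
      proof eventually_elim
       fix t assume "t ~= h"
       show "(if 0 < t & njumps t (case_nat (s, h) v) = Suc n & wpath x t (case_nat (s, h) v) : staying N E w
        then f (wpath x t (case_nat (s, h) v)) else 0) = (if x : E then g h (t + - h) v else 0)"
       proof (cases "t < h")
        case True
        then show ?thesis using elim h by (simp add: njumps_case_nat g_def)
       next
        case False
        with \<open>t ~= h\<close> have "h < t" by simp
        moreover have "wpath (x + s) (t - h) v : SP N"
         using elim(2) xs by (rule wpath_step_paths[rotated])
        ultimately show ?thesis using elim h x
         by (simp add: njumps_case_nat g_def wpath_case_nat_less append_hold_staying_iff)
       qed
      qed
     qed
    qed
   qed
   also have "... = (if x : E then (NI v. NI t. g h (t + - h) v;lborel;src N) else 0)"
    by simp
   also have "(NI v. NI t. g h (t + - h) v;lborel;src N) = (NI v. NI t. g h t v;lborel;src N)"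
    by (intro nn_integral_cong nn_integral_shift) measurable
   also have "... = (NI t. NI v. g h t v;src N;lborel)"
    by (rule time_source.Fubini') measurable
   also have "... = (NI p. f (papp (hold x h) p);PM E n (x + s) w)"
    unfolding g_def by (rule nn_integral_PM[OF xs, symmetric]) measurable
   finally show ?thesis .
  qed
  note inner = this
  have "(NI h. ennreal ((real N)\<^sup>2) *
   (NI v. NI t. (if 0 < t & njumps t (case_nat (s, h) v) = Suc n & wpath x t (case_nat (s, h) v) : staying N E w
    then f (wpath x t (case_nat (s, h) v)) else 0);lborel;src N);expm)
   = (NI h. ennreal ((real N)\<^sup>2) * (if x : E then (NI p. f (papp (hold x h) p);PM E n (x + s) w) else 0);expm)"
   by (intro nn_integral_cong_AE) (use AE_expm in \<open>eventually_elim, simp only: inner\<close>)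
  also have "... = (if x : E then ennreal ((real N)\<^sup>2) * (NI h. NI p. f (papp (hold x h) p);PM E n (x + s) w;expm) else 0)"
  proof -
   have "(%h. NI p. f (papp (hold x h) p);PM E n (x + s) w)
    = (%h. NI t. NI v. g h t v;src N;lborel)"
    unfolding g_def by (intro ext nn_integral_PM[OF xs]) measurable
   also have "... : bm expm" unfolding g_def by measurable
   finally show ?thesis by (simp add: nn_integral_cmult)
  qed
  finally show ?thesis .
 qed
 then show ?thesis
  unfolding nn_integral_PM_first[OF x f] by simp
qed

text \<open>Without a jump the duration \<open>t\<close> lies below the first holding period
  \<open>h\<close>. Integrating out \<open>h\<close> leaves the exponential tail at
  \<open>t\<close>, so \<open>t\<close> is again distributed as \<open>expm\<close>; the four equal
  steps and the factor N^2 cancel the constant 1/(4 N^2) of the tail.\<close>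

lemma nn_integral_PM_0:
 assumes x: "x : grid N" and f[measurable]: "f : bm (PS N)"
 shows "(NI p. f p;PM E 0 x w) = (if x : E & x = w then NI h. f (hold x h);expm else 0)"
proof -
 note [measurable] = x
 let ?g = "%h t. if 0 < t & t < h & x : E & x = w then f (hold x t) else 0"
 interpret te: pair_sigma_finite "lborel :: real measure" expm ..
 have "(NI h. ennreal ((real N)\<^sup>2) *
  (NI v. NI t. (if 0 < t & njumps t (case_nat (s, h) v) = 0 & wpath x t (case_nat (s, h) v) : staying N E w
   then f (wpath x t (case_nat (s, h) v)) else 0);lborel;src N);expm)
  = (NI h. ennreal ((real N)\<^sup>2) * (NI t. ?g h t;lborel);expm)"
  if s: "s : steps N" for s
 proof (rule nn_integral_cong_AE)
  show "AE h in expm. ennreal ((real N)\<^sup>2) * (NI v. NI t. (if 0 < t & njumps t (case_nat (s, h) v) = 0 & wpath x t (case_nat (s, h) v) : staying N E w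
   then f (wpath x t (case_nat (s, h) v)) else 0);lborel;src N) = ennreal ((real N)\<^sup>2) * (NI t. ?g h t;lborel)"
   using AE_expm
  proof eventually_elim
   fix h :: real assume h: "0 < h"
   have "(NI v. NI t. (if 0 < t & njumps t (case_nat (s, h) v) = 0 & wpath x t (case_nat (s, h) v) : staying N E w
    then f (wpath x t (case_nat (s, h) v)) else 0);lborel;src N) = (NI v. NI t. ?g h t;lborel;src N)"
   proof (rule nn_integral_cong_AE)
    show "AE v in src N. (NI t. (if 0 < t & njumps t (case_nat (s, h) v) = 0 & wpath x t (case_nat (s, h) v) : staying N E w
     then f (wpath x t (case_nat (s, h) v)) else 0);lborel) = (NI t. ?g h t;lborel)"
     using AE_good_source
    proof eventually_elim
     case (elim v)
     show ?case
     proof (rule nn_integral_cong_AE)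
      show "AE t in lborel. (if 0 < t & njumps t (case_nat (s, h) v) = 0 & wpath x t (case_nat (s, h) v) : staying N E w
       then f (wpath x t (case_nat (s, h) v)) else 0) = ?g h t"
       using AE_lborel_singleton[of h]
       by eventually_elim (use elim h x in \<open>auto simp: njumps_case_nat wpath_case_nat_gt hold_staying_iff\<close>)
     qed
    qed
   qed
   also have "... = (NI t. ?g h t;lborel)" by (simp add: source.emeasure_space_1)
   finally show "ennreal ((real N)\<^sup>2) * (NI v. NI t. (if 0 < t & njumps t (case_nat (s, h) v) = 0 & wpath x t (case_nat (s, h) v) : staying N E w
   then f (wpath x t (case_nat (s, h) v)) else 0);lborel;src N) = ennreal ((real N)\<^sup>2) * (NI t. ?g h t;lborel)" by simp
  qed
 qed
 then have "(NI p. f p;PM E 0 x w) = (\<Sum>s\<in>steps N. NI h. ennreal ((real N)\<^sup>2) * (NI t. ?g h t;lborel);expm)"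
  unfolding nn_integral_PM_first[OF x f] by simp
 also have "... = 4 * (NI h. ennreal ((real N)\<^sup>2) * (NI t. ?g h t;lborel);expm)"
  by (simp add: card_steps)
 also have "... = ennreal (4 * (real N)\<^sup>2) * (NI h. NI t. ?g h t;lborel;expm)"
  by (subst nn_integral_cmult, measurable) (simp add: ennreal_mult mult.assoc)
 also have "(NI h. NI t. ?g h t;lborel;expm) = (NI t. NI h. ?g h t;expm;lborel)"
  by (rule te.Fubini') measurable
 also have "... = (NI t. (if 0 < t & x : E & x = w then f (hold x t) * emeasure expm {t<..} else 0);lborel)"
 proof (rule nn_integral_cong)
  fix t :: real
  have *: "(NI h. ?g h t;expm) = (NI h. (if 0 < t & x : E & x = w then f (hold x t) else 0) * indicator {t<..} h;expm)"
   by (intro nn_integral_cong) (auto simp: indicator_def)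
  show "(NI h. ?g h t;expm) = (if 0 < t & x : E & x = w then f (hold x t) * emeasure expm {t<..} else 0)"
   unfolding * by (subst nn_integral_cmult_indicator) (simp_all only: if_distrib[of "%a. a * _"] mult_zero_left sets_expm, simp)
 qed
 also have "ennreal (4 * (real N)\<^sup>2) * ...
  = (NI t. ennreal (4 * (real N)\<^sup>2) * (if 0 < t & x : E & x = w then f (hold x t) * emeasure expm {t<..} else 0);lborel)"
 proof (rule nn_integral_cmult[symmetric])
  have "(%t. if 0 < t & x : E & x = w then f (hold x t) * emeasure expm {t<..} else 0)
   = (%t. if 0 < t & x : E & x = w then f (hold x t) * ennreal (exp (- (4 * (real N)\<^sup>2) * t) / (4 * (real N)\<^sup>2)) else 0)"
   by (auto simp: emeasure_expm_tail fun_eq_iff)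
  also have "... : bm lborel" by measurable
  finally show "(%t. if 0 < t & x : E & x = w then f (hold x t) * emeasure expm {t<..} else 0) : bm lborel" .
 qed
 also have "... = (NI t. ennreal (indicator {0<..} t * exp (- (4 * (real N)\<^sup>2) * t)) *
   (if x : E & x = w then f (hold x t) else 0);lborel)"
 proof (rule nn_integral_cong)
  fix t :: real
  have "ennreal (4 * (real N)\<^sup>2) * ennreal (exp (- (4 * (real N)\<^sup>2) * t) / (4 * (real N)\<^sup>2)) = ennreal (exp (- (4 * (real N)\<^sup>2) * t))"
   using N_pos by (simp add: ennreal_mult[symmetric])
  then show "ennreal (4 * (real N)\<^sup>2) * (if 0 < t & x : E & x = w then f (hold x t) * emeasure expm {t<..} else 0)
   = ennreal (indicator {0<..} t * exp (- (4 * (real N)\<^sup>2) * t)) * (if x : E & x = w then f (hold x t) else 0)"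
   by (auto simp: emeasure_expm_tail indicator_def mult.left_commute) (metis mult.commute)
 qed
 also have "... = (NI t. (if x : E & x = w then f (hold x t) else 0);expm)"
  by (subst nn_integral_expm) measurable
 finally show ?thesis by auto
qed

end

context grid_walk
begin

lemma emeasure_PM_Suc:
 assumes "x : grid N"
 shows "emeasure (PM E (Suc n) x w) (SP N)
  = (if x : E then ennreal (1 / 4) * (\<Sum>s\<in>steps N. emeasure (PM E n (x + s) w) (SP N)) else 0)"
proof -
 have "emeasure (PM E (Suc n) x w) (SP N) = (NI p. 1;PM E (Suc n) x w)"
  by simp
 also have "... = (if x : E then \<Sum>s\<in>steps N. ennreal ((real N)\<^sup>2) *
   (emeasure (PM E n (x + s) w) (SP N) * ennreal (1 / (4 * (real N)\<^sup>2))) else 0)"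
  by (subst nn_integral_PM_Suc[OF assms]) (auto simp: emeasure_expm_UNIV)
 also have "... = (if x : E then \<Sum>s\<in>steps N. ennreal (1 / 4) * emeasure (PM E n (x + s) w) (SP N) else 0)"
 proof -
  have "ennreal ((real N)\<^sup>2) * ennreal (1 / (4 * (real N)\<^sup>2)) = ennreal (1 / 4)"
   using N_pos by (simp add: ennreal_mult[symmetric])
  then have "ennreal ((real N)\<^sup>2) * (m * ennreal (1 / (4 * (real N)\<^sup>2))) = ennreal (1 / 4) * m" for m
   by (metis mult.left_commute mult.commute)
  then show ?thesis by simp
 qed
 finally show ?thesis by (simp add: sum_distrib_left)
qed

lemma emeasure_PM_0:
 assumes "x : grid N"
 shows "emeasure (PM E 0 x w) (SP N) = (if x : E & x = w then ennreal (1 / (4 * (real N)\<^sup>2)) else 0)"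
proof -
 have "emeasure (PM E 0 x w) (SP N) = (NI p. 1;PM E 0 x w)"
  by simp
 then show ?thesis by (subst (asm) nn_integral_PM_0[OF assms]) (auto simp: emeasure_expm_UNIV)
qed

lemma sum_steps_const: "(\<Sum>s\<in>steps N. ennreal (1 / 4) * c) = c"
proof -
 have "(\<Sum>s\<in>steps N. ennreal (1 / 4) * c) = (4 * ennreal (1 / 4)) * c"
  by (simp add: card_steps mult.assoc)
 also have "4 * ennreal (1 / 4) = ennreal (4 * (1 / 4))"
  by (subst ennreal_mult) auto
 finally show ?thesis by simp
qed

text \<open>By the first jump the mass for \<open>n + 1\<close> is 0 or an average over the four
  neighbours, so the bound for \<open>n = 0\<close> persists.\<close>

lemma emeasure_PM_le: "x : grid N ==> emeasure (PM E n x w) (SP N) <= ennreal (1 / (4 * (real N)\<^sup>2))"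
proof (induction n arbitrary: x)
 case (Suc n)
 have "ennreal (1 / 4) * (\<Sum>s\<in>steps N. emeasure (PM E n (x + s) w) (SP N))
  <= (\<Sum>s\<in>steps N. ennreal (1 / 4) * ennreal (1 / (4 * (real N)\<^sup>2)))"
  unfolding sum_distrib_left using Suc grid_add_steps by (intro sum_mono mult_left_mono) auto
 then show ?case using Suc.prems by (simp add: emeasure_PM_Suc sum_steps_const del: sum_constant)
qed (simp add: emeasure_PM_0)

lemma finite_measure_PM: "x : grid N ==> finite_measure (PM E n x w)"
 by (rule finite_measureI) (use emeasure_PM_le[of x E n w] in \<open>auto simp: top_unique\<close>)

lemma measurable_nn_integral_PM [measurable (raw)]:
 assumes "x : grid N" and [measurable]: "case_prod f : bm (Y ** PS N)"
 shows "(%y. NI p. f y p;PM E n x w) : bm Y"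
proof -
 interpret finite_measure "PM E n x w" by (rule finite_measure_PM[OF assms(1)])
 show ?thesis by measurable
qed

text \<open>Exponential densities multiply, so for a given sum \<open>u\<close> the summand
  \<open>h\<close> is free in \<open>(0, u)\<close> and contributes the length \<open>u\<close>.
  Read backwards: marking a time inside a holding period cuts it into two independent periods with
  law \<open>expm\<close>.\<close>

lemma nn_integral_expm_convolution:
 assumes [measurable]: "k : bm borel"
 shows "(NI h. NI g. k (h + g);expm;expm) = (NI h. ennreal h * k h;expm)"
proof -
 define e where "e h = ennreal (exp (- (4 * (real N)\<^sup>2) * h))" for h
 have [measurable]: "e : bm borel" unfolding e_def by measurable
 have expm: "(NI h. f h;expm) = (NI h. indicator {0<..} h * e h * f h;lborel)"
  if "f : bm borel" for f
  unfolding nn_integral_expm[OF that] by (intro nn_integral_cong) (auto simp: e_def indicator_def)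
 have e: "e h * e g = e (h + g)" for h g
  by (simp add: e_def ennreal_mult[symmetric] exp_add[symmetric] algebra_simps)
 have "(NI h. NI g. k (h + g);expm;expm)
  = (NI h. indicator {0<..} h * e h * (NI g. indicator {0<..} g * e g * k (h + g);lborel);lborel)"
  by (subst expm) (auto intro!: nn_integral_cong arg_cong2[where f=times] expm)
 also have "... = (NI h. NI g. (indicator {0<..} h * e h) * (indicator {0<..} g * e g * k (h + g));lborel;lborel)"
  by (intro nn_integral_cong nn_integral_cmult[symmetric]) measurable
 also have "... = (NI h. NI u. indicator {0<..} h * indicator {h<..} u * (e u * k u);lborel;lborel)"
 proof (rule nn_integral_cong)
  fix h :: real
  have "(NI g. (indicator {0<..} h * e h) * (indicator {0<..} g * e g * k (h + g));lborel)
   = (NI g. indicator {0<..} h * indicator {h<..} (g + h) * (e (g + h) * k (g + h));lborel)"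
  proof (rule nn_integral_cong)
   fix g :: real
   have "(indicator {0<..} h * e h) * (indicator {0<..} g * e g * k (h + g))
    = indicator {0<..} h * indicator {0<..} g * ((e h * e g) * k (h + g))"
    by (simp add: mult_ac)
   also have "... = indicator {0<..} h * indicator {h<..} (g + h) * (e (g + h) * k (g + h))"
    unfolding e by (auto simp: indicator_def add.commute)
   finally show "(indicator {0<..} h * e h) * (indicator {0<..} g * e g * k (h + g))
    = indicator {0<..} h * indicator {h<..} (g + h) * (e (g + h) * k (g + h))" .
  qed
  also have "... = (NI u. indicator {0<..} h * indicator {h<..} u * (e u * k u);lborel)"
   by (rule nn_integral_shift) measurable
  finally show "(NI g. (indicator {0<..} h * e h) * (indicator {0<..} g * e g * k (h + g));lborel) = ..." .
 qed
 also have "... = (NI u. NI h. indicator {0<..} h * indicator {h<..} u * (e u * k u);lborel;lborel)"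
 proof (rule lborel_pair.Fubini')
  have "(%y. indicator {0<..} (snd y) * (if snd y < fst y then 1 else 0) * (e (fst y) * k (fst y)) :: ennreal)
   : bm (lborel ** lborel :: (real \<times> real) measure)" by measurable
  also have "(%y. indicator {0<..} (snd y) * (if snd y < fst y then 1 else 0) * (e (fst y) * k (fst y)) :: ennreal)
   = (%(u, h). indicator {0<..} h * indicator {h<..} u * (e u * k u))"
   by (auto simp: fun_eq_iff)
  finally show "(%(u, h). indicator {0<..} h * indicator {h<..} u * (e u * k u) :: ennreal)
   : bm (lborel ** lborel :: (real \<times> real) measure)" .
 qed
 also have "... = (NI u. indicator {0<..} u * e u * (ennreal u * k u);lborel)"
 proof (rule nn_integral_cong)
  fix u :: real
  have "(NI h. indicator {0<..} h * indicator {h<..} u * (e u * k u);lborel) = (NI h. (e u * k u) * indicator {0<..<u} h;lborel)"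
   by (intro nn_integral_cong) (auto simp: indicator_def)
  also have "... = e u * k u * emeasure lborel {0<..<u}" by (subst nn_integral_cmult_indicator) auto
  also have "... = indicator {0<..} u * e u * (ennreal u * k u)"
   by (cases "0 < u") (auto simp: mult_ac)
  finally show "(NI h. indicator {0<..} h * indicator {h<..} u * (e u * k u);lborel) = ..." .
 qed
 also have "... = (NI h. ennreal h * k h;expm)"
  by (subst expm) auto
 finally show ?thesis .
qed

lemma expm_cong: "(!!h. 0 < h ==> f h = g h) ==> (NI h. f h;expm) = (NI h. g h;expm)"
 by (intro nn_integral_cong_AE) (use AE_expm in \<open>eventually_elim, simp\<close>)

lemma PM_cong: "(!!p. p : SP N ==> f p = g p) ==> (NI p. f p;PM E n x w) = (NI p. g p;PM E n x w)"
 by (intro nn_integral_cong) simp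

text \<open>The weight \<open>occ y\<close> is the choice of a time spent at \<open>y\<close>.
  Cutting there leaves two independent paths, because exponential holding periods have no memory;
  the jumps are shared out as \<open>i\<close> and \<open>n - i\<close>.\<close>

theorem PM_split:
 assumes x: "x : grid N" and y: "y : grid N" and f: "f : bm (PS N)"
 shows "(NI p. occ y p * f p;PM E n x w)
  = (\<Sum>i\<le>n. NI p. NI q. f (papp p q);PM E (n - i) y w;PM E i x y)"
 using x f
proof (induction n arbitrary: x f)
 case (0 x f)
 note [measurable] = 0 y
 have "(NI p. occ y p * f p;PM E 0 x w)
  = (if x : E & x = w then NI h. occ y (hold x h) * f (hold x h);expm else 0)"
  by (rule nn_integral_PM_0[OF 0(1)]) measurable
 also have "(NI h. occ y (hold x h) * f (hold x h);expm)
  = (if x = y then NI h. ennreal h * f (hold x h);expm else 0)"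
  by (subst expm_cong[where g="%h. if x = y then ennreal h * f (hold x h) else 0"])
   (auto simp: occ_hold_path)
 also have "(NI h. ennreal h * f (hold x h);expm)
   = (NI h. NI g. f (hold x (h + g));expm;expm)"
  by (rule nn_integral_expm_convolution[symmetric]) measurable
 also have "... = (NI h. NI g. f (papp (hold x h) (hold x g));expm;expm)"
  by (intro expm_cong) (simp add: path_append_hold)
 finally have *: "(NI p. occ y p * f p;PM E 0 x w) = (if x : E & x = w then if x = y then
  NI h. NI g. f (papp (hold x h) (hold x g));expm;expm else 0 else 0)" .
 have "(NI p. NI q. f (papp p q);PM E 0 y w;PM E 0 x y)
  = (if x : E & x = y then NI h. NI q. f (papp (hold x h) q);PM E 0 y w;expm else 0)"
  by (rule nn_integral_PM_0[OF 0(1)]) measurable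
 also have "... = (if x : E & x = y then NI h. (if y : E & y = w then
   NI g. f (papp (hold x h) (hold y g));expm else 0);expm else 0)"
  by (intro if_cong refl nn_integral_cong nn_integral_PM_0[OF y]) measurable
 finally show ?case
  unfolding * by (cases "x : E"; cases "x = y"; cases "y = w") auto
next
 case (Suc n x f)
 note [measurable] = Suc.prems y
 have m: "(%p. f (papp (hold x h) p)) : bm (PS N)" for h by measurable
 have xs[measurable]: "x + s : grid N" if "s : steps N" for s using that Suc.prems grid_add_steps by blast
 let ?N = "ennreal ((real N)\<^sup>2)"
 let ?A = "%s. NI h. ennreal h * (NI p. f (papp (hold x h) p);PM E n (x + s) w);expm"
 let ?B = "%s i. NI h. NI p. NI q. f (papp (hold x h) (papp p q));PM E (n - i) y w;PM E i (x + s) y;expm"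
 \<comment> \<open>The marked time lies either in the first holding period, which requires
   \<open>x = y\<close>, or in the rest of the path, where the induction hypothesis applies.\<close>
 have 1: "(NI h. NI p. occ y (papp (hold x h) p) * f (papp (hold x h) p);PM E n (x + s) w;expm)
   = (if x = y then ?A s else 0) + (\<Sum>i\<le>n. ?B s i)" if s: "s : steps N" for s
 proof -
  note [measurable] = xs[OF s]
  have "(NI h. NI p. occ y (papp (hold x h) p) * f (papp (hold x h) p);PM E n (x + s) w;expm)
   = (NI h. (if x = y then ennreal h * (NI p. f (papp (hold x h) p);PM E n (x + s) w) else 0)
     + (\<Sum>i\<le>n. NI p. NI q. f (papp (hold x h) (papp p q));PM E (n - i) y w;PM E i (x + s) y);expm)"
  proof (rule expm_cong)
   fix h :: real assume h: "0 < h"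
   have "(NI p. occ y (papp (hold x h) p) * f (papp (hold x h) p);PM E n (x + s) w)
    = (NI p. (if x = y then ennreal h else 0) * f (papp (hold x h) p)
      + occ y p * f (papp (hold x h) p);PM E n (x + s) w)"
    using h Suc.prems by (intro PM_cong) (simp add: occ_append[OF hold_path_step] occ_hold_path distrib_right)
   also have "... = (NI p. (if x = y then ennreal h else 0) * f (papp (hold x h) p);PM E n (x + s) w)
      + (NI p. occ y p * f (papp (hold x h) p);PM E n (x + s) w)"
    by (rule nn_integral_add) measurable
   also have "(NI p. (if x = y then ennreal h else 0) * f (papp (hold x h) p);PM E n (x + s) w)
    = (if x = y then ennreal h * (NI p. f (papp (hold x h) p);PM E n (x + s) w) else 0)"
    by (subst nn_integral_cmult) auto
   also have "(NI p. occ y p * f (papp (hold x h) p);PM E n (x + s) w)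
    = (\<Sum>i\<le>n. NI p. NI q. f (papp (hold x h) (papp p q));PM E (n - i) y w;PM E i (x + s) y)"
    by (rule Suc.IH) measurable
   finally show "(NI p. occ y (papp (hold x h) p) * f (papp (hold x h) p);PM E n (x + s) w)
    = (if x = y then ennreal h * (NI p. f (papp (hold x h) p);PM E n (x + s) w) else 0)
     + (\<Sum>i\<le>n. NI p. NI q. f (papp (hold x h) (papp p q));PM E (n - i) y w;PM E i (x + s) y)" .
  qed
  also have "... = (NI h. (if x = y then ennreal h * (NI p. f (papp (hold x h) p);PM E n (x + s) w) else 0);expm)
   + (NI h. (\<Sum>i\<le>n. NI p. NI q. f (papp (hold x h) (papp p q));PM E (n - i) y w;PM E i (x + s) y);expm)"
   by (rule nn_integral_add) measurable
  also have "(NI h. (\<Sum>i\<le>n. NI p. NI q. f (papp (hold x h) (papp p q));PM E (n - i) y w;PM E i (x + s) y);expm)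
   = (\<Sum>i\<le>n. ?B s i)"
   by (rule nn_integral_sum) measurable
  finally show ?thesis by (simp cong: if_cong)
 qed
 \<comment> \<open>The summand \<open>i = 0\<close>: the first piece is a rest at
   \<open>x = y\<close>, which glues with the initial holding period of the second piece.\<close>
 have 2: "(NI p. NI q. f (papp p q);PM E (Suc n) y w;PM E 0 x y)
  = (if x : E then \<Sum>s\<in>steps N. ?N * (if x = y then ?A s else 0) else 0)"
 proof (cases "x : E & x = y")
  case True
  then have xE: "x : E" "y = x" by auto
  have "(NI p. NI q. f (papp p q);PM E (Suc n) y w;PM E 0 x y)
   = (NI h. NI q. f (papp (hold x h) q);PM E (Suc n) y w;expm)"
   by (subst nn_integral_PM_0[OF Suc.prems(1)], measurable, subst if_P[OF True], rule refl)
  also have "... = (NI h. (\<Sum>s\<in>steps N. ?N * (NI g. NI q. f (papp (hold x h) (papp (hold x g) q));PM E n (x + s) w;expm));expm)"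
   using xE by (intro expm_cong) (simp add: nn_integral_PM_Suc[OF Suc.prems(1)])
  also have "... = (\<Sum>s\<in>steps N. NI h. ?N * (NI g. NI q. f (papp (hold x h) (papp (hold x g) q));PM E n (x + s) w;expm);expm)"
   by (rule nn_integral_sum) measurable
  also have "... = (\<Sum>s\<in>steps N. ?N * ?A s)"
  proof (rule sum.cong[OF refl])
   fix s assume s: "s : steps N"
   note [measurable] = xs[OF s]
   have "(NI h. ?N * (NI g. NI q. f (papp (hold x h) (papp (hold x g) q));PM E n (x + s) w;expm);expm)
    = ?N * (NI h. NI g. NI q. f (papp (hold x h) (papp (hold x g) q));PM E n (x + s) w;expm;expm)"
    by (rule nn_integral_cmult) measurable
   also have "(NI h. NI g. NI q. f (papp (hold x h) (papp (hold x g) q));PM E n (x + s) w;expm;expm)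
    = (NI h. NI g. NI q. f (papp (hold x (h + g)) q);PM E n (x + s) w;expm;expm)"
    by (intro expm_cong PM_cong) (simp add: path_append_assoc[symmetric] path_append_hold)
   also have "... = ?A s"
    by (rule nn_integral_expm_convolution) measurable
   finally show "(NI h. ?N * (NI g. NI q. f (papp (hold x h) (papp (hold x g) q));PM E n (x + s) w;expm);expm) = ?N * ?A s" .
  qed
  finally show ?thesis using xE by simp
 next
  case False
  have "(NI p. NI q. f (papp p q);PM E (Suc n) y w;PM E 0 x y) = 0"
   using False by (subst nn_integral_PM_0[OF Suc.prems(1)]) auto
  then show ?thesis using False by auto
 qed
 have 3: "(NI p. NI q. f (papp p q);PM E (n - i) y w;PM E (Suc i) x y)
  = (if x : E then \<Sum>s\<in>steps N. ?N * ?B s i else 0)" for i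
 proof -
  have "(NI p. NI q. f (papp p q);PM E (n - i) y w;PM E (Suc i) x y)
   = (if x : E then \<Sum>s\<in>steps N. ?N * (NI h. NI p. NI q. f (papp (papp (hold x h) p) q)
     ;PM E (n - i) y w;PM E i (x + s) y;expm) else 0)"
   by (rule nn_integral_PM_Suc[OF Suc.prems(1)]) measurable
  also have "... = (if x : E then \<Sum>s\<in>steps N. ?N * ?B s i else 0)"
   by (intro if_cong refl sum.cong arg_cong2[where f=times] expm_cong PM_cong)
    (simp add: path_append_assoc step_paths_pos)
  finally show ?thesis .
 qed
 have "(NI p. occ y p * f p;PM E (Suc n) x w)
  = (if x : E then \<Sum>s\<in>steps N. ?N * ((if x = y then ?A s else 0) + (\<Sum>i\<le>n. ?B s i)) else 0)"
  by (subst nn_integral_PM_Suc[OF Suc.prems(1)], measurable) (simp add: 1 cong: sum.cong if_cong)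
 also have "... = (if x : E then \<Sum>s\<in>steps N. ?N * (if x = y then ?A s else 0) else 0)
   + (\<Sum>i\<le>n. if x : E then \<Sum>s\<in>steps N. ?N * ?B s i else 0)"
  by (simp add: distrib_left sum.distrib sum_distrib_left sum.swap[of _ "{..n}"])
 also have "... = (\<Sum>i\<le>Suc n. NI p. NI q. f (papp p q);PM E (Suc n - i) y w;PM E i x y)"
  unfolding sum.atMost_Suc_shift by (simp only: 2 3 diff_Suc_Suc diff_zero)
 finally show ?case .
qed

end

text \<open>Passes from measures of sets to integrals by induction on the integrand. The counting
  measure on \<open>I\<close> covers finite sums, series and sums over a whole domain at
  once.\<close>

lemma nn_integral_eq_of_emeasure:
 fixes K :: "'i => 'a measure"
 assumes "!!i. i : I ==> sets (K i) = sets S" "sets b = sets S"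
  and em: "!!B. B : sets S ==> emeasure b B = (NI i. emeasure (K i) B;count_space I)"
  and f: "f : bm S"
 shows "(NI x. f x;b) = (NI i. NI x. f x;K i;count_space I)"
proof -
have m1: "g : bm b" if "g : bm S" for g :: "'a => ennreal"
 using that unfolding measurable_cong_sets[OF assms(2) refl] .
have m2: "g : bm (K i)" if "i : I" "g : bm S" for g :: "'a => ennreal" and i
 using that(2) unfolding measurable_cong_sets[OF assms(1)[OF that(1)] refl] .
show ?thesis
 using f
proof (induction rule: borel_measurable_induct)
 case (cong f g)
 have sp: "space b = space S" "!!i. i : I ==> space (K i) = space S"
  using sets_eq_imp_space_eq[OF assms(2)] sets_eq_imp_space_eq[OF assms(1)] by simp_all
 have "(NI x. f x;b) = (NI x. g x;b)"
  using cong sp by (intro nn_integral_cong) auto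
 moreover have "(NI x. f x;K i) = (NI x. g x;K i)" if "i : I" for i
  using cong sp(2)[OF that] by (intro nn_integral_cong) auto
 ultimately show ?case using cong(4) by (simp cong: nn_integral_cong_simp)
next
 case (set A)
 then show ?case using assms by (simp add: em cong: nn_integral_cong_simp)
next
 case (mult u c)
 have u: "u : bm b" "!!i. i : I ==> u : bm (K i)"
  using m1[OF \<open>u : bm S\<close>] m2[OF _ \<open>u : bm S\<close>] by blast+
 have "(NI i. NI x. c * u x;K i;count_space I) = (NI i. c * (NI x. u x;K i);count_space I)"
  using u(2) by (intro nn_integral_cong nn_integral_cmult) simp
 also have "... = c * (NI x. u x;b)" unfolding mult(4) by (rule nn_integral_cmult) simp
 also have "... = (NI x. c * u x;b)" by (rule nn_integral_cmult[symmetric, OF u(1)])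
 finally show ?case by simp
next
 case (add u v)
 have u: "u : bm b" "!!i. i : I ==> u : bm (K i)"
  "v : bm b" "!!i. i : I ==> v : bm (K i)"
  using m1[OF \<open>u : bm S\<close>] m2[OF _ \<open>u : bm S\<close>]
    m1[OF \<open>v : bm S\<close>] m2[OF _ \<open>v : bm S\<close>] by blast+
 have "(NI i. NI x. v x + u x;K i;count_space I) = (NI i. (NI x. v x;K i) + (NI x. u x;K i);count_space I)"
  using u by (intro nn_integral_cong nn_integral_add) simp_all
 also have "... = (NI x. v x;b) + (NI x. u x;b)"
  unfolding add.IH by (rule nn_integral_add) simp_all
 also have "... = (NI x. v x + u x;b)" by (rule nn_integral_add[symmetric, OF u(3) u(1)])
 finally show ?case by simp
next
 case (seq U)
 have u: "U n : bm b" "i : I ==> U n : bm (K i)" for n i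
  using m1[OF seq(1)] m2[OF _ seq(1)] by blast+
 have *: "(SUP n. U n) = (%x. SUP n. U n x)" by (simp add: fun_eq_iff image_image)
 have "(NI i. (NI x. (SUP n. U n x);K i);count_space I) = (NI i. (SUP n. NI x. U n x;K i);count_space I)"
  using seq u by (intro nn_integral_cong) (simp add: nn_integral_monotone_convergence_SUP)
 also have "... = (SUP n. NI i. NI x. U n x;K i;count_space I)"
  using \<open>incseq U\<close> by (intro nn_integral_monotone_convergence_SUP)
   (auto simp: incseq_def le_fun_def intro!: nn_integral_mono)
 also have "... = (SUP n. NI x. U n x;b)" using seq.IH by simp
 also have "... = (NI x. (SUP n. U n x);b)"
  using seq u by (intro nn_integral_monotone_convergence_SUP[symmetric]) auto
 finally show ?case unfolding * by simp
qed
qed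

lemma emeasure_measure_of_sum:
 fixes K :: "'i => 'a measure"
 assumes "!!i. i : I ==> sets (K i) = sets S" and "B : sets S"
 shows "emeasure (measure_of (space S) (sets S) (%B. NI i. emeasure (K i) B;count_space I)) B
  = (NI i. emeasure (K i) B;count_space I)"
proof (rule emeasure_measure_of_sigma)
 show "countably_additive (sets S) (%B. NI i. emeasure (K i) B;count_space I)"
  unfolding countably_additive_def
 proof (intro allI impI)
  fix A :: "nat => 'a set" assume A: "range A \<subseteq> sets S" "disjoint_family A"
  have "(\<Sum>n. NI i. emeasure (K i) (A n);count_space I) = (NI i. (\<Sum>n. emeasure (K i) (A n));count_space I)"
   by (rule nn_integral_suminf[symmetric]) simp
  also have "... = (NI i. emeasure (K i) (\<Union>n. A n);count_space I)"
   using A assms(1) by (intro nn_integral_cong suminf_emeasure) auto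
  finally show "(\<Sum>n. NI i. emeasure (K i) (A n);count_space I) = (NI i. emeasure (K i) (\<Union>n. A n);count_space I)" .
 qed
qed (use assms sets.sigma_algebra_axioms in \<open>auto simp: positive_def\<close>)

section \<open>Rerooting and splitting of the loop measure\<close>

lemma ennreal_time_divide_mult: "0 < t ==> ennreal t * (H / (ennreal t * c)) = H / c"
proof -
 assume "0 < t"
 then have "ennreal t * (H / (ennreal t * c)) = (H * ennreal t) / (c * ennreal t)"
  by (simp add: ennreal_times_divide mult_ac)
 then show ?thesis using \<open>0 < t\<close> divide_mult_eq[of "ennreal t" H c] by simp
qed

text \<open>By right-constancy every visit lasts for a positive time, except possibly one that
  begins at the final instant; such a visit is excluded because the path ends where it
  starts.\<close>

lemma occ_eq_0_iff:
 assumes p: "p : SP N" and st: "p : staying N D x" "snd p 0 = x"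
 shows "occ z p = 0 \<longleftrightarrow> p : staying N (D - {z}) x"
proof
 assume "p : staying N (D - {z}) x"
 then have "snd p t ~= z" if "0 <= t" "t <= fst p" for t using that by (auto simp: staying_def)
 then have "occ z p = (NI t. 0;(lborel :: real measure))" unfolding occ_def by (intro nn_integral_cong) (auto simp: indicator_def)
 then show "occ z p = 0" by simp
next
 assume occ: "occ z p = 0"
 have D: "snd p t : D" if "0 <= t" "t <= fst p" for t using st that by (auto simp: staying_def)
 have end_: "snd p (fst p) = snd p 0" using st by (auto simp: staying_def)
 have "snd p t ~= z" if t: "0 <= t" "t < fst p" for t
 proof
  assume z: "snd p t = z"
  obtain d where d: "d > 0" "!!s. t <= s ==> s < t + d ==> snd p s = snd p t"
   using step_paths_right_constant[OF p] by metis
  have "0 < ennreal (min d (fst p - t))" using d t by simp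
  also have "... = (NI s. indicator {t..<t + min d (fst p - t)} s;lborel)" using d t by simp
  also have "... <= occ z p"
   unfolding occ_def using d z t by (intro nn_integral_mono) (auto simp: indicator_def)
  finally show False using occ by simp
 qed
 moreover have "0 < fst p" using p step_paths_pos by auto
 ultimately have "snd p t ~= z" if "0 <= t" "t <= fst p" for t
  using that end_ by (cases "t < fst p") auto
 then have "\<forall>t\<in>{0..fst p}. snd p t : D - {z}" using D by simp
 then show "p : staying N (D - {z}) x" using st by (simp add: staying_def case_prod_unfold)
qed

lemma staying_mono: "p : staying N (D - {z}) x ==> p : staying N D x"
 by (auto simp: staying_def)

text \<open>At each time the path is at exactly one point of \<open>D\<close>. The identity
  exchanges the duration, which enters the loop measure as a weight, for a sum over possible
  roots.\<close>

lemma nn_integral_occ_sum: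
 assumes "D \<subseteq> grid N" and p: "p : staying N D w"
 shows "(NI x. occ x p;count_space D) = ennreal (fst p)"
proof -
 have step: "p : SP N" using p by (auto simp: staying_def)
 have D: "snd p t : D" if "0 <= t" "t <= fst p" for t using p that by (auto simp: staying_def)
 have cD: "countable D" using assms(1) countable_grid countable_subset by blast
 interpret C: sigma_finite_measure "count_space D" by (rule sigma_finite_measure_count_space_countable[OF cD])
 interpret pair_sigma_finite "count_space D" "lborel :: real measure" ..
 have "(NI x. occ x p;count_space D)
  = (NI t. NI x. indicator {0..<fst p} t * indicator {x} (snd p t);count_space D;lborel)"
  unfolding occ_def using measurable_step_path_indicator[OF step]
  by (intro Fubini'[symmetric] measurable_pair_measure_countable1 cD) auto
 also have "... = (NI t. indicator {0..<fst p} t;lborel)"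
 proof (rule nn_integral_cong)
  fix t
  have "(NI x. indicator {0..<fst p} t * indicator {x} (snd p t);count_space D)
   = (NI x. indicator {0..<fst p} t * indicator {snd p t} x;count_space D)"
   by (intro nn_integral_cong) (auto simp: indicator_def)
  also have "... = indicator {0..<fst p} t * emeasure (count_space D) ({snd p t} \<inter> D)"
   by (simp add: nn_integral_cmult nn_integral_indicator')
  also have "... = indicator {0..<fst p} t" using D[of t] by (auto simp: indicator_def)
  finally show "(NI x. indicator {0..<fst p} t * indicator {x} (snd p t);count_space D) = indicator {0..<fst p} t" .
 qed
 also have "... = ennreal (fst p)" using step_paths_pos[OF step] by simp
 finally show ?thesis .
qed

text \<open>Extension by 0 beyond the rooted loops, so that functionals of loops can be integrated
  against measures on all step paths.\<close>

definition loop_fun :: "nat => (loop => ennreal) => path => ennreal" where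
 "loop_fun N k p = (if p : rooted_loops N then k (unroot p) else 0)"

lemma measurable_loop_fun [measurable]:
 assumes "k : bm (loop_space N)"
 shows "loop_fun N k : bm (PS N)"
proof -
 have "(%p. k (unroot p)) : bm (restrict_space (PS N) (rooted_loops N))"
  by (rule measurable_compose[OF measurable_unroot assms])
 then have "(%p. if p : rooted_loops N then k (unroot p) else 0) : bm (PS N)"
  by (subst (asm) measurable_restrict_space_iff[where c=0]) auto
 then show ?thesis by (simp add: loop_fun_def[abs_def])
qed

context grid_walk
begin

lemma AE_PM:
 assumes x: "x : grid N"
 shows "AE p in PM E n x w. p : staying N E w & snd p 0 = x"
proof -
 have "(NI p. indicator {p : space (PS N). ~ (p : staying N E w & snd p 0 = x)} p;PM E n x w)
   = (NI t. NI v. (if 0 < t & njumps t v = n & wpath x t v : staying N E w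
   then indicator {p : space (PS N). ~ (p : staying N E w & snd p 0 = x)} (wpath x t v) else 0);src N;lborel)"
  by (rule nn_integral_PM[OF x]) measurable
 also have "... = (NI t. NI v. 0;src N;(lborel :: real measure))"
 proof (rule nn_integral_cong, rule nn_integral_cong_AE)
  fix t :: real
  show "AE v in src N. (if 0 < t & njumps t v = n & wpath x t v : staying N E w
   then indicator {p : space (PS N). ~ (p : staying N E w & snd p 0 = x)} (wpath x t v) else 0) = (0 :: ennreal)"
   using AE_good_source
  proof eventually_elim
   case (elim v)
   have "{k. jump_time v k <= 0} = {}" using good_source_jump_pos[OF elim] by (auto simp: not_le)
   then have "snd (wpath x t v) 0 = x" if "0 < t"
    using that by (simp add: wpath_def walk_path_def walk_def)
   then show ?case by (simp add: indicator_def)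
  qed
 qed
 finally have "(NI p. indicator {p : space (PS N). ~ (p : staying N E w & snd p 0 = x)} p;PM E n x w) = 0" by simp
 moreover define B where "B = {p : space (PS N). ~ (p : staying N E w & snd p 0 = x)}"
 moreover have B: "B : sets (PS N)" unfolding B_def by measurable
 ultimately have "emeasure (PM E n x w) B = 0" by simp
 then show ?thesis
  by (rule AE_I[rotated]) (use B in \<open>auto simp: B_def\<close>)
qed

text \<open>Rerooting at \<open>z\<close>: cutting a loop at a time spent at \<open>z\<close> and exchanging the two pieces.\<close>

lemma reroot_PM:
 assumes D: "D \<subseteq> grid N" and z: "z : D" and [measurable]: "k : bm (loop_space N)"
 shows "(NI x. NI p. (if occ z p = 0 then 0 else loop_fun N k p / ennreal (fst p));PM D n x x;count_space D)
  = (NI p. loop_fun N k p / occ z p;PM D n z z)"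
proof -
 \<comment> \<open>The symmetric weight: \<open>occ z p * \<phi> p\<close> carries the weight 1/T of
   the loop measure, while \<open>occ x p * \<phi> p\<close> summed over \<open>x\<close> carries
   the weight one over \<open>occ z p\<close>.\<close>
 define \<phi> where "\<phi> p = loop_fun N k p / (ennreal (fst p) * occ z p)" for p
 have [measurable]: "\<phi> : bm (PS N)" unfolding \<phi>_def by measurable
 have zg: "z : grid N" using D z by auto
 have cD: "countable D" using D countable_grid countable_subset by blast
 interpret C: sigma_finite_measure "count_space D" by (rule sigma_finite_measure_count_space_countable[OF cD])
 have 1: "(NI p. (if occ z p = 0 then 0 else loop_fun N k p / ennreal (fst p));PM D n x x) = (NI p. occ x p * \<phi> p;PM D n z z)"
  if x: "x : D" for x
 proof -
  have xg: "x : grid N" using D x by auto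
  have "(NI p. (if occ z p = 0 then 0 else loop_fun N k p / ennreal (fst p));PM D n x x)
   = (NI p. occ z p * \<phi> p;PM D n x x)"
  proof (rule PM_cong)
   fix p assume p: "p : SP N"
   have "occ z p < \<infinity>" using occ_le[of z p] by (simp add: le_less_trans)
   then obtain c where c: "occ z p = ennreal c" "0 <= c" by (cases "occ z p") auto
   show "(if occ z p = 0 then 0 else loop_fun N k p / ennreal (fst p)) = occ z p * \<phi> p"
    using c ennreal_time_divide_mult[of c "loop_fun N k p" "ennreal (fst p)"]
    by (cases "c = 0") (simp_all add: \<phi>_def mult.commute)
  qed
  also have "... = (\<Sum>i\<le>n. NI p. NI q. \<phi> (papp p q);PM D (n - i) z x;PM D i x z)"
   by (rule PM_split[OF xg zg]) measurable
  \<comment> \<open>\<open>\<phi>\<close> sees only the unrooted loop, the duration and the time at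
    \<open>z\<close>, all unchanged when the two pieces trade places; the loop rooted at
    \<open>x\<close> thereby becomes one rooted at \<open>z\<close>.\<close>
  also have "... = (\<Sum>i\<le>n. NI p. NI q. \<phi> (papp q p);PM D (n - i) z x;PM D i x z)"
  proof (intro sum.cong refl nn_integral_cong_AE)
   fix i
   show "AE p in PM D i x z. (NI q. \<phi> (papp p q);PM D (n - i) z x) = (NI q. \<phi> (papp q p);PM D (n - i) z x)"
    using AE_PM[OF xg] AE_space
   proof eventually_elim
    case p: (elim p)
    show ?case
    proof (rule nn_integral_cong_AE)
     show "AE q in PM D (n - i) z x. \<phi> (papp p q) = \<phi> (papp q p)"
      using AE_PM[OF zg] AE_space
     proof eventually_elim
      case (elim q)
      have st: "p : SP N" "q : SP N" using elim p by auto
      have e: "snd p (fst p) = z" "snd q (fst q) = x" "snd p 0 = x" "snd q 0 = z"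
       using elim p by (auto simp: staying_def)
      have "unroot (papp p q) = unroot (papp q p)"
       using st e by (intro unroot_append_swap) auto
      moreover have "papp p q : rooted_loops N" "papp q p : rooted_loops N"
       using st e path_append_step[OF st] path_append_step[OF st(2,1)] step_paths_pos[OF st(1)] step_paths_pos[OF st(2)]
       by (auto simp: rooted_loops_iff)
      ultimately show ?case
       using occ_append[OF st] occ_append[OF st(2,1)] by (simp add: \<phi>_def loop_fun_def add.commute)
     qed
    qed
   qed
  qed
  also have "... = (\<Sum>i\<le>n. NI q. NI p. \<phi> (papp q p);PM D i x z;PM D (n - i) z x)"
  proof (intro sum.cong refl)
   fix i
   interpret A: finite_measure "PM D i x z" by (rule finite_measure_PM[OF xg])
   interpret B: finite_measure "PM D (n - i) z x" by (rule finite_measure_PM[OF zg])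
   interpret AB: pair_sigma_finite "PM D (n - i) z x" "PM D i x z" ..
   show "(NI p. NI q. \<phi> (papp q p);PM D (n - i) z x;PM D i x z) = (NI q. NI p. \<phi> (papp q p);PM D i x z;PM D (n - i) z x)"
    by (rule AB.Fubini') measurable
  qed
  also have "... = (\<Sum>i\<le>n. NI q. NI p. \<phi> (papp q p);PM D (n - i) x z;PM D i z x)"
   by (rule sum.reindex_bij_witness[of _ "%i. n - i" "%i. n - i"]) auto
  also have "... = (NI p. occ x p * \<phi> p;PM D n z z)"
   by (rule PM_split[OF zg xg, symmetric]) measurable
  finally show ?thesis .
 qed
 interpret Z: finite_measure "PM D n z z" by (rule finite_measure_PM[OF zg])
 interpret CZ: pair_sigma_finite "PM D n z z" "count_space D" ..
 have "(NI x. NI p. (if occ z p = 0 then 0 else loop_fun N k p / ennreal (fst p));PM D n x x;count_space D)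
  = (NI x. NI p. occ x p * \<phi> p;PM D n z z;count_space D)"
  by (intro nn_integral_cong) (simp add: 1)
 also have "... = (NI p. NI x. occ x p * \<phi> p;count_space D;PM D n z z)"
 proof (rule CZ.Fubini')
  have "(%(x, p). occ x p * \<phi> p) : bm (count_space D ** PM D n z z)"
   by (rule measurable_pair_measure_countable1[OF cD]) simp
  from measurable_pair_swap[OF this] show "(%(x, y). occ y x * \<phi> x) : bm (PM D n z z ** count_space D)"
   by (simp add: case_prod_unfold)
 qed
 also have "... = (NI p. loop_fun N k p / occ z p;PM D n z z)"
 proof (rule nn_integral_cong_AE)
  show "AE p in PM D n z z. (NI x. occ x p * \<phi> p;count_space D) = loop_fun N k p / occ z p"
   using AE_PM[OF zg] AE_space
  proof eventually_elim
   case (elim p)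
   then have "0 < fst p" using step_paths_pos[of p N] by simp
   have "(NI x. occ x p * \<phi> p;count_space D) = ennreal (fst p) * \<phi> p"
    using nn_integral_occ_sum[OF D, of p z] elim by (simp add: nn_integral_multc)
   then show ?case unfolding \<phi>_def using \<open>0 < fst p\<close> by (simp add: ennreal_time_divide_mult)
  qed
 qed
 finally show ?thesis .
qed

definition PA :: "point set => point => point => path measure" where
 "PA E x w = distr (density (lborel ** src N)
   (%y. if 0 < fst y & wpath x (fst y) (snd y) : staying N E w then 1 else 0))
   (PS N) (%y. wpath x (fst y) (snd y))"

lemma sets_PA [simp, measurable_cong]: "sets (PA E x w) = sets (PS N)"
 and space_PA [simp]: "space (PA E x w) = SP N"
 by (simp_all add: PA_def)

lemma nn_integral_PA_source:
 assumes [measurable]: "x : grid N" "f : bm (PS N)"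
 shows "(NI p. f p;PA E x w) = (NI t. NI v. (if 0 < t & wpath x t v : staying N E w
   then f (wpath x t v) else 0);src N;lborel)"
proof -
 have "(NI p. f p;PA E x w) = (NI y. (if 0 < fst y & wpath x (fst y) (snd y) : staying N E w
   then 1 else 0) * f (wpath x (fst y) (snd y));(lborel ** src N))"
  unfolding PA_def by (subst nn_integral_distr, measurable, subst nn_integral_density, measurable)
 also have "... = (NI y. (if 0 < fst y & wpath x (fst y) (snd y) : staying N E w
   then f (wpath x (fst y) (snd y)) else 0);(lborel ** src N))"
  by (intro nn_integral_cong) auto
 also have "... = (NI t. NI v. (if 0 < t & wpath x t v : staying N E w
   then f (wpath x t v) else 0);src N;lborel)"
  by (subst source.nn_integral_fst[symmetric], measurable) (simp cong: if_cong)
 finally show ?thesis .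
qed

lemma nn_integral_PA:
 assumes x[measurable]: "x : grid N" and f[measurable]: "f : bm (PS N)"
 shows "(NI p. f p;PA E x w) = (\<Sum>n. NI p. f p;PM E n x w)"
proof -
 let ?g = "%n t v. if 0 < t & njumps t v = n & wpath x t v : staying N E w then f (wpath x t v) else 0"
 have "(\<Sum>n. NI p. f p;PM E n x w) = (NI t. (\<Sum>n. NI v. ?g n t v;src N);lborel)"
  unfolding nn_integral_PM[OF x f] by (rule nn_integral_suminf[symmetric]) measurable
 also have "... = (NI t. NI v. (\<Sum>n. ?g n t v);src N;lborel)"
  by (intro nn_integral_cong nn_integral_suminf[symmetric]) measurable
 also have "... = (NI t. NI v. (if 0 < t & wpath x t v : staying N E w then f (wpath x t v) else 0);src N;lborel)"
 proof (intro nn_integral_cong)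
  fix t v
  have "(\<Sum>n. ?g n t v) = (\<Sum>n\<in>{njumps t v}. ?g n t v)"
   by (rule suminf_finite) auto
  then show "(\<Sum>n. ?g n t v) = (if 0 < t & wpath x t v : staying N E w then f (wpath x t v) else 0)"
   by simp
 qed
 finally show ?thesis unfolding nn_integral_PA_source[OF x f] by simp
qed

lemma walk_path_eq_wpath: "0 < t ==> walk_path x t = wpath x t"
 by (simp add: wpath_def fun_eq_iff)

lemma measurable_walk_path: "x : grid N ==> 0 < t ==> walk_path x t : src N ->M PS N"
 unfolding walk_path_eq_wpath by measurable

lemma emeasure_walk_law:
 assumes "x : grid N" "0 < t" "B : sets (PS N)"
 shows "emeasure (walk_law N x t) B = (NI w. indicator B (wpath x t w);src N)"
proof -
 have "emeasure (walk_law N x t) B = (NI p. indicator B p;walk_law N x t)"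
  using assms by (simp add: walk_law_def)
 also have "... = (NI w. indicator B (wpath x t w);src N)"
  using assms(3) measurable_walk_path[OF assms(1,2)] unfolding walk_law_def walk_path_eq_wpath[OF assms(2)]
  by (subst nn_integral_distr) auto
 finally show ?thesis .
qed

text \<open>The normalisation of the conditioned law cancels against the heat kernel. If the
  conditioning event is null, both sides vanish.\<close>

lemma bridge_heat_kernel:
 assumes "x : grid N" "0 < t" and B: "B : sets (PS N)"
 shows "emeasure (bridge_law N E t x w) B * ennreal (heat_kernel N E t x w)
  = ennreal ((real N)\<^sup>2) * (NI v. (if wpath x t v : staying N E w then indicator B (wpath x t v) else 0);src N)"
proof -
 interpret W: prob_space "walk_law N x t"
  unfolding walk_law_def by (rule source.prob_space_distr[OF measurable_walk_path[OF assms(1,2)]])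
 have sets: "sets (walk_law N x t) = sets (PS N)" by (simp add: walk_law_def)
 let ?S = "staying N E w"
 have hk: "ennreal (heat_kernel N E t x w) = ennreal ((real N)\<^sup>2) * emeasure (walk_law N x t) ?S"
  by (simp add: heat_kernel_def W.emeasure_eq_measure ennreal_mult)
 have "emeasure (bridge_law N E t x w) B * emeasure (walk_law N x t) ?S = emeasure (walk_law N x t) (?S \<inter> B)"
 proof (cases "emeasure (walk_law N x t) ?S = 0")
  case True
  then have "emeasure (walk_law N x t) (?S \<inter> B) = 0"
   using emeasure_mono[of "?S \<inter> B" ?S "walk_law N x t"] by (simp add: sets)
  then show ?thesis using True by simp
 next
  case False
  then show ?thesis unfolding bridge_law_def using B
   by (subst emeasure_uniform_measure)
    (auto simp: sets ennreal_divide_times W.emeasure_eq_measure divide_ennreal ennreal_mult[symmetric]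
     zero_less_iff_neq_zero[symmetric])
 qed
 then have "emeasure (bridge_law N E t x w) B * ennreal (heat_kernel N E t x w)
  = ennreal ((real N)\<^sup>2) * emeasure (walk_law N x t) (?S \<inter> B)"
  unfolding hk by (simp add: mult.left_commute)
 also have "emeasure (walk_law N x t) (?S \<inter> B) = (NI v. (if wpath x t v : ?S then indicator B (wpath x t v) else 0);src N)"
  using B by (subst emeasure_walk_law[OF assms(1,2)]) (auto intro!: nn_integral_cong simp: indicator_def)
 finally show ?thesis .
qed

lemma path_measure_eq:
 assumes x: "x : grid N"
 shows "path_measure N E x w = scale_measure (ennreal ((real N)\<^sup>2)) (PA E x w)"
proof -
 let ?b = "scale_measure (ennreal ((real N)\<^sup>2)) (PA E x w)"
 note [measurable] = x
 have "(\<integral>\<^sup>+t\<in>{0<..}. emeasure (bridge_law N E t x w) B * ennreal (heat_kernel N E t x w) \<partial>lborel) = emeasure ?b B"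
  if B[measurable]: "B : sets (PS N)" for B
 proof -
  have "(\<integral>\<^sup>+t\<in>{0<..}. emeasure (bridge_law N E t x w) B * ennreal (heat_kernel N E t x w) \<partial>lborel)
   = (NI t. ennreal ((real N)\<^sup>2) * (NI v. (if 0 < t & wpath x t v : staying N E w then indicator B (wpath x t v) else 0);src N);lborel)"
   using bridge_heat_kernel[OF x _ B] by (intro nn_integral_cong) (auto simp: indicator_def)
  also have "... = ennreal ((real N)\<^sup>2) * (NI t. NI v. (if 0 < t & wpath x t v : staying N E w then indicator B (wpath x t v) else 0);src N;lborel)"
   by (rule nn_integral_cmult) measurable
  also have "... = ennreal ((real N)\<^sup>2) * emeasure (PA E x w) B"
   using nn_integral_PA_source[OF x, of "indicator B" E w] B by simp
  finally show ?thesis using B by simp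
 qed
 then have "path_measure N E x w = measure_of (space (PS N)) (sets (PS N)) (emeasure ?b)"
  unfolding path_measure_def by (intro measure_of_eq sets.space_closed) (use sets.sigma_sets_eq[of "PS N"] in simp)
 also have "... = measure_of (space ?b) (sets ?b) (emeasure ?b)"
  using sets_eq_imp_space_eq[of ?b "PS N"] by simp
 finally show ?thesis by (simp only: measure_of_of_measure)
qed

text \<open>The factor 1/N^2 of the loop measure cancels the N^2 of the heat kernel, which leaves
  \<open>PA\<close> divided by the duration.\<close>

lemma nn_integral_rooted_loop_measure:
 assumes E: "E \<subseteq> grid N" and f[measurable]: "f : bm (PS N)"
 shows "sets (rooted_loop_measure N E) = sets (PS N)"
  and "(NI p. f p;rooted_loop_measure N E) = (NI x. NI p. f p / ennreal (fst p);PA E x x;count_space E)"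
proof -
 let ?K = "%x. density (PA E x x) (%p. 1 / ennreal (fst p))"
 let ?S = "PS N"
 define \<nu> where "\<nu> = measure_of (space ?S) (sets ?S) (%B. NI x. emeasure (?K x) B;count_space E)"
 have *: "ennreal (1 / (real N)\<^sup>2) * (NI x. (\<integral>\<^sup>+t\<in>{0<..}. emeasure (bridge_law N E t x x) B
      * ennreal (heat_kernel N E t x x / t) \<partial>lborel);count_space E) = (NI x. emeasure (?K x) B;count_space E)"
  if B[measurable]: "B : sets ?S" for B
 proof -
  have "(\<integral>\<^sup>+t\<in>{0<..}. emeasure (bridge_law N E t x x) B * ennreal (heat_kernel N E t x x / t) \<partial>lborel)
   = ennreal ((real N)\<^sup>2) * emeasure (?K x) B" if "x : E" for x
  proof -
   have x[measurable]: "x : grid N" using that E by auto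
   have "(\<integral>\<^sup>+t\<in>{0<..}. emeasure (bridge_law N E t x x) B * ennreal (heat_kernel N E t x x / t) \<partial>lborel)
    = (NI t. ennreal ((real N)\<^sup>2) * (NI w. (if 0 < t & wpath x t w : staying N E x
      then (1 / ennreal (fst (wpath x t w))) * indicator B (wpath x t w) else 0);src N);lborel)"
   proof (rule nn_integral_cong)
    fix t :: real
    show "emeasure (bridge_law N E t x x) B * ennreal (heat_kernel N E t x x / t) * indicator {0<..} t
     = ennreal ((real N)\<^sup>2) * (NI w. (if 0 < t & wpath x t w : staying N E x
      then (1 / ennreal (fst (wpath x t w))) * indicator B (wpath x t w) else 0);src N)"
    proof (cases "0 < t")
     case True
     have "emeasure (bridge_law N E t x x) B * ennreal (heat_kernel N E t x x / t)
      = (1 / ennreal t) * (emeasure (bridge_law N E t x x) B * ennreal (heat_kernel N E t x x))"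
      using True by (simp add: divide_ennreal[symmetric] heat_kernel_def divide_ennreal_def mult_ac)
     also have "... = ennreal ((real N)\<^sup>2) * ((1 / ennreal t) * (NI w. (if wpath x t w : staying N E x
      then indicator B (wpath x t w) else 0);src N))"
      unfolding bridge_heat_kernel[OF x True B] by (simp only: mult_ac)
     also have "(1 / ennreal t) * (NI w. (if wpath x t w : staying N E x then indicator B (wpath x t w) else 0);src N)
      = (NI w. (1 / ennreal t) * (if wpath x t w : staying N E x then indicator B (wpath x t w) else 0);src N)"
      by (rule nn_integral_cmult[symmetric]) measurable
     also have "... = (NI w. (if 0 < t & wpath x t w : staying N E x
      then (1 / ennreal (fst (wpath x t w))) * indicator B (wpath x t w) else 0);src N)"
      using True by (intro nn_integral_cong) (auto simp: wpath_def walk_path_def)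
     finally show ?thesis using True by simp
    qed simp
   qed
   also have "... = ennreal ((real N)\<^sup>2) * (NI p. (1 / ennreal (fst p)) * indicator B p;PA E x x)"
    by (subst nn_integral_cmult, measurable, subst nn_integral_PA_source[OF x], measurable)
   also have "... = ennreal ((real N)\<^sup>2) * emeasure (?K x) B"
    by (subst emeasure_density) auto
   finally show ?thesis .
  qed
  then have "(NI x. (\<integral>\<^sup>+t\<in>{0<..}. emeasure (bridge_law N E t x x) B
      * ennreal (heat_kernel N E t x x / t) \<partial>lborel);count_space E)
   = ennreal ((real N)\<^sup>2) * (NI x. emeasure (?K x) B;count_space E)"
   by (simp add: nn_integral_cmult[symmetric] cong: nn_integral_cong_simp)
  then have "ennreal (1 / (real N)\<^sup>2) * (NI x. (\<integral>\<^sup>+t\<in>{0<..}. emeasure (bridge_law N E t x x) B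
      * ennreal (heat_kernel N E t x x / t) \<partial>lborel);count_space E)
   = (ennreal (1 / (real N)\<^sup>2) * ennreal ((real N)\<^sup>2)) * (NI x. emeasure (?K x) B;count_space E)"
   by (simp add: mult.assoc)
  also have "ennreal (1 / (real N)\<^sup>2) * ennreal ((real N)\<^sup>2) = 1"
   using N_pos by (simp add: ennreal_mult[symmetric])
  finally show ?thesis by simp
 qed
 have eq: "rooted_loop_measure N E = \<nu>"
  unfolding rooted_loop_measure_def \<nu>_def
  by (intro measure_of_eq sets.space_closed) (use sets.sigma_sets_eq[of "PS N"] * in simp)
 show sets: "sets (rooted_loop_measure N E) = sets (PS N)"
  unfolding eq \<nu>_def by (rule sets.sets_measure_of_eq)
 have "(NI p. f p;\<nu>) = (NI x. NI p. f p;?K x;count_space E)"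
 proof (rule nn_integral_eq_of_emeasure[where S = "?S"])
  show "emeasure \<nu> B = (NI x. emeasure (?K x) B;count_space E)" if "B : sets ?S" for B
   unfolding \<nu>_def using that by (intro emeasure_measure_of_sum) auto
 qed (use sets eq in auto)
 also have "... = (NI x. NI p. f p / ennreal (fst p);PA E x x;count_space E)"
  by (intro nn_integral_cong) (simp add: nn_integral_density divide_ennreal_def mult.commute)
 finally show "(NI p. f p;rooted_loop_measure N E) = ..." unfolding eq .
qed

lemma sets_loop_measure [simp, measurable_cong]: "sets (loop_measure N E) = sets (loop_space N)"
 by (simp add: loop_measure_def)

lemma nn_integral_loop_measure:
 assumes E: "E \<subseteq> grid N" and k[measurable]: "k : bm (loop_space N)"
 shows "(NI l. k l;loop_measure N E) = (\<Sum>n. NI x. NI p. loop_fun N k p / ennreal (fst p);PM E n x x;count_space E)"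
proof -
 let ?R = "rooted_loop_measure N E"
 have sR: "sets ?R = sets (PS N)"
  by (rule nn_integral_rooted_loop_measure(1)[OF E, of "%_. 0"]) simp
 have "unroot : restrict_space ?R (rooted_loops N) ->M loop_space N"
  using measurable_unroot measurable_cong_sets[OF sets_restrict_space_cong[OF sR] refl] by blast
 then have "(NI l. k l;loop_measure N E) = (NI p. k (unroot p);restrict_space ?R (rooted_loops N))"
  unfolding loop_measure_def by (intro nn_integral_distr) auto
 also have "... = (NI p. k (unroot p) * indicator (rooted_loops N) p;?R)"
  by (rule nn_integral_restrict_space) (simp add: sR sets_eq_imp_space_eq[OF sR])
 also have "... = (NI p. loop_fun N k p;?R)"
  by (intro nn_integral_cong) (simp add: loop_fun_def)
 also have "... = (NI x. NI p. loop_fun N k p / ennreal (fst p);PA E x x;count_space E)"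
  by (rule nn_integral_rooted_loop_measure(2)[OF E]) measurable
 also have "... = (NI x. (\<Sum>n. NI p. loop_fun N k p / ennreal (fst p);PM E n x x);count_space E)"
  using E by (intro nn_integral_cong nn_integral_PA) auto
 also have "... = (\<Sum>n. NI x. NI p. loop_fun N k p / ennreal (fst p);PM E n x x;count_space E)"
  by (rule nn_integral_suminf) simp
 finally show ?thesis .
qed

lemma PM_avoiding:
 assumes x[measurable]: "x : grid N" and [measurable]: "f : bm (PS N)"
 shows "(NI p. (if occ z p = 0 then f p else 0);PM D n x x) = (NI p. f p;PM (D - {z}) n x x)"
proof -
 have "(NI p. (if occ z p = 0 then f p else 0);PM D n x x) = (NI p. indicator (staying N (D - {z}) x) p * f p;PM D n x x)"
 proof (rule nn_integral_cong_AE)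
  show "AE p in PM D n x x. (if occ z p = 0 then f p else 0) = indicator (staying N (D - {z}) x) p * f p"
   using AE_PM[OF x] AE_space by eventually_elim (auto simp: occ_eq_0_iff)
 qed
 also have "... = (NI p. f p;PM (D - {z}) n x x)"
  by (subst (1 2) nn_integral_PM[OF x], measurable)
   (auto intro!: nn_integral_cong simp: indicator_def dest: staying_mono)
 finally show ?thesis .
qed

text \<open>A loop that spends no time at \<open>z\<close> is a loop of \<open>D - {z}\<close>. Any
  other loop is rerooted at a time spent at \<open>z\<close>, which turns its weight 1/T into one
  over the time at \<open>z\<close>.\<close>

theorem loop_measure_split:
 assumes D: "D \<subseteq> grid N" and z: "z : D" and k[measurable]: "k : bm (loop_space N)"
 shows "(NI l. k l;loop_measure N D)
  = (NI l. k l;loop_measure N (D - {z})) + (NI p. loop_fun N k p / occ z p;PA D z z)"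
proof -
 have zg: "z : grid N" using D z by auto
 let ?f = "%p. loop_fun N k p / ennreal (fst p)"
 have 1: "(NI x. NI p. ?f p;PM D n x x;count_space D)
  = (NI x. NI p. ?f p;PM (D - {z}) n x x;count_space (D - {z})) + (NI p. loop_fun N k p / occ z p;PM D n z z)" for n
 proof -
  have "(NI p. ?f p;PM D n x x) = (NI p. (if occ z p = 0 then ?f p else 0);PM D n x x) + (NI p. (if occ z p = 0 then 0 else ?f p);PM D n x x)" for x
   by (subst nn_integral_add[symmetric], measurable) (auto intro!: nn_integral_cong)
  then have "(NI x. NI p. ?f p;PM D n x x;count_space D)
   = (NI x. NI p. (if occ z p = 0 then ?f p else 0);PM D n x x;count_space D)
    + (NI x. NI p. (if occ z p = 0 then 0 else ?f p);PM D n x x;count_space D)"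
   by (simp only: nn_integral_add borel_measurable_count_space)
  also have "(NI x. NI p. (if occ z p = 0 then 0 else ?f p);PM D n x x;count_space D) = (NI p. loop_fun N k p / occ z p;PM D n z z)"
   by (rule reroot_PM[OF D z k])
  also have "(NI x. NI p. (if occ z p = 0 then ?f p else 0);PM D n x x;count_space D)
   = (NI x. (NI p. ?f p;PM (D - {z}) n x x);count_space D)"
   using D by (intro nn_integral_cong PM_avoiding) auto
  also have "... = (NI x. (NI p. ?f p;PM (D - {z}) n x x) * indicator D x;count_space UNIV)"
   by (simp add: nn_integral_count_space_indicator)
  \<comment> \<open>The root \<open>z\<close> may be dropped: a path confined to
    \<open>D - {z}\<close> cannot end at \<open>z\<close>.\<close>
  also have "... = (NI x. (NI p. ?f p;PM (D - {z}) n x x) * indicator (D - {z}) x;count_space UNIV)"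
  proof (intro nn_integral_cong)
   fix x
   have "(NI p. ?f p;PM (D - {z}) n z z) = (NI p. 0;PM (D - {z}) n z z)"
   proof (rule nn_integral_cong_AE)
    show "AE p in PM (D - {z}) n z z. ?f p = 0"
     using AE_PM[OF zg, where E = "D - {z}" and n = n and w = z] AE_space
    proof eventually_elim
     case (elim p)
     then have "0 < fst p" using step_paths_pos[of p N] by simp
     then have "snd p (fst p) ~= z" using elim by (auto simp: staying_def)
     then show ?case using elim by (auto simp: staying_def)
    qed
   qed
   then show "(NI p. ?f p;PM (D - {z}) n x x) * indicator D x = (NI p. ?f p;PM (D - {z}) n x x) * indicator (D - {z}) x"
    by (auto simp: indicator_def)
  qed
  also have "... = (NI x. NI p. ?f p;PM (D - {z}) n x x;count_space (D - {z}))"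
   by (simp add: nn_integral_count_space_indicator)
  finally show ?thesis .
 qed
 have D': "D - {z} \<subseteq> grid N" using D by auto
 show ?thesis
  unfolding nn_integral_loop_measure[OF D k] nn_integral_loop_measure[OF D' k] 1
  by (subst nn_integral_PA[OF zg], measurable) (rule suminf_add[symmetric], auto)
qed

end

section \<open>Excursions away from \<open>z\<close> and the Green function\<close>

lemma neighbours_iff:
 assumes "2 <= N" "D \<subseteq> grid N" "z : grid N"
 shows "x : neighbours N D z \<longleftrightarrow> x : D - {z} & (\<exists>s\<in>steps N. x = z + s)"
proof -
 have N: "0 < real N" using assms(1) by simp
 have "norm (x - z) = 1 / real N \<longleftrightarrow> (\<exists>s\<in>steps N. x = z + s)" if "x : D"
 proof
  assume n: "norm (x - z) = 1 / real N"
  have "x : grid N" using that assms by auto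
  then obtain i j where x: "x = (of_int i / of_nat N, of_int j / of_nat N)" by (auto simp: grid_def)
  obtain k l where z: "z = (of_int k / of_nat N, of_int l / of_nat N)" using assms(3) by (auto simp: grid_def)
  have "(norm (x - z))\<^sup>2 = (1 / real N)\<^sup>2" using n by simp
  moreover have "(norm (x - z))\<^sup>2 = (of_int (i - k) / real N)\<^sup>2 + (of_int (j - l) / real N)\<^sup>2"
   by (simp add: x z norm_Pair diff_divide_distrib)
  ultimately have "(of_int (i - k) / real N)\<^sup>2 + (of_int (j - l) / real N)\<^sup>2 = (1 / real N)\<^sup>2" by simp
  then have "(of_int (i - k))\<^sup>2 + (of_int (j - l))\<^sup>2 = (1 :: real)"
   using N by (simp add: power_divide add_divide_distrib[symmetric])
  \<comment> \<open>Multiplied by N^2, the Euclidean condition becomes an equation between integers,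
    whose only solutions are the four unit vectors.\<close>
  then have eq: "(i - k)\<^sup>2 + (j - l)\<^sup>2 = 1"
   by (metis (mono_tags, lifting) of_int_add of_int_eq_1_iff of_int_power)
  have "\<bar>i - k\<bar> <= 1" "\<bar>j - l\<bar> <= 1"
  proof -
   have "(i - k)\<^sup>2 <= 1\<^sup>2" "(j - l)\<^sup>2 <= 1\<^sup>2" using eq zero_le_power2[of "i - k"] zero_le_power2[of "j - l"]
    unfolding power_one by linarith+
   then show "\<bar>i - k\<bar> <= 1" "\<bar>j - l\<bar> <= 1" using abs_le_square_iff[of "i - k" 1] abs_le_square_iff[of "j - l" 1] by auto
  qed
  then have "i - k : {-1, 0, 1}" "j - l : {-1, 0, 1}" by auto
  with eq have "(i - k = 1 & j - l = 0) | (i - k = -1 & j - l = 0) | (i - k = 0 & j - l = 1) | (i - k = 0 & j - l = -1)"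
   by auto
  moreover have "x - z = (of_int (i - k) / real N, of_int (j - l) / real N)"
   by (simp add: x z diff_divide_distrib)
  ultimately have "x - z : steps N" by (elim disjE) (simp_all add: steps_def)
  then show "\<exists>s\<in>steps N. x = z + s" by (intro bexI[of _ "x - z"]) auto
 next
  assume "\<exists>s\<in>steps N. x = z + s"
  then obtain s where "s : steps N" "x - z = s" by auto
  then show "norm (x - z) = 1 / real N" using N by (auto simp: steps_def norm_Pair)
 qed
 then show ?thesis by (auto simp: neighbours_def)
qed

lemma steps_uminus: "s : steps N ==> - s : steps N"
 by (auto simp: steps_def)

lemma steps_nonzero: "2 <= N ==> s : steps N ==> s ~= 0"
 by (auto simp: steps_def zero_prod_def)

text \<open>Rearrangement with \<open>n = i + 1 + j\<close>; the extra 1 is the jump into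
  \<open>z\<close> that separates the two pieces in \<open>PM_first_hit\<close>.\<close>

lemma suminf_triangle:
 fixes a :: "nat => nat => ennreal"
 shows "(\<Sum>n. \<Sum>i<n. a i (n - Suc i)) = (\<Sum>i. \<Sum>j. a i j)"
proof -
 let ?b = "%n i. if i < n then a i (n - Suc i) else 0"
 have "(\<Sum>n. \<Sum>i<n. a i (n - Suc i)) = (\<Sum>n. \<Sum>i. ?b n i)"
 proof (rule suminf_cong)
  fix n
  have "(\<Sum>i. ?b n i) = (\<Sum>i<n. ?b n i)" by (rule suminf_finite) auto
  then show "(\<Sum>i<n. a i (n - Suc i)) = (\<Sum>i. ?b n i)" by simp
 qed
 also have "... = (NI n. (\<Sum>i. ?b n i);count_space UNIV)" by (simp add: nn_integral_count_space_nat)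
 also have "... = (\<Sum>i. NI n. ?b n i;count_space UNIV)" by (rule nn_integral_suminf) simp
 also have "... = (\<Sum>i. \<Sum>n. ?b n i)" by (simp add: nn_integral_count_space_nat)
 also have "... = (\<Sum>i. \<Sum>j. a i j)"
 proof (rule suminf_cong)
  fix i
  have "(\<Sum>n. ?b n i) = (\<Sum>j. ?b (j + Suc i) i) + (\<Sum>n<Suc i. ?b n i)"
   by (rule suminf_offset) simp
  also have "(\<Sum>n<Suc i. ?b n i) = 0" by (intro sum.neutral) auto
  finally show "(\<Sum>n. ?b n i) = (\<Sum>j. a i j)" by simp
 qed
 finally show ?thesis .
qed

lemma close_excursion_simps [simp]:
 "fst (close_excursion z p) = fst p"
 "snd (close_excursion z p) t = (if t < fst p then snd p t else z)"
 by (simp_all add: close_excursion_def case_prod_unfold)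

lemma close_excursion_step:
 assumes p: "p : SP N" and z: "z : grid N"
 shows "close_excursion z p : SP N"
proof -
 obtain J where J: "0 < fst p" "finite J" "J \<subseteq> {0<..fst p}"
  "!!s t. s <= t ==> {s<..t} \<inter> J = {} ==> snd p s = snd p t"
  using p by (elim step_pathsE) auto
 show ?thesis
 proof (rule step_pathsI[where J="insert (fst p) J"])
  fix s t :: real assume st: "s <= t" "{s<..t} \<inter> insert (fst p) J = {}"
  then have "snd p s = snd p t" by (intro J(4)) auto
  moreover have "s < fst p \<longleftrightarrow> t < fst p" using st by fastforce
  ultimately show "snd (close_excursion z p) s = snd (close_excursion z p) t" by simp
 qed (use J z step_paths_grid[OF p] in auto)
qed

lemma measurable_close_excursion [measurable]:
 assumes z: "z : grid N"
 shows "close_excursion z : PS N ->M PS N"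
proof (rule measurable_path_spaceI)
 fix t
 show "(%p. snd (close_excursion z p) t) : PS N ->M count_space (grid N)"
  unfolding close_excursion_simps
  by (rule measurable_If[OF measurable_eval_fixed]) (use z in simp, measurable)
qed (use close_excursion_step[OF _ z] in \<open>simp_all add: measurable_duration\<close>)

text \<open>Concatenation reads its first path only before the final time, where
  \<open>close_excursion\<close> changes nothing.\<close>

lemma path_append_close: "papp (close_excursion z e) p = papp e p"
 by (rule path_eqI) auto

locale grid_excursions = grid_walk +
 fixes D :: "point set" and z :: point
 assumes D: "D \<subseteq> grid N" and z: "z : D" and not_full: "grid N - D ~= {}"
begin

abbreviation "nb == neighbours N D z"
abbreviation "D' == D - {z}"

lemma zg [measurable]: "z : grid N" using D z by auto

lemma nb_iff: "x : nb \<longleftrightarrow> x : D' & (\<exists>s\<in>steps N. x = z + s)"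
 by (rule neighbours_iff[OF N D zg])

lemma nb_grid: "x : nb ==> x : grid N" and nb_D': "x : nb ==> x : D'"
 using D by (auto simp: nb_iff)

lemma finite_nb [simp]: "finite nb"
proof (rule finite_subset)
 show "nb \<subseteq> (%s. z + s) ` steps N" by (auto simp: nb_iff)
qed simp

lemma sum_steps_nb:
 fixes X :: "point => ennreal"
 assumes "!!y. y ~: D ==> X y = 0"
 shows "(\<Sum>s\<in>steps N. X (z + s)) = (\<Sum>x\<in>nb. X x)"
proof -
 have "(\<Sum>s\<in>steps N. X (z + s)) = (\<Sum>x\<in>(%s. z + s) ` steps N. X x)"
  by (subst sum.reindex) (auto simp: inj_on_def)
 also have "... = (\<Sum>x\<in>nb. X x)"
 proof (rule sum.mono_neutral_right)
  show "\<forall>x\<in>(%s. z + s) ` steps N - nb. X x = 0"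
  proof
   fix x assume "x : (%s. z + s) ` steps N - nb"
   then obtain s where "s : steps N" "x = z + s" "x ~: nb" by blast
   then have "x ~: D" using steps_nonzero[OF N, of s] unfolding nb_iff by auto
   then show "X x = 0" by (rule assms)
  qed
 qed (auto simp: nb_iff)
 finally show ?thesis .
qed

lemma sum_steps_to_z:
 fixes c :: ennreal
 assumes "x : D'"
 shows "(\<Sum>s\<in>steps N. if x + s = z then c else 0) = (if x : nb then c else 0)"
proof -
 have eq: "x + s = z \<longleftrightarrow> s = z - x" for s by (auto simp: algebra_simps)
 have "z - x : steps N \<longleftrightarrow> x : nb"
 proof
  assume "z - x : steps N"
  then show "x : nb" using assms steps_uminus[of "z - x" N]
   unfolding nb_iff by (intro conjI bexI[of _ "- (z - x)"]) auto
 next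
  assume "x : nb"
  then obtain s where "s : steps N" "x = z + s" by (auto simp: nb_iff)
  then show "z - x : steps N" using steps_uminus[of s N] by simp
 qed
 then show ?thesis unfolding eq by simp
qed

lemma PM_outside:
 assumes "y : grid N" "y ~: E" "f : bm (PS N)"
 shows "(NI p. f p;PM E n y w) = 0"
 using assms by (cases n) (simp_all add: nn_integral_PM_0 nn_integral_PM_Suc)

text \<open>Decomposition at the first visit to \<open>z\<close>: \<open>i\<close> jumps inside
  \<open>D - {z}\<close>, one jump from a neighbour \<open>w\<close> into \<open>z\<close>, which
  costs N^2, and \<open>n - i - 1\<close> further jumps. The induction removes the first jump of the
  path.\<close>

lemma PM_first_hit:
 assumes x: "x : D'" and f: "f : bm (PS N)"
 shows "(NI p. f p;PM D n x z) = (\<Sum>i<n. \<Sum>w\<in>nb. ennreal ((real N)\<^sup>2) *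
  (NI p. NI q. f (papp p q);PM D (n - Suc i) z z;PM D' i x w))"
 using x f
proof (induction n arbitrary: x f)
 case (0 x f)
 have "x : grid N" "x ~= z" using 0 D by auto
 then show ?case using 0 by (simp add: nn_integral_PM_0)
next
 case (Suc n x f)
 let ?N = "ennreal ((real N)\<^sup>2)"
 have xg[measurable]: "x : grid N" using Suc.prems D by auto
 note [measurable] = Suc.prems(2)
 let ?X = "NI h. NI p. f (papp (hold x h) p);PM D n z z;expm"
 let ?Y = "%i w s. NI h. NI p. NI q. f (papp (hold x h) (papp p q));PM D (n - Suc i) z z;PM D' i (x + s) w;expm"
 \<comment> \<open>The first step reaches \<open>z\<close>, stays in \<open>D - {z}\<close>, or
   leaves \<open>D\<close>. These cases give \<open>?X\<close>, the induction hypothesis and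
   0.\<close>
 have 1: "(NI h. NI p. f (papp (hold x h) p);PM D n (x + s) z;expm)
  = (if x + s = z then ?X else 0) + (\<Sum>i<n. \<Sum>w\<in>nb. ?N * ?Y i w s)" if s: "s : steps N" for s
 proof -
  have xs[measurable]: "x + s : grid N" using xg s by (rule grid_add_steps)
  consider "x + s = z" | "x + s : D'" | "x + s ~: D" by auto
  then show ?thesis
  proof cases
   case 1
   have "?Y i w s = 0" for i w
   proof -
    have "?Y i w s = (NI h. 0;expm)"
     by (intro nn_integral_cong PM_outside xs) (use 1 in simp, measurable)
    then show ?thesis by simp
   qed
   then show ?thesis using 1 by simp
  next
   case 2
   have "(NI h. NI p. f (papp (hold x h) p);PM D n (x + s) z;expm)
    = (NI h. (\<Sum>i<n. \<Sum>w\<in>nb. ?N * (NI p. NI q. f (papp (hold x h) (papp p q));PM D (n - Suc i) z z;PM D' i (x + s) w));expm)"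
    by (intro nn_integral_cong Suc.IH 2) measurable
   also have "... = (\<Sum>i<n. NI h. (\<Sum>w\<in>nb. ?N * (NI p. NI q. f (papp (hold x h) (papp p q));PM D (n - Suc i) z z;PM D' i (x + s) w));expm)"
    by (rule nn_integral_sum) measurable
   also have "... = (\<Sum>i<n. \<Sum>w\<in>nb. NI h. ?N * (NI p. NI q. f (papp (hold x h) (papp p q));PM D (n - Suc i) z z;PM D' i (x + s) w);expm)"
    by (intro sum.cong refl nn_integral_sum) measurable
   also have "... = (\<Sum>i<n. \<Sum>w\<in>nb. ?N * ?Y i w s)"
    by (intro sum.cong refl nn_integral_cmult) measurable
   finally show ?thesis using 2 by simp
  next
   case 3
   have "?Y i w s = 0" for i w
   proof -
    have "?Y i w s = (NI h. 0;expm)"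
     by (intro nn_integral_cong PM_outside xs) (use 3 in simp, measurable)
    then show ?thesis by simp
   qed
   moreover have "(NI h. NI p. f (papp (hold x h) p);PM D n (x + s) z;expm) = (NI h. 0;expm)"
    by (intro nn_integral_cong PM_outside xs) (use 3 in simp, measurable)
   ultimately show ?thesis using 3 z by auto
  qed
 qed
 have 2: "(\<Sum>w\<in>nb. ?N * (NI p. NI q. f (papp p q);PM D n z z;PM D' 0 x w)) = (if x : nb then ?N * ?X else 0)"
 proof -
  have "(NI p. NI q. f (papp p q);PM D n z z;PM D' 0 x w) = (if x = w then ?X else 0)" for w
   using Suc.prems(1) by (subst nn_integral_PM_0[OF xg]) measurable
  then have "(\<Sum>w\<in>nb. ?N * (NI p. NI q. f (papp p q);PM D n z z;PM D' 0 x w)) = (\<Sum>w\<in>nb. if w = x then ?N * ?X else 0)"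
   by (intro sum.cong refl) auto
  then show ?thesis by simp
 qed
 have 3: "(NI p. NI q. f (papp p q);PM D (n - Suc i) z z;PM D' (Suc i) x w) = (\<Sum>s\<in>steps N. ?N * ?Y i w s)" for i w
 proof -
  have "(NI p. NI q. f (papp p q);PM D (n - Suc i) z z;PM D' (Suc i) x w)
   = (if x : D' then \<Sum>s\<in>steps N. ?N * (NI h. NI p. NI q. f (papp (papp (hold x h) p) q)
     ;PM D (n - Suc i) z z;PM D' i (x + s) w;expm) else 0)"
   by (rule nn_integral_PM_Suc[OF xg]) measurable
  also have "... = (\<Sum>s\<in>steps N. ?N * (NI h. NI p. NI q. f (papp (papp (hold x h) p) q)
     ;PM D (n - Suc i) z z;PM D' i (x + s) w;expm))" using Suc.prems(1) by simp
  also have "... = (\<Sum>s\<in>steps N. ?N * ?Y i w s)"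
   by (intro refl sum.cong arg_cong2[where f=times] expm_cong PM_cong)
    (simp add: path_append_assoc step_paths_pos)
  finally show ?thesis .
 qed
 have "(NI p. f p;PM D (Suc n) x z)
  = (\<Sum>s\<in>steps N. ?N * (NI h. NI p. f (papp (hold x h) p);PM D n (x + s) z;expm))"
  using Suc.prems(1) by (subst nn_integral_PM_Suc[OF xg Suc.prems(2)]) simp
 also have "... = (\<Sum>s\<in>steps N. (if x + s = z then ?N * ?X else 0) + (\<Sum>i<n. \<Sum>w\<in>nb. ?N * (?N * ?Y i w s)))"
  by (intro sum.cong refl) (simp add: 1 distrib_left sum_distrib_left)
 also have "... = (if x : nb then ?N * ?X else 0) + (\<Sum>s\<in>steps N. \<Sum>i<n. \<Sum>w\<in>nb. ?N * (?N * ?Y i w s))"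
  by (simp only: sum.distrib sum_steps_to_z[OF Suc.prems(1)])
 also have "(\<Sum>s\<in>steps N. \<Sum>i<n. \<Sum>w\<in>nb. ?N * (?N * ?Y i w s)) = (\<Sum>i<n. \<Sum>w\<in>nb. \<Sum>s\<in>steps N. ?N * (?N * ?Y i w s))"
  by (rule trans[OF sum.swap], rule sum.cong[OF refl], rule sum.swap)
 also have "... = (\<Sum>i<n. \<Sum>w\<in>nb. ?N * (NI p. NI q. f (papp p q);PM D (n - Suc i) z z;PM D' (Suc i) x w))"
  by (simp only: 3 sum_distrib_left)
 also have "(if x : nb then ?N * ?X else 0) + ... = (\<Sum>i<Suc n. \<Sum>w\<in>nb. ?N *
  (NI p. NI q. f (papp p q);PM D (Suc n - Suc i) z z;PM D' i x w))"
  unfolding sum.lessThan_Suc_shift by (simp only: 2 diff_Suc_Suc diff_zero)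
 finally show ?case .
qed

definition EM :: "path measure" where "EM = excursion_measure N D z"

lemma sets_EM [simp, measurable_cong]: "sets EM = sets (PS N)"
 by (simp add: EM_def excursion_measure_def sets.sets_measure_of_eq del: space_path_space)

lemma space_EM [simp]: "space EM = SP N"
 using sets_eq_imp_space_eq[OF sets_EM] by simp

lemma nn_integral_EM:
 assumes [measurable]: "g : bm (PS N)"
 shows "(NI e. g e;EM) = ennreal ((real N)\<^sup>2) * (\<Sum>x\<in>nb. \<Sum>w\<in>nb. NI e. g (close_excursion z e);PA D' x w)"
proof -
 let ?S = "PS N"
 let ?K = "%(x, w). distr (path_measure N D' x w) ?S (close_excursion z)"
 have sum: "(\<Sum>x\<in>nb. \<Sum>w\<in>nb. h x w) = (NI i. (case i of (x, w) => h x w);count_space (nb \<times> nb))" for h :: "point => point => ennreal"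
  by (simp add: nn_integral_count_space_finite sum.cartesian_product)
 have eq: "EM = measure_of (space ?S) (sets ?S) (%B. NI i. emeasure (?K i) B;count_space (nb \<times> nb))"
  unfolding EM_def excursion_measure_def sum by (simp add: case_prod_unfold)
 have "(NI e. g e;EM) = (NI i. NI e. g e;?K i;count_space (nb \<times> nb))"
 proof (rule nn_integral_eq_of_emeasure[where S="?S"])
  show "emeasure EM B = (NI i. emeasure (?K i) B;count_space (nb \<times> nb))" if "B : sets ?S" for B
   unfolding eq using that by (intro emeasure_measure_of_sum) auto
 qed auto
 also have "... = (\<Sum>x\<in>nb. \<Sum>w\<in>nb. NI e. g e;distr (path_measure N D' x w) ?S (close_excursion z))"
  unfolding sum by (simp add: case_prod_unfold)
 also have "... = (\<Sum>x\<in>nb. \<Sum>w\<in>nb. ennreal ((real N)\<^sup>2) * (NI e. g (close_excursion z e);PA D' x w))"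
 proof (intro sum.cong refl)
  fix x w assume "x : nb"
  then have x: "x : grid N" by (rule nb_grid)
  have "close_excursion z : scale_measure (ennreal ((real N)\<^sup>2)) (PA D' x w) ->M ?S"
   by (simp add: measurable_def[of "scale_measure _ _"] space_scale_measure)
    (use measurable_close_excursion[OF zg] in \<open>simp add: measurable_def\<close>)
  then show "(NI e. g e;distr (path_measure N D' x w) ?S (close_excursion z)) = ennreal ((real N)\<^sup>2) * (NI e. g (close_excursion z e);PA D' x w)"
   unfolding path_measure_eq[OF x]
   by (subst nn_integral_distr) (auto intro!: nn_integral_scale_measure)
 qed
 finally show ?thesis by (simp only: sum_distrib_left)
qed

text \<open>For \<open>x\<close> in \<open>D - {z}\<close>, the probability that the walk from
  \<open>x\<close> reaches \<open>z\<close> before leaving \<open>D\<close>. At \<open>z\<close>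
  itself and at grid points outside \<open>D\<close> it is 0.\<close>

definition hit :: "point => ennreal" where
 "hit x = (\<Sum>i. \<Sum>w\<in>nb. ennreal ((real N)\<^sup>2) * emeasure (PM D' i x w) (SP N))"

lemma emeasure_EM: "emeasure EM (SP N) = (\<Sum>x\<in>nb. hit x)"
proof -
 have "emeasure EM (SP N) = (NI e. 1;EM)" by simp
 also have "... = ennreal ((real N)\<^sup>2) * (\<Sum>x\<in>nb. \<Sum>w\<in>nb. \<Sum>i. emeasure (PM D' i x w) (SP N))"
  by (subst nn_integral_EM) (auto simp: nn_integral_PA nb_grid simp del: nn_integral_const intro!: sum.cong suminf_cong, simp)
 also have "... = (\<Sum>x\<in>nb. \<Sum>w\<in>nb. \<Sum>i. ennreal ((real N)\<^sup>2) * emeasure (PM D' i x w) (SP N))"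
  by (simp only: sum_distrib_left ennreal_suminf_cmult)
 also have "... = (\<Sum>x\<in>nb. hit x)"
  unfolding hit_def by (intro sum.cong refl suminf_sum[symmetric]) auto
 finally show ?thesis .
qed


lemma hit_outside: "x : grid N ==> x ~: D' ==> hit x = 0"
proof -
 assume x: "x : grid N" "x ~: D'"
 have "emeasure (PM D' i x w) (SP N) = 0" for i w
  using PM_outside[OF x, of "%_. 1" i w] by simp
 then show ?thesis by (simp add: hit_def)
qed

lemma N2_quarter: "ennreal ((real N)\<^sup>2) * ennreal (1 / (4 * (real N)\<^sup>2)) = ennreal (1 / 4)"
 using N_pos by (simp add: ennreal_mult[symmetric])

text \<open>Average over the first step. The boundary value 1 at \<open>z\<close> is supplied by the
  separate conditional because \<open>hit z\<close> is 0.\<close>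

lemma hit_step:
 assumes x: "x : D'"
 shows "hit x = (\<Sum>s\<in>steps N. ennreal (1 / 4) * ((if x + s = z then 1 else 0) + hit (x + s)))"
proof -
 let ?N = "ennreal ((real N)\<^sup>2)"
 have xg: "x : grid N" using x D by auto
 let ?a = "%i x. \<Sum>w\<in>nb. ?N * emeasure (PM D' i x w) (SP N)"
 have "hit x = (\<Sum>i. ?a (Suc i) x) + ?a 0 x"
  unfolding hit_def using suminf_offset[of "%i. ?a i x" 1] by simp
 also have "?a 0 x = (\<Sum>w\<in>nb. if w = x then ennreal (1 / 4) else 0)"
  using x by (intro sum.cong refl) (auto simp: emeasure_PM_0[OF xg] N2_quarter)
 also have "... = (if x : nb then ennreal (1 / 4) else 0)" by simp
 also have "... = (\<Sum>s\<in>steps N. ennreal (1 / 4) * (if x + s = z then 1 else 0))"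
  using sum_steps_to_z[OF x, of "ennreal (1 / 4)"] by (simp add: if_distrib[of "%c. ennreal (1 / 4) * c"] cong: if_cong)
 also have "(\<Sum>i. ?a (Suc i) x) = (\<Sum>i. \<Sum>s\<in>steps N. ennreal (1 / 4) * ?a i (x + s))"
 proof (rule suminf_cong)
  fix i
  have "?a (Suc i) x = (\<Sum>w\<in>nb. \<Sum>s\<in>steps N. ennreal (1 / 4) * (?N * emeasure (PM D' i (x + s) w) (SP N)))"
   using x by (intro sum.cong refl) (simp add: emeasure_PM_Suc[OF xg] sum_distrib_left mult.left_commute)
  also have "... = (\<Sum>s\<in>steps N. \<Sum>w\<in>nb. ennreal (1 / 4) * (?N * emeasure (PM D' i (x + s) w) (SP N)))"
   by (rule sum.swap)
  finally show "?a (Suc i) x = (\<Sum>s\<in>steps N. ennreal (1 / 4) * ?a i (x + s))"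
   by (simp only: sum_distrib_left)
 qed
 also have "... = (\<Sum>s\<in>steps N. \<Sum>i. ennreal (1 / 4) * ?a i (x + s))"
  by (intro suminf_sum) auto
 also have "... = (\<Sum>s\<in>steps N. ennreal (1 / 4) * hit (x + s))"
  by (simp only: ennreal_suminf_cmult hit_def)
 finally show ?thesis by (simp only: distrib_left sum.distrib add.commute)
qed

text \<open>The averaging identity alone gives no bound, so it is applied by induction to the
  partial sums, the probabilities of hitting within a given number of jumps.\<close>

lemma hit_le_1: "x : grid N ==> hit x <= 1"
proof -
 let ?N = "ennreal ((real N)\<^sup>2)"
 let ?a = "%i x. \<Sum>w\<in>nb. ?N * emeasure (PM D' i x w) (SP N)"
 have part: "(\<Sum>i<n. ?a i x) <= 1" if "x : grid N" for n x
  using that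
 proof (induction n arbitrary: x)
  case (Suc n x)
  show ?case
  proof (cases "x : D'")
   case x: True
   have "?a 0 x = (\<Sum>w\<in>nb. if w = x then ennreal (1 / 4) else 0)"
    using x by (intro sum.cong refl) (auto simp: emeasure_PM_0[OF Suc.prems] N2_quarter)
   also have "... = (if x : nb then ennreal (1 / 4) else 0)" by simp
   also have "... = (\<Sum>s\<in>steps N. ennreal (1 / 4) * (if x + s = z then 1 else 0))"
    using sum_steps_to_z[OF x, of "ennreal (1 / 4)"] by (simp add: if_distrib[of "%c. ennreal (1 / 4) * c"] cong: if_cong)
   finally have 1: "?a 0 x = (\<Sum>s\<in>steps N. ennreal (1 / 4) * (if x + s = z then 1 else 0))" .
   have "(\<Sum>i<n. ?a (Suc i) x) = (\<Sum>i<n. \<Sum>s\<in>steps N. ennreal (1 / 4) * ?a i (x + s))"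
   proof (rule sum.cong[OF refl])
    fix i
    have "?a (Suc i) x = (\<Sum>w\<in>nb. \<Sum>s\<in>steps N. ennreal (1 / 4) * (?N * emeasure (PM D' i (x + s) w) (SP N)))"
     using x by (intro sum.cong refl) (simp add: emeasure_PM_Suc[OF Suc.prems] sum_distrib_left mult.left_commute)
    also have "... = (\<Sum>s\<in>steps N. \<Sum>w\<in>nb. ennreal (1 / 4) * (?N * emeasure (PM D' i (x + s) w) (SP N)))"
     by (rule sum.swap)
    finally show "?a (Suc i) x = (\<Sum>s\<in>steps N. ennreal (1 / 4) * ?a i (x + s))"
     by (simp only: sum_distrib_left)
   qed
   also have "... = (\<Sum>s\<in>steps N. ennreal (1 / 4) * (\<Sum>i<n. ?a i (x + s)))"
    by (subst sum.swap) (simp only: sum_distrib_left)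
   finally have "(\<Sum>i<Suc n. ?a i x) = (\<Sum>s\<in>steps N. ennreal (1 / 4) * ((if x + s = z then 1 else 0) + (\<Sum>i<n. ?a i (x + s))))"
    unfolding sum.lessThan_Suc_shift 1 by (simp only: distrib_left sum.distrib)
   also have "... <= (\<Sum>s\<in>steps N. ennreal (1 / 4) * 1)"
   proof (intro sum_mono mult_left_mono)
    fix s assume s: "s : steps N"
    then have xs: "x + s : grid N" by (rule grid_add_steps[OF Suc.prems])
    have "(\<Sum>i<n. ?a i z) = 0"
    proof (intro sum.neutral ballI)
     fix i w
     show "?N * emeasure (PM D' i z w) (SP N) = 0"
      using PM_outside[OF zg, of D' "%_. 1" i w] by simp
    qed
    then show "(if x + s = z then 1 else 0) + (\<Sum>i<n. ?a i (x + s)) <= 1"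
     using Suc.IH[OF xs] by auto
   qed simp
   also have "... = 1" by (rule sum_steps_const)
   finally show ?thesis .
  next
   case False
   have "emeasure (PM D' i x w) (SP N) = 0" for i w
    using PM_outside[OF Suc.prems False, of "%_. 1" i w] by simp
   then show ?thesis by simp
  qed
 qed simp
 assume x: "x : grid N"
 have "hit x = (SUP n. \<Sum>i<n. ?a i x)" unfolding hit_def by (rule suminf_eq_SUP)
 also have "... <= 1" using part[OF x] by (intro SUP_least)
 finally show ?thesis .
qed

text \<open>Were the excursions never to leave \<open>D\<close>, the walk started at \<open>z\<close> would return almost surely,
 and then so would the walk started at any point of the grid: all of them would lie in \<open>D\<close>.\<close>

lemma emeasure_EM_less: "emeasure EM (SP N) < 4"
proof (rule ccontr)
 assume "~ ?thesis"
 then have ge: "4 <= (\<Sum>x\<in>nb. hit x)" by (simp add: emeasure_EM not_less)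
 have sum: "(\<Sum>x\<in>nb. hit x) = (\<Sum>s\<in>steps N. if z + s : D then hit (z + s) else 0)"
 proof -
  have "(\<Sum>x\<in>nb. hit x) = (\<Sum>x\<in>nb. if x : D then hit x else 0)"
   by (intro sum.cong refl) (simp add: nb_iff)
  also have "... = (\<Sum>s\<in>steps N. if z + s : D then hit (z + s) else 0)"
   by (rule sum_steps_nb[symmetric]) simp
  finally show ?thesis .
 qed
 \<comment> \<open>The core of a maximum principle: four terms bounded by 1 with sum at least 4 all
   equal 1.\<close>
 have all1: "f s0 = 1" if "!!s. s : steps N ==> f s <= 1" "4 <= (\<Sum>s\<in>steps N. f s)" "s0 : steps N"
  for f :: "point => ennreal" and s0
 proof (rule ccontr)
  assume "f s0 ~= 1"
  with that have "f s0 < 1" by (simp add: order.strict_iff_order)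
  have "(\<Sum>s\<in>steps N. f s) = f s0 + (\<Sum>s\<in>steps N - {s0}. f s)"
   using that(3) by (simp add: sum.remove)
  also have "... <= f s0 + (\<Sum>s\<in>steps N - {s0}. 1)" using that by (intro add_left_mono sum_mono) auto
  also have "... = f s0 + 3" using that(3) by (simp add: card_steps)
  also have "... < 1 + 3" using \<open>f s0 < 1\<close> by (metis add.commute ennreal_add_left_cancel_less ennreal_numeral ennreal_less_top numeral_less_iff infinity_ennreal_def top.not_eq_extremum)
  also have "... = 4" by simp
  finally show False using that(2) by simp
 qed
 have nbr: "z + s : D' & hit (z + s) = 1" if s: "s : steps N" for s
 proof -
  have "(if z + s : D then hit (z + s) else 0) = 1"
  proof (rule all1[OF _ _ s])
   show "4 <= (\<Sum>s\<in>steps N. if z + s : D then hit (z + s) else 0)" using ge sum by simp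
  qed (use hit_le_1 grid_add_steps[OF zg] in auto)
  moreover have "z + s ~= z" using steps_nonzero[OF N s] by simp
  ultimately show ?thesis by (auto split: if_splits)
 qed
 \<comment> \<open>If the walk from \<open>x\<close> hits \<open>z\<close> almost surely, so does
   the walk from each neighbour, and no neighbour is outside \<open>D\<close>.\<close>
 have propagate: "x + s = z | (x + s : D' & hit (x + s) = 1)" if x: "x : D'" "hit x = 1" and s: "s : steps N" for x s
 proof -
  have xg: "x : grid N" using x D by auto
  let ?f = "%s. (if x + s = z then 1 else 0) + hit (x + s)"
  have hz: "hit z = 0" by (rule hit_outside[OF zg]) simp
  have le: "?f s <= 1" if "s : steps N" for s
   using hit_le_1[OF grid_add_steps[OF xg that]] hz by auto
  have "1 = ennreal (1 / 4) * (\<Sum>s\<in>steps N. ?f s)"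
   using hit_step[OF x(1)] x(2) by (simp only: sum_distrib_left)
  then have "4 * 1 = 4 * (ennreal (1 / 4) * (\<Sum>s\<in>steps N. ?f s))" by simp
  also have "... = (4 * ennreal (1 / 4)) * (\<Sum>s\<in>steps N. ?f s)" by (simp add: mult.assoc)
  also have "4 * ennreal (1 / 4) = 1"
   by (metis ennreal_1 ennreal_mult' ennreal_numeral mult.commute nonzero_divide_eq_eq zero_le_numeral zero_neq_numeral)
  finally have "4 <= (\<Sum>s\<in>steps N. ?f s)" by simp
  then have "?f s = 1" using all1[of ?f s] le s by blast
  then show ?thesis using hit_outside[OF grid_add_steps[OF xg s]] by (cases "x + s = z"; cases "x + s : D'") auto
 qed
 define S where "S = insert z {x\<in>D'. hit x = 1}"
 have S: "x + s : S" if "x : S" "s : steps N" for x s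
  using that nbr propagate unfolding S_def by blast
 have iter: "x + (of_nat n / real N * c, of_nat n / real N * d) : S"
  if "x : S" "(c / real N, d / real N) : steps N" for x n c d
 proof (induction n)
  case (Suc n)
  have *: "x + (of_nat (Suc n) / real N * c, of_nat (Suc n) / real N * d)
   = (x + (of_nat n / real N * c, of_nat n / real N * d)) + (c / real N, d / real N)"
   by (simp add: add_divide_distrib algebra_simps prod_eq_iff)
  show ?case using S[OF Suc that(2)] by (simp only: *)
 qed (use that in \<open>simp add: zero_prod_def[symmetric]\<close>)
 have "x : S" if x: "x : grid N" for x
 proof -
  obtain i j where x: "x = (of_int i / of_nat N, of_int j / of_nat N)" using x by (auto simp: grid_def)
  obtain k l where zz: "z = (of_int k / of_nat N, of_int l / of_nat N)" using zg by (auto simp: grid_def)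
  \<comment> \<open>Signs of the two displacements: every grid point is reached from
    \<open>z\<close> by a horizontal and then a vertical run of steps.\<close>
  define c where "c = (if i \<ge> k then 1 else -1 :: real)"
  define d where "d = (if j \<ge> l then 1 else -1 :: real)"
  have c: "real (nat \<bar>i - k\<bar>) * c = of_int (i - k)" by (auto simp: c_def)
  have d: "real (nat \<bar>j - l\<bar>) * d = of_int (j - l)" by (auto simp: d_def)
  have "(c / real N, 0 / real N) : steps N" by (auto simp: c_def steps_def)
  then have A: "z + (of_nat (nat \<bar>i - k\<bar>) / real N * c, of_nat (nat \<bar>i - k\<bar>) / real N * 0) : S"
   by (intro iter) (auto simp: S_def)
  have B: "(0 / real N, d / real N) : steps N" by (auto simp: d_def steps_def)
  have "(z + (of_nat (nat \<bar>i - k\<bar>) / real N * c, of_nat (nat \<bar>i - k\<bar>) / real N * 0))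
    + (of_nat (nat \<bar>j - l\<bar>) / real N * 0, of_nat (nat \<bar>j - l\<bar>) / real N * d) : S"
   by (rule iter[OF A B])
  moreover have "of_nat (nat \<bar>i - k\<bar>) / real N * c = of_int (i - k) / real N"
   "of_nat (nat \<bar>j - l\<bar>) / real N * d = of_int (j - l) / real N"
   using c d by (metis times_divide_eq_left)+
  ultimately show ?thesis using N by (simp add: x zz add_divide_distrib[symmetric])
 qed
 then have "grid N \<subseteq> D" using z unfolding S_def by auto
 then show False using not_full by auto
qed


text \<open>The sum of \<open>hit\<close> over the neighbours of \<open>z\<close>, hence four times
  the probability that the walk from \<open>z\<close> returns to \<open>z\<close> before leaving
  \<open>D\<close>.\<close>

definition mE :: real where "mE = measure EM (SP N)"

lemma finite_measure_EM: "finite_measure EM"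
 by (rule finite_measureI) (use emeasure_EM_less in \<open>auto simp: top_unique\<close>)

sublocale EM: finite_measure EM
 by (rule finite_measure_EM)

lemma emeasure_EM_eq: "emeasure EM (SP N) = ennreal mE"
 unfolding mE_def by (rule EM.emeasure_eq_measure)

lemma mE: "0 <= mE" "mE < 4"
proof -
 show "0 <= mE" by (simp add: mE_def)
 then show "mE < 4" using emeasure_EM_less unfolding emeasure_EM_eq
  by (metis ennreal_less_iff ennreal_numeral)
qed

lemma nn_integral_PM_from_z:
 assumes f[measurable]: "f : bm (PS N)"
 shows "(NI p. f p;PM D (Suc n) z z) = (\<Sum>x\<in>nb. ennreal ((real N)\<^sup>2) *
  (NI h. NI p. f (papp (hold z h) p);PM D n x z;expm))"
proof -
 let ?X = "%x. if x : grid N then ennreal ((real N)\<^sup>2) *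
  (NI h. NI p. f (papp (hold z h) p);PM D n x z;expm) else 0"
 have "(NI p. f p;PM D (Suc n) z z) = (\<Sum>s\<in>steps N. ?X (z + s))"
  using z grid_add_steps[OF zg] by (subst nn_integral_PM_Suc[OF zg f]) (auto intro!: sum.cong)
 also have "... = (\<Sum>x\<in>nb. ?X x)"
 proof (rule sum_steps_nb)
  fix y assume y: "y ~: D"
  show "?X y = 0"
  proof (cases "y : grid N")
   case True
   have "(NI h. NI p. f (papp (hold z h) p);PM D n y z;expm) = (NI h. 0;expm)"
    by (intro nn_integral_cong PM_outside[OF True y]) measurable
   then show ?thesis by simp
  qed simp
 qed
 finally show ?thesis using nb_grid by (simp cong: sum.cong)
qed

text \<open>The contribution to \<open>mE\<close> of the excursions that make \<open>i\<close> jumps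
  inside \<open>D - {z}\<close>.\<close>

definition exits :: "nat => ennreal" where
 "exits i = (\<Sum>x\<in>nb. \<Sum>w\<in>nb. ennreal ((real N)\<^sup>2) * emeasure (PM D' i x w) (SP N))"

lemma suminf_exits: "(\<Sum>i. exits i) = ennreal mE"
proof -
 have "(\<Sum>i. exits i) = (\<Sum>x\<in>nb. hit x)"
  unfolding exits_def hit_def by (rule suminf_sum) auto
 then show ?thesis using emeasure_EM emeasure_EM_eq by simp
qed

lemma emeasure_PM_return:
 "emeasure (PM D (Suc n) z z) (SP N)
  = ennreal (1 / 4) * (\<Sum>i<n. exits i * emeasure (PM D (n - Suc i) z z) (SP N))"
proof -
 let ?N = "ennreal ((real N)\<^sup>2)"
 let ?m = "%j. emeasure (PM D j z z) (SP N)"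
 have "emeasure (PM D (Suc n) z z) (SP N) = (NI p. 1;PM D (Suc n) z z)" by simp
 also have "... = (\<Sum>x\<in>nb. ennreal (1 / 4) * (NI p. 1;PM D n x z))"
  by (subst nn_integral_PM_from_z) (auto simp: emeasure_expm_UNIV N2_quarter[symmetric] mult_ac)
 also have "... = (\<Sum>x\<in>nb. ennreal (1 / 4) * (\<Sum>i<n. \<Sum>w\<in>nb. ?N * (?m (n - Suc i) * emeasure (PM D' i x w) (SP N))))"
 proof (intro sum.cong refl arg_cong2[where f=times])
  fix x assume "x : nb"
  show "(NI p. 1;PM D n x z) = (\<Sum>i<n. \<Sum>w\<in>nb. ?N * (?m (n - Suc i) * emeasure (PM D' i x w) (SP N)))"
   by (subst PM_first_hit[OF nb_D'[OF \<open>x : nb\<close>]]) simp_all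
 qed
 also have "... = ennreal (1 / 4) * (\<Sum>i<n. \<Sum>x\<in>nb. \<Sum>w\<in>nb. ?N * (?m (n - Suc i) * emeasure (PM D' i x w) (SP N)))"
  by (subst sum.swap) (simp only: sum_distrib_left)
 also have "... = ennreal (1 / 4) * (\<Sum>i<n. exits i * ?m (n - Suc i))"
  unfolding exits_def by (intro arg_cong2[where f=times] refl sum.cong) (simp add: sum_distrib_left sum_distrib_right mult_ac)
 finally show ?thesis .
qed

text \<open>Renewal equation: the total mass \<open>g\<close> satisfies
  \<open>g = mE / 4 * g + 1 / (4 * N^2)\<close>. It can be solved only once \<open>g\<close> is
  known to be finite, which the partial sums provide.\<close>

lemma emeasure_PA_z: "emeasure (PA D z z) (SP N) = ennreal (1 / ((real N)\<^sup>2 * (4 - mE)))"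
proof -
 let ?m = "%j. emeasure (PM D j z z) (SP N)"
 let ?c = "1 / (4 * (real N)\<^sup>2)"
 have m0: "?m 0 = ennreal ?c" using z by (simp add: emeasure_PM_0[OF zg])
 have fin: "?m j < \<infinity>" for j using emeasure_PM_le[OF zg, of D j z] by (simp add: le_less_trans)
 have tri: "(\<Sum>n. \<Sum>i<n. exits i * g (n - Suc i)) = ennreal mE * (\<Sum>j. g j)" for g
 proof -
  have "(\<Sum>n. \<Sum>i<n. exits i * g (n - Suc i)) = (\<Sum>i. \<Sum>j. exits i * g j)" by (rule suminf_triangle)
  then show ?thesis by (simp add: ennreal_suminf_cmult ennreal_suminf_multc suminf_exits)
 qed
 \<comment> \<open>The same equation as an inequality for the sum \<open>s\<close> of the first
   \<open>K\<close> terms, which is finite: \<open>s <= 1 / (4 * N^2) + mE / 4 * s\<close>. As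
   \<open>mE < 4\<close>, this bounds \<open>s\<close> uniformly in \<open>K\<close>.\<close>
 have part: "(\<Sum>j<K. ?m j) <= ennreal (?c / (1 - mE / 4))" for K
 proof -
  let ?S = "\<Sum>j<K. ?m j"
  have "?S <= ?m 0 + (\<Sum>n<K. ?m (Suc n))"
  proof (cases K)
   case (Suc n)
   have "?S = ?m 0 + (\<Sum>j<n. ?m (Suc j))" unfolding Suc by (rule sum.lessThan_Suc_shift)
   also have "... <= ?m 0 + (\<Sum>n<K. ?m (Suc n))" unfolding Suc by (intro add_left_mono sum_mono2) auto
   finally show ?thesis .
  qed simp
  also have "(\<Sum>n<K. ?m (Suc n)) = ennreal (1 / 4) * (\<Sum>n<K. \<Sum>i<n. exits i * (if n - Suc i < K then ?m (n - Suc i) else 0))"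
   unfolding emeasure_PM_return sum_distrib_left by (intro sum.cong refl) auto
  also have "... <= ennreal (1 / 4) * (\<Sum>n. \<Sum>i<n. exits i * (if n - Suc i < K then ?m (n - Suc i) else 0))"
   by (intro mult_left_mono sum_le_suminf) auto
  also have "... = ennreal (1 / 4) * (ennreal mE * (\<Sum>j. if j < K then ?m j else 0))"
   using tri[of "%j. if j < K then ?m j else 0"] by simp
  also have "(\<Sum>j. if j < K then ?m j else 0) = (\<Sum>j<K. if j < K then ?m j else 0)"
   by (rule suminf_finite) auto
  also have "... = ?S" by simp
  finally have le: "?S <= ennreal ?c + ennreal (1 / 4) * (ennreal mE * ?S)"
   unfolding m0 by (simp add: add_left_mono)
  have "?S < \<infinity>" using fin by simp
  then obtain s where s: "?S = ennreal s" "0 <= s" by (cases ?S) auto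
  have "s <= ?c + (1 / 4) * (mE * s)"
   using le mE s(2) unfolding s(1) by (simp add: ennreal_mult[symmetric] ennreal_plus[symmetric] del: ennreal_plus)
  then have le': "s * (1 - mE / 4) <= ?c" by (simp add: algebra_simps)
  have "0 < 1 - mE / 4" using mE by simp
  from pos_le_divide_eq[OF this, THEN iffD2, OF le'] show ?thesis unfolding s(1) by (rule ennreal_leI)
 qed
 have sum: "emeasure (PA D z z) (SP N) = (\<Sum>n. ?m n)"
  using nn_integral_PA[OF zg, of "%_. 1" D z] by simp
 also have "... = (SUP K. \<Sum>j<K. ?m j)" by (rule suminf_eq_SUP)
 also have "... <= ennreal (?c / (1 - mE / 4))" using part by (intro SUP_least)
 finally have "(\<Sum>n. ?m n) < \<infinity>" using sum by (simp add: le_less_trans)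
 then obtain g where g: "(\<Sum>n. ?m n) = ennreal g" "0 <= g" by (cases "\<Sum>n. ?m n") auto
 have "(\<Sum>n. ?m n) = (\<Sum>n. ?m (Suc n)) + ?m 0"
  using suminf_offset[of ?m 1] by simp
 also have "(\<Sum>n. ?m (Suc n)) = ennreal (1 / 4) * (ennreal mE * (\<Sum>n. ?m n))"
  unfolding emeasure_PM_return by (simp only: ennreal_suminf_cmult tri[of ?m])
 finally have "ennreal g = ennreal (1 / 4) * (ennreal mE * ennreal g) + ennreal ?c" unfolding g(1) m0 .
 then have "g = (1 / 4) * (mE * g) + ?c"
  using mE g(2) by (simp add: ennreal_mult[symmetric] ennreal_plus[symmetric] del: ennreal_plus)
 then have "g * (4 - mE) = 4 * ?c" by (simp add: algebra_simps)
 moreover have "4 - mE ~= 0" using mE by simp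
 ultimately have "g = 4 * ?c / (4 - mE)" by (metis nonzero_eq_divide_eq)
 then show ?thesis unfolding sum g(1) by simp
qed

lemma finite_measure_PA_z: "finite_measure (PA D z z)"
 by (rule finite_measureI) (simp add: emeasure_PA_z)

sublocale PA: finite_measure "PA D z z"
 by (rule finite_measure_PA_z)

text \<open>A path from \<open>z\<close> to \<open>z\<close> rests at \<open>z\<close> and then
  either stops or makes an excursion and starts afresh. The factor N^2 in front belongs to the jump
  out of \<open>z\<close>; that of the jump back is contained in \<open>EM\<close>.\<close>

theorem PA_excursion:
 assumes f[measurable]: "f : bm (PS N)"
 shows "(NI p. f p;PA D z z) = (NI h. f (hold z h);expm)
  + ennreal ((real N)\<^sup>2) * (NI h. NI e. NI p. f (papp (hold z h) (papp e p));PA D z z;EM;expm)"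
proof -
 let ?N = "ennreal ((real N)\<^sup>2)"
 let ?g = "%h e. NI p. f (papp (hold z h) (papp e p));PA D z z"
 have first: "(\<Sum>n. NI p. k p;PM D n x z) = (\<Sum>w\<in>nb. ?N * (NI e. NI p. k (papp e p);PA D z z;PA D' x w))"
  if x: "x : nb" and k[measurable]: "k : bm (PS N)" for k x
 proof -
  have xg[measurable]: "x : grid N" using x nb_grid by auto
  let ?a = "%i j. \<Sum>w\<in>nb. ?N * (NI p. NI q. k (papp p q);PM D j z z;PM D' i x w)"
  have "(\<Sum>n. NI p. k p;PM D n x z) = (\<Sum>i. \<Sum>j. ?a i j)"
   unfolding PM_first_hit[OF nb_D'[OF x] k] by (rule suminf_triangle)
  also have "... = (\<Sum>i. \<Sum>w\<in>nb. ?N * (\<Sum>j. NI p. NI q. k (papp p q);PM D j z z;PM D' i x w))"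
   by (subst suminf_sum) (simp_all add: ennreal_suminf_cmult)
  also have "... = (\<Sum>w\<in>nb. ?N * (\<Sum>i. \<Sum>j. NI p. NI q. k (papp p q);PM D j z z;PM D' i x w))"
   by (subst suminf_sum) (simp_all add: ennreal_suminf_cmult)
  also have "... = (\<Sum>w\<in>nb. ?N * (\<Sum>i. NI p. NI q. k (papp p q);PA D z z;PM D' i x w))"
  proof (intro sum.cong refl arg_cong2[where f=times] suminf_cong)
   fix w i
   have "(\<Sum>j. NI p. NI q. k (papp p q);PM D j z z;PM D' i x w)
    = (NI p. (\<Sum>j. NI q. k (papp p q);PM D j z z);PM D' i x w)"
    by (rule nn_integral_suminf[symmetric]) measurable
   also have "... = (NI p. NI q. k (papp p q);PA D z z;PM D' i x w)"
    by (intro PM_cong nn_integral_PA[OF zg, symmetric]) measurable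
   finally show "(\<Sum>j. NI p. NI q. k (papp p q);PM D j z z;PM D' i x w) = ..." .
  qed
  also have "... = (\<Sum>w\<in>nb. ?N * (NI e. NI p. k (papp e p);PA D z z;PA D' x w))"
   by (intro sum.cong refl arg_cong2[where f=times] nn_integral_PA[OF xg, symmetric]) measurable
  finally show ?thesis .
 qed
 have "(NI p. f p;PA D z z) = (\<Sum>n. NI p. f p;PM D (Suc n) z z) + (NI p. f p;PM D 0 z z)"
  unfolding nn_integral_PA[OF zg f] using suminf_offset[of "%n. NI p. f p;PM D n z z" 1] by simp
 also have "(NI p. f p;PM D 0 z z) = (NI h. f (hold z h);expm)"
  using z by (simp add: nn_integral_PM_0[OF zg f])
 also have "(\<Sum>n. NI p. f p;PM D (Suc n) z z)
  = (\<Sum>x\<in>nb. ?N * (\<Sum>n. NI h. NI p. f (papp (hold z h) p);PM D n x z;expm))"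
  unfolding nn_integral_PM_from_z[OF f] by (subst suminf_sum) (simp_all add: ennreal_suminf_cmult)
 also have "... = (\<Sum>x\<in>nb. ?N * (NI h. (\<Sum>n. NI p. f (papp (hold z h) p);PM D n x z);expm))"
  using nb_grid by (intro sum.cong refl arg_cong2[where f=times] nn_integral_suminf[symmetric]) measurable
 also have "... = (\<Sum>x\<in>nb. ?N * (NI h. (\<Sum>w\<in>nb. ?N * (NI e. ?g h e;PA D' x w));expm))"
  by (intro sum.cong refl arg_cong2[where f=times] nn_integral_cong first) measurable
 also have "... = ?N * (\<Sum>x\<in>nb. NI h. (\<Sum>w\<in>nb. ?N * (NI e. ?g h e;PA D' x w));expm)"
  by (simp only: sum_distrib_left)
 also have "(\<Sum>x\<in>nb. NI h. (\<Sum>w\<in>nb. ?N * (NI e. ?g h e;PA D' x w));expm)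
   = (NI h. (\<Sum>x\<in>nb. \<Sum>w\<in>nb. ?N * (NI e. ?g h e;PA D' x w));expm)"
 proof (rule nn_integral_sum[symmetric])
  fix x assume "x : nb"
  then have [measurable]: "x : grid N" by (rule nb_grid)
  have "(%h. NI e. ?g h e;PA D' x w) = (%h. \<Sum>n. NI e. ?g h e;PM D' n x w)" for w
   by (intro ext nn_integral_PA) measurable
  moreover have "(%h. \<Sum>n. NI e. ?g h e;PM D' n x w) : bm expm" for w by measurable
  ultimately have [measurable]: "(%h. NI e. ?g h e;PA D' x w) : bm expm" for w by metis
  show "(%h. \<Sum>w\<in>nb. ?N * (NI e. ?g h e;PA D' x w)) : bm expm" by measurable
 qed
 also have "... = (NI h. NI e. ?g h e;EM;expm)"
 proof (rule nn_integral_cong)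
  fix h
  have "(NI e. ?g h e;EM) = ?N * (\<Sum>x\<in>nb. \<Sum>w\<in>nb. NI e. ?g h (close_excursion z e);PA D' x w)"
   by (rule nn_integral_EM) measurable
  then show "(\<Sum>x\<in>nb. \<Sum>w\<in>nb. ?N * (NI e. ?g h e;PA D' x w)) = (NI e. ?g h e;EM)"
   by (simp add: path_append_close sum_distrib_left)
 qed
 finally show ?thesis by (simp add: add.commute)
qed

text \<open>The time integral of the heat kernel is N^2 times the total mass of
  \<open>PA D z z\<close>, which the renewal equation has computed.\<close>

theorem green_eq: "green N D z z = 1 / (4 - mE)"
proof -
 note [measurable] = zg
 let ?f = "%t. indicator {0<..} t * heat_kernel N D t z z"
 let ?g = "%t. NI w. (if 0 < t & wpath z t w : staying N D z then 1 else 0);src N"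
 have f: "ennreal (?f t) = ennreal ((real N)\<^sup>2) * ?g t" for t
 proof (cases "0 < t")
  case True
  interpret W: prob_space "walk_law N z t"
   unfolding walk_law_def by (rule source.prob_space_distr[OF measurable_walk_path[OF zg True]])
  have "ennreal (?f t) = ennreal ((real N)\<^sup>2) * emeasure (walk_law N z t) (staying N D z)"
   using True by (simp add: heat_kernel_def W.emeasure_eq_measure ennreal_mult)
  also have "emeasure (walk_law N z t) (staying N D z) = ?g t"
   using True by (subst emeasure_walk_law[OF zg True]) (auto intro!: nn_integral_cong simp: indicator_def)
  finally show ?thesis .
 qed simp
 have pos: "0 <= ?f t" for t by (simp add: heat_kernel_def)
 have "?f = (%t. enn2real (ennreal ((real N)\<^sup>2) * ?g t))"
  using f pos by (metis enn2real_ennreal)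
 also have "... : bm lborel" by measurable
 finally have m: "?f : bm lborel" .
 have "green N D z z = (\<integral>t. ?f t \<partial>lborel)"
  by (simp add: green_def interval_lebesgue_integral_def set_lebesgue_integral_def zero_ereal_def
    einterval_def greaterThan_def)
 also have "... = enn2real (NI t. ennreal (?f t);lborel)"
  by (rule integral_eq_nn_integral[OF m]) (use pos in auto)
 also have "(NI t. ennreal (?f t);lborel) = ennreal ((real N)\<^sup>2) * (NI t. ?g t;lborel)"
  unfolding f by (rule nn_integral_cmult) measurable
 also have "(NI t. ?g t;lborel) = emeasure (PA D z z) (SP N)"
  using nn_integral_PA_source[OF zg, of "%_. 1" D z] by simp
 finally show ?thesis
  unfolding emeasure_PA_z using N_pos mE by (simp add: ennreal_mult[symmetric])
qed

end

section \<open>Laplace functionals of random collections\<close>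

definition en :: "ennreal => ennreal" where
 "en x = (if x = \<infinity> then 0 else ennreal (exp (- enn2real x)))"

lemma en_simps [simp]: "en 0 = 1" "en \<top> = 0" "0 <= x ==> en (ennreal x) = ennreal (exp (- x))"
 by (simp_all add: en_def)

lemma en_le_1: "en x <= 1"
 by (cases x) auto

lemma en_neq_top [simp]: "en x ~= \<top>" "en x < \<top>"
 using en_le_1[of x] by (auto simp: top_unique le_less_trans)

lemma en_add: "en (x + y) = en x * en y"
 by (cases x; cases y)
  (auto simp: ennreal_mult[symmetric] exp_add[symmetric] ennreal_plus[symmetric] simp del: ennreal_plus)

lemma en_mono: "x <= y ==> en y <= en x"
 by (cases x; cases y) (auto intro!: ennreal_leI simp: top_unique)

lemma measurable_en [measurable]: "en : bm borel"
 unfolding en_def by measurable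

lemma en_sum: "finite I ==> en (\<Sum>i\<in>I. f i) = (\<Prod>i\<in>I. en (f i))"
 by (induction I rule: finite_induct) (auto simp: en_add)

lemma en_of_nat_mult: "en (of_nat n * x) = en x ^ n"
 by (induction n) (auto simp: distrib_right en_add)

text \<open>Antitone continuity of the exponential, including the case of convergence to infinity,
  where \<open>en\<close> is 0 by convention.\<close>

lemma en_SUP:
 fixes f :: "nat => ennreal"
 assumes "incseq f"
 shows "en (SUP i. f i) = (INF i. en (f i))"
proof (rule tendsto_unique[OF sequentially_bot])
 let ?s = "SUP i. f i"
 have lim: "f \<longlonglongrightarrow> ?s" by (rule LIMSEQ_SUP[OF assms])
 show "(%i. en (f i)) \<longlonglongrightarrow> en ?s"
 proof (cases "?s = \<infinity>")
  case False
  then obtain s where s: "?s = ennreal s" "0 <= s" by (cases ?s) auto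
  have le: "f i <= ennreal s" for i using SUP_upper[of i UNIV f] s by simp
  then have fin: "f i ~= \<infinity>" for i by (metis ennreal_neq_top infinity_ennreal_def top_unique)
  have "(%i. enn2real (f i)) \<longlonglongrightarrow> s"
   using tendsto_enn2real[OF lim[unfolded s(1)] s(2)] .
  then have "(%i. ennreal (exp (- enn2real (f i)))) \<longlonglongrightarrow> ennreal (exp (- s))"
   by (intro tendsto_ennrealI tendsto_exp tendsto_minus)
  then show ?thesis using fin s by (simp add: en_def)
 next
  case True
  have "(%i. en (f i)) \<longlonglongrightarrow> 0"
  proof (rule order_tendstoI)
   fix a :: ennreal assume "0 < a"
   then obtain e where e: "0 < e" "ennreal e <= a"
    by (cases a) (auto intro: exI[of _ 1] simp: less_top[symmetric] intro!: that[of 1])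
   have "\<forall>\<^sub>F i in sequentially. ennreal (\<bar>ln e\<bar> + 1) < f i"
    using lim True by (intro order_tendstoD(1)) (auto simp: less_top[symmetric])
   then show "\<forall>\<^sub>F i in sequentially. en (f i) < a"
   proof eventually_elim
    case (elim i)
    show ?case
    proof (cases "f i")
     case (real r)
     then have "\<bar>ln e\<bar> + 1 < r" using elim by (simp add: ennreal_less_iff del: ennreal_plus)
     then have "exp (- r) < exp (ln e)" by simp
     then have "ennreal (exp (- r)) < ennreal e" using e by (simp add: ennreal_lessI)
     then show ?thesis using real e(2) by simp
    qed (use \<open>0 < a\<close> in simp)
   qed
  qed simp
  then show ?thesis unfolding True by simp
 qed
 show "(%i. en (f i)) \<longlonglongrightarrow> (INF i. en (f i))"
  by (rule LIMSEQ_INF) (use assms in \<open>auto simp: decseq_def incseq_def intro: en_mono\<close>)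
qed

text \<open>Inverse of \<open>en\<close> on [0, 1], with value infinity at 0. It allows an infinite
  product of numbers in [0, 1] to be written as \<open>en\<close> of a series.\<close>

definition nln :: "ennreal => ennreal" where
 "nln y = (if y = 0 then \<infinity> else ennreal (- ln (enn2real y)))"

lemma en_nln: "y <= 1 ==> en (nln y) = y"
proof (cases y)
 case (real r)
 assume "y <= 1"
 then have "0 < r ==> r <= 1" using real by (simp add: ennreal_le_1)
 then show ?thesis using real by (cases "r = 0") (auto simp: nln_def ln_le_zero_iff)
qed (auto simp: top_unique)

lemma measurable_nln [measurable]: "nln : bm borel"
 unfolding nln_def by measurable

lemma collection_sum_add: "csum (%x. f x + g x) C = csum f C + csum g C"
 unfolding collection_sum_def distrib_left by (rule nn_integral_add) auto

lemma collection_sum_cmult: "csum (%x. c * f x) C = c * csum f C"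
 unfolding collection_sum_def by (subst nn_integral_cmult[symmetric]) (auto simp: mult.left_commute)

lemma collection_sum_SUP:
 "incseq f ==> csum (%x. SUP i. f i x) C = (SUP i. csum (f i) C)"
 unfolding collection_sum_def SUP_mult_left_ennreal
 by (rule nn_integral_monotone_convergence_SUP) (auto simp: incseq_def le_fun_def intro!: mult_left_mono)

lemma collection_sum_cong:
 assumes "C : collections S" "!!x. x : space S ==> f x = g x"
 shows "csum f C = csum g C"
 unfolding collection_sum_def
proof (rule nn_integral_cong)
 fix x show "ennreal_of_enat (C x) * f x = ennreal_of_enat (C x) * g x"
  using assms by (cases "C x = 0") (auto simp: collections_def)
qed

lemma collection_sum_sum:
 "finite I ==> csum (%x. \<Sum>i\<in>I. f i x) C = (\<Sum>i\<in>I. csum (f i) C)"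
 by (induction I rule: finite_induct) (auto simp: collection_sum_add, simp add: collection_sum_def)

lemma collection_space_gen:
 "{(%C. npoints C B) -` U \<inter> collections S | B U. B : sets S & U : sets borel} \<subseteq> Pow (collections S)"
 by auto

lemma space_collection_space [simp]: "space (collection_space S) = collections S"
 unfolding collection_space_def by (rule space_measure_of[OF collection_space_gen])

lemma sets_collection_space: "sets (collection_space S) = sigma_sets (collections S)
   {(%C. npoints C B) -` U \<inter> collections S | B U. B : sets S & U : sets borel}"
 unfolding collection_space_def by (rule sets_measure_of[OF collection_space_gen])

lemma collection_space_cong:
 assumes "sets S = sets S'"
 shows "collection_space S = collection_space S'"
 unfolding collection_space_def collections_def sets_eq_imp_space_eq[OF assms] assms ..

lemma measurable_npoints [measurable]: "B : sets S ==> (%C. npoints C B) : bm (collection_space S)"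
 by (rule measurableI) (auto simp: sets_collection_space)

lemma measurable_collection_spaceI:
 assumes "!!y. y : space Y ==> g y : collections S"
  and "!!B. B : sets S ==> (%y. npoints (g y) B) : bm Y"
 shows "g : Y ->M collection_space S"
 unfolding collection_space_def
proof (rule measurable_measure_of[OF collection_space_gen])
 fix A assume "A : {(%C. npoints C B) -` U \<inter> collections S | B U. B : sets S & U : sets borel}"
 then obtain B U where *: "A = (%C. npoints C B) -` U \<inter> collections S" "B : sets S" "U : sets borel" by blast
 then have "g -` A \<inter> space Y = (%y. npoints (g y) B) -` U \<inter> space Y" using assms(1) by auto
 then show "g -` A \<inter> space Y : sets Y" using measurable_sets[OF assms(2)] * by simp
qed (use assms in auto)

lemma measurable_collection_sum [measurable]:
 assumes "f : bm S"
 shows "csum f : bm (collection_space S)"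
 using assms
proof (induction rule: borel_measurable_induct)
 case (cong f g)
 then show ?case
  using measurable_cong[of "collection_space S" "csum f" "csum g"] collection_sum_cong[of _ S f g]
  by simp
next
 case (set A)
 then show ?case using measurable_npoints[OF set] by (simp add: npoints_def[abs_def])
next
 case (mult u c)
 have "csum (%x. c * u x) = (%C. c * csum u C)"
  by (simp add: fun_eq_iff collection_sum_cmult)
 then show ?case using mult by simp
next
 case (add u v)
 have "csum (%x. v x + u x) = (%C. csum v C + csum u C)"
  by (simp add: fun_eq_iff collection_sum_add)
 then show ?case using add by simp
next
 case (seq U)
 have eq: "csum (SUP i. U i) = (%C. SUP i. csum (U i) C)"
  using collection_sum_SUP[OF \<open>incseq U\<close>] by (simp add: fun_eq_iff SUP_apply[abs_def])
 note [measurable] = seq.IH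
 show ?case unfolding eq by measurable
qed

lemma npoints_nat: "npoints C B = \<infinity> | (EX k. npoints C B = of_nat k)"
proof -
 define A where "A = {x\<in>B. C x ~= 0}"
 have eq: "npoints C B = (NI x. ennreal_of_enat (C x);count_space A)"
  unfolding npoints_def collection_sum_def A_def
  by (subst (2) nn_integral_count_space_indicator) (auto intro!: nn_integral_cong simp: indicator_def)
 have one: "1 <= ennreal_of_enat (C x)" if "x : A" for x
  using that by (cases "C x") (auto simp: A_def enat_0_iff)
 show ?thesis
 proof (cases "finite A & (\<forall>x\<in>A. C x ~= \<infinity>)")
  case True
  then have "npoints C B = (\<Sum>x\<in>A. of_nat (the_enat (C x)))"
   unfolding eq by (subst nn_integral_count_space_finite, simp, intro sum.cong refl) auto
  then show ?thesis by (metis of_nat_sum)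
 next
  case False
  have "npoints C B = \<infinity>"
  proof (cases "finite A")
   case True
   then obtain x where x: "x : A" "C x = \<infinity>" using False by auto
   have "ennreal_of_enat (C x) <= npoints C B"
    unfolding eq by (rule nn_integral_ge_point[OF x(1)])
   then show ?thesis using x by (simp add: top_unique)
  next
   case False
   have "(NI x. 1;count_space A) <= npoints C B"
    unfolding eq using one by (intro nn_integral_mono) auto
   then show ?thesis using False by (simp add: top_unique)
  qed
  then show ?thesis ..
 qed
qed


text \<open>Extraction of a power series coefficient at x = exp(-(i+1)): the lower terms are
  subtracted, the rest is divided by x^k, and x tends to 0. An infinite count contributes 0. The
  bound by 1 serves dominated convergence.\<close>

lemma coefficient_limit:
 fixes n :: ennreal and k :: nat
 assumes n: "n = \<infinity> | (\<exists>m::nat. n = of_nat m)"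
 defines "u == %i::nat. (enn2real (en (of_nat (Suc i) * n))
   - (\<Sum>j<k. exp (- (real (Suc i) * real j)) * (if n = of_nat j then 1 else 0))) * exp (real (Suc i) * real k)"
 shows "u \<longlonglongrightarrow> (if n = of_nat k then 1 else 0)" and "\<bar>u i\<bar> <= 1"
proof -
 have "u \<longlonglongrightarrow> (if n = of_nat k then 1 else 0) & (ALL i. \<bar>u i\<bar> <= 1)"
 proof (cases "n = \<infinity>")
  case True
  then have "u = (%_. 0)"
   by (auto simp: u_def fun_eq_iff ennreal_mult_top)
  then show ?thesis using True by simp
 next
  case False
  then obtain m where m: "n = of_nat m" using n by blast
  have en: "enn2real (en (of_nat (Suc i) * n)) = exp (- (real (Suc i) * real m))" for i
  proof -
   have "of_nat (Suc i) * n = ennreal (real (Suc i) * real m)"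
    unfolding m by (simp add: ennreal_of_nat_eq_real_of_nat ennreal_mult del: of_nat_Suc)
   then show ?thesis by simp
  qed
  have sum: "(\<Sum>j<k. exp (- (real (Suc i) * real j)) * (if n = of_nat j then 1 else 0))
   = (if m < k then exp (- (real (Suc i) * real m)) else 0)" for i
  proof -
   have "(\<Sum>j<k. exp (- (real (Suc i) * real j)) * (if n = of_nat j then 1 else 0))
    = (\<Sum>j<k. if j = m then exp (- (real (Suc i) * real m)) else 0)"
    unfolding m by (intro sum.cong refl) auto
   then show ?thesis by simp
  qed
  have u: "u i = (if m < k then 0 else exp (- real (Suc i) * real (m - k)))" for i
   unfolding u_def en sum by (auto simp: exp_add[symmetric] algebra_simps of_nat_diff)
  have "(%i. exp (- real (Suc i) * real (m - k))) \<longlonglongrightarrow> 0" if "k < m"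
  proof -
   have "(%i. exp (- real (Suc i) * real (m - k))) = (%i. exp (- real (m - k)) ^ Suc i)"
    by (rule ext) (simp add: exp_of_nat_mult[symmetric] mult.commute del: of_nat_Suc power_Suc)
   moreover have "(%i. exp (- real (m - k)) ^ Suc i) \<longlonglongrightarrow> 0"
    using that by (intro LIMSEQ_Suc LIMSEQ_power_zero) auto
   ultimately show ?thesis by simp
  qed
  moreover have "\<bar>u i\<bar> <= 1" for i
   unfolding u by (simp add: mult_nonneg_nonneg del: of_nat_Suc of_nat_diff)
  ultimately show ?thesis
   unfolding m by (cases m k rule: linorder_cases) (auto simp: u[abs_def] simp del: of_nat_Suc of_nat_diff)
 qed
 then show "u \<longlonglongrightarrow> (if n = of_nat k then 1 else 0)" "\<bar>u i\<bar> <= 1" by auto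
qed

text \<open>The law of a random collection is determined by its Laplace functional: the probability of
 \<open>k\<close> points in \<open>B\<close> is the coefficient of \<open>x\<^sup>k\<close> in the expectation of \<open>x\<close> to the number of points.\<close>

theorem collection_law_determined:
 fixes q :: "'a collection measure" and K :: "'p => 'a collection measure" and P :: "'p measure"
 assumes q: "finite_measure q" "sets q = sets (collection_space S)"
  and K: "!!r. r : space P ==> finite_measure (K r)" "!!r. r : space P ==> sets (K r) = sets (collection_space S)"
  and en_meas: "!!f. f : bm S ==> (%r. NI C. en (csum f C);K r) : bm P"
  and en_eq: "!!f. f : bm S ==>
   (NI C. en (csum f C);q) = (NI r. NI C. en (csum f C);K r;P)"
  and H: "H : bm (collection_space S)"
 shows "(%r. NI C. H C;K r) : bm P"
  and "(NI C. H C;q) = (NI r. NI C. H C;K r;P)"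
proof -
 let ?C = "collection_space S"
 interpret mu: finite_measure q by (rule q(1))
 have sp: "space q = collections S" "!!r. r : space P ==> space (K r) = collections S"
  using sets_eq_imp_space_eq[OF q(2)] sets_eq_imp_space_eq[OF K(2)] by simp_all
 have mmu: "f : bm q \<longleftrightarrow> f : bm ?C" for f :: "_ => 'z::topological_space"
  unfolding measurable_cong_sets[OF q(2) refl] ..
 have mK: "r : space P ==> f : bm (K r) \<longleftrightarrow> f : bm ?C" for f :: "_ => 'z::topological_space" and r
  using measurable_cong_sets[OF K(2) refl] by blast
 have intK: "integrable (K r) f" if "r : space P" "f : bm ?C" "!!C. \<bar>f C\<bar> <= B" for r B and f :: "_ => real"
  by (rule finite_measure.integrable_const_bound[OF K(1)[OF that(1)], of _ B])
   (use that(2,3) mK[OF that(1), of f] in simp_all)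
 have intmu: "integrable q f" if "f : bm ?C" "!!C. \<bar>f C\<bar> <= B" for B and f :: "_ => real"
  by (rule mu.integrable_const_bound[of _ B]) (use that mmu[of f] in simp_all)
 \<comment> \<open>Real-valued, since the extraction of coefficients subtracts. Integrability over
   \<open>P\<close> is carried along because \<open>P\<close> may have infinite mass.\<close>
 define good where "good f \<longleftrightarrow> f : bm ?C & (EX B. ALL C. \<bar>f C\<bar> <= B) & integrable P (%r. \<integral>C. f C \<partial>K r)
  & (\<integral>C. f C \<partial>q) = (\<integral>r. \<integral>C. f C \<partial>K r \<partial>P)" for f :: "'a collection => real"
 define E where "E f C = enn2real (en (csum f C))" for f and C :: "'a collection"
 have E01: "0 <= E f C" "E f C <= 1" for f C
  unfolding E_def using en_le_1[of "csum f C"] enn2real_leI[of 1] by auto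
 have Em[measurable]: "E f : bm ?C" if "f : bm S" for f
  unfolding E_def[abs_def] using measurable_collection_sum[OF that] by measurable
 have ennE: "ennreal (E f C) = en (csum f C)" for f C
  by (simp add: E_def)
 have E_mult: "E f C * E g C = E (%x. f x + g x) C" for f g C
  by (simp add: E_def collection_sum_add en_add enn2real_mult)
 have goodE: "good (E f)" if f: "f : bm S" for f
 proof -
  have K1: "(NI C. en (csum f C);K r) = ennreal (\<integral>C. E f C \<partial>K r)" if "r : space P" for r
   unfolding ennE[symmetric] by (rule nn_integral_eq_integral[OF intK[OF that Em[OF f], of 1]]) (use E01 in auto)
  have m1: "(NI C. en (csum f C);q) = ennreal (\<integral>C. E f C \<partial>q)"
   unfolding ennE[symmetric] by (rule nn_integral_eq_integral[OF intmu[OF Em[OF f], of 1]]) (use E01 in auto)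
  have nn: "(NI r. ennreal (\<integral>C. E f C \<partial>K r);P) = ennreal (\<integral>C. E f C \<partial>q)"
   unfolding m1[symmetric] en_eq[OF f] by (intro nn_integral_cong) (simp add: K1)
  have "(%r. enn2real (NI C. en (csum f C);K r)) : bm P"
   using en_meas[OF f] by measurable
  then have mP: "(%r. \<integral>C. E f C \<partial>K r) : bm P"
   by (rule measurable_cong[THEN iffD1, rotated]) (simp add: K1 E01)
  have int: "integrable P (%r. \<integral>C. E f C \<partial>K r)"
   using mP nn by (intro integrableI_nonneg) (auto simp: E01)
  moreover have "(\<integral>r. \<integral>C. E f C \<partial>K r \<partial>P) = (\<integral>C. E f C \<partial>q)"
   using nn nn_integral_eq_integral[OF int] by (simp add: E01)
  ultimately show ?thesis
   unfolding good_def using Em[OF f] E01 by (auto intro!: exI[of _ 1] simp: abs_le_iff intro: order_trans[of _ 0])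
 qed
 have good_lin: "good (%C. a * f C + b * g C)" if f: "good f" and g: "good g" for f g a b
 proof -
  obtain A B where AB: "!!C. \<bar>f C\<bar> <= A" "!!C. \<bar>g C\<bar> <= B" using f g unfolding good_def by blast
  have fm: "f : bm ?C" and gm: "g : bm ?C" using f g unfolding good_def by blast+
  have K1: "(\<integral>C. a * f C + b * g C \<partial>K r) = a * (\<integral>C. f C \<partial>K r) + b * (\<integral>C. g C \<partial>K r)" if "r : space P" for r
   using intK[OF that fm AB(1)] intK[OF that gm AB(2)] by simp
  have m1: "(\<integral>C. a * f C + b * g C \<partial>q) = a * (\<integral>C. f C \<partial>q) + b * (\<integral>C. g C \<partial>q)"
   using intmu[OF fm AB(1)] intmu[OF gm AB(2)] by simp
  have int: "integrable P (%r. a * (\<integral>C. f C \<partial>K r) + b * (\<integral>C. g C \<partial>K r))" using f g by (auto simp: good_def)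
  have "\<bar>a * f C + b * g C\<bar> <= \<bar>a\<bar> * A + \<bar>b\<bar> * B" for C
   using AB[of C] by (intro order_trans[OF abs_triangle_ineq] add_mono) (auto simp: abs_mult intro!: mult_left_mono)
  moreover have "integrable P (%r. \<integral>C. a * f C + b * g C \<partial>K r)"
   using int by (rule Bochner_Integration.integrable_cong[THEN iffD1, OF refl, rotated]) (simp add: K1)
  moreover have "(\<integral>r. \<integral>C. a * f C + b * g C \<partial>K r \<partial>P) = (\<integral>r. a * (\<integral>C. f C \<partial>K r) + b * (\<integral>C. g C \<partial>K r) \<partial>P)"
   by (rule Bochner_Integration.integral_cong) (simp_all add: K1)
  moreover have "(%C. a * f C + b * g C) : bm ?C" using fm gm by measurable
  moreover have "a * (\<integral>C. f C \<partial>q) + b * (\<integral>C. g C \<partial>q) = (\<integral>r. a * (\<integral>C. f C \<partial>K r) + b * (\<integral>C. g C \<partial>K r) \<partial>P)"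
   using f g by (simp add: good_def)
  ultimately show ?thesis unfolding good_def m1 by auto
 qed
 have good_lim: "good f" if u: "!!i. good (u i)" and b: "!!i C. \<bar>u i C\<bar> <= B" and l: "!!C. (%i. u i C) \<longlonglongrightarrow> f C"
  for u :: "nat => 'a collection => real" and f B
 proof -
  have um[measurable]: "u i : bm ?C" for i using u by (auto simp: good_def)
  have fm[measurable]: "f : bm ?C"
   using borel_measurable_LIMSEQ_real[of ?C u f] l um by blast
  \<comment> \<open>The zero function makes constants good. The mass of \<open>K r\<close> is
    therefore integrable over \<open>P\<close> and provides a majorant for all bounded
    functionals.\<close>
  have "E (%_. 0) = (%_. 1)" by (simp add: E_def collection_sum_def fun_eq_iff)
  then have one: "good (%_. 1)" using goodE[of "%_. 0"] by simp
  have bf: "\<bar>f C\<bar> <= B" for C using b by (intro LIMSEQ_le_const2[OF tendsto_rabs[OF l]]) auto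
  have K1: "(%i. \<integral>C. u i C \<partial>K r) \<longlonglongrightarrow> (\<integral>C. f C \<partial>K r)" if "r : space P" for r
   by (rule integral_dominated_convergence[where w="%_. B"])
    (use b l finite_measure.integrable_const[OF K(1)[OF that]] mK[OF that, of f] mK[OF that, of "u _"] fm um in auto)
  have m1: "(%i. \<integral>C. u i C \<partial>q) \<longlonglongrightarrow> (\<integral>C. f C \<partial>q)"
   by (rule integral_dominated_convergence[where w="%_. B"]) (use b l mmu[of f] mmu[of "u _"] fm um in auto)
  have uP: "(%r. \<integral>C. u i C \<partial>K r) : bm P" for i
   using u[of i] borel_measurable_integrable unfolding good_def by blast
  have mP: "(%r. \<integral>C. f C \<partial>K r) : bm P"
   by (rule borel_measurable_LIMSEQ_real[where u="%i r. \<integral>C. u i C \<partial>K r", OF K1 uP])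
  have intB: "integrable P (%r. B * (\<integral>C. 1 \<partial>K r))" using one by (auto simp: good_def)
  have dom: "\<bar>\<integral>C. u i C \<partial>K r\<bar> <= B * (\<integral>C. 1 \<partial>K r)" if "r : space P" for r i
  proof -
   have "\<bar>\<integral>C. u i C \<partial>K r\<bar> <= (\<integral>C. \<bar>u i C\<bar> \<partial>K r)" by (rule integral_abs_bound)
   also have "... <= (\<integral>C. B * 1 \<partial>K r)"
    using intK[OF that um b] intK[OF that, of "%_. B" "\<bar>B\<bar>"] b by (intro integral_mono) auto
   finally show ?thesis by (simp add: mult.commute)
  qed
  have dom': "AE r in P. norm (\<integral>C. u i C \<partial>K r) <= B * (\<integral>C. 1 \<partial>K r)" for i
   using dom by (intro AE_I2) auto
  have K1': "AE r in P. (%i. \<integral>C. u i C \<partial>K r) \<longlonglongrightarrow> (\<integral>C. f C \<partial>K r)" using K1 by (intro AE_I2) auto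
  have P1: "(%i. \<integral>r. \<integral>C. u i C \<partial>K r \<partial>P) \<longlonglongrightarrow> (\<integral>r. \<integral>C. f C \<partial>K r \<partial>P)"
   by (rule integral_dominated_convergence[OF mP uP intB K1' dom'])
  have "integrable P (%r. \<integral>C. f C \<partial>K r)"
   by (rule integrable_dominated_convergence[OF mP uP intB K1' dom'])
  moreover have "(\<integral>C. f C \<partial>q) = (\<integral>r. \<integral>C. f C \<partial>K r \<partial>P)"
   using LIMSEQ_unique[OF m1] P1 u by (simp add: good_def)
  ultimately show ?thesis using fm bf unfolding good_def by blast
 qed
 have good_sum: "good (%C. \<Sum>j\<in>J. c j * g j C)" if "finite J" "!!j. j : J ==> good (g j)" for J :: "nat set" and c g
  using that
 proof (induction J rule: finite_induct)
  case empty then show ?case by (auto simp: good_def intro: exI[of _ 0])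
 next
  case (insert j J)
  then show ?case using good_lin[of "g j" "%C. \<Sum>j\<in>J. c j * g j C" "c j" 1] by simp
 qed
 define I where "I B k C = (if npoints C B = of_nat k then 1 else 0 :: real)" for B k and C :: "'a collection"
 define G where "G h \<longleftrightarrow> (ALL C. \<bar>h C\<bar> <= 1) & (\<forall>f\<in>bm S. good (%C. E f C * h C))" for h
 \<comment> \<open>Adding multiples of \<open>indicator B\<close> to \<open>f\<close> gives the
   generating function of the count at the points exp(-(i+1)); the terms for \<open>j < k\<close> to
   be subtracted are good by strong induction.\<close>
 have G_step: "G (%C. h C * I B k C)" if h: "G h" and B: "B : sets S" for h B k
 proof (induction k rule: less_induct)
  case (less k)
  have h1: "\<bar>h C\<bar> <= 1" for C using h by (simp add: G_def)
  show ?case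
   unfolding G_def
  proof (intro conjI allI ballI)
   show "\<bar>h C * I B k C\<bar> <= 1" for C using h1[of C] by (simp add: I_def)
   fix f :: "'a => ennreal" assume f[measurable]: "f : bm S"
   define u where "u i C = (enn2real (en (of_nat (Suc i) * npoints C B))
    - (\<Sum>j<k. exp (- (real (Suc i) * real j)) * I B j C)) * exp (real (Suc i) * real k)" for i :: nat and C
   note lim = coefficient_limit[OF npoints_nat, where k = k]
   have u1: "\<bar>u i C\<bar> <= 1" for i C unfolding u_def I_def by (rule lim(2))
   show "good (%C. E f C * (h C * I B k C))"
   proof (rule good_lim[of "%i C. E f C * (h C * u i C)" 1])
    fix C i
    show "\<bar>E f C * (h C * u i C)\<bar> <= 1"
     using E01[of f C] h1[of C] u1[of i C] by (simp add: abs_mult mult_le_one)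
    have "(%i. u i C) \<longlonglongrightarrow> I B k C" unfolding u_def I_def by (rule lim(1))
    then show "(%i. E f C * (h C * u i C)) \<longlonglongrightarrow> E f C * (h C * I B k C)" by (intro tendsto_intros)
   next
    fix i
    let ?f = "%x. f x + of_nat (Suc i) * indicator B x"
    have fm: "?f : bm S" using B by measurable
    have eq: "E ?f C = E f C * enn2real (en (of_nat (Suc i) * npoints C B))" for C
     unfolding E_mult[symmetric] by (simp add: E_def collection_sum_cmult npoints_def)
    have "good (%C. exp (real (Suc i) * real k) * (E ?f C * h C)
      + (- exp (real (Suc i) * real k)) * (\<Sum>j<k. exp (- (real (Suc i) * real j)) * (E f C * (h C * I B j C))))"
    proof (rule good_lin)
     show "good (%C. E ?f C * h C)" using h fm by (simp add: G_def)
     show "good (%C. \<Sum>j<k. exp (- (real (Suc i) * real j)) * (E f C * (h C * I B j C)))"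
     proof (rule good_sum)
      fix j assume "j : {..<k}"
      then have "G (%C. h C * I B j C)" by (intro less.IH) simp
      then show "good (%C. E f C * (h C * I B j C))" using f unfolding G_def by blast
     qed simp
    qed
    also have "(%C. exp (real (Suc i) * real k) * (E ?f C * h C)
      + (- exp (real (Suc i) * real k)) * (\<Sum>j<k. exp (- (real (Suc i) * real j)) * (E f C * (h C * I B j C))))
      = (%C. E f C * (h C * u i C))"
     unfolding eq u_def by (simp add: algebra_simps sum_distrib_left sum_negf)
    finally show "good (%C. E f C * (h C * u i C))" .
   qed
  qed
 qed
 \<comment> \<open>A pi-system of events that prescribe finite counts; infinite counts are recovered
   through complements.\<close>
 define PP :: "'a collection set set" where "PP = {{C\<in>collections S. \<forall>i<n. npoints C (B i) = of_nat (k i)} | (n::nat) B k. \<forall>i<n. B i : sets S}"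
 have G_prod: "G (%C. \<Prod>i<n. I (B i) (k i) C)" if "\<forall>i<n. B i : sets S" for n :: nat and B k
  using that
 proof (induction n)
  case 0
  then show ?case using goodE by (simp add: G_def)
 next
  case (Suc n)
  then show ?case using G_step[of "%C. \<Prod>i<n. I (B i) (k i) C" "B n" "k n"] by simp
 qed
 have good_cong: "good g" if "good f" "!!C. C : collections S ==> f C = g C" "!!C. \<bar>g C\<bar> <= 1" for f g
 proof -
  have K1: "(\<integral>C. f C \<partial>K r) = (\<integral>C. g C \<partial>K r)" if "r : space P" for r
   using that \<open>!!C. C : collections S ==> f C = g C\<close> by (intro Bochner_Integration.integral_cong) (auto simp: sp)
  have 1: "integrable P (%r. \<integral>C. f C \<partial>K r) \<longleftrightarrow> integrable P (%r. \<integral>C. g C \<partial>K r)"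
   "(\<integral>r. \<integral>C. f C \<partial>K r \<partial>P) = (\<integral>r. \<integral>C. g C \<partial>K r \<partial>P)"
   by (rule Bochner_Integration.integrable_cong[OF refl K1], assumption)
    (rule Bochner_Integration.integral_cong[OF refl K1])
  have 2: "(\<integral>C. f C \<partial>q) = (\<integral>C. g C \<partial>q)"
   using that(2) by (intro Bochner_Integration.integral_cong) (auto simp: sp)
  have 3: "g : bm ?C"
   using that(1,2) measurable_cong[of ?C f g borel] by (simp add: good_def)
  show ?thesis using that(1,3) 1 2 3 unfolding good_def by auto
 qed
 have good_Pi: "good (indicator A)" if APP: "A : PP" for A
 proof -
  obtain n :: nat and B k where A: "A = {C\<in>collections S. \<forall>i<n. npoints C (B i) = of_nat (k i)}" and B: "\<forall>i<n. B i : sets S"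
   using APP unfolding PP_def by blast
  have "good (%C. E (%_. 0) C * (\<Prod>i<n. I (B i) (k i) C))" using G_prod[OF B] unfolding G_def by auto
  then show ?thesis
  proof (rule good_cong)
   fix C assume "C : collections S"
   have "(\<Prod>i<n. I (B i) (k i) C) = (if \<forall>i<n. npoints C (B i) = of_nat (k i) then 1 else 0)"
    by (auto simp: I_def intro!: prod.neutral prod_zero)
   then show "E (%_. 0) C * (\<Prod>i<n. I (B i) (k i) C) = indicator A C"
    using \<open>C : collections S\<close> by (simp add: A E_def collection_sum_def indicator_def)
  qed (simp add: indicator_def)
 qed
 have PP_sub: "PP \<subseteq> Pow (collections S)" by (auto simp: PP_def)
 have sPi: "sets ?C = sigma_sets (collections S) PP"
 proof
  have npt: "{C\<in>collections S. npoints C B = of_nat k} : PP" if "B : sets S" for B k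
   unfolding PP_def using that
   by (intro CollectI exI[of _ "1::nat"] exI[of _ "%_. B"] exI[of _ "%_. k"]) auto
  interpret sig: sigma_algebra "collections S" "sigma_sets (collections S) PP"
   by (rule sigma_algebra_sigma_sets[OF PP_sub])
  show "sets ?C \<subseteq> sigma_sets (collections S) PP"
   unfolding sets_collection_space
  proof (rule sig.sigma_sets_subset, rule subsetI)
   fix A assume "A : {(%C. npoints C B) -` U \<inter> collections S | B U. B : sets S & U : sets borel}"
   then obtain B U where A: "A = (%C. npoints C B) -` U \<inter> collections S" and B: "B : sets S" by blast
   let ?n = "%k. {C\<in>collections S. npoints C B = of_nat k}"
   have "A = (\<Union>k\<in>{k. of_nat k : U}. ?n k) \<union> (if \<infinity> : U then collections S - (\<Union>k. ?n k) else {})"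
    using npoints_nat[of _ B] unfolding A by (auto split: if_splits) metis+
   also have "... : sigma_sets (collections S) PP"
   proof -
    have nk: "?n k : sigma_sets (collections S) PP" for k
     by (rule sigma_sets.Basic[OF npt[OF B]])
    have "(\<Union>k\<in>X. ?n k) : sigma_sets (collections S) PP" for X :: "nat set"
     by (rule sig.countable_UN'') (use nk in auto)
    then show ?thesis by (auto intro!: sig.Un sig.compl_sets)
   qed
   finally show "A : sigma_sets (collections S) PP" .
  qed
  have "PP \<subseteq> sets ?C"
  proof
   fix A assume "A : PP"
   then obtain n :: nat and B k where A: "A = {C\<in>collections S. \<forall>i<n. npoints C (B i) = of_nat (k i)}" and B: "\<forall>i<n. B i : sets S"
    unfolding PP_def mem_Collect_eq by (elim exE conjE)
   have "{C : space ?C. \<forall>i\<in>{..<n}. npoints C (B i) = of_nat (k i)} : sets ?C"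
   proof (rule sets.sets_Collect_finite_All)
    fix i assume "i : {..<n}"
    then have [measurable]: "(%C. npoints C (B i)) : bm ?C" using B by (intro measurable_npoints) auto
    show "{C : space ?C. npoints C (B i) = of_nat (k i)} : sets ?C" by measurable
   qed simp
   then show "A : sets ?C" unfolding A Ball_def lessThan_iff space_collection_space .
  qed
  then show "sigma_sets (collections S) PP \<subseteq> sets ?C"
   using sets.sigma_sets_subset[of PP ?C] by simp
 qed
 have int: "Int_stable PP"
 proof (rule Int_stableI)
  fix A A' assume "A : PP" "A' : PP"
  then obtain n n' :: nat and B k B' k' where A: "A = {C\<in>collections S. \<forall>i<n. npoints C (B i) = of_nat (k i)}" "\<forall>i<n. B i : sets S"
   and A': "A' = {C\<in>collections S. \<forall>i<n'. npoints C (B' i) = of_nat (k' i)}" "\<forall>i<n'. B' i : sets S"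
   unfolding PP_def mem_Collect_eq by (elim exE conjE)
  let ?B = "%i. if i < n then B i else B' (i - n)" and ?k = "%i. if i < n then k i else k' (i - n)"
  have "(\<forall>i<n + n'. npoints C (?B i) = of_nat (?k i)) \<longleftrightarrow>
    (\<forall>i<n. npoints C (B i) = of_nat (k i)) & (\<forall>i<n'. npoints C (B' i) = of_nat (k' i))" for C
  proof safe
   fix i assume *: "\<forall>i<n + n'. npoints C (?B i) = of_nat (?k i)"
   show "i < n ==> npoints C (B i) = of_nat (k i)" using *[rule_format, of i] by simp
   show "i < n' ==> npoints C (B' i) = of_nat (k' i)" using *[rule_format, of "n + i"] by simp
  qed auto
  then have "A \<inter> A' = {C\<in>collections S. \<forall>i<n + n'. npoints C (?B i) = of_nat (?k i)}"
   unfolding A A' by blast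
  moreover have "\<forall>i<n + n'. ?B i : sets S" using A A' by auto
  ultimately show "A \<inter> A' : PP"
   unfolding PP_def by (intro CollectI exI[of _ "n + n'"] exI[of _ ?B] exI[of _ ?k] conjI)
 qed
 have one: "good (indicator (collections S))"
 proof -
  have "collections S : PP" unfolding PP_def by (intro CollectI exI[of _ "0::nat"]) auto
  then show ?thesis by (rule good_Pi)
 qed
 have good_ind: "good (indicator A)" if "A : sets ?C" for A
  using int PP_sub that[unfolded sPi]
 proof (induction rule: sigma_sets_induct_disjoint)
  case (basic A) then show ?case by (rule good_Pi)
 next
  case empty then show ?case by (auto simp: good_def intro: exI[of _ 0])
 next
  case (compl A)
  have "(indicator (collections S - A) :: _ => real) = (%C. 1 * indicator (collections S) C + (- 1) * indicator A C)"
   using sigma_sets_into_sp[OF PP_sub compl(1)] by (auto simp: indicator_def fun_eq_iff)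
  then show ?case using good_lin[OF one compl(2), of 1 "-1"] by simp
 next
  case (union A)
  define v :: "nat => 'a collection => real" where "v n C = (\<Sum>i<n. indicator (A i) C)" for n C
  have eq: "v n C = indicator (\<Union>i<n. A i) C" for n C
   unfolding v_def
   by (rule indicator_UN_disjoint[symmetric, OF _ disjoint_family_on_mono[OF subset_UNIV union(1)]]) simp
  show ?case
  proof (rule good_lim[of v 1])
   show "good (v n)" for n
    using good_sum[of "{..<n}" "%i. indicator (A i)" "%_. 1"] union by (simp add: v_def[abs_def])
   show "\<bar>v n C\<bar> <= 1" for n C unfolding eq by (simp add: indicator_def)
   show "(%n. v n C) \<longlonglongrightarrow> indicator (\<Union>i. A i) C" for C
    unfolding eq by (rule LIMSEQ_indicator_UN)
  qed
 qed
 have "(%r. NI C. H C;K r) : bm P & (NI C. H C;q) = (NI r. NI C. H C;K r;P)"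
  using H
 proof (induction rule: borel_measurable_induct)
  case (cong f g)
  have "(NI C. f C;K r) = (NI C. g C;K r)" if "r : space P" for r
   using cong that by (intro nn_integral_cong) (auto simp: sp)
  moreover have "(NI C. f C;q) = (NI C. g C;q)"
   using cong by (intro nn_integral_cong) (auto simp: sp)
  ultimately show ?case using cong(4)
   by (simp cong: measurable_cong nn_integral_cong_simp)
 next
  case (set A)
  define v :: "'a collection => real" where "v = indicator A"
  have g: "good v" unfolding v_def by (rule good_ind[OF set])
  have v: "indicator A C = ennreal (v C)" for C by (simp add: v_def indicator_def)
  have vm: "v : bm ?C" "!!C. \<bar>v C\<bar> <= 1" using set by (auto simp: v_def indicator_def)
  have vm0: "0 <= v C" for C by (simp add: v_def)
  have 1: "(NI C. indicator A C;K r) = ennreal (\<integral>C. v C \<partial>K r)" if "r : space P" for r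
   unfolding v by (rule nn_integral_eq_integral[OF intK[OF that vm]]) (simp add: vm0)
  have int: "integrable P (%r. \<integral>C. v C \<partial>K r)" using g unfolding good_def by blast
  have "(%r. NI C. indicator A C;K r) : bm P"
   using borel_measurable_integrable[OF int] by (subst measurable_cong[OF 1]) auto
  moreover have "(NI C. indicator A C;q) = ennreal (\<integral>C. v C \<partial>q)"
   unfolding v by (rule nn_integral_eq_integral[OF intmu[OF vm]]) (simp add: vm0)
  moreover have "(NI r. NI C. indicator A C;K r;P) = (NI r. ennreal (\<integral>C. v C \<partial>K r);P)"
   by (rule nn_integral_cong[OF 1])
  moreover have "... = ennreal (\<integral>r. \<integral>C. v C \<partial>K r \<partial>P)"
   by (rule nn_integral_eq_integral[OF int]) (simp add: vm0)
  moreover have "(\<integral>C. v C \<partial>q) = (\<integral>r. \<integral>C. v C \<partial>K r \<partial>P)" using g unfolding good_def by blast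
  ultimately show ?case by simp
 next
  case (mult u c)
  have "(NI C. c * u C;K r) = c * (NI C. u C;K r)" if "r : space P" for r
   using mult(2) that by (simp add: nn_integral_cmult mK)
  moreover have "(NI C. c * u C;q) = c * (NI C. u C;q)"
   using mult(2) by (simp add: nn_integral_cmult mmu)
  moreover from mult.IH have [measurable]: "(%r. NI C. u C;K r) : bm P" by blast
  have "(%r. c * (NI C. u C;K r)) : bm P" by measurable
  ultimately show ?case using mult.IH by (simp add: nn_integral_cmult cong: measurable_cong nn_integral_cong_simp)
 next
  case (add u v)
  have "(NI C. v C + u C;K r) = (NI C. v C;K r) + (NI C. u C;K r)" if "r : space P" for r
   using add.hyps that by (intro nn_integral_add) (auto simp: mK)
  moreover have "(NI C. v C + u C;q) = (NI C. v C;q) + (NI C. u C;q)"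
   using add.hyps by (intro nn_integral_add) (auto simp: mmu)
  moreover from add.IH have [measurable]: "(%r. NI C. u C;K r) : bm P"
   "(%r. NI C. v C;K r) : bm P" by blast+
  have "(%r. (NI C. v C;K r) + (NI C. u C;K r)) : bm P" by measurable
  ultimately show ?case using add.IH by (simp add: nn_integral_add cong: measurable_cong nn_integral_cong_simp)
 next
  case (seq U)
  have K1: "(NI C. (SUP i. U i) C;K r) = (SUP i. NI C. U i C;K r)" if "r : space P" for r
   unfolding SUP_apply using seq.hyps that by (intro nn_integral_monotone_convergence_SUP) (auto simp: mK)
  have m1: "(NI C. (SUP i. U i) C;q) = (SUP i. NI C. U i C;q)"
   unfolding SUP_apply using seq.hyps by (intro nn_integral_monotone_convergence_SUP) (auto simp: mmu)
  have "(NI r. NI C. (SUP i. U i) C;K r;P) = (NI r. (SUP i. NI C. U i C;K r);P)"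
   by (intro nn_integral_cong K1)
  also have "... = (SUP i. NI r. NI C. U i C;K r;P)"
   using seq.IH \<open>incseq U\<close>
   by (intro nn_integral_monotone_convergence_SUP) (auto simp: incseq_def le_fun_def intro!: nn_integral_mono)
  also have "... = (SUP i. NI C. U i C;q)" using seq.IH by simp
  finally have 1: "(NI C. (SUP i. U i) C;q) = (NI r. NI C. (SUP i. U i) C;K r;P)" unfolding m1 by simp
  have [measurable]: "(%r. NI C. U i C;K r) : bm P" for i using seq.IH by blast
  have "(%r. SUP i. NI C. U i C;K r) : bm P" by measurable
  then have "(%r. NI C. (SUP i. U i) C;K r) : bm P"
   by (rule measurable_cong[THEN iffD1, rotated]) (rule K1[symmetric])
  with 1 show ?case by blast
 qed
 then show "(%r. NI C. H C;K r) : bm P" "(NI C. H C;q) = (NI r. NI C. H C;K r;P)"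
  by auto
qed

text \<open>The generating function of the Poisson law. For \<open>c ~= 0\<close> an infinite value
  of \<open>X\<close> contributes 0, in accordance with its absence from the series;
  \<open>c = 0\<close> is separate because its product with infinity is 0, where \<open>en\<close>
  is 1.\<close>

lemma nn_integral_en_poisson:
 assumes "prob_space M" and X[measurable]: "X : bm M"
  and vals: "!!w. X w = \<infinity> | (EX k. X w = of_nat k)"
  and pois: "!!k. measure M {w\<in>space M. X w = of_nat k} = exp (- m) * m ^ k / fact k"
 shows "(NI w. en (c * X w);M) = en (ennreal m * (1 - en c))"
proof (cases "c = 0")
 case True
 then show ?thesis using prob_space.emeasure_space_1[OF assms(1)] by simp
next
 case False
 interpret prob_space M by fact
 have m: "0 <= m"
  using pois[of 1] measure_nonneg[of M "{w\<in>space M. X w = of_nat 1}"] by (simp add: zero_le_mult_iff)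
 obtain q where q: "en c = ennreal q" "0 <= q" "q <= 1"
  using en_le_1[of c] by (cases "en c") (auto simp: ennreal_le_1)
 have pt: "en (c * X w) = (\<Sum>k. indicator {w\<in>space M. X w = of_nat k} w * en c ^ k)" if "w : space M" for w
 proof (cases "X w = \<infinity>")
  case True
  then show ?thesis using False by (simp add: ennreal_mult_top)
 next
  case False
  then obtain j where j: "X w = of_nat j" using vals by blast
  have "(\<Sum>k. indicator {w\<in>space M. X w = of_nat k} w * en c ^ k) = (\<Sum>k\<in>{j}. indicator {w\<in>space M. X w = of_nat k} w * en c ^ k)"
   by (rule suminf_finite) (auto simp: j indicator_def)
  then show ?thesis using that by (simp add: j en_of_nat_mult mult.commute[of c])
 qed
 have "(NI w. en (c * X w);M) = (NI w. (\<Sum>k. indicator {w\<in>space M. X w = of_nat k} w * en c ^ k);M)"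
  by (intro nn_integral_cong pt)
 also have "... = (\<Sum>k. NI w. indicator {w\<in>space M. X w = of_nat k} w * en c ^ k;M)"
  by (rule nn_integral_suminf) measurable
 also have "... = (\<Sum>k. ennreal (exp (- m) * ((m * q) ^ k /\<^sub>R fact k)))"
 proof (rule suminf_cong)
  fix k
  have "(NI w. indicator {w\<in>space M. X w = of_nat k} w * en c ^ k;M) = emeasure M {w\<in>space M. X w = of_nat k} * en c ^ k"
  proof -
   have "{w\<in>space M. X w = of_nat k} : sets M" by measurable
   then show ?thesis by (simp add: nn_integral_multc)
  qed
  also have "... = ennreal (exp (- m) * ((m * q) ^ k /\<^sub>R fact k))"
   using m q by (simp add: emeasure_eq_measure pois ennreal_power ennreal_mult[symmetric] power_mult_distrib divide_inverse mult_ac)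
  finally show "(NI w. indicator {w\<in>space M. X w = of_nat k} w * en c ^ k;M) = ..." .
 qed
 also have "... = ennreal (exp (- m) * exp (m * q))"
  using m q by (intro suminf_ennreal_eq sums_mult exp_converges) auto
 also have "... = en (ennreal m * (1 - en c))"
 proof -
  have *: "ennreal m * (1 - en c) = ennreal (m * (1 - q))"
   unfolding q(1) using m q by (simp add: ennreal_mult ennreal_minus[symmetric])
  have "0 <= m * (1 - q)" using m q by simp
  then show ?thesis unfolding * by (subst en_simps(3)) (auto simp: exp_add[symmetric] algebra_simps)
 qed
 finally show ?thesis .
qed

text \<open>Independence of the counts on level sets settles simple functions; the general case is a
  monotone limit. As \<open>en\<close> reverses the order, the limit of the expectations is a
  decreasing one, which requires a finite first integral.\<close>

theorem ppp_laplace: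
 assumes ppp: "poisson_point_process M b m" and f: "f : bm m"
 shows "(NI w. en (csum f (b w));M) = en (NI x. 1 - en (f x);m)"
proof -
 interpret prob_space M using ppp by (simp add: poisson_point_process_def)
 have b[measurable]: "b : M ->M collection_space m" using ppp by (simp add: poisson_point_process_def)
 have pm: "(%w. npoints (b w) B) : bm M" if "B : sets m" for B
  by (rule measurable_compose[OF b measurable_npoints[OF that]])
 have cm: "(%w. csum g (b w)) : bm M" if "g : bm m" for g
  by (rule measurable_compose[OF b measurable_collection_sum[OF that]])
 have one: "(NI w. en (c * npoints (b w) B);M) = en (emeasure m B * (1 - en c))" if B: "B : sets m" for B c
 proof (cases "emeasure m B < \<infinity>")
  case True
  then have "measure M {w\<in>space M. npoints (b w) B = of_nat k} = exp (- measure m B) * measure m B ^ k / fact k" for k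
   using ppp B by (simp add: poisson_point_process_def)
  then have "(NI w. en (c * npoints (b w) B);M) = en (ennreal (measure m B) * (1 - en c))"
   by (intro nn_integral_en_poisson prob_space_axioms pm B npoints_nat)
  then show ?thesis using True by (simp add: emeasure_eq_ennreal_measure)
 next
  case False
  then have inf: "emeasure m B = \<infinity>" by (simp add: less_top[symmetric])
  then have "AE w in M. npoints (b w) B = \<infinity>" using ppp B by (simp add: poisson_point_process_def)
  then have "(NI w. en (c * npoints (b w) B);M) = (NI w. en (c * \<infinity>);M)"
   by (intro nn_integral_cong_AE) (auto elim: eventually_mono)
  also have "... = en (\<infinity> * (1 - en c))"
  proof (cases "c = 0")
   case False
   have "1 - en c ~= 0"
   proof (cases c)
    case (real r)
    then have "0 < r" using False by (cases "r = 0") auto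
    then have "en c < 1" using real by (simp add: ennreal_less_one_iff)
    then show ?thesis by (simp add: diff_eq_0_iff_ennreal)
   qed simp
   then show ?thesis using False by (simp add: ennreal_mult_top ennreal_top_mult emeasure_space_1)
  qed (simp add: emeasure_space_1)
  finally show ?thesis unfolding inf .
 qed
 have simple: "(NI w. en (csum g (b w));M) = en (NI x. 1 - en (g x);m)" if g: "simple_function m g" for g
 proof -
  let ?Y = "g ` space m" and ?B = "%y. g -` {y} \<inter> space m"
  have Y: "finite ?Y" using g by (rule simple_functionD(1))
  have B: "?B y : sets m" for y using g by (rule simple_functionD(2))
  \<comment> \<open>Independence is available for families indexed by an initial segment of the
    naturals, hence the enumeration of the finitely many values.\<close>
  obtain h where h: "bij_betw h {0..<card ?Y} ?Y" using ex_bij_betw_nat_finite[OF Y] by blast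
  then have hb: "bij_betw h {..<card ?Y} ?Y" by (simp add: atLeast0LessThan)
  have gx: "k (g x) = (\<Sum>y\<in>?Y. k y * indicator (?B y) x)" if "x : space m" for x and k :: "ennreal => ennreal"
  proof -
   have "(\<Sum>y\<in>?Y. k y * indicator (?B y) x) = (\<Sum>y\<in>?Y. if y = g x then k (g x) else 0)"
    using that by (intro sum.cong refl) (auto simp: indicator_def)
   then show ?thesis using Y that by simp
  qed
  have cs: "csum g (b w) = (\<Sum>i<card ?Y. h i * npoints (b w) (?B (h i)))" if "w : space M" for w
  proof -
   have "b w : collections m" using measurable_space[OF b that] by simp
   then have "csum g (b w) = csum (%x. \<Sum>y\<in>?Y. y * indicator (?B y) x) (b w)"
    by (rule collection_sum_cong) (rule gx[of _ "%y. y"])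
   also have "... = (\<Sum>y\<in>?Y. y * npoints (b w) (?B y))"
    by (simp only: collection_sum_sum[OF Y] collection_sum_cmult npoints_def)
   also have "... = (\<Sum>i<card ?Y. h i * npoints (b w) (?B (h i)))"
    by (rule sum.reindex_bij_betw[OF hb, symmetric])
   finally show ?thesis .
  qed
  have "indep_vars (%_. borel) (%i w. npoints (b w) (?B (h i))) {..<card ?Y}"
  proof -
   have "disjoint_family_on (%i. ?B (h i)) {..<card ?Y}"
    using bij_betw_imp_inj_on[OF hb] by (auto simp: disjoint_family_on_def inj_on_def)
   moreover have "\<forall>(n::nat) B. (\<forall>i<n. B i : sets m) & disjoint_family_on B {..<n} -->
     indep_vars (%_. borel) (%i w. npoints (b w) (B i)) {..<n}"
    using ppp unfolding poisson_point_process_def by (elim conjE)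
   ultimately show ?thesis using B by simp
  qed
  then have ind: "indep_vars (%_. borel) (%i w. en (h i * npoints (b w) (?B (h i)))) {..<card ?Y}"
   by (rule indep_vars_compose2) measurable
  have "(NI w. en (csum g (b w));M) = (NI w. (\<Prod>i<card ?Y. en (h i * npoints (b w) (?B (h i))));M)"
   by (intro nn_integral_cong) (simp add: cs en_sum)
  also have "... = (\<Prod>i<card ?Y. NI w. en (h i * npoints (b w) (?B (h i)));M)"
   by (rule indep_vars_nn_integral[OF _ ind]) auto
  also have "... = en (\<Sum>i<card ?Y. emeasure m (?B (h i)) * (1 - en (h i)))"
   by (simp only: one[OF B] en_sum finite_lessThan)
  also have "(\<Sum>i<card ?Y. emeasure m (?B (h i)) * (1 - en (h i))) = (\<Sum>y\<in>?Y. emeasure m (?B y) * (1 - en y))"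
   by (rule sum.reindex_bij_betw[OF hb])
  also have "... = (NI x. (\<Sum>y\<in>?Y. (1 - en y) * indicator (?B y) x);m)"
   using B by (subst nn_integral_sum) (auto simp: nn_integral_cmult_indicator mult.commute)
  also have "... = (NI x. 1 - en (g x);m)"
   by (intro nn_integral_cong gx[symmetric, of _ "%y. 1 - en y"])
  finally show ?thesis .
 qed
 obtain U where U: "!!i. simple_function m (U i)" "incseq U" "!!x. (SUP i. U i x) = f x"
  using borel_measurable_implies_simple_function_sequence'[OF f] by metis
 have Um: "U i : bm m" for i using U(1) by (rule borel_measurable_simple_function)
 have Uinc: "incseq (%i. U i x)" for x using U(2) by (auto simp: incseq_def le_fun_def)
 have cinc: "incseq (%i. csum (U i) C)" for C
  using U(2) unfolding collection_sum_def by (auto simp: incseq_def le_fun_def intro!: nn_integral_mono mult_left_mono)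
 have "csum f = csum (%x. SUP i. U i x)" by (simp add: U(3))
 then have "(NI w. en (csum f (b w));M) = (NI w. (INF i. en (csum (U i) (b w)));M)"
  by (simp add: collection_sum_SUP[OF U(2)] en_SUP[OF cinc])
 also have "... = (INF i. NI w. en (csum (U i) (b w));M)"
 proof (rule nn_integral_monotone_convergence_INF_decseq)
  show "decseq (%i w. en (csum (U i) (b w)))"
   by (intro antimonoI le_funI en_mono incseqD[OF cinc])
  show "(%w. en (csum (U i) (b w))) : bm M" for i
   using cm[OF Um] by measurable
  have "(NI w. en (csum (U 0) (b w));M) <= (NI w. 1;M)"
   by (intro nn_integral_mono en_le_1)
  then show "(NI w. en (csum (U 0) (b w));M) < \<infinity>"
   by (simp add: emeasure_space_1 le_less_trans)
 qed
 also have "... = (INF i. en (NI x. 1 - en (U i x);m))" by (simp only: simple[OF U(1)])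
 also have "... = en (SUP i. NI x. 1 - en (U i x);m)"
  using Uinc by (intro en_SUP[symmetric]) (auto simp: incseq_def intro!: nn_integral_mono ennreal_minus_mono en_mono)
 also have "(SUP i. NI x. 1 - en (U i x);m) = (NI x. (SUP i. 1 - en (U i x));m)"
  using Uinc Um by (intro nn_integral_monotone_convergence_SUP[symmetric])
   (auto simp: incseq_def le_fun_def intro!: ennreal_minus_mono en_mono)
 also have "... = (NI x. 1 - en (f x);m)"
  by (simp add: ennreal_INF_const_minus en_SUP[OF Uinc, symmetric] U(3))
 finally show ?thesis .
qed

section \<open>Paths from \<open>z\<close> to \<open>z\<close> as ordered sequences of
  excursions\<close>

primrec chain :: "nat => real => real => (nat => real \<times> path) => bool" where
 "chain 0 s a w \<longleftrightarrow> s < a"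
| "chain (Suc k) s a w \<longleftrightarrow> s < fst (w k) & chain k (fst (w k)) a w"

text \<open>Like \<open>chain\<close>, this reads the tuple from its last entry: the clock shows
  \<open>fst (w (k - 1))\<close>, ..., \<open>fst (w 0)\<close> in increasing order. A new first
  excursion is thus appended at index \<open>k\<close>, which suits the product spaces over
  \<open>{..<k}\<close>. The factor \<open>b\<close> converts clock readings into time spent at
  \<open>z\<close>.\<close>

primrec ipath :: "point => real => nat => real => real => (nat => real \<times> path) => path" where
 "ipath z b 0 s a w = hold z (b * (a - s))"
| "ipath z b (Suc k) s a w = papp (hold z (b * (fst (w k) - s)))
   (papp (snd (w k)) (ipath z b k (fst (w k)) a w))"

lemma chain_cong: "(!!i. i < k ==> w i = w' i) ==> chain k s a w = chain k s a w'"
 by (induction k arbitrary: s) auto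

lemma ipath_cong: "(!!i. i < k ==> w i = w' i) ==> ipath z b k s a w = ipath z b k s a w'"
 by (induction k arbitrary: s) auto

lemma chain_upd [simp]: "chain k s a (fun_upd w k y) = chain k s a w"
 by (rule chain_cong) simp

lemma ipath_upd [simp]: "ipath z b k s a (fun_upd w k y) = ipath z b k s a w"
 by (rule ipath_cong) simp

lemma chain_less: "chain k s a w ==> s < a"
 by (induction k arbitrary: s) (auto intro: less_trans)

lemma chain_less_fst: "chain k s a w ==> i < k ==> s < fst (w i) & fst (w i) < a"
 by (induction k arbitrary: s) (auto simp: less_Suc_eq dest: chain_less intro: less_trans)

lemma chain_strict: "chain k s a w ==> i < j ==> j < k ==> fst (w j) < fst (w i)"
 by (induction k arbitrary: s) (auto simp: less_Suc_eq dest: chain_less_fst)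

lemma measurable_chain:
 assumes "!!i. i < k ==> (%x. w x i) : X ->M borel ** PS N"
  and [measurable]: "s : bm X" "a : bm X"
 shows "Measurable.pred X (%x. chain k (s x) (a x) (w x))"
 using assms(1,2)
proof (induction k arbitrary: s)
 case (Suc k)
 have [measurable]: "s : bm X" "(%x. w x k) : X ->M borel ** PS N" using Suc.prems by auto
 have [measurable]: "Measurable.pred X (%x. chain k (fst (w x k)) (a x) (w x))"
  by (rule Suc.IH) (use Suc.prems in simp, measurable)
 show ?case unfolding chain.simps by measurable
qed simp

lemma measurable_ipath:
 assumes "!!i. i < k ==> (%x. w x i) : X ->M borel ** PS N"
  and [measurable]: "s : bm X" "a : bm X" and z[measurable]: "z : grid N"
 shows "(%x. ipath z b k (s x) (a x) (w x)) : X ->M PS N"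
 using assms(1,2)
proof (induction k arbitrary: s)
 case 0
 then have [measurable]: "s : bm X" by simp
 show ?case unfolding ipath.simps by measurable
next
 case (Suc k)
 have [measurable]: "s : bm X" "(%x. w x k) : X ->M borel ** PS N" using Suc.prems by auto
 have [measurable]: "(%x. ipath z b k (fst (w x k)) (a x) (w x)) : X ->M PS N"
  by (rule Suc.IH) (use Suc.prems in simp, measurable)
 show ?case unfolding ipath.simps by measurable
qed


definition coll :: "nat => (nat => 'a) => 'a collection" where
 "coll k w = (%p. if p : w ` {..<k} then 1 else 0)"

lemma chain_inj: "chain k s a w ==> inj_on w {..<k}"
 using chain_strict[of k s a w] by (intro linorder_inj_onI) fastforce+

lemma collection_sum_coll:
 assumes "chain k s a w"
 shows "csum f (coll k w) = (\<Sum>i<k. f (w i))"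
proof -
 have "csum f (coll k w) = (NI p. f p * indicator (w ` {..<k}) p;count_space UNIV)"
  unfolding collection_sum_def coll_def by (intro nn_integral_cong) (simp add: indicator_def)
 also have "... = (NI p. f p;count_space (w ` {..<k}))"
  by (subst nn_integral_count_space_indicator[symmetric]) auto
 also have "... = (\<Sum>p\<in>w ` {..<k}. f p)" by (rule nn_integral_count_space_finite) simp
 also have "... = (\<Sum>i<k. f (w i))" by (rule sum.reindex[OF chain_inj[OF assms], unfolded comp_def])
 finally show ?thesis .
qed

text \<open>Formally the tail integral \<open>F\<close> of \<open>B\<close> has derivative
  \<open>- B\<close>, and the integrand is a derivative of a power of \<open>F\<close>. But
  \<open>B\<close> is only measurable and its integrals may be infinite, hence an induction with
  Fubini.\<close>

lemma nn_integral_power_tail: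
 fixes B :: "real => ennreal"
 assumes B[measurable]: "B : bm borel"
 shows "of_nat (Suc k) * (NI u. (if s < u then B u * (NI v. (if u < v then B v else 0);lborel) ^ k else 0);lborel)
  = (NI v. (if s < v then B v else 0);lborel) ^ Suc k"
proof -
 define F where "F u = (NI v. (if u < v then B v else 0);lborel)" for u
 have [measurable]: "F : bm borel"
 proof -
  have "(%(u, v). if u < v then B v else 0) : bm (borel ** lborel)" unfolding case_prod_unfold by measurable
  from lborel.borel_measurable_nn_integral[OF this] show ?thesis by (simp add: F_def[abs_def])
 qed
 define J where "J k s = (NI u. (if s < u then B u * F u ^ k else 0);lborel)" for k s
 have split: "F s * X = X * (NI u. (if s < u & u < v then B u else 0);lborel) + X * F v" if "s < v" for s v X
 proof -
  have "F s = (NI u. (if s < u & u < v then B u else 0) + (if v < u then B u else 0);lborel)"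
   unfolding F_def
  proof (rule nn_integral_cong_AE)
   show "AE u in lborel. (if s < u then B u else 0) = (if s < u & u < v then B u else 0) + (if v < u then B u else 0)"
    using AE_lborel_singleton[of v] by eventually_elim (use that in auto)
  qed
  also have "... = (NI u. (if s < u & u < v then B u else 0);lborel) + F v"
   unfolding F_def by (rule nn_integral_add) measurable
  finally show ?thesis by (simp add: algebra_simps)
 qed
 have "of_nat (Suc k) * J k s = F s ^ Suc k" for s
 proof (induction k arbitrary: s)
  case 0
  show ?case by (simp add: J_def F_def cong: if_cong)
 next
  case (Suc k)
  let ?A = "NI v. (if s < v then B v * F v ^ k * (NI u. (if s < u & u < v then B u else 0);lborel) else 0);lborel"
  have "J (Suc k) s = (NI u. (if s < u then B u * (of_nat (Suc k) * J k u) else 0);lborel)"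
   unfolding Suc.IH by (simp add: J_def)
  also have "... = (NI u. NI v. of_nat (Suc k) * (if s < u & u < v then B u * (B v * F v ^ k) else 0);lborel;lborel)"
  proof (rule nn_integral_cong)
   fix u
   show "(if s < u then B u * (of_nat (Suc k) * J k u) else 0) = (NI v. of_nat (Suc k) * (if s < u & u < v then B u * (B v * F v ^ k) else 0);lborel)"
   proof (cases "s < u")
    case True
    have "B u * (of_nat (Suc k) * J k u) = (NI v. (B u * of_nat (Suc k)) * (if u < v then B v * F v ^ k else 0);lborel)"
     unfolding J_def mult.assoc[symmetric] by (rule nn_integral_cmult[symmetric]) measurable
    then show ?thesis using True by (simp add: mult_ac if_distrib cong: if_cong)
   qed simp
  qed
  also have "... = (NI v. NI u. of_nat (Suc k) * (if s < u & u < v then B u * (B v * F v ^ k) else 0);lborel;lborel)"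
   by (rule lborel_pair.Fubini') measurable
  also have "... = (NI v. of_nat (Suc k) * (if s < v then B v * F v ^ k * (NI u. (if s < u & u < v then B u else 0);lborel) else 0);lborel)"
  proof (rule nn_integral_cong)
   fix v
   have "(NI u. of_nat (Suc k) * (if s < u & u < v then B u * (B v * F v ^ k) else 0);lborel)
     = (NI u. of_nat (Suc k) * (B v * F v ^ k) * (if s < u & u < v then B u else 0);lborel)"
    by (intro nn_integral_cong) (simp add: mult_ac)
   also have "... = of_nat (Suc k) * (B v * F v ^ k) * (NI u. (if s < u & u < v then B u else 0);lborel)"
    by (rule nn_integral_cmult) measurable
   also have "... = of_nat (Suc k) * (if s < v then B v * F v ^ k * (NI u. (if s < u & u < v then B u else 0);lborel) else 0)"
   proof (cases "s < v")
    case False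
    then have "(NI u. (if s < u & u < v then B u else 0);lborel) = (NI u. 0;(lborel :: real measure))"
     by (intro nn_integral_cong) auto
    then show ?thesis using False by simp
   qed (simp add: mult.assoc)
   finally show "(NI u. of_nat (Suc k) * (if s < u & u < v then B u * (B v * F v ^ k) else 0);lborel) = ..." .
  qed
  also have "... = of_nat (Suc k) * ?A" by (rule nn_integral_cmult) measurable
  finally have J1: "J (Suc k) s = of_nat (Suc k) * ?A" .
  \<comment> \<open>A second relation between \<open>?A\<close> and \<open>J (Suc k) s\<close>, from
    splitting \<open>F s\<close> at \<open>v\<close> into the mass between \<open>s\<close> and
    \<open>v\<close> and the tail beyond. Combined with \<open>J1\<close> it closes the induction
    without any subtraction.\<close>
  have "F s * J k s = (NI v. F s * (if s < v then B v * F v ^ k else 0);lborel)"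
   unfolding J_def by (rule nn_integral_cmult[symmetric]) measurable
  also have "... = (NI v. (if s < v then B v * F v ^ k * (NI u. (if s < u & u < v then B u else 0);lborel) else 0)
    + (if s < v then B v * F v ^ Suc k else 0);lborel)"
   by (intro nn_integral_cong) (simp add: split mult_ac distrib_left)
  also have "... = ?A + J (Suc k) s" unfolding J_def by (rule nn_integral_add) measurable
  finally have J2: "F s * J k s = ?A + J (Suc k) s" .
  have "of_nat (Suc (Suc k)) * J (Suc k) s = of_nat (Suc k) * (?A + J (Suc k) s)"
   unfolding distrib_left J1[symmetric] by (simp add: algebra_simps)
  also have "... = F s * (of_nat (Suc k) * J k s)" unfolding J2[symmetric] by (simp add: mult_ac)
  finally show ?case unfolding Suc.IH by simp
 qed
 from this[of s] show ?thesis unfolding J_def F_def .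
qed

context grid_excursions
begin

text \<open>Units: parameter 1 of an excursion loop means local time \<open>cN\<close> at
  \<open>z\<close>, that is, time \<open>bN\<close> spent there.\<close>

definition cN :: real where "cN = (ln (real N))\<^sup>2 / (2 * pi)"
definition bN :: real where "bN = cN / (real N)\<^sup>2"

lemma cN: "0 < cN" and bN: "0 < bN" and cN_bN: "cN = (real N)\<^sup>2 * bN"
 using N by (auto simp: cN_def bN_def)

lemma holding_eq: "holding N a = bN * a"
 by (simp add: holding_def bN_def cN_def)

abbreviation Bm :: "(real \<times> path) measure" where "Bm == lborel ** EM"
abbreviation Pk :: "nat => (nat => real \<times> path) measure" where "Pk k == \<Pi>\<^sub>M i\<in>{..<k}. Bm"

lemma sets_Bm [measurable_cong]: "sets Bm = sets (borel ** PS N)"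
 by (rule sets_pair_measure_cong) (simp_all add: sets_EM)

lemma space_Bm [simp]: "space Bm = UNIV \<times> SP N"
 by (simp add: space_pair_measure)

sublocale Bm: pair_sigma_finite "lborel :: real measure" EM
 by unfold_locales

sublocale prod_Bm: product_sigma_finite "%_::nat. Bm"
 by unfold_locales

lemma sigma_finite_Pk: "sigma_finite_measure (Pk k)"
 by (rule prod_Bm.sigma_finite) simp

lemma measurable_Pk_component [measurable]: "i < k ==> (%w. w i) : Pk k ->M borel ** PS N"
 using measurable_component_singleton[of i "{..<k}" "%_. Bm"] by (simp add: measurable_cong_sets[OF refl sets_Bm])

lemma nn_integral_Pk_Suc:
 assumes f: "f : bm (Pk (Suc k))"
 shows "(NI w. f w;Pk (Suc k)) = (NI u. NI e. NI w. f (fun_upd w k (u, e));Pk k;EM;lborel)"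
proof -
 have f': "f : bm (PiM (insert k {..<k}) (%_. Bm))" using f by (simp only: lessThan_Suc)
 have m: "(%(y, w). f (fun_upd w k y)) : bm (Bm ** Pk k)"
 proof -
  have "(%(w, y). fun_upd w k y) : Pk k ** Bm ->M PiM (insert k {..<k}) (%_. Bm)"
   by (rule measurable_add_dim)
  from measurable_compose[OF measurable_compose[OF measurable_pair_swap' this] f'] show ?thesis
   by (simp add: case_prod_unfold)
 qed
 have "(NI w. f w;Pk (Suc k)) = (NI y. NI w. f (fun_upd w k y);Pk k;Bm)"
  unfolding lessThan_Suc by (rule prod_Bm.product_nn_integral_insert_rev[OF _ _ f']) auto
 also have "... = (NI u. NI e. NI w. f (fun_upd w k (u, e));Pk k;EM;lborel)"
  by (rule EM.nn_integral_fst[symmetric])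
   (use sigma_finite_measure.borel_measurable_nn_integral[OF sigma_finite_Pk m] in simp)
 finally show ?thesis .
qed

text \<open>Each excursion contributes N^2 for the jump out of \<open>z\<close> and
  \<open>bN\<close> for the change from time to clock reading, together \<open>cN\<close>. The final
  rest contributes one more \<open>bN\<close>, and the exponential collects all the time at
  \<open>z\<close>.\<close>

definition wgt :: "nat => real => real => ennreal" where
 "wgt k s a = ennreal (bN * cN ^ k * exp (- (4 * (real N)\<^sup>2) * (bN * (a - s))))"

lemma measurable_wgt [measurable]: "(%x. wgt k (s x) (a x)) : bm X"
 if [measurable]: "s : bm X" "a : bm X"
 unfolding wgt_def by measurable

text \<open>The part of \<open>PA D z z\<close> carried by the paths with \<open>k\<close> excursions, the clock at \<open>z\<close> starting from \<open>s\<close>.\<close>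

definition XP :: "nat => real => path measure" where
 "XP k s = distr (density (lborel ** Pk k) (%(a, w). if chain k s a w then wgt k s a else 0))
   (PS N) (%(a, w). ipath z bN k s a w)"

lemma sets_XP [simp, measurable_cong]: "sets (XP k s) = sets (PS N)"
 by (simp add: XP_def)

lemma nn_integral_XP:
 assumes F[measurable]: "F : bm (PS N)"
 shows "(NI p. F p;XP k s) = (NI a. NI w. (if chain k s a w then wgt k s a * F (ipath z bN k s a w) else 0);Pk k;lborel)"
proof -
 interpret Q: sigma_finite_measure "Pk k" by (rule sigma_finite_Pk)
 note measurable_chain[measurable (raw)] measurable_ipath[measurable (raw)]
 have [measurable]: "(%y. snd y i) : lborel ** Pk k ->M borel ** PS N" if "i < k" for i
  using that by measurable
 have "(NI p. F p;XP k s) = (NI y. (if chain k s (fst y) (snd y) then wgt k s (fst y) else 0) * F (ipath z bN k s (fst y) (snd y));(lborel ** Pk k))"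
  unfolding XP_def case_prod_unfold
  by (subst nn_integral_distr, simp, measurable, subst nn_integral_density, measurable)
 also have "... = (NI y. (if chain k s (fst y) (snd y) then wgt k s (fst y) * F (ipath z bN k s (fst y) (snd y)) else 0);(lborel ** Pk k))"
  by (intro nn_integral_cong) simp
 also have "... = (NI a. NI w. (if chain k s a w then wgt k s a * F (ipath z bN k s a w) else 0);Pk k;lborel)"
  by (subst Q.nn_integral_fst[symmetric]) (measurable, simp cong: if_cong)
 finally show ?thesis .
qed


lemma measurable_XP_inner:
 assumes F: "F : bm (PS N)"
 shows "(%a. NI w. (if chain k u a w then wgt k u a * F (ipath z bN k u a w) else 0);Pk k) : bm lborel"
proof (rule sigma_finite_measure.borel_measurable_nn_integral[OF sigma_finite_Pk], unfold case_prod_unfold)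
 have c: "(%y. snd y i) : lborel ** Pk k ->M borel ** PS N" if "i < k" for i
  by (rule measurable_compose[OF measurable_snd measurable_Pk_component[OF that]])
 show "(%y. if chain k u (fst y) (snd y) then wgt k u (fst y) * F (ipath z bN k u (fst y) (snd y)) else 0) : bm (lborel ** Pk k)"
  by (intro measurable_If predE measurable_chain[where N=N] borel_measurable_times_ennreal measurable_compose[OF measurable_ipath F] measurable_wgt zg) (simp_all add: c)
qed

lemma measurable_XP_param:
 assumes F[measurable]: "(%(x, p). F x p) : bm (X ** PS N)"
  and u[measurable]: "u : bm X"
 shows "(%x. NI p. F x p;XP k (u x)) : bm X"
proof -
 interpret Q: sigma_finite_measure "Pk k" by (rule sigma_finite_Pk)
 note measurable_chain[measurable (raw)] measurable_ipath[measurable (raw)]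
 have c4: "(%y. snd y i) : (Y ** Pk k) ->M borel ** PS N" if "i < k" for i and Y :: "'y measure"
  using that by measurable
 note [measurable] = c4
 have "(%y. case y of ((x, a), w) => if chain k (u x) a w then wgt k (u x) a * F x (ipath z bN k (u x) a w) else 0)
   : bm ((X ** lborel) ** Pk k)"
  unfolding case_prod_unfold by measurable
 from Q.borel_measurable_nn_integral_fst[OF this]
 have "(%y. case y of (x, a) => NI w. (if chain k (u x) a w then wgt k (u x) a * F x (ipath z bN k (u x) a w) else 0);Pk k)
   : bm (X ** lborel)"
  by (simp add: case_prod_unfold)
 from lborel.borel_measurable_nn_integral[OF this]
 have "(%x. NI a. NI w. (if chain k (u x) a w then wgt k (u x) a * F x (ipath z bN k (u x) a w) else 0);Pk k;lborel) : bm X"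
  by simp
 then show ?thesis
 proof (rule subst[OF measurable_cong, rotated])
  fix x assume "x : space X"
  then have "F x : bm (PS N)" by measurable
  from nn_integral_XP[OF this, of k "u x"]
  show "(NI a. NI w. (if chain k (u x) a w then wgt k (u x) a * F x (ipath z bN k (u x) a w) else 0);Pk k;lborel)
    = (NI p. F x p;XP k (u x))" by (rule sym)
 qed
qed

lemma XP_0:
 assumes F[measurable]: "F : bm (PS N)"
 shows "(NI p. F p;XP 0 s) = (NI h. F (hold z h);expm)"
proof -
 have "(NI p. F p;XP 0 s) = (NI a. (if s < a then wgt 0 s a * F (hold z (bN * (a - s))) else 0);lborel)"
  by (simp add: nn_integral_XP prod_Bm.nn_integral_empty emeasure_PiM_empty space_PiM_empty cong: if_cong)
 also have "... = ennreal \<bar>1 / bN\<bar> * (NI h. (if s < s + 1 / bN * h then wgt 0 s (s + 1 / bN * h) * F (hold z (bN * (s + 1 / bN * h - s))) else 0);lborel)"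
 proof (rule nn_integral_real_affine)
  show "(%a. if s < a then wgt 0 s a * F (hold z (bN * (a - s))) else 0) : bm borel" by measurable
 qed (use bN in simp)
 also have "... = (NI h. ennreal \<bar>1 / bN\<bar> * (if s < s + 1 / bN * h then wgt 0 s (s + 1 / bN * h) * F (hold z (bN * (s + 1 / bN * h - s))) else 0);lborel)"
  by (rule nn_integral_cmult[symmetric]) measurable
 also have "... = (NI h. F (hold z h);expm)"
  using bN by (subst nn_integral_expm)
   (auto intro!: nn_integral_cong simp: wgt_def indicator_def zero_less_mult_iff zero_less_divide_iff mult.assoc[symmetric] ennreal_mult[symmetric])
 finally show ?thesis .
qed

text \<open>The first excursion is the last coordinate of the tuple. With its clock reading
  \<open>u\<close> moved to the outermost integral, the substitution \<open>u = s + h / bN\<close>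
  makes the first rest at \<open>z\<close> distributed as \<open>expm\<close>.\<close>

lemma XP_Suc_shift:
 assumes F[measurable]: "F : bm (PS N)"
 shows "(NI p. F p;XP (Suc k) s) = ennreal ((real N)\<^sup>2) *
  (NI h. NI e. NI p. F (papp (hold z h) (papp e p));XP k (s + h / bN);EM;expm)"
proof -
 interpret Q: sigma_finite_measure "Pk k" by (rule sigma_finite_Pk)
 note measurable_chain[measurable (raw)] measurable_ipath[measurable (raw)]
 let ?q = "%u e p. papp (hold z (bN * (u - s))) (papp e p)"
 let ?r = "%u. ennreal (cN * exp (- (4 * (real N)\<^sup>2) * (bN * (u - s))))"
 let ?g = "%a u e v. if s < u & chain k u a v then wgt (Suc k) s a * F (?q u e (ipath z bN k u a v)) else 0"
 \<comment> \<open>The exponential weight is multiplicative along the clock, so it factors at any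
   intermediate reading.\<close>
 have w: "wgt (Suc k) s a = ?r u * wgt k u a" for u a
  using cN bN by (simp add: wgt_def ennreal_mult[symmetric] exp_add[symmetric] algebra_simps)
 have c4: "(%y. snd y i) : (Y ** Pk k) ->M borel ** PS N" if "i < k" for i and Y :: "'y measure"
  using that by measurable
 note [measurable] = c4
 have m4: "(%((a, u, e), v). ?g a u e v) : bm ((lborel ** (lborel ** EM)) ** Pk k)"
  unfolding case_prod_unfold by measurable
 define G where "G a u e = (NI v. ?g a u e v;Pk k)" for a u e
 have m3: "(%(a, u, e). G a u e) : bm (lborel ** (lborel ** EM))"
  using Q.borel_measurable_nn_integral[OF m4] by (simp add: case_prod_unfold G_def)
 have m3s: "(%x. G (a x) (u x) (e x)) : bm X"
  if "a : bm X" "u : bm X" "e : X ->M PS N" for a u e and X :: "'x measure"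
 proof -
  have "(%x. (a x, u x, e x)) : X ->M lborel ** (lborel ** EM)"
   using that by (intro measurable_Pair) (simp_all add: measurable_cong_sets[OF refl sets_EM])
  from measurable_compose[OF this m3] show ?thesis by simp
 qed
 have "(NI p. F p;XP (Suc k) s) = (NI a. NI u. NI e. G a u e;EM;lborel;lborel)"
 proof (unfold nn_integral_XP[OF F], rule nn_integral_cong)
  fix a :: real
  show "(NI v. (if chain (Suc k) s a v then wgt (Suc k) s a * F (ipath z bN (Suc k) s a v) else 0);Pk (Suc k)) =
    (NI u. NI e. G a u e;EM;lborel)"
  proof (subst nn_integral_Pk_Suc)
   show "(%v. if chain (Suc k) s a v then wgt (Suc k) s a * F (ipath z bN (Suc k) s a v) else 0) : bm (Pk (Suc k))"
    by (intro measurable_If predE measurable_chain[where N=N] borel_measurable_times_ennreal measurable_compose[OF measurable_ipath F] zg) simp_all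
  qed (simp add: G_def[abs_def] cong: if_cong)
 qed
 also have "... = (NI u. NI a. NI e. G a u e;EM;lborel;lborel)"
 proof (rule lborel_pair.Fubini')
  show "(%(u, a). NI e. G a u e;EM) : bm (lborel ** lborel)"
   unfolding case_prod_unfold
   by (rule EM.borel_measurable_nn_integral, unfold case_prod_unfold, rule m3s) measurable
 qed
 also have "... = (NI u. NI e. NI a. G a u e;lborel;EM;lborel)"
 proof (intro nn_integral_cong Bm.Fubini'[symmetric])
  fix u :: real
  show "(%(a, e). G a u e) : bm Bm"
   unfolding case_prod_unfold
  proof (rule m3s)
   show "(%y. snd y) : Bm ->M PS N"
    using measurable_snd[of "lborel :: real measure" EM] by (simp add: measurable_cong_sets[OF refl sets_EM])
  qed (use measurable_fst[of "lborel :: real measure" EM] in simp_all)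
 qed
 also have "... = (NI u. (if s < u then ?r u * (NI e. NI p. F (?q u e p);XP k u;EM) else 0);lborel)"
 proof (rule nn_integral_cong)
  fix u :: real
  have "(NI a. G a u e;lborel) = (if s < u then ?r u * (NI p. F (?q u e p);XP k u) else 0)" if e: "e : space EM" for e
  proof -
   have [measurable]: "e : space (PS N)" using e by simp
   have F': "(%p. F (?q u e p)) : bm (PS N)" by measurable
   have "(NI a. G a u e;lborel) = (NI a. ?r u * (NI v. (if chain k u a v then wgt k u a * F (?q u e (ipath z bN k u a v)) else 0);Pk k);lborel)"
    if "s < u"
   proof (rule nn_integral_cong)
    fix a :: real
    have "(%v. if chain k u a v then wgt k u a * F (?q u e (ipath z bN k u a v)) else 0) : bm (Pk k)"
     by (intro measurable_If predE measurable_chain[where N=N] borel_measurable_times_ennreal measurable_compose[OF measurable_ipath F'] zg) simp_all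
    then show "G a u e = ?r u * (NI v. (if chain k u a v then wgt k u a * F (?q u e (ipath z bN k u a v)) else 0);Pk k)"
     using that unfolding G_def
     by (subst nn_integral_cmult[symmetric]) (auto intro!: nn_integral_cong simp: w[of _ u] mult.assoc)
   qed
   also have "... = ?r u * (NI p. F (?q u e p);XP k u)"
    unfolding nn_integral_XP[OF F'] by (rule nn_integral_cmult[OF measurable_XP_inner[OF F']])
   finally have *: "s < u ==> (NI a. G a u e;lborel) = ?r u * (NI p. F (?q u e p);XP k u)" .
   show ?thesis
   proof (cases "s < u")
    case False
    then show ?thesis by (simp add: G_def)
   qed (simp add: *)
  qed
  then have "(NI e. NI a. G a u e;lborel;EM) = (NI e. (if s < u then ?r u * (NI p. F (?q u e p);XP k u) else 0);EM)"
   by (intro nn_integral_cong) simp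
  also have "... = (if s < u then ?r u * (NI e. NI p. F (?q u e p);XP k u;EM) else 0)"
  proof (cases "s < u")
   case True
   have "(%e. NI p. F (?q u e p);XP k u) : bm EM" by (rule measurable_XP_param) (measurable, simp_all add: hold_path_step zg)
   with True show ?thesis by (simp add: nn_integral_cmult)
  qed simp
  finally show "(NI e. NI a. G a u e;lborel;EM) = ..." .
 qed
 also have "... = ennreal ((real N)\<^sup>2) *
  (NI h. NI e. NI p. F (papp (hold z h) (papp e p));XP k (s + h / bN);EM;expm)"
 proof -
  define V where "V u = (NI e. NI p. F (?q u e p);XP k u;EM)" for u
  have [measurable]: "V : bm borel"
  proof -
   have "(%x. NI p. F (?q (fst x) (snd x) p);XP k (fst x)) : bm (borel ** EM)"
    by (rule measurable_XP_param) measurable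
   from EM.borel_measurable_nn_integral_fst[OF this] show ?thesis by (simp add: V_def[abs_def])
  qed
  have "(NI u. (if s < u then ?r u * V u else 0);lborel) = ennreal \<bar>1 / bN\<bar> * (NI h. (if s < s + 1 / bN * h then ?r (s + 1 / bN * h) * V (s + 1 / bN * h) else 0);lborel)"
  proof (rule nn_integral_real_affine)
   show "(%u. if s < u then ?r u * V u else 0) : bm borel" by measurable
  qed (use bN in simp)
  also have "... = (NI h. ennreal \<bar>1 / bN\<bar> * (if s < s + 1 / bN * h then ?r (s + 1 / bN * h) * V (s + 1 / bN * h) else 0);lborel)"
   by (rule nn_integral_cmult[symmetric]) measurable
  also have "... = (NI h. ennreal ((real N)\<^sup>2) * V (s + h / bN);expm)"
  proof -
   have r: "ennreal \<bar>1 / bN\<bar> * ?r (s + 1 / bN * h) = ennreal (exp (- (4 * (real N)\<^sup>2) * h)) * ennreal ((real N)\<^sup>2)" for h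
    using bN by (simp add: cN_bN ennreal_mult[symmetric])
   have "ennreal \<bar>1 / bN\<bar> * (if s < s + 1 / bN * h then ?r (s + 1 / bN * h) * V (s + 1 / bN * h) else 0)
     = ennreal (indicator {0<..} h * exp (- (4 * (real N)\<^sup>2) * h)) * (ennreal ((real N)\<^sup>2) * V (s + h / bN))" for h
   proof (cases "0 < h")
    case True
    then have "ennreal \<bar>1 / bN\<bar> * (if s < s + 1 / bN * h then ?r (s + 1 / bN * h) * V (s + 1 / bN * h) else 0)
      = (ennreal \<bar>1 / bN\<bar> * ?r (s + 1 / bN * h)) * V (s + 1 / bN * h)"
     using bN by (simp add: mult.assoc)
    then show ?thesis unfolding r using True by (simp add: mult.assoc)
   qed (use bN in \<open>simp add: zero_less_divide_iff\<close>)
   then show ?thesis by (subst nn_integral_expm) simp_all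
  qed
  also have "... = ennreal ((real N)\<^sup>2) * (NI h. V (s + h / bN);expm)"
   by (rule nn_integral_cmult) measurable
  finally show ?thesis using bN by (simp add: V_def cong: if_cong)
 qed
 finally show ?thesis .
qed


lemma measurable_prefix:
 assumes "F : bm (PS N)" "e : space EM"
 shows "(%p. F (papp (hold z h) (papp e p))) : bm (PS N)"
proof -
 have "(%p. papp (hold z h) (papp e p)) : PS N ->M PS N"
  using assms by (intro measurable_path_append) (simp_all add: hold_path_step zg)
 from measurable_compose[OF this assms(1)] show ?thesis .
qed

text \<open>Only differences of clock readings matter; the recursion over the first excursion shows
  this without translating the product space.\<close>

lemma XP_shift: "F : bm (PS N) ==> (NI p. F p;XP k s) = (NI p. F p;XP k 0)"
proof (induction k arbitrary: F s)
 case (Suc k)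
 have eq: "(NI e. NI p. F (papp (hold z h) (papp e p));XP k s';EM) =
  (NI e. NI p. F (papp (hold z h) (papp e p));XP k 0;EM)" for h s'
 proof (rule nn_integral_cong)
  fix e assume "e : space EM"
  note measurable_prefix[OF Suc.prems this]
  then show "(NI p. F (papp (hold z h) (papp e p));XP k s') = (NI p. F (papp (hold z h) (papp e p));XP k 0)"
   by (rule Suc.IH)
 qed
 show ?case unfolding XP_Suc_shift[OF Suc.prems]
  by (intro arg_cong2[where f="(*)"] refl nn_integral_cong trans[OF eq eq[symmetric]])
qed (simp add: XP_0)

lemma XP_Suc:
 assumes F: "F : bm (PS N)"
 shows "(NI p. F p;XP (Suc k) 0) = ennreal ((real N)\<^sup>2) *
  (NI h. NI e. NI p. F (papp (hold z h) (papp e p));XP k 0;EM;expm)"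
 unfolding XP_Suc_shift[OF F]
 by (intro arg_cong2[where f="(*)"] refl nn_integral_cong XP_shift measurable_prefix F)

text \<open>Unrolling \<open>PA_excursion\<close> \<open>n\<close> times leaves a nonnegative
  remainder, the paths with at least \<open>n\<close> excursions; hence an inequality for the time
  being.\<close>

lemma sum_XP_le_PA:
 assumes F[measurable]: "F : bm (PS N)"
 shows "(\<Sum>k<n. NI p. F p;XP k 0) <= (NI p. F p;PA D z z)"
 using F
proof (induction n arbitrary: F)
 case (Suc n)
 note Suc.prems[measurable]
 let ?F = "%h e p. F (papp (hold z h) (papp e p))"
 have m: "(%(h, e). NI p. ?F h e p;XP k 0) : bm (expm ** EM)" for k
 proof -
  have "(%x. NI p. ?F (fst x) (snd x) p;XP k 0) : bm (expm ** EM)"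
   by (rule measurable_XP_param) measurable
  then show ?thesis by (simp add: case_prod_unfold)
 qed
 have m1: "(%e. NI p. ?F h e p;XP k 0) : bm EM" for h k
  using measurable_compose[OF measurable_Pair1'[of h expm EM] m] by simp
 have m2: "(%h. NI e. NI p. ?F h e p;XP k 0;EM) : bm expm" for k
  using EM.borel_measurable_nn_integral[OF m] by simp
 have "(\<Sum>k<Suc n. NI p. F p;XP k 0) = (NI h. F (hold z h);expm) + (\<Sum>k<n. ennreal ((real N)\<^sup>2) * (NI h. NI e. NI p. ?F h e p;XP k 0;EM;expm))"
  by (simp only: sum.lessThan_Suc_shift XP_0[OF Suc.prems] XP_Suc[OF Suc.prems])
 also have "... = (NI h. F (hold z h);expm) + ennreal ((real N)\<^sup>2) * (NI h. NI e. (\<Sum>k<n. NI p. ?F h e p;XP k 0);EM;expm)"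
  by (simp only: sum_distrib_left[symmetric] nn_integral_sum[OF m1] nn_integral_sum[OF m2])
 also have "... <= (NI h. F (hold z h);expm) + ennreal ((real N)\<^sup>2) * (NI h. NI e. NI p. ?F h e p;PA D z z;EM;expm)"
  by (intro add_left_mono mult_left_mono nn_integral_mono Suc.IH measurable_prefix Suc.prems) simp_all
 also have "... = (NI p. F p;PA D z z)" by (rule PA_excursion[OF Suc.prems, symmetric])
 finally show ?case .
qed simp

lemma XP_total: "emeasure (XP k 0) (SP N) = ennreal (1 / (4 * (real N)\<^sup>2) * (mE / 4) ^ k)"
proof (induction k)
 have e1: "emeasure (XP k 0) (SP N) = (NI p. 1;XP k 0)" for k
  using sets_eq_imp_space_eq[OF sets_XP[of k 0]] by simp
 {
  case 0
  show ?case by (simp only: e1 XP_0[of "%_. 1"] borel_measurable_const) (simp add: emeasure_expm_UNIV)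
 next
  case (Suc k)
  have "(NI p. 1;XP (Suc k) 0) = ennreal ((real N)\<^sup>2) * (NI h. NI e. NI p. 1;XP k 0;EM;expm)"
   by (rule XP_Suc) simp
  then show ?case
   using N mE unfolding e1 Suc[unfolded e1]
   by (simp add: emeasure_expm_UNIV emeasure_EM_eq ennreal_mult[symmetric] field_simps power2_eq_square power4_eq_xxxx)
 }
qed

text \<open>The sum over \<open>k\<close> is dominated by \<open>PA D z z\<close> on every
  measurable set and, by a geometric series, has the same finite total mass. Domination on the
  complement then forces equality.\<close>

theorem PA_XP:
 assumes F: "F : bm (PS N)"
 shows "(NI p. F p;PA D z z) = (NI k. NI p. F p;XP k 0;count_space UNIV)"
proof (rule nn_integral_eq_of_emeasure[where S="PS N"])
 fix B assume B: "B : sets (PS N)"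
 have C: "SP N - B : sets (PS N)" using sets.compl_sets[OF B] by simp
 have le: "(\<Sum>k. emeasure (XP k 0) X) <= emeasure (PA D z z) X" if X: "X : sets (PS N)" for X
 proof (rule suminf_le_const[OF summableI])
  fix n
  have "(\<Sum>k<n. NI p. indicator X p;XP k 0) <= (NI p. indicator X p;PA D z z)"
   using X by (intro sum_XP_le_PA) simp
  then show "(\<Sum>k<n. emeasure (XP k 0) X) <= emeasure (PA D z z) X" using X by simp
 qed
 have un: "emeasure m B + emeasure m (SP N - B) = emeasure m (SP N)" if "sets m = sets (PS N)" for m
  using that B C sets.sets_into_space[OF B] by (subst plus_emeasure) (auto intro!: arg_cong[where f="emeasure m"])
 have "(\<Sum>k. emeasure (XP k 0) B) + (\<Sum>k. emeasure (XP k 0) (SP N - B)) = (\<Sum>k. emeasure (XP k 0) (SP N))"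
  by (subst suminf_add[OF summableI summableI]) (simp add: un)
 also have "... = (\<Sum>k. ennreal (1 / (4 * (real N)\<^sup>2) * (mE / 4) ^ k))" by (simp only: XP_total)
 also have "... = ennreal (1 / (4 * (real N)\<^sup>2) * (1 / (1 - mE / 4)))"
  using mE by (intro suminf_ennreal_eq sums_mult geometric_sums) auto
 also have "... = emeasure (PA D z z) (SP N)"
  using mE by (simp add: emeasure_PA_z field_simps)
 also have "... = emeasure (PA D z z) B + emeasure (PA D z z) (SP N - B)" by (rule un[symmetric]) simp
 finally have eq: "(\<Sum>k. emeasure (XP k 0) B) + (\<Sum>k. emeasure (XP k 0) (SP N - B)) = ..." .
 have "emeasure (PA D z z) B <= (\<Sum>k. emeasure (XP k 0) B)"
 proof -
  have "(\<Sum>k. emeasure (XP k 0) (SP N - B)) + emeasure (PA D z z) B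
    <= (\<Sum>k. emeasure (XP k 0) (SP N - B)) + (\<Sum>k. emeasure (XP k 0) B)"
   using le[OF C] eq by (simp add: add.commute add_left_mono)
  moreover have "(\<Sum>k. emeasure (XP k 0) (SP N - B)) ~= \<infinity>"
   using le[OF C] PA.emeasure_finite neq_top_trans by fastforce
  ultimately show ?thesis by (simp add: ennreal_add_left_cancel_le)
 qed
 with le[OF B] show "emeasure (PA D z z) B = (NI k. emeasure (XP k 0) B;count_space UNIV)"
  by (simp add: nn_integral_count_space_nat)
qed (use F in simp_all)

end

section \<open>The Poisson process of excursions\<close>

context grid_excursions
begin

abbreviation Xi :: "real => (real \<times> path) measure" where "Xi == Xi_intensity N D z"

lemma space_Xi [simp]: "space (Xi a) = {0<..<a} \<times> SP N"
 by (simp add: Xi_intensity_def normalized_excursion_measure_def space_pair_measure space_restrict_space EM_def[symmetric]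
   sets_eq_imp_space_eq[OF sets_scale_measure])

lemma measurable_Xi_extend:
 assumes f: "f : bm (Xi a)" and a: "0 < a"
 shows "(%y. if fst y : {0<..<a} then f y else 0 :: ennreal) : bm (borel ** PS N)"
proof -
 \<comment> \<open>Positions outside the interval are sent to an arbitrary point of it, so that
   \<open>f\<close> can be composed.\<close>
 let ?c = "%u. if u : {0<..<a} then u else a / 2"
 have "sets (Xi a) = sets (restrict_space borel {0<..<a} ** PS N)"
  unfolding Xi_intensity_def normalized_excursion_measure_def EM_def[symmetric]
  by (intro sets_pair_measure_cong) (simp_all add: sets_restrict_space_cong[OF sets_lborel])
 moreover have "(%y. (?c (fst y), snd y)) : borel ** PS N ->M restrict_space borel {0<..<a} ** PS N"
  using a by (intro measurable_Pair measurable_restrict_space2) (auto simp: measurable_fst'')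
 ultimately have "(%y. (?c (fst y), snd y)) : borel ** PS N ->M Xi a"
  using measurable_cong_sets[OF refl] by blast
 from measurable_compose[OF this f]
 have [measurable]: "(%y. f (?c (fst y), snd y)) : bm (borel ** PS N)" .
 have "(%y. if fst y : {0<..<a} then f y else 0) = (%y. if fst y : {0<..<a} then f (?c (fst y), snd y) else 0)"
  by (auto simp: fun_eq_iff)
 then show ?thesis by simp
qed

text \<open>The constant arises as 2 pi times the square of log N / (2 pi), which is
  \<open>cN\<close>.\<close>

lemma nn_integral_Xi:
 assumes f: "f : bm (Xi r)" and r: "0 < r"
 shows "(NI y. f y;Xi r) = ennreal cN * (NI u. (if 0 < u then if u < r then NI e. f (u, e);EM else 0 else 0);lborel)"
proof -
 let ?a = "ennreal (2 * pi)" and ?b = "ennreal ((ln (real N) / (2 * pi))\<^sup>2)"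
 let ?E = "scale_measure ?a (scale_measure ?b EM)" and ?R = "restrict_space lborel {0<..<r}"
 interpret E: finite_measure ?E
  by (rule finite_measureI) (simp add: ennreal_mult_eq_top_iff EM.emeasure_finite[unfolded infinity_ennreal_def])
 have Xi: "Xi r = ?R ** ?E"
  by (simp add: Xi_intensity_def normalized_excursion_measure_def EM_def)
 have f': "f : bm (?R ** ?E)" using f unfolding Xi .
 have fe: "(%e. f (u, e)) : bm EM" if "u : {0<..<r}" for u
  using measurable_compose[OF measurable_Pair1'[of u ?R ?E] f'] that by (simp add: space_restrict_space)
 have ab: "?a * ?b = ennreal cN"
  by (simp add: cN_def ennreal_mult[symmetric] power2_eq_square)
 have meas: "(%u. if 0 < u then if u < r then NI e. f (u, e);EM else 0 else 0) : bm lborel"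
 proof -
  have "(%y. if fst y : {0<..<r} then f y else 0) : bm (lborel ** EM)"
   using measurable_Xi_extend[OF f r] by (simp add: measurable_cong_sets[OF sets_Bm refl])
  from EM.borel_measurable_nn_integral_fst[OF this]
  have "(%u. NI e. (if u : {0<..<r} then f (u, e) else 0);EM) : bm lborel" by simp
  also have "(%u. NI e. (if u : {0<..<r} then f (u, e) else 0);EM) = (%u. if 0 < u then if u < r then NI e. f (u, e);EM else 0 else 0)"
   by (auto simp: fun_eq_iff)
  finally show ?thesis .
 qed
 have "(NI y. f y;Xi r) = (NI u. NI e. f (u, e);?E;?R)"
  unfolding Xi by (rule E.nn_integral_fst[OF f', symmetric])
 also have "... = (NI u. (NI e. f (u, e);?E) * indicator {0<..<r} u;lborel)"
  by (rule nn_integral_restrict_space) simp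
 also have "... = (NI u. ennreal cN * (if 0 < u then if u < r then NI e. f (u, e);EM else 0 else 0);lborel)"
  by (intro nn_integral_cong) (auto simp: indicator_def nn_integral_scale_measure fe mult.assoc[symmetric] ab)
 also have "... = ennreal cN * (NI u. (if 0 < u then if u < r then NI e. f (u, e);EM else 0 else 0);lborel)"
  by (rule nn_integral_cmult[OF meas])
 finally show ?thesis .
qed

text \<open>The ordered tuples are one of \<open>k!\<close> arrangements of equal weight; the
  recursion over the first reading is the one of \<open>nn_integral_power_tail\<close>.\<close>

lemma chain_integral:
 assumes g[measurable]: "g : bm (borel ** PS N)"
 shows "of_nat (fact k) * (NI w. (if chain k s a w then \<Prod>i<k. g (w i) else 0);Pk k)
  = (if s < a then (NI u. (if s < u then if u < a then NI e. g (u, e);EM else 0 else 0);lborel) ^ k else 0)"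
proof (induction k arbitrary: s)
 case 0
 show ?case by (simp add: prod_Bm.nn_integral_empty emeasure_PiM_empty space_PiM_empty cong: if_cong)
next
 case (Suc k)
 define B where "B u = (if u < a then NI e. g (u, e);EM else 0)" for u
 have gE: "g : bm (borel ** EM)"
  using g unfolding measurable_cong_sets[OF sets_pair_measure_cong[OF refl sets_EM] refl] .
 have gm: "(%e. g (u, e)) : bm EM" for u
  using measurable_compose[OF measurable_Pair1'[of u borel EM] gE] by simp
 have [measurable]: "B : bm borel"
 proof -
  from EM.borel_measurable_nn_integral_fst[OF gE] have [measurable]: "(%u. NI e. g (u, e);EM) : bm borel" .
  show ?thesis unfolding B_def by measurable
 qed
 let ?I = "%s. NI w. (if chain k s a w then \<Prod>i<k. g (w i) else 0);Pk k"
 have m: "(%w. if chain k s a w then \<Prod>i<k. g (w i) else 0) : bm (Pk k)" for k s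
  by (intro measurable_If predE measurable_chain[where N=N] borel_measurable_prod_ennreal measurable_compose[OF measurable_Pk_component g]) simp_all
 have "(NI w. (if chain (Suc k) s a w then \<Prod>i<Suc k. g (w i) else 0);Pk (Suc k))
  = (NI u. NI e. NI w. (if s < u & chain k u a w then (\<Prod>i<k. g (w i)) * g (u, e) else 0);Pk k;EM;lborel)"
  by (subst nn_integral_Pk_Suc[OF m]) (simp cong: if_cong)
 also have "... = (NI u. (if s < u then B u * ?I u else 0);lborel)"
 proof (rule nn_integral_cong)
  fix u
  have "(NI w. (if s < u & chain k u a w then (\<Prod>i<k. g (w i)) * g (u, e) else 0);Pk k) = (if s < u then ?I u * g (u, e) else 0)" for e
  proof (cases "s < u")
   case True
   have "(NI w. (if chain k u a w then \<Prod>i<k. g (w i) else 0) * g (u, e);Pk k) = ?I u * g (u, e)"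
    by (rule nn_integral_multc[OF m])
   with True show ?thesis by (simp add: if_distrib[of "%x. x * g (u, e)"] cong: if_cong)
  qed simp
  then have "(NI e. NI w. (if s < u & chain k u a w then (\<Prod>i<k. g (w i)) * g (u, e) else 0);Pk k;EM) = (if s < u then ?I u * (NI e. g (u, e);EM) else 0)"
   using gm[of u] by (simp add: nn_integral_cmult)
  also have "... = (if s < u then B u * ?I u else 0)"
  proof (cases "u < a")
   case False
   then have "of_nat (fact k) * ?I u = 0" using Suc.IH[of u] by simp
   then have "?I u = 0" by simp
   then show ?thesis by simp
  qed (simp add: B_def mult.commute)
  finally show "(NI e. NI w. (if s < u & chain k u a w then (\<Prod>i<k. g (w i)) * g (u, e) else 0);Pk k;EM) = ..." .
 qed
 finally have "of_nat (fact (Suc k)) * (NI w. (if chain (Suc k) s a w then \<Prod>i<Suc k. g (w i) else 0);Pk (Suc k))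
   = of_nat (fact (Suc k)) * (NI u. (if s < u then B u * ?I u else 0);lborel)" by (rule arg_cong)
 also have "... = of_nat (Suc k) * (NI u. of_nat (fact k) * (if s < u then B u * ?I u else 0);lborel)"
 proof -
  have [measurable]: "?I : bm lborel"
  proof (rule sigma_finite_measure.borel_measurable_nn_integral[OF sigma_finite_Pk], unfold case_prod_unfold)
   have c: "(%y. snd y i) : lborel ** Pk k ->M borel ** PS N" if "i < k" for i
    by (rule measurable_compose[OF measurable_snd measurable_Pk_component[OF that]])
   show "(%y. if chain k (fst y) a (snd y) then \<Prod>i<k. g (snd y i) else 0) : bm (lborel ** Pk k)"
    by (intro measurable_If predE measurable_chain[where N=N] borel_measurable_prod_ennreal measurable_compose[OF c g]) (simp_all add: c)
  qed
  have "(NI u. of_nat (fact k) * (if s < u then B u * ?I u else 0);lborel) = of_nat (fact k) * (NI u. (if s < u then B u * ?I u else 0);lborel)"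
   by (rule nn_integral_cmult) measurable
  then show ?thesis by (simp only: fact_Suc of_nat_mult of_nat_fact mult.assoc of_nat_id)
 qed
 also have "... = of_nat (Suc k) * (NI u. (if s < u then B u * (NI v. (if u < v then B v else 0);lborel) ^ k else 0);lborel)"
 proof (intro arg_cong2[where f="(*)"] refl nn_integral_cong)
  fix u
  show "of_nat (fact k) * (if s < u then B u * ?I u else 0) = (if s < u then B u * (NI v. (if u < v then B v else 0);lborel) ^ k else 0)"
   using Suc.IH[of u] by (auto simp: B_def mult.left_commute[of "fact k"] cong: if_cong)
 qed
 also have "... = (NI v. (if s < v then B v else 0);lborel) ^ Suc k"
  by (rule nn_integral_power_tail) measurable
 also have "... = (if s < a then (NI v. (if s < v then B v else 0);lborel) ^ Suc k else 0)"
 proof (cases "s < a")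
  case False
  then have "(NI v. (if s < v then B v else 0);lborel) = (NI v. 0;(lborel :: real measure))"
   by (intro nn_integral_cong) (auto simp: B_def)
  then show ?thesis using False by simp
 qed simp
 finally show ?case unfolding B_def .
qed


lemma AE_Bm_total: "(NI u. (if 0 < u then if u < a then NI e. 1;EM else 0 else 0);lborel) = ennreal (a * mE)" if "0 < a"
proof -
 have "(NI u. (if 0 < u then if u < a then NI e. 1;EM else 0 else 0);lborel) = (NI u. ennreal mE * indicator {0<..<a} u;lborel)"
  by (intro nn_integral_cong) (auto simp: emeasure_EM_eq indicator_def)
 also have "... = ennreal mE * ennreal a" using that by (subst nn_integral_cmult_indicator) auto
 finally show ?thesis using that mE by (simp add: ennreal_mult[symmetric] mult.commute)
qed

lemma measurable_coll:
 assumes a: "0 < a"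
 shows "(%w. if chain k 0 a w then coll k w else (%_. 0)) : Pk k ->M collection_space (Xi a)"
proof (rule measurable_collection_spaceI)
 fix w assume w: "w : space (Pk k)"
 have "w i : space (Xi a)" if "chain k 0 a w" "i < k" for i
  using chain_less_fst[OF that] w that by (auto simp: space_PiM PiE_def Pi_def mem_Times_iff)
 moreover have "{x. coll k w x ~= 0} = w ` {..<k}" by (auto simp: coll_def)
 ultimately show "(if chain k 0 a w then coll k w else (%_. 0)) : collections (Xi a)"
  by (simp add: collections_def image_subset_iff del: space_Xi)
next
 fix B assume B: "B : sets (Xi a)"
 define g where "g = (%y. if fst y : {0<..<a} then indicator B y else 0 :: ennreal)"
 have g: "g : bm (borel ** PS N)"
  unfolding g_def by (rule measurable_Xi_extend) (use B a in auto)
 have "(%w. npoints (if chain k 0 a w then coll k w else (%_. 0)) B) = (%w. if chain k 0 a w then \<Sum>i<k. g (w i) else 0)"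
 proof (rule ext, goal_cases)
  case (1 w)
  show ?case
  proof (cases "chain k 0 a w")
   case True
   then show ?thesis using chain_less_fst[OF True] unfolding npoints_def
    by (simp add: collection_sum_coll[OF True] g_def)
  qed (simp add: npoints_def collection_sum_def)
 qed
 also have "... : bm (Pk k)"
  by (intro measurable_If predE measurable_chain[where N=N] borel_measurable_sum measurable_compose[OF measurable_Pk_component g]) simp_all
 finally show "(%w. npoints (if chain k 0 a w then coll k w else (%_. 0)) B) : bm (Pk k)" .
qed

text \<open>The part of the Poisson law with exactly \<open>k\<close> points: \<open>Xi a\<close>
  has total mass \<open>a * cN * mE\<close>, and integrating over ordered tuples absorbs the usual
  1/k!. Tuples out of order have weight 0; the empty collection is their default image.\<close>

definition XK :: "real => nat => (real \<times> path) collection measure" where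
 "XK a k = distr (density (Pk k) (%w. if chain k 0 a w then ennreal (exp (- (a * cN * mE)) * cN ^ k) else 0))
   (collection_space (Xi a)) (%w. if chain k 0 a w then coll k w else (%_. 0))"

lemma nn_integral_XK:
 assumes a: "0 < a" and H: "H : bm (collection_space (Xi a))"
 shows "(NI C. H C;XK a k) = ennreal (exp (- (a * cN * mE)) * cN ^ k) * (NI v. (if chain k 0 a v then H (coll k v) else 0);Pk k)"
proof -
 let ?w = "ennreal (exp (- (a * cN * mE)) * cN ^ k)" and ?c = "%v. if chain k 0 a v then coll k v else (%_. 0)"
 have ch: "Measurable.pred (Pk k) (%v. chain k 0 a v)" by (rule measurable_chain[where N=N]) simp_all
 have Hc: "(%v. H (?c v)) : bm (Pk k)"
  by (rule measurable_compose[OF measurable_coll[OF a] H])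
 have "(NI C. H C;XK a k) = (NI v. (if chain k 0 a v then ?w else 0) * H (?c v);Pk k)"
  unfolding XK_def using ch Hc measurable_coll[OF a, of k] H
  by (subst nn_integral_distr) (simp_all add: nn_integral_density)
 also have "... = (NI v. ?w * (if chain k 0 a v then H (?c v) else 0);Pk k)"
  by (intro nn_integral_cong) simp
 also have "... = ?w * (NI v. (if chain k 0 a v then H (?c v) else 0);Pk k)"
  by (intro nn_integral_cmult measurable_If predE ch Hc) simp
 finally show ?thesis by (simp cong: if_cong)
qed

text \<open>The number \<open>v\<close> is the integral of \<open>en (f y)\<close> against length
  times \<open>EM\<close> over positions in \<open>(0, a)\<close>; the integral over ordered tuples
  is v^k / k!.\<close>

lemma XK_laplace:
 assumes a: "0 < a" and f: "f : bm (Xi a)"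
 obtains v where "0 <= v" "v <= a * mE" "(NI y. en (f y);Xi a) = ennreal (cN * v)"
  "!!k. (NI C. en (csum f C);XK a k) = ennreal (exp (- (a * cN * mE)) * ((cN * v) ^ k /\<^sub>R fact k))"
proof -
 define g where "g = (%y. if fst y : {0<..<a} then en (f y) else 0)"
 have enf: "(%y. en (f y)) : bm (Xi a)" using f by measurable
 have g: "g : bm (borel ** PS N)"
  unfolding g_def by (rule measurable_Xi_extend[OF enf a])
 let ?\<Phi> = "NI u. (if 0 < u then if u < a then NI e. g (u, e);EM else 0 else 0);lborel"
 have "?\<Phi> <= (NI u. (if 0 < u then if u < a then NI e. 1;EM else 0 else 0);lborel)"
 proof (rule nn_integral_mono)
  fix u
  have "(NI e. g (u, e);EM) <= (NI e. 1;EM)" by (intro nn_integral_mono) (simp add: g_def en_le_1)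
  then show "(if 0 < u then if u < a then NI e. g (u, e);EM else 0 else 0) <= (if 0 < u then if u < a then NI e. 1;EM else 0 else 0)"
   by auto
 qed
 also have "... = ennreal (a * mE)" by (rule AE_Bm_total[OF a])
 finally have le: "?\<Phi> <= ennreal (a * mE)" .
 then obtain v where v: "?\<Phi> = ennreal v" "0 <= v" by (cases ?\<Phi>) (auto simp: top_unique)
 have "(NI y. en (f y);Xi a) = ennreal cN * ?\<Phi>"
  unfolding nn_integral_Xi[OF enf a]
  by (intro arg_cong2[where f="(*)"] refl nn_integral_cong) (simp add: g_def)
 then have 1: "(NI y. en (f y);Xi a) = ennreal (cN * v)" using cN v by (simp add: ennreal_mult)
 have 2: "(NI C. en (csum f C);XK a k) = ennreal (exp (- (a * cN * mE)) * ((cN * v) ^ k /\<^sub>R fact k))" for k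
 proof -
  have "(NI w. (if chain k 0 a w then en (csum f (coll k w)) else 0);Pk k)
    = (NI w. (if chain k 0 a w then \<Prod>i<k. g (w i) else 0);Pk k)" (is "?I = ?J")
  proof (intro nn_integral_cong, goal_cases)
   case (1 w)
   show ?case
   proof (cases "chain k 0 a w")
    case True
    then show ?thesis using chain_less_fst[OF True] by (simp add: collection_sum_coll[OF True] g_def en_sum)
   qed simp
  qed
  moreover have J: "of_nat (fact k) * ?J = ennreal v ^ k"
   using a by (simp only: chain_integral[OF g] v if_True)
  have "?J = ennreal (inverse (fact k)) * (of_nat (fact k) * ?J)"
   by (simp add: mult.assoc[symmetric] ennreal_of_nat_eq_real_of_nat ennreal_mult[symmetric])
  then have "?J = ennreal (v ^ k / fact k)" unfolding J using v by (simp add: ennreal_power ennreal_mult[symmetric] divide_inverse mult.commute)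
  moreover have "(%C. en (csum f C)) : bm (collection_space (Xi a))" using f by measurable
  ultimately show ?thesis
   using v cN by (simp add: nn_integral_XK[OF a] ennreal_mult[symmetric] power_mult_distrib divide_inverse mult_ac)
 qed
 show ?thesis
 proof (rule that[OF v(2) _ 1 2])
  have "0 <= a * mE" using a mE by simp
  with le show "v <= a * mE" unfolding v(1) by (simp add: ennreal_le_iff)
 qed
qed

text \<open>Both sides have the same Laplace functional: those of the measures \<open>XK a k\<close>
  form an exponential series in \<open>cN * v\<close>, and the prefactor accounts for the total
  mass.\<close>

theorem Exc_law:
 assumes ppp: "poisson_point_process P E (Xi a)" and a: "0 < a"
  and H: "H : bm (collection_space (Xi a))"
 shows "(NI w. H (E w);P) = (NI k. NI C. H C;XK a k;count_space UNIV)"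
proof -
 interpret P: prob_space P using ppp by (simp add: poisson_point_process_def)
 have E[measurable]: "E : P ->M collection_space (Xi a)" using ppp by (simp add: poisson_point_process_def)
 have sXK: "sets (XK a k) = sets (collection_space (Xi a))" for k by (simp add: XK_def)
 have "(NI C. H C;distr P (collection_space (Xi a)) E) = (NI k. NI C. H C;XK a k;count_space UNIV)"
 proof (rule collection_law_determined(2)[where S="Xi a"])
  show "finite_measure (distr P (collection_space (Xi a)) E)" by (rule P.finite_measure_distr) measurable
  show "finite_measure (XK a k)" for k
  proof (rule finite_measureI)
   obtain v where v: "(NI C. en (csum (%_. 0) C);XK a k) = ennreal (exp (- (a * cN * mE)) * ((cN * v) ^ k /\<^sub>R fact k))"
    using XK_laplace[OF a, of "%_. 0"] by (metis borel_measurable_const)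
   have "emeasure (XK a k) (space (XK a k)) = (NI C. en (csum (%_. 0) C);XK a k)"
    by (simp add: collection_sum_def)
   then show "emeasure (XK a k) (space (XK a k)) ~= \<infinity>" by (simp add: v)
  qed
  fix f :: "real \<times> path => ennreal" assume f: "f : bm (Xi a)"
  obtain v where v: "0 <= v" "v <= a * mE" "(NI y. en (f y);Xi a) = ennreal (cN * v)"
   "!!k. (NI C. en (csum f C);XK a k) = ennreal (exp (- (a * cN * mE)) * ((cN * v) ^ k /\<^sub>R fact k))"
   using XK_laplace[OF a f] by metis
  have one: "(NI y. 1;Xi a) = ennreal (cN * (a * mE))"
   unfolding nn_integral_Xi[OF borel_measurable_const a] AE_Bm_total[OF a]
   using a cN mE by (simp add: ennreal_mult[symmetric])
  have m: "(%y. en (f y)) : bm (Xi a)" using f by measurable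
  have "(NI y. 1 - en (f y);Xi a) = ennreal (cN * (a * mE)) - ennreal (cN * v)"
   unfolding one[symmetric] v(3)[symmetric] using m by (rule nn_integral_diff[OF borel_measurable_const]) (simp_all add: v(3) en_le_1)
  also have "... = ennreal (cN * (a * mE) - cN * v)" using v cN by (simp add: ennreal_minus)
  finally have "en (NI y. 1 - en (f y);Xi a) = ennreal (exp (- (a * cN * mE)) * exp (cN * v))"
   using v cN by (simp add: exp_add[symmetric] algebra_simps mult_left_mono)
  also have "... = (\<Sum>k. ennreal (exp (- (a * cN * mE)) * ((cN * v) ^ k /\<^sub>R fact k)))"
   using v cN by (intro suminf_ennreal_eq[symmetric] sums_mult exp_converges) auto
  finally show "(NI C. en (csum f C);distr P (collection_space (Xi a)) E)
    = (NI k. NI C. en (csum f C);XK a k;count_space UNIV)"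
   using f by (simp add: nn_integral_distr ppp_laplace[OF ppp f] v(4) nn_integral_count_space_nat)
 qed (use sXK H in simp_all)
 then show ?thesis using H by (simp add: nn_integral_distr)
qed

end

section \<open>The excursion loop: local time and measurability\<close>

lemma measurable_loop_local_time [measurable]: "(%l. ennreal (loop_local_time N z l)) : bm (loop_space N)"
proof (rule measurable_loop_spaceI)
 have "(%p. ennreal ((real N)\<^sup>2) * occ z p) : bm (restrict_space (PS N) (rooted_loops N))"
  by (intro measurable_restrict_space1) measurable
 then show "(%p. ennreal (loop_local_time N z (unroot p))) : bm (restrict_space (PS N) (rooted_loops N))"
  by (rule subst[OF measurable_cong, rotated]) (simp add: loop_local_time_unroot space_restrict_space)
qed

lemma staying_occ: "p : staying N (E - {z}) w ==> occ z p = 0"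
proof -
 assume "p : staying N (E - {z}) w"
 then have "occ z p = (NI t. 0;(lborel :: real measure))"
  unfolding occ_def staying_def by (intro nn_integral_cong) (auto simp: indicator_def)
 then show ?thesis by simp
qed

lemma snd_ipath: "snd (ipath z b k s a w) 0 = z"
 by (cases k) (auto simp: hold_def)

lemma ipath_rooted:
 assumes z: "z : grid N" and w: "!!i. i < k ==> snd (v i) : SP N"
 shows "ipath z b k s a v : rooted_loops N"
proof -
 have "ipath z b k s a v : SP N & snd (ipath z b k s a v) (fst (ipath z b k s a v)) = z"
  using w
 proof (induction k arbitrary: s)
  case (Suc k)
  let ?q = "ipath z b k (fst (v k)) a v"
  have q: "?q : SP N" "snd ?q (fst ?q) = z" using Suc by auto
  have pos: "0 < fst ?q" "0 < fst (snd (v k))" using q(1) Suc.prems[of k]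
   by (metis prod.collapse step_paths_pos lessI)+
  show ?case using q pos Suc.prems z by (auto intro!: path_append_step hold_path_step)
 qed (simp add: hold_path_step z)
 then show ?thesis by (simp add: rooted_loops_iff snd_ipath)
qed

text \<open>Only the rests at \<open>z\<close> count, and their lengths telescope along the
  clock.\<close>

lemma occ_ipath:
 assumes b: "0 < b" and z: "z : grid N"
  and w: "!!i. i < k ==> snd (v i) : SP N" "!!i. i < k ==> occ z (snd (v i)) = 0"
  and c: "chain k s a v"
 shows "occ z (ipath z b k s a v) = ennreal (b * (a - s))"
 using c w
proof (induction k arbitrary: s)
 case 0
 then show ?case using b by (simp add: occ_hold_path)
next
 case (Suc k)
 let ?q = "ipath z b k (fst (v k)) a v" and ?u = "fst (v k)"
 have q: "?q : SP N" using ipath_rooted[OF z, of k v] Suc.prems(2) by (simp add: rooted_loops_iff)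
 have IH: "occ z ?q = ennreal (b * (a - ?u))" using Suc by simp
 have lt: "s < ?u" "?u < a" using Suc.prems(1) chain_less by auto
 have "occ z (ipath z b (Suc k) s a v) = ennreal (b * (?u - s)) + (occ z (snd (v k)) + occ z ?q)"
  using q Suc.prems(2)[of k] lt b by (simp add: occ_append[where N=N] hold_path_step z path_append_step occ_hold_path)
 also have "... = ennreal (b * (a - s))"
  using Suc.prems(3)[of k] lt b by (simp add: IH ennreal_plus[symmetric] algebra_simps del: ennreal_plus)
 finally show ?case .
qed

lemma chainI:
 assumes "!!i. i < k ==> s < fst (w i) & fst (w i) < a" "!!i j. i < j ==> j < k ==> fst (w j) < fst (w i)" "s < a"
 shows "chain k s a w"
 using assms by (induction k arbitrary: s) auto

lemma coll_set: "coll k w = (%p. if p : set (map w (rev [0..<k])) then 1 else 0)"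
 by (auto simp: coll_def fun_eq_iff atLeast0LessThan)

lemma chain_sorted:
 "chain k s a w ==> sorted_wrt (%p p'. fst p < fst p') (map w (rev [0..<k]))"
 by (auto simp: sorted_wrt_iff_nth_less rev_nth intro!: chain_strict)

lemma sorted_wrt_fst_unique:
 fixes ps qs :: "('a::linorder \<times> 'b) list"
 assumes "sorted_wrt (%p p'. fst p < fst p') ps" "sorted_wrt (%p p'. fst p < fst p') qs" "set ps = set qs"
 shows "ps = qs"
proof -
 have s: "sorted_wrt (<) (map fst ps)" "sorted_wrt (<) (map fst qs)"
  using assms by (simp_all add: sorted_wrt_map)
 have "map fst ps = map fst qs"
  by (rule strict_sorted_equal[OF s(2,1)]) (simp add: assms(3))
 moreover have "inj_on fst (set ps \<union> set qs)"
  using strict_sorted_iff[THEN iffD1, OF s(1)] assms(3) by (simp add: distinct_map)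
 ultimately show ?thesis by (rule map_inj_on)
qed

lemma Xi_loop_eq:
 assumes sorted: "sorted_wrt (%p p'. fst p < fst p') ps" and C: "C = (%p. if p : set ps then 1 else 0)"
 shows "Xi_loop N z a C = unroot (insert_excursions z 0 (holding N a) (map (%(u, e). (holding N u, e)) ps))"
proof -
 let ?o = "%ps. sorted_wrt (%p p'. fst p < fst p') ps & C = (%p. if p : set ps then 1 else 0)"
 have "(THE ps. ?o ps) = ps"
 proof (rule the_equality)
  fix qs assume qs: "?o qs"
  then have "(p : set qs) = (p : set ps)" for p
   using fun_cong[OF C, of p] by (auto dest!: fun_cong[of C _ p] split: if_splits)
  then show "qs = ps" using qs sorted by (intro sorted_wrt_fst_unique) auto
 qed (use assms in simp)
 moreover have "EX ps. ?o ps" using assms by blast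
 ultimately show ?thesis unfolding Xi_loop_def Let_def by simp
qed

lemma npoints_1E:
 assumes 1: "npoints C A = 1"
 obtains y where "y : A" "C y = 1" "!!x. x : A ==> C x ~= 0 ==> x = y"
proof -
 have le: "(\<Sum>x\<in>F. ennreal_of_enat (C x)) <= 1" if "finite F" "F \<subseteq> A" for F
 proof -
  have "(\<Sum>x\<in>F. ennreal_of_enat (C x)) = (NI x. ennreal_of_enat (C x) * indicator F x;count_space UNIV)"
   using that by (simp add: nn_integral_count_space_indicator[symmetric] nn_integral_count_space_finite)
  also have "... <= npoints C A"
   unfolding npoints_def collection_sum_def using that by (intro nn_integral_mono) (auto simp: indicator_def)
  finally show ?thesis using 1 by simp
 qed
 have one: "1 <= ennreal_of_enat (C x)" if "C x ~= 0" for x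
  using that by (cases "C x") (auto simp: zero_enat_def ennreal_of_enat_enat)
 have "\<exists>y\<in>A. C y ~= 0"
 proof (rule ccontr)
  assume "~ ?thesis"
  then have "npoints C A = (NI x. 0;count_space (UNIV :: 'a set))"
   unfolding npoints_def collection_sum_def by (intro nn_integral_cong) (auto simp: indicator_def)
  then show False using 1 by simp
 qed
 then obtain y where y: "y : A" "C y ~= 0" by blast
 show ?thesis
 proof (rule that[OF y(1)])
  have "ennreal_of_enat (C y) = 1" using le[of "{y}"] one[OF y(2)] y by (intro antisym) auto
  then show "C y = 1" by (metis ennreal_of_enat_1 ennreal_of_enat_inj)
  fix x assume x: "x : A" "C x ~= 0"
  show "x = y"
  proof (rule ccontr)
   assume "x ~= y"
   then have "ennreal_of_enat (C x) + ennreal_of_enat (C y) <= 1" using le[of "{x, y}"] x y by simp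
   from order_trans[OF add_mono[OF one[OF x(2)] one[OF y(2)]] this] show False by simp
  qed
 qed
qed

context grid_excursions
begin

lemma nn_integral_PM_D'_zero:
 assumes "x : grid N" "f : bm (PS N)" "!!p. occ z p = 0 ==> f p = 0"
 shows "(NI p. f p;PM D' n x w) = 0"
proof -
 have "(NI p. f p;PM D' n x w) = (NI t. NI v. 0;src N;(lborel :: real measure))"
  unfolding nn_integral_PM[OF assms(1,2)]
  by (intro nn_integral_cong) (auto intro!: assms(3) staying_occ)
 then show ?thesis by simp
qed

text \<open>Before its final time an excursion is a path in \<open>D - {z}\<close>, and
  \<open>occ\<close> does not look at the final time.\<close>

lemma AE_EM_occ: "AE e in EM. occ z e = 0"
proof -
 let ?f = "%e. if occ z e = 0 then 0 else 1 :: ennreal"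
 have f: "?f : bm (PS N)" by measurable
 have oc: "occ z (close_excursion z e) = occ z e" for e
  unfolding occ_def by (intro nn_integral_cong) (auto simp: indicator_def)
 have "(NI e. ?f e;EM) = 0"
  unfolding nn_integral_EM[OF f] oc by (simp add: nn_integral_PA nb_grid nn_integral_PM_D'_zero f)
 then show ?thesis using f by (subst (asm) nn_integral_0_iff_AE) (auto split: if_splits)
qed

lemma AE_Pk_occ: "AE w in Pk k. \<forall>i<k. occ z (snd (w i)) = 0"
proof -
 have "AE w in Pk k. occ z (snd (w i)) = 0" if i: "i < k" for i
 proof (rule AE_I)
  let ?Z = "{e : space EM. occ z e ~= 0}"
  let ?A = "%j. if j = i then UNIV \<times> ?Z else space Bm"
  have Z: "?Z : sets EM" by measurable
  then have "?Z : null_sets EM" using AE_EM_occ by (subst (asm) AE_iff_null) auto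
  then have A0: "emeasure Bm (?A i) = 0" using Z by (simp add: EM.emeasure_pair_measure_Times null_setsD1)
  have A: "?A j : sets Bm" for j
   using pair_measureI[of UNIV lborel ?Z EM] Z sets.top[of Bm] by (simp del: space_Bm)
  show "emeasure (Pk k) (PiE {..<k} ?A) = 0"
   using i A0 A by (subst prod_Bm.emeasure_PiM) (auto intro!: prod_zero)
  show "PiE {..<k} ?A : sets (Pk k)" using A by (intro sets_PiM_I_finite) auto
  show "{w : space (Pk k). ~ occ z (snd (w i)) = 0} \<subseteq> PiE {..<k} ?A"
   by (auto simp: space_PiM PiE_iff mem_Times_iff extensional_def split: if_splits)
 qed
 then have "AE w in Pk k. \<forall>i\<in>{..<k}. occ z (snd (w i)) = 0" by (intro AE_finite_allI) auto
 then show ?thesis by (rule eventually_mono) auto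
qed

lemma loop_measure_D'_llt: "(NI l. k l;loop_measure N D') = 0"
 if k: "k : bm (loop_space N)" "!!l. loop_local_time N z l <= 0 ==> k l = 0"
proof -
 have D'g: "D' \<subseteq> grid N" using D by auto
 have "loop_fun N k p / ennreal (fst p) = 0" if "occ z p = 0" for p
 proof (cases "p : rooted_loops N")
  case True
  then have "loop_local_time N z (unroot p) <= 0"
   using loop_local_time_unroot[OF True, of z] \<open>occ z p = 0\<close> by (simp add: ennreal_eq_0_iff)
  then show ?thesis by (simp add: loop_fun_def k(2))
 qed (simp add: loop_fun_def)
 then have "(NI p. loop_fun N k p / ennreal (fst p);PM D' n x x) = 0" if "x : D'" for x n
  using that D'g k(1) by (intro nn_integral_PM_D'_zero) auto
 then have "(NI x. NI p. loop_fun N k p / ennreal (fst p);PM D' n x x;count_space D') = (NI x. 0;count_space D')" for n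
  by (intro nn_integral_cong) simp
 then show ?thesis unfolding nn_integral_loop_measure[OF D'g k(1)] by simp
qed

lemma insert_excursions_ipath:
 "chain k s a w ==> insert_excursions z (holding N s) (holding N a) (map (%(u, e). (holding N u, e)) (map w (rev [0..<k])))
  = ipath z bN k s a w"
proof (induction k arbitrary: s)
 case (Suc k)
 then have lt: "s < fst (w k)" by simp
 show ?case using Suc lt bN
  by (simp add: case_prod_unfold hold_def holding_eq right_diff_distrib[symmetric])
qed (use bN in \<open>auto simp: hold_def holding_eq right_diff_distrib[symmetric]\<close>)

lemma Xi_loop_coll:
 assumes "chain k 0 a w"
 shows "Xi_loop N z a (coll k w) = unroot (ipath z bN k 0 a w)"
 using Xi_loop_eq[OF chain_sorted[OF assms] coll_set] insert_excursions_ipath[OF assms]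
 by (simp add: holding_eq)


lemma nn_integral_Xi_loop_coll:
 assumes "!!i. i < k ==> snd (w i) : SP N"
 shows "loop_fun N h (ipath z bN k 0 a w) = h (unroot (ipath z bN k 0 a w))"
 using ipath_rooted[OF zg assms] by (simp add: loop_fun_def)

lemma id_Xi: "(%y. y) : Xi a ->M borel ** PS N"
proof -
 let ?E = "scale_measure (ennreal (2 * pi)) (scale_measure (ennreal ((ln (real N) / (2 * pi))\<^sup>2)) EM)"
 have Xi: "Xi a = restrict_space lborel {0<..<a} ** ?E"
  by (simp add: Xi_intensity_def normalized_excursion_measure_def EM_def)
 have sE: "sets ?E = sets (PS N)" by simp
 have "fst : Xi a ->M restrict_space lborel {0<..<a}" unfolding Xi by (rule measurable_fst)
 then have 1: "fst : bm (Xi a)"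
  by (rule measurable_compose[where g="%x. x"]) (simp add: measurable_restrict_space1)
 have "snd : Xi a ->M ?E" unfolding Xi by (rule measurable_snd)
 then have "snd : Xi a ->M PS N" unfolding measurable_cong_sets[OF refl sE] .
 from measurable_Pair[OF 1 this] show ?thesis by (simp only: prod.collapse)
qed

text \<open>The levels in \<open>q\<close> are meant to decrease, so that strip \<open>i\<close>
  isolates the point with index \<open>i\<close> of a chain.\<close>

definition slab :: "real => real list => nat => (real \<times> path) set" where
 "slab a q i = {y : space (Xi a). q ! Suc i < fst y & fst y <= q ! i}"

lemma sets_slab: "slab a q i : sets (Xi a)"
proof -
 have [measurable]: "fst : bm (Xi a)" using measurable_compose[OF id_Xi measurable_fst] .
 have "{y : space (Xi a). q ! Suc i < fst y & fst y <= q ! i} : sets (Xi a)" by measurable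
 then show ?thesis by (simp only: slab_def)
qed

text \<open>With rational levels there are countably many such events, and together they cover the
  collections that have an ordered enumeration. On each of them the points can be picked out
  measurably, strip by strip.\<close>

definition separated :: "real => real list => (real \<times> path) collection set" where
 "separated a q = {C : collections (Xi a). npoints C (space (Xi a)) = of_nat (length q - 1) &
   (\<forall>i<length q - 1. npoints C (slab a q i) = 1)}"

definition nth_point :: "real => real list => (real \<times> path) collection => nat => real \<times> path" where
 "nth_point a q C i = (THE y. y : slab a q i & C y ~= 0)"

lemma nth_point:
 assumes "npoints C (slab a q i) = 1"
 shows "nth_point a q C i : slab a q i" "C (nth_point a q C i) = 1"
  "!!y. y : slab a q i ==> C y ~= 0 ==> y = nth_point a q C i"
proof -
 obtain y where y: "y : slab a q i" "C y = 1" "!!x. x : slab a q i ==> C x ~= 0 ==> x = y"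
  using npoints_1E[OF assms] by metis
 have "nth_point a q C i = y"
  unfolding nth_point_def
 proof (rule the_equality)
  show "y : slab a q i & C y ~= 0" using y(1,2) by simp
 qed (use y(3) in blast)
 then show "nth_point a q C i : slab a q i" "C (nth_point a q C i) = 1"
  "!!y. y : slab a q i ==> C y ~= 0 ==> y = nth_point a q C i"
  using y by blast+
qed

text \<open>On the separated event the selected point lies in \<open>B\<close> exactly when
  \<open>B\<close> meets the strip in a collection with one point, which is an event about
  counts.\<close>

lemma measurable_nth_point:
 assumes i: "i < length q - 1"
 shows "(%C. nth_point a q C i) : restrict_space (collection_space (Xi a)) (separated a q) ->M borel ** PS N"
  (is "?f : ?S ->M ?B")
proof (rule measurableI)
 have sp: "C : space ?S ==> npoints C (slab a q i) = 1" for C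
  using i by (auto simp: space_restrict_space separated_def)
 show "?f C : space ?B" if "C : space ?S" for C
  using nth_point(1)[OF sp[OF that]] by (auto simp: slab_def space_pair_measure mem_Times_iff)
 fix B assume B: "B : sets ?B"
 have B': "B \<inter> slab a q i : sets (Xi a)"
 proof -
  have "B \<inter> slab a q i = ((%y. y) -` B \<inter> space (Xi a)) \<inter> slab a q i"
   by (auto simp: slab_def simp del: space_Xi)
  then show ?thesis using measurable_sets[OF id_Xi B] sets_slab by (metis sets.Int)
 qed
 have "?f -` B \<inter> space ?S = {C : space ?S. npoints C (B \<inter> slab a q i) = 1}"
 proof (intro set_eqI iffI; clarsimp)
  fix C assume C: "C : space ?S"
  note np = nth_point[OF sp[OF C]]
  show "npoints C (B \<inter> slab a q i) = 1" if "?f C : B"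
  proof -
   have "npoints C (B \<inter> slab a q i) = npoints C (slab a q i)"
    unfolding npoints_def collection_sum_def
   proof (rule nn_integral_cong)
    fix y show "ennreal_of_enat (C y) * indicator (B \<inter> slab a q i) y = ennreal_of_enat (C y) * indicator (slab a q i) y"
     using np(3)[of y] that by (cases "C y = 0") (auto simp: indicator_def)
   qed
   then show ?thesis using sp[OF C] by simp
  qed
  show "?f C : B" if 1: "npoints C (B \<inter> slab a q i) = 1"
  proof -
   obtain y where "y : B \<inter> slab a q i" "C y = 1" using npoints_1E[OF 1] by metis
   then show ?thesis using np(3)[of y] by auto
  qed
 qed
 also have "... : sets ?S"
 proof -
  have "(%C. npoints C (B \<inter> slab a q i)) : bm ?S"
   by (intro measurable_restrict_space1 measurable_npoints B')
  then show ?thesis by measurable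
 qed
 finally show "?f -` B \<inter> space ?S : sets ?S" .
qed

lemma separated_coll:
 assumes C: "C : separated a q" and q: "sorted_wrt (>) q" and a: "0 < a"
 shows "chain (length q - 1) 0 a (nth_point a q C)" "C = coll (length q - 1) (nth_point a q C)"
proof -
 let ?k = "length q - 1" and ?y = "nth_point a q C"
 have np: "npoints C (slab a q i) = 1" if "i < ?k" for i using C that by (simp add: separated_def)
 note n = nth_point[OF np]
 have y: "q ! Suc i < fst (?y i)" "fst (?y i) <= q ! i" "0 < fst (?y i)" "fst (?y i) < a" if "i < ?k" for i
  using n(1)[OF that] by (auto simp: slab_def mem_Times_iff)
 have dec: "q ! j <= q ! Suc i" if "i < j" "j < length q" for i j
  using that sorted_wrt_nth_less[OF q, of "Suc i" j] by (cases "Suc i = j") auto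
 show "chain ?k 0 a ?y"
 proof (rule chainI[OF _ _ a])
  show "fst (?y j) < fst (?y i)" if "i < j" "j < ?k" for i j
   using y(1)[of i] y(2)[of j] dec[of i j] that by linarith
 qed (use y in auto)
 have one: "(\<Sum>i<?k. indicator (slab a q i) x) <= (1::ennreal)" for x
 proof (cases "\<exists>i<?k. x : slab a q i")
  case True
  then obtain i where i: "i < ?k" "x : slab a q i" by blast
  have "x ~: slab a q j" if "j < ?k" "j ~= i" for j
  proof
   assume "x : slab a q j"
   then have "q ! Suc i < fst x" "fst x <= q ! i" "q ! Suc j < fst x" "fst x <= q ! j"
    using i(2) by (simp_all add: slab_def)
   moreover have "i < length q" "j < length q" "i < j | j < i" using i(1) that by auto
   ultimately show False using dec[of i j] dec[of j i] by linarith
  qed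
  then have "(\<Sum>j<?k. indicator (slab a q j) x) = (\<Sum>j<?k. if j = i then 1 else 0 :: ennreal)"
   using i by (intro sum.cong) auto
  then show ?thesis by simp
 qed (simp add: indicator_def)
 have in_slab: "\<exists>i<?k. x : slab a q i" if x: "C x ~= 0" for x
 proof (rule ccontr)
  assume no: "~ ?thesis"
  have xs: "x : space (Xi a)" using C x by (auto simp: separated_def collections_def)
  \<comment> \<open>A point outside all strips would be counted in addition to the \<open>?k\<close>
    points inside them and exceed the prescribed total.\<close>
  have "of_nat ?k + npoints C {x} = csum (%x'. (\<Sum>i<?k. indicator (slab a q i) x') + indicator {x} x') C"
   using np by (simp add: collection_sum_add collection_sum_sum npoints_def[symmetric])
  also have "... <= npoints C (space (Xi a))"
   unfolding npoints_def collection_sum_def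
  proof (intro nn_integral_mono mult_left_mono)
   fix x'
   show "(\<Sum>i<?k. indicator (slab a q i) x') + indicator {x} x' <= (indicator (space (Xi a)) x' :: ennreal)"
   proof (cases "x' = x")
    case True
    then show ?thesis using no xs by (simp add: indicator_def)
   next
    case False
    show ?thesis
    proof (cases "x' : space (Xi a)")
     case True
     then show ?thesis using one[of x'] False by (simp del: space_Xi)
    qed (simp add: False slab_def indicator_def)
   qed
  qed simp
  also have "... = of_nat ?k + 0" using C by (simp add: separated_def)
  finally have "npoints C {x} = 0" unfolding ennreal_add_left_cancel_le by simp
  then show False using x unfolding npoints_def collection_sum_def
   by (cases "C x") (auto simp: nn_integral_0_iff_AE AE_count_space ennreal_of_enat_enat zero_enat_def)
 qed
 show "C = coll ?k ?y"
 proof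
  fix x show "C x = coll ?k ?y x"
  proof (cases "C x = 0")
   case True
   then show ?thesis using n(2) by (auto simp: coll_def)
  next
   case False
   then obtain i where i: "i < ?k" "x : slab a q i" using in_slab by blast
   from n(3)[OF i False] n(2)[OF i(1)] have "C x = 1" "x : ?y ` {..<?k}" using i(1) by (metis, blast)
   then show ?thesis by (simp add: coll_def)
  qed
 qed
qed

text \<open>A rational fits between any two consecutive readings and between the extreme readings
  and the ends 0 and \<open>a\<close>: \<open>k + 1\<close> levels for \<open>k\<close>
  points.\<close>

lemma coll_separated:
 assumes c: "chain k 0 a v" and w: "!!i. i < k ==> snd (v i) : SP N"
 obtains q where "set q \<subseteq> \<rat>" "sorted_wrt (>) q" "q ~= []" "coll k v : separated a q"
proof -
 let ?t = "%i. if i < k then fst (v i) else 0" and ?u = "%i. if i = 0 then a else fst (v (i - 1))"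
 note lf = chain_less_fst[OF c] and st = chain_strict[OF c]
 have "\<exists>r\<in>\<rat>. ?t i < r & r < ?u i" if "i <= k" for i
  using that lf[of i] lf[of "i - 1"] chain_less[OF c] st[of "i - 1" i] by (intro Rats_dense_in_real) auto
 then obtain r where r: "!!i. i <= k ==> r i : \<rat>" "!!i. i <= k ==> ?t i < r i" "!!i. i <= k ==> r i < ?u i" by metis
 have le: "fst (v j) <= fst (v i)" if "i <= j" "j < k" for i j
  using st[of i j] that by (cases "i = j") auto
 have dec: "r j < r i" if "i < j" "j <= k" for i j
 proof -
  have "i <= j - 1" "j - 1 < k" "j ~= 0" "i < k" using that by auto
  then show ?thesis using r(3)[of j] r(2)[of i] le[of i "j - 1"] that by simp
 qed
 let ?q = "map r [0..<Suc k]"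
 have q: "?q ! i = r i" if "i <= k" for i using that by (simp add: nth_map del: upt_Suc)
 have sp: "v i : space (Xi a)" if "i < k" for i using lf[OF that] w[OF that] by (simp add: mem_Times_iff)
 have supp: "{x. coll k v x ~= 0} = v ` {..<k}" by (auto simp: coll_def)
 have "coll k v : separated a ?q"
  unfolding separated_def
 proof (intro CollectI conjI allI impI)
  show "coll k v : collections (Xi a)" using sp by (simp add: collections_def supp image_subset_iff del: space_Xi)
  show "npoints (coll k v) (space (Xi a)) = of_nat (length ?q - 1)"
   using sp unfolding npoints_def by (simp add: collection_sum_coll[OF c] del: space_Xi)
  fix i assume "i < length ?q - 1"
  then have i: "i < k" by simp
  have "v j : slab a ?q i \<longleftrightarrow> j = i" if j: "j < k" for j
  proof -
   have "v j : slab a ?q i \<longleftrightarrow> r (Suc i) < fst (v j) & fst (v j) <= r i"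
    using sp[OF j] i q[of i] q[of "Suc i"] by (simp add: slab_def del: space_Xi upt_Suc)
   also have "... \<longleftrightarrow> j = i"
   proof (cases i j rule: linorder_cases)
    case equal
    then show ?thesis using r(2)[of i] r(3)[of "Suc i"] i by simp
   next
    case less
    then have "fst (v j) < r (Suc i)" using r(2)[of "Suc i"] le[of "Suc i" j] j i by (simp split: if_splits)
    then show ?thesis using less by auto
   next
    case greater
    then have "j <= i - 1" "i - 1 < k" "i ~= 0" using i by auto
    then have "r i < fst (v j)" using r(3)[of i] le[of j "i - 1"] i by simp
    then show ?thesis using greater by auto
   qed
   finally show ?thesis .
  qed
  then have "(\<Sum>j<k. indicator (slab a ?q i) (v j)) = (\<Sum>j<k. if j = i then 1 else 0 :: ennreal)"
   by (intro sum.cong) (auto simp del: upt_Suc)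
  then show "npoints (coll k v) (slab a ?q i) = 1"
   using i unfolding npoints_def by (simp add: collection_sum_coll[OF c] del: upt_Suc)
 qed
 moreover have "set ?q \<subseteq> \<rat>" using r(1) by (auto simp: less_Suc_eq_le)
 moreover have "sorted_wrt (>) ?q"
  unfolding sorted_wrt_map by (rule sorted_wrt_mono_rel[OF _ sorted_wrt_upt]) (auto intro!: dec simp: less_Suc_eq_le simp del: upt_Suc)
 ultimately show ?thesis by (intro that) auto
qed

text \<open>Without a separating list of levels there is no ordered enumeration, so
  \<open>Xi_loop\<close> falls back to the empty list of excursions.\<close>

lemma Xi_loop_eq_hold:
 assumes C: "C : collections (Xi a)" and a: "0 < a"
  and no: "!!q. set q \<subseteq> \<rat> ==> sorted_wrt (>) q ==> q ~= [] ==> C ~: separated a q"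
 shows "Xi_loop N z a C = unroot (hold z (bN * a))"
proof -
 have "~ (sorted_wrt (%p p'. fst p < fst p') ps & C = (%p. if p : set ps then 1 else 0))" for ps
 proof (rule notI, elim conjE)
  assume ps: "sorted_wrt (%p p'. fst p < fst p') ps" "C = (%p. if p : set ps then 1 else 0)"
  define \<omega> where "\<omega> i = ps ! (length ps - Suc i)" for i
  have "{x. C x ~= 0} = set ps" unfolding ps(2) by (simp add: set_eq_iff)
  then have "set ps \<subseteq> space (Xi a)" using C by (simp add: collections_def)
  then have sp: "\<omega> i : space (Xi a)" if "i < length ps" for i using that by (auto simp: \<omega>_def simp del: space_Xi)
  have "chain (length ps) 0 a \<omega>"
  proof (rule chainI[OF _ _ a])
   show "fst (\<omega> j) < fst (\<omega> i)" if "i < j" "j < length ps" for i j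
    unfolding \<omega>_def using that by (intro sorted_wrt_nth_less[OF ps(1)]) auto
  qed (use sp in \<open>auto simp: mem_Times_iff\<close>)
  moreover have "snd (\<omega> i) : SP N" if "i < length ps" for i
   using sp[OF that] by (simp add: mem_Times_iff)
  moreover have "C = coll (length ps) \<omega>"
  proof -
   have "\<omega> ` {..<length ps} = set ps"
   proof -
    have "\<omega> i = rev ps ! i" if "i < length ps" for i using that by (simp add: \<omega>_def rev_nth)
    then have "\<omega> ` {..<length ps} = (!) (rev ps) ` {..<length (rev ps)}" by (auto simp: image_iff)
    also have "... = set ps" by (simp add: nth_image[of "length (rev ps)" "rev ps", simplified] atLeast0LessThan[symmetric])
    finally show ?thesis .
   qed
   then show ?thesis by (simp add: ps(2) coll_def)
  qed
  ultimately show False using coll_separated[of "length ps" a \<omega>] no by metis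
 qed
 then have "~ (EX ps. sorted_wrt (%p p'. fst p < fst p') ps & C = (%p. if p : set ps then 1 else 0))" by blast
 then show ?thesis using a bN unfolding Xi_loop_def Let_def by (simp only: if_not_P) (simp add: hold_def holding_eq)
qed

text \<open>\<open>Xi_loop\<close> is defined by a description operator, so measurability is
  obtained piecewise: on countably many separated events, where the points are explicit, and on the
  rest, where the loop is constant.\<close>

theorem measurable_Xi_loop:
 assumes a: "0 < a"
 shows "Xi_loop N z a : collection_space (Xi a) ->M loop_space N"
proof -
 let ?S = "collection_space (Xi a)"
 let ?Q = "{q. set q \<subseteq> \<rat> & sorted_wrt (>) q & q ~= []}"
 have cQ: "countable ?Q"
  by (rule countable_subset[of _ "lists \<rat>"]) (auto simp: countable_rat intro!: countable_lists)
 have sep: "separated a q : sets ?S" for q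
 proof -
  have "{C : space ?S. npoints C (space (Xi a)) = of_nat (length q - 1) & (\<forall>i<length q - 1. npoints C (slab a q i) = 1)} : sets ?S"
  proof -
   note [measurable] = sets_slab
   show ?thesis by measurable
  qed
  then show ?thesis by (simp add: separated_def)
 qed
 let ?O = "space ?S - (\<Union>q\<in>?Q. separated a q)"
 have O: "?O : sets ?S" using sep cQ by (intro sets.Diff sets.top sets.countable_UN'') auto
 show ?thesis
 proof (rule measurable_piecewise_restrict[where C="insert ?O (separated a ` ?Q)"])
  show "countable (insert ?O (separated a ` ?Q))" by (intro countable_insert countable_image cQ)
  show "\<Omega> \<inter> space ?S : sets ?S" if "\<Omega> : insert ?O (separated a ` ?Q)" for \<Omega>
   using that O sep by (intro sets.Int sets.top) auto
  show "space ?S \<subseteq> \<Union> (insert ?O (separated a ` ?Q))" by auto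
  fix \<Omega> assume "\<Omega> : insert ?O (separated a ` ?Q)"
  then consider "\<Omega> = ?O" | q where "q : ?Q" "\<Omega> = separated a q" by auto
  then show "Xi_loop N z a : restrict_space ?S \<Omega> ->M loop_space N"
  proof cases
   case 1
   have "Xi_loop N z a C = unroot (hold z (bN * a))" if "C : space (restrict_space ?S \<Omega>)" for C
    using that 1 by (intro Xi_loop_eq_hold a) (auto simp: space_restrict_space)
   moreover have "unroot (hold z (bN * a)) : space (loop_space N)"
    by (auto simp: rooted_loops_iff hold_path_step zg)
   ultimately show ?thesis by (subst measurable_cong) auto
  next
   case 2
   let ?k = "length q - 1"
   have q: "sorted_wrt (>) q" "q ~= []" using 2 by auto
   have sp: "C : separated a q" if "C : space (restrict_space ?S \<Omega>)" for C
    using that 2 by (auto simp: space_restrict_space)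
   have nm: "(%C. nth_point a q C i) : restrict_space ?S \<Omega> ->M borel ** PS N" if "i < ?k" for i
    using measurable_nth_point[OF that] 2 by simp
   have "(%C. ipath z bN ?k 0 a (nth_point a q C)) : restrict_space ?S \<Omega> ->M PS N"
    by (rule measurable_ipath[OF nm _ _ zg]) simp_all
   moreover have "ipath z bN ?k 0 a (nth_point a q C) : rooted_loops N" if "C : space (restrict_space ?S \<Omega>)" for C
    using measurable_space[OF nm that] by (intro ipath_rooted zg) (auto simp: space_pair_measure mem_Times_iff)
   ultimately have "(%C. ipath z bN ?k 0 a (nth_point a q C)) : restrict_space ?S \<Omega> ->M restrict_space (PS N) (rooted_loops N)"
    by (intro measurable_restrict_space2) auto
   from measurable_compose[OF this measurable_unroot]
   have "(%C. unroot (ipath z bN ?k 0 a (nth_point a q C))) : restrict_space ?S \<Omega> ->M loop_space N" .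
   then show ?thesis
   proof (rule subst[OF measurable_cong, rotated])
    fix C assume "C : space (restrict_space ?S \<Omega>)"
    note sc = separated_coll[OF sp[OF this] q(1) a]
    show "unroot (ipath z bN ?k 0 a (nth_point a q C)) = Xi_loop N z a C"
     using Xi_loop_coll[OF sc(1)] sc(2) by simp
   qed
  qed
 qed
qed


text \<open>The expectation of \<open>k\<close> at the excursion loop, as a series over fixed
  product spaces. The spaces that carry the Poisson processes for different \<open>a\<close> are
  unrelated; in this form measurability in \<open>a\<close> can be proved.\<close>

definition Qn :: "real => (loop => ennreal) => ennreal" where
 "Qn a k = (\<Sum>n. NI C. k (Xi_loop N z a C);XK a n)"

lemma Qn_eq:
 assumes "poisson_point_process P E (Xi a)" "0 < a" and k: "k : bm (loop_space N)"
 shows "(NI w. k (Xi_loop N z a (E w));P) = Qn a k"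
 unfolding Qn_def nn_integral_count_space_nat[symmetric]
 by (rule Exc_law[OF assms(1,2)]) (rule measurable_compose[OF measurable_Xi_loop[OF assms(2)] k])

lemma Qn_ipath:
 assumes "0 < a" and k: "k : bm (loop_space N)"
 shows "Qn a k = (\<Sum>n. ennreal (exp (- (a * cN * mE)) * cN ^ n) *
  (NI w. (if chain n 0 a w then loop_fun N k (ipath z bN n 0 a w) else 0);Pk n))"
 unfolding Qn_def
proof (rule suminf_cong)
 fix n
 have "(NI w. (if chain n 0 a w then k (Xi_loop N z a (coll n w)) else 0);Pk n)
   = (NI w. (if chain n 0 a w then loop_fun N k (ipath z bN n 0 a w) else 0);Pk n)"
  by (intro nn_integral_cong)
   (simp add: Xi_loop_coll nn_integral_Xi_loop_coll space_PiM PiE_iff mem_Times_iff)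
 then show "(NI C. k (Xi_loop N z a C);XK a n) = ennreal (exp (- (a * cN * mE)) * cN ^ n) *
   (NI w. (if chain n 0 a w then loop_fun N k (ipath z bN n 0 a w) else 0);Pk n)"
  using nn_integral_XK[OF assms(1) measurable_compose[OF measurable_Xi_loop[OF assms(1)] k], of n] by simp
qed

lemma measurable_chain_integral:
 assumes F: "F : bm (PS N)"
 shows "(%a. NI w. (if chain n 0 a w then F (ipath z bN n 0 a w) else 0);Pk n) : bm lborel"
proof (rule sigma_finite_measure.borel_measurable_nn_integral[OF sigma_finite_Pk], unfold case_prod_unfold)
 have c: "(%y. snd y i) : lborel ** Pk n ->M borel ** PS N" if "i < n" for i
  by (rule measurable_compose[OF measurable_snd measurable_Pk_component[OF that]])
 show "(%y. if chain n 0 (fst y) (snd y) then F (ipath z bN n 0 (fst y) (snd y)) else 0) : bm (lborel ** Pk n)"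
  by (intro measurable_If predE measurable_chain[where N=N] measurable_compose[OF measurable_ipath F] zg) (simp_all add: c)
qed

lemma measurable_Qn [measurable]:
 assumes k: "k : bm (loop_space N)"
 shows "(%a. if 0 < a then Qn a k else 0) : bm borel"
proof -
 have [measurable]: "(%a. NI w. (if chain n 0 a w then loop_fun N k (ipath z bN n 0 a w) else 0);Pk n) : bm borel" for n
  using measurable_chain_integral[OF measurable_loop_fun[OF k], of n] by simp
 have "(%a. if 0 < a then Qn a k else 0) = (%a. if 0 < a then \<Sum>n. ennreal (exp (- (a * cN * mE)) * cN ^ n) *
   (NI w. (if chain n 0 a w then loop_fun N k (ipath z bN n 0 a w) else 0);Pk n) else 0)"
  by (auto simp: Qn_ipath[OF _ k])
 then show ?thesis by simp
qed

text \<open>Time \<open>bN a\<close> spent at \<open>z\<close> turns the rooting weight \<open>1 / occ\<close> into \<open>1 / a\<close>; the factor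
 \<open>exp (- 4 N\<^sup>2 bN a)\<close> of the holding times absorbs the normalisation of the Poisson process.\<close>

theorem loop_measure_Qn:
 assumes k: "k : bm (loop_space N)"
 shows "(NI l. k l;loop_measure N D) = (NI l. k l;loop_measure N D')
  + (NI a. (if 0 < a then ennreal (exp (- (cN * (4 - mE) * a)) / a) * Qn a k else 0);lborel)"
proof -
 let ?F = "%p. loop_fun N k p / occ z p"
 have F: "?F : bm (PS N)" using k by measurable
 let ?I = "%n a. NI v. (if chain n 0 a v then loop_fun N k (ipath z bN n 0 a v) else 0);Pk n"
 let ?w = "%n a. ennreal (exp (- (a * cN * mE)) * cN ^ n)"
 have "(NI p. ?F p;PA D z z) = (\<Sum>n. NI p. ?F p;XP n 0)"
  unfolding nn_integral_count_space_nat[symmetric] by (rule PA_XP[OF F])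
 also have "... = (\<Sum>n. NI a. (if 0 < a then ennreal (exp (- (cN * (4 - mE) * a)) / a) * (?w n a * ?I n a) else 0);lborel)"
  unfolding nn_integral_XP[OF F]
 proof (intro suminf_cong nn_integral_cong)
  fix n :: nat and a :: real
  show "(NI v. (if chain n 0 a v then wgt n 0 a * ?F (ipath z bN n 0 a v) else 0);Pk n)
   = (if 0 < a then ennreal (exp (- (cN * (4 - mE) * a)) / a) * (?w n a * ?I n a) else 0)"
  proof (cases "0 < a")
   case True
   \<comment> \<open>Here \<open>4 * N^2 * bN = 4 * cN = cN * (4 - mE) + cN * mE\<close>: the first
     part is the rate of the loops through \<open>z\<close>, the second normalises the Poisson
     process.\<close>
   have w: "wgt n 0 a * (x / ennreal (bN * a)) = ennreal (exp (- (cN * (4 - mE) * a)) / a) * (?w n a * x)" for x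
   proof -
    have "wgt n 0 a = ennreal (exp (- (cN * (4 - mE) * a)) / a * (exp (- (a * cN * mE)) * cN ^ n)) * ennreal (bN * a)"
     using True bN cN unfolding wgt_def
     by (subst ennreal_mult[symmetric]) (auto simp: cN_bN exp_add[symmetric] algebra_simps intro!: arg_cong[where f=ennreal])
    then have "wgt n 0 a * (x / ennreal (bN * a)) = ennreal (exp (- (cN * (4 - mE) * a)) / a * (exp (- (a * cN * mE)) * cN ^ n)) * (ennreal (bN * a) * x / ennreal (bN * a))"
     by (simp add: mult.assoc ennreal_times_divide)
    also have "ennreal (bN * a) * x / ennreal (bN * a) = x"
     using True bN by (subst mult.commute) (simp add: ennreal_mult_divide_eq)
    finally show ?thesis using True cN by (subst (asm) ennreal_mult) (simp_all only: mult.assoc, simp_all)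
   qed
   have m: "(%v. if chain n 0 a v then loop_fun N k (ipath z bN n 0 a v) else 0) : bm (Pk n)"
    by (intro measurable_If predE measurable_chain[where N=N] measurable_compose[OF measurable_ipath measurable_loop_fun[OF k]] zg) simp_all
   have "(NI v. (if chain n 0 a v then wgt n 0 a * ?F (ipath z bN n 0 a v) else 0);Pk n)
    = (NI v. ennreal (exp (- (cN * (4 - mE) * a)) / a) * (?w n a * (if chain n 0 a v then loop_fun N k (ipath z bN n 0 a v) else 0));Pk n)"
   proof (rule nn_integral_cong_AE)
    show "AE v in Pk n. (if chain n 0 a v then wgt n 0 a * ?F (ipath z bN n 0 a v) else 0)
     = ennreal (exp (- (cN * (4 - mE) * a)) / a) * (?w n a * (if chain n 0 a v then loop_fun N k (ipath z bN n 0 a v) else 0))"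
     using AE_Pk_occ AE_space
    proof eventually_elim
     case (elim v)
     show ?case
     proof (cases "chain n 0 a v")
      case True
      have "occ z (ipath z bN n 0 a v) = ennreal (bN * (a - 0))"
       using elim by (intro occ_ipath[OF bN zg _ _ True]) (auto simp: space_PiM PiE_iff mem_Times_iff)
      then show ?thesis using True w by simp
     qed simp
    qed
   qed
   also have "... = ennreal (exp (- (cN * (4 - mE) * a)) / a) * (?w n a * ?I n a)"
    using m by (simp add: nn_integral_cmult)
   finally show ?thesis using True by simp
  next
   case False
   then have "~ chain n 0 a v" for v using chain_less by blast
   then show ?thesis using False by simp
  qed
 qed
 also have "... = (NI a. (\<Sum>n. if 0 < a then ennreal (exp (- (cN * (4 - mE) * a)) / a) * (?w n a * ?I n a) else 0);lborel)"
 proof (rule nn_integral_suminf[symmetric])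
  fix n
  have [measurable]: "?I n : bm lborel" by (rule measurable_chain_integral[OF measurable_loop_fun[OF k]])
  show "(%a. if 0 < a then ennreal (exp (- (cN * (4 - mE) * a)) / a) * (?w n a * ?I n a) else 0) : bm lborel"
   by measurable
 qed
 also have "... = (NI a. (if 0 < a then ennreal (exp (- (cN * (4 - mE) * a)) / a) * Qn a k else 0);lborel)"
  by (intro nn_integral_cong) (simp add: Qn_ipath[OF _ k] ennreal_suminf_cmult)
 finally show ?thesis using loop_measure_split[OF D z k] by simp
qed

text \<open>Expresses that the local time at \<open>z\<close> of the excursion loop is almost surely
  \<open>cN * a\<close>, in a form that refers to no probability space.\<close>

lemma Qn_llt:
 assumes a: "0 < a" and k: "k : bm (loop_space N)"
  and 0: "!!l. ennreal (loop_local_time N z l) = ennreal (cN * a) ==> k l = 0"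
 shows "Qn a k = 0"
proof -
 have "(NI v. (if chain n 0 a v then loop_fun N k (ipath z bN n 0 a v) else 0);Pk n) = (NI v. 0;Pk n)" for n
 proof (rule nn_integral_cong_AE)
  show "AE v in Pk n. (if chain n 0 a v then loop_fun N k (ipath z bN n 0 a v) else 0) = 0"
   using AE_Pk_occ AE_space
  proof eventually_elim
   case (elim v)
   show ?case
   proof (cases "chain n 0 a v")
    case True
    have w: "!!i. i < n ==> snd (v i) : SP N" using elim by (auto simp: space_PiM PiE_iff mem_Times_iff)
    have "occ z (ipath z bN n 0 a v) = ennreal (bN * (a - 0))"
     using elim by (intro occ_ipath[OF bN zg w _ True]) auto
    then have "ennreal (loop_local_time N z (unroot (ipath z bN n 0 a v))) = ennreal (cN * a)"
     using bN a by (subst loop_local_time_unroot[OF ipath_rooted[OF zg w]]) (auto simp: cN_bN ennreal_mult[symmetric] mult.assoc)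
    then show ?thesis by (simp add: loop_fun_def 0)
   qed simp
  qed
 qed
 then show ?thesis unfolding Qn_ipath[OF a k] by simp
qed

end

section \<open>Ranked sequences and Laplace transforms on the line\<close>

lemma ranked_set_attained:
 fixes x :: "nat => real"
 assumes "0 < t" "n < card {i. t <= x i}"
 obtains j where "t <= x j" "n < card {i. x j <= x i}"
proof -
 let ?F = "{i. t <= x i}"
 have "0 < card ?F" using assms(2) by simp
 then have fin: "finite ?F" and ne: "?F ~= {}" unfolding card_gt_0_iff by auto
 have "Min (x ` ?F) : x ` ?F" using fin ne by (intro Min_in) auto
 then obtain j where j: "j : ?F" "x j = Min (x ` ?F)" by auto
 have "{i. x j <= x i} = ?F" using j(1) fin by (auto simp: j(2) intro: order_trans)
 then show ?thesis using that j(1) assms(2) by auto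
qed

text \<open>The supremum runs over all real \<open>t\<close>; by \<open>ranked_set_attained\<close>
  only the terms of the sequence matter, so that exceeding a level is a countable condition.\<close>

lemma measurable_ranked [measurable]: "ranked : (\<Pi>\<^sub>M i\<in>UNIV. borel) ->M (\<Pi>\<^sub>M i\<in>UNIV. borel)"
proof (rule measurable_PiM_single')
 fix n :: nat
 let ?P = "\<Pi>\<^sub>M i\<in>(UNIV::nat set). (borel :: real measure)"
 let ?T = "%x. {t. 0 < t & n < card {i. t <= x i}}"
 \<comment> \<open>The unspecified value of \<open>ranked\<close> at sequences for which no
   \<open>t\<close> qualifies.\<close>
 let ?c = "Sup {} :: real"
 have [measurable]: "(%x. x i) : bm ?P" for i by (rule measurable_component_singleton) simp
 have pj[measurable]: "(%x. card {i. x j <= x i}) : ?P ->M count_space UNIV" for j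
 proof (rule measurable_card)
  have "{x : space ?P. x j <= x i} : sets ?P" for i by (rule borel_measurable_le) measurable
  then show "{x : space ?P. i : {i. x j <= x i}} : sets ?P" for i by simp
 qed
 have m: "{x : space ?P. EX j. 0 < x j & n < card {i. x j <= x i} & c < x j} : sets ?P"
  "{x : space ?P. ~ (EX j. 0 < x j & n < card {i. x j <= x i}) & c < ?c} : sets ?P" for c
  by measurable
 have "(%x. ranked x n) : bm ?P"
 proof (rule borel_measurable_iff_greater[THEN iffD2], rule allI)
  fix c
  have "c < ranked x n \<longleftrightarrow> (EX j. 0 < x j & n < card {i. x j <= x i} & c < x j) |
   (~ (EX j. 0 < x j & n < card {i. x j <= x i}) & c < ?c)" for x
  proof (cases "?T x = {}")
   case True
   then have "~ (EX j. 0 < x j & n < card {i. x j <= x i})" by auto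
   then show ?thesis unfolding ranked_def True by auto
  next
   case False
   then obtain t where t: "0 < t" "n < card {i. t <= x i}" by auto
   then have "0 < card {i. t <= x i}" by simp
   then have fin: "finite {i. t <= x i}" unfolding card_gt_0_iff by auto
   have "t' <= max t (Max (x ` {i. t <= x i}))" if "t' : ?T x" for t'
   proof (rule ccontr)
    assume *: "~ ?thesis"
    have "0 < card {i. t' <= x i}" using that by auto
    then obtain i where i: "t' <= x i" unfolding card_gt_0_iff by auto
    then have "x i <= Max (x ` {i. t <= x i})" using * fin by (intro Max_ge) auto
    then show False using * i by auto
   qed
   then have "bdd_above (?T x)" by (rule bdd_aboveI)
   then have "c < ranked x n \<longleftrightarrow> (\<exists>t\<in>?T x. c < t)"
    unfolding ranked_def using False by (rule less_cSup_iff[rotated])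
   also have "... \<longleftrightarrow> (EX j. 0 < x j & n < card {i. x j <= x i} & c < x j)"
   proof
    assume "\<exists>t\<in>?T x. c < t"
    then obtain s where s: "0 < s" "n < card {i. s <= x i}" "c < s" by auto
    obtain j where "s <= x j" "n < card {i. x j <= x i}" using ranked_set_attained[OF s(1,2)] .
    then show "EX j. 0 < x j & n < card {i. x j <= x i} & c < x j" using s by (intro exI[of _ j]) auto
   qed auto
   finally have *: "c < ranked x n \<longleftrightarrow> (EX j. 0 < x j & n < card {i. x j <= x i} & c < x j)" .
   obtain j where "t <= x j" "n < card {i. x j <= x i}" using ranked_set_attained[OF t] .
   then have "EX j. 0 < x j & n < card {i. x j <= x i}" using t(1) by (intro exI[of _ j]) auto
   then show ?thesis using * by blast
  qed
  then have "{x : space ?P. c < ranked x n} = {x : space ?P. EX j. 0 < x j & n < card {i. x j <= x i} & c < x j} \<union>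
   {x : space ?P. ~ (EX j. 0 < x j & n < card {i. x j <= x i}) & c < ?c}" by blast
  then show "{x : space ?P. c < ranked x n} : sets ?P" using m[of c] by (simp only: sets.Un)
 qed
 then show "(%x. ranked x n) : ?P ->M borel" .
qed (simp add: space_PiM)

text \<open>Since the sequence is positive and tends to 0, only finitely many terms reach a given
  positive level, and the supremum in \<open>ranked\<close> is attained.\<close>

lemma le_ranked_iff:
 assumes "x \<longlonglongrightarrow> 0" and t: "0 < t" and pos: "!!i. 0 < x i"
 shows "t <= ranked x n \<longleftrightarrow> n < card {i. t <= x i}" and "finite {i. t <= x i}" and "0 < ranked x n"
proof -
 have fin: "finite {i. t <= x i}" if "0 < t" for t
 proof -
  have "eventually (%i. x i < t) sequentially" using order_tendstoD(2)[OF assms(1) that] .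
  then obtain K where "!!i. K <= i ==> x i < t" unfolding eventually_sequentially by blast
  then have "{i. t <= x i} \<subseteq> {..<K}" by (force simp: not_le[symmetric])
  then show ?thesis by (rule finite_subset) simp
 qed
 then show "finite {i. t <= x i}" using t by blast
 let ?T = "{t. 0 < t & n < card {i. t <= x i}}"
 have down: "s : ?T" if "0 < s" "s <= t" "t : ?T" for s t
 proof -
  have "card {i. t <= x i} <= card {i. s <= x i}" using that by (intro card_mono fin) auto
  then show ?thesis using that by auto
 qed
 \<comment> \<open>The terms with index up to \<open>n\<close> are all at least \<open>m\<close>, so
   \<open>m\<close> shows that the set is nonempty and the supremum positive.\<close>
 define m where "m = Min (x ` {..n})"
 have "0 < m" unfolding m_def using pos by (subst Min_gr_iff) auto
 moreover have "card {..n} <= card {i. m <= x i}"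
  using \<open>0 < m\<close> by (intro card_mono fin) (auto simp: m_def)
 ultimately have mT: "m : ?T" by simp
 obtain B where B: "!!i. x i < B"
 proof -
  have f: "finite (insert m (x ` {i. m <= x i}))" using fin[OF \<open>0 < m\<close>] by simp
  have "x i <= Max (insert m (x ` {i. m <= x i}))" for i
  proof (cases "m <= x i")
   case True
   then show ?thesis by (intro Max_ge[OF f]) auto
  next
   case False
   then show ?thesis using Max_ge[OF f, of m] by simp
  qed
  then show ?thesis using that[of "Max (insert m (x ` {i. m <= x i})) + 1"] by (meson less_add_one le_less_trans)
 qed
 have bdd: "bdd_above ?T"
 proof (rule bdd_aboveI[of _ B])
  fix s assume "s : ?T"
  then have "0 < card {i. s <= x i}" by simp
  then have "{i. s <= x i} ~= {}" unfolding card_gt_0_iff by simp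
  then obtain i where "s <= x i" by auto
  then show "s <= B" using B[of i] by simp
 qed
 have *: "t <= ranked x n \<longleftrightarrow> t : ?T" if t: "0 < t" for t
 proof
  assume "t : ?T"
  then show "t <= ranked x n" unfolding ranked_def by (rule cSup_upper[OF _ bdd])
 next
  assume le: "t <= ranked x n"
  show "t : ?T"
  proof (rule ccontr)
   assume no: "t ~: ?T"
   then have card: "card {i. t <= x i} <= n" using t by auto
   define F where "F = {i. t / 2 <= x i & x i < t}"
   \<comment> \<open>The largest term below \<open>t\<close>, or \<open>t / 2\<close>. If
     \<open>t\<close> does not qualify, no level above \<open>u\<close> does, and the supremum stays
     strictly below \<open>t\<close>.\<close>
   define u where "u = Max (insert (t / 2) (x ` F))"
   have finF: "finite F" by (rule finite_subset[OF _ fin[of "t / 2"]]) (auto simp: F_def t)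
   have u: "u < t" using finF t unfolding u_def by (subst Max_less_iff) (auto simp: F_def)
   have "s <= u" if s: "s : ?T" for s
   proof (rule ccontr)
    assume su: "~ s <= u"
    have xu: "x i < t ==> x i <= u" for i
     using finF Max_ge[of "insert (t / 2) (x ` F)" "x i"] Max_ge[of "insert (t / 2) (x ` F)" "t / 2"]
     unfolding u_def[symmetric] by (cases "t / 2 <= x i") (auto simp: F_def)
    have "t <= x i" if "s <= x i" for i using xu[of i] su that by linarith
    then have "{i. s <= x i} \<subseteq> {i. t <= x i}" by blast
    then have "card {i. s <= x i} <= n" using card card_mono[OF fin[OF t]] by (meson order_trans)
    then show False using s by simp
   qed
   then have "ranked x n <= u" unfolding ranked_def using mT by (intro cSup_least) auto
   then show False using le u by simp
  qed
 qed
 then show "t <= ranked x n \<longleftrightarrow> n < card {i. t <= x i}" using t by simp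
 have "m <= ranked x n" using *[OF \<open>0 < m\<close>] mT by simp
 then show "0 < ranked x n" using \<open>0 < m\<close> by simp
qed

text \<open>Both sides are integrals against counting measures giving each \<open>{t..}\<close>, \<open>t > 0\<close>, the same finite
 mass; the logarithm makes these sets a generator on the whole line.\<close>

lemma suminf_ranked:
 fixes u :: "real => ennreal"
 assumes x: "x \<longlonglongrightarrow> 0" and pos: "!!i. 0 < x i" and u[measurable]: "u : bm borel"
 shows "(\<Sum>n. u (ranked x n)) = (\<Sum>i. u (x i))"
proof -
 let ?m = "%y :: nat => real. distr (count_space UNIV) borel (%i. ln (y i))"
 note r = le_ranked_iff[OF x _ pos]
 have em: "emeasure (?m y) {t..} = of_nat (card {i. exp t <= x i})"
  if "!!i. 0 < y i" "card {i. exp t <= y i} = card {i. exp t <= x i}" "finite {i. exp t <= y i}" for y t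
 proof -
  have "(%i. ln (y i)) -` {t..} \<inter> space (count_space UNIV) = {i. exp t <= y i}"
   using that(1) by (auto simp: ln_ge_iff)
  then show ?thesis using that by (simp add: emeasure_distr emeasure_count_space_finite)
 qed
 have e1: "emeasure (?m (ranked x)) {t..} = of_nat (card {i. exp t <= x i})" for t
  using r(1)[of "exp t"] r(3)[of 1] by (intro em) (simp_all add: lessThan_def[symmetric])
 have e2: "emeasure (?m x) {t..} = of_nat (card {i. exp t <= x i})" for t
  using r(2)[of "exp t"] pos by (intro em) simp_all
 have "?m (ranked x) = ?m x"
 proof (rule measure_eqI_generator_eq[where E="range atLeast" and \<Omega>=UNIV and A="%i. {- real i..}"])
  have "{a..} \<inter> {b..} = {max a b..}" for a b :: real by auto
  then show "Int_stable (range atLeast :: real set set)" unfolding Int_stable_def by auto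
  have "sets borel = sigma_sets UNIV (range atLeast :: real set set)" by (simp add: borel_Ici)
  then show "sets (?m (ranked x)) = sigma_sets UNIV (range atLeast)" "sets (?m x) = sigma_sets UNIV (range atLeast)" by simp_all
  show "(\<Union>i. {- real i..}) = UNIV"
  proof (intro equalityI subsetI)
   fix y :: real
   obtain n where "- y <= real n" using real_arch_simple by blast
   then show "y : (\<Union>i. {- real i..})" by (auto intro!: exI[of _ n])
  qed simp
 qed (auto simp: e1 e2)
 then have "(NI v. u (exp v);?m (ranked x)) = (NI v. u (exp v);?m x)" by simp
 then show ?thesis using r(3)[of 1] pos by (simp add: nn_integral_distr nn_integral_count_space_nat)
qed

lemma stick_breaking_Suc: "stick_breaking y (Suc n) = (1 - y 0) * stick_breaking (%i. y (Suc i)) n"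
 by (simp add: stick_breaking_def prod.lessThan_Suc_shift del: prod.lessThan_Suc)

lemma stick_breaking_pos:
 assumes "!!i. 0 < y i & y i < 1"
 shows "0 < stick_breaking y n" "stick_breaking y \<longlonglongrightarrow> 0"
proof -
 show pos: "0 < stick_breaking y n" for n
  unfolding stick_breaking_def using assms by (intro mult_pos_pos prod_pos) auto
 \<comment> \<open>What remains unbroken telescopes to the product, which is nonnegative; so the
   partial sums are at most 1.\<close>
 have "(\<Sum>i<n. stick_breaking y i) = 1 - (\<Prod>i<n. 1 - y i)" for n
  by (induction n) (simp_all add: stick_breaking_def algebra_simps)
 moreover have "0 <= (\<Prod>i<n. 1 - y i)" for n using assms by (intro prod_nonneg) (simp add: less_imp_le)
 ultimately have "(\<Sum>i<n. stick_breaking y i) <= 1" for n by simp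
 then have "summable (stick_breaking y)"
  using pos by (intro summableI_nonneg_bounded) (auto intro: less_imp_le)
 then show "stick_breaking y \<longlonglongrightarrow> 0" by (rule summable_LIMSEQ_zero)
qed

lemma laplace_deriv:
 fixes k :: "real => real"
 assumes k[measurable]: "k : bm borel" and k0: "!!x. x <= 0 ==> k x = 0"
  and int: "!!a. 0 < a ==> integrable lborel (%x. exp (- (a * x)) * k x)" and l: "0 < l"
 shows "((%l. \<integral>x. exp (- (l * x)) * k x \<partial>lborel) has_real_derivative - (\<integral>x. x * exp (- (l * x)) * k x \<partial>lborel)) (at l)"
proof -
 let ?q = "%h x. (exp (- ((l + h) * x)) - exp (- (l * x))) / h"
 \<comment> \<open>The shift by \<open>h\<close> costs at most exp(l x / 2), and the factor x is
   paid for by (4 / l) exp(l x / 4). What remains is exp(- l x / 4), for which integrability is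
   assumed.\<close>
 have bound: "norm (?q h x * k x) <= 4 / l * norm (exp (- (l / 4 * x)) * k x)" if h: "h ~= 0" "\<bar>h\<bar> <= l / 2" for h x
 proof (cases "x <= 0")
  case False
  then have x: "0 < x" by simp
  have e1: "\<bar>exp u - 1\<bar> <= \<bar>u\<bar> * exp \<bar>u\<bar>" for u :: real
  proof (cases "0 <= u")
   case True
   have "1 - u <= exp (- u)" using exp_ge_add_one_self[of "- u"] by simp
   then have "(1 - u) * exp u <= exp (- u) * exp u" by (intro mult_right_mono) auto
   then show ?thesis using True by (simp add: exp_minus algebra_simps)
  next
   case False
   then have "\<bar>exp u - 1\<bar> = 1 - exp u" by simp
   also have "... <= - u" using exp_ge_add_one_self[of u] by linarith
   also have "... = \<bar>u\<bar> * 1" using False by simp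
   also have "... <= \<bar>u\<bar> * exp \<bar>u\<bar>" by (intro mult_left_mono) auto
   finally show ?thesis .
  qed
  have "?q h x = exp (- (l * x)) * ((exp (- (h * x)) - 1) / h)"
   by (simp add: exp_add[symmetric] algebra_simps diff_divide_distrib)
  then have "\<bar>?q h x\<bar> = exp (- (l * x)) * (\<bar>exp (- (h * x)) - 1\<bar> / \<bar>h\<bar>)" by (simp only: abs_mult abs_divide abs_exp_cancel)
  also have "... <= exp (- (l * x)) * (x * exp (l / 2 * x))"
  proof (intro mult_left_mono)
   have "\<bar>exp (- (h * x)) - 1\<bar> <= (\<bar>h\<bar> * x) * exp (\<bar>h\<bar> * x)" using e1[of "- (h * x)"] x by (simp add: abs_mult)
   also have "... <= (\<bar>h\<bar> * x) * exp (l / 2 * x)" using h x by (intro mult_left_mono) (auto intro!: mult_right_mono)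
   finally show "\<bar>exp (- (h * x)) - 1\<bar> / \<bar>h\<bar> <= x * exp (l / 2 * x)" using h by (simp add: divide_le_eq mult_ac)
  qed simp
  also have "x <= 4 / l * exp (l / 4 * x)" using exp_ge_add_one_self[of "l / 4 * x"] l by (simp add: field_simps)
  then have "exp (- (l * x)) * (x * exp (l / 2 * x)) <= exp (- (l * x)) * (4 / l * exp (l / 4 * x) * exp (l / 2 * x))"
   by (intro mult_left_mono mult_right_mono) auto
  also have "... = 4 / l * exp (- (l / 4 * x))" by (simp add: exp_add[symmetric] mult_ac)
  finally have "\<bar>?q h x\<bar> * \<bar>k x\<bar> <= 4 / l * exp (- (l / 4 * x)) * \<bar>k x\<bar>" by (rule mult_right_mono) simp
  then show ?thesis using l by (simp add: abs_mult mult_ac)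
 qed (simp add: k0)
 have pt: "((%h. ?q h x * k x) \<longlongrightarrow> - (x * exp (- (l * x)) * k x)) (at 0)" for x
 proof -
  have "((%l. exp (- (l * x))) has_real_derivative - (x * exp (- (l * x)))) (at l)"
   by (auto intro!: derivative_eq_intros)
  then have "(%h. ?q h x) \<midarrow>0\<rightarrow> - (x * exp (- (l * x)))" by (simp add: DERIV_def)
  from tendsto_mult_right[OF this, of "k x"] show ?thesis by simp
 qed
 let ?I = "%l. \<integral>x. exp (- (l * x)) * k x \<partial>lborel"
 have "((%h. (?I (l + h) - ?I l) / h) \<longlongrightarrow> - (\<integral>x. x * exp (- (l * x)) * k x \<partial>lborel)) (at 0)"
 proof (subst tendsto_at_iff_sequentially, intro allI impI)
  fix X :: "nat => real" assume X: "ALL i. X i : UNIV - {0}" "X \<longlonglongrightarrow> 0"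
  have "eventually (%n. \<bar>X n\<bar> < l / 2) sequentially"
   using order_tendstoD(2)[OF tendsto_rabs[OF X(2)], of "l / 2"] l by simp
  then obtain m where m: "!!n. m <= n ==> \<bar>X n\<bar> < l / 2" unfolding eventually_sequentially by blast
  let ?Y = "%n. X (n + m)"
  have fY: "filterlim ?Y (at 0) sequentially"
   using X by (auto simp: filterlim_at LIMSEQ_ignore_initial_segment)
  have "(%n. \<integral>x. ?q (?Y n) x * k x \<partial>lborel) \<longlonglongrightarrow> (\<integral>x. - (x * exp (- (l * x)) * k x) \<partial>lborel)"
  proof (rule integral_dominated_convergence[where w="%x. 4 / l * norm (exp (- (l / 4 * x)) * k x)"])
   show "integrable lborel (%x. 4 / l * norm (exp (- (l / 4 * x)) * k x))"
    using int[of "l / 4"] l by (intro integrable_mult_right integrable_norm) auto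
   show "AE x in lborel. (%n. ?q (?Y n) x * k x) \<longlonglongrightarrow> - (x * exp (- (l * x)) * k x)"
    using filterlim_compose[OF pt fY] by simp
   show "AE x in lborel. norm (?q (?Y n) x * k x) <= 4 / l * norm (exp (- (l / 4 * x)) * k x)" for n
    using bound[of "?Y n"] m[of "n + m"] X(1) by (auto simp: less_imp_le)
  qed measurable
  moreover have "(\<integral>x. ?q (?Y n) x * k x \<partial>lborel) = (?I (l + ?Y n) - ?I l) / ?Y n" for n
  proof -
   have "0 < l + ?Y n" using m[of "n + m"] l by (simp add: abs_less_iff field_simps)
   then have "?I (l + ?Y n) - ?I l = (\<integral>x. exp (- ((l + ?Y n) * x)) * k x - exp (- (l * x)) * k x \<partial>lborel)"
    using int l by (intro Bochner_Integration.integral_diff[symmetric]) auto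
   then have "(?I (l + ?Y n) - ?I l) / ?Y n = (\<integral>x. (exp (- ((l + ?Y n) * x)) * k x - exp (- (l * x)) * k x) / ?Y n \<partial>lborel)" by simp
   then show ?thesis by (simp add: left_diff_distrib diff_divide_distrib)
  qed
  ultimately have "(%n. (?I (l + ?Y n) - ?I l) / ?Y n) \<longlonglongrightarrow> (\<integral>x. - (x * exp (- (l * x)) * k x) \<partial>lborel)" by (simp only:)
  then have "(%n. (?I (l + ?Y n) - ?I l) / ?Y n) \<longlonglongrightarrow> - (\<integral>x. x * exp (- (l * x)) * k x \<partial>lborel)" by (simp only: integral_minus)
  then show "((%h. (?I (l + h) - ?I l) / h) \<circ> X) \<longlonglongrightarrow> - (\<integral>x. x * exp (- (l * x)) * k x \<partial>lborel)"
   unfolding comp_def by (rule LIMSEQ_offset)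
 qed
 then show ?thesis by (simp add: DERIV_def)
qed

lemma nn_integral_Gamma:
 assumes "0 < \<theta>" "0 < l"
 shows "(NI s. (if 0 < s then ennreal (exp (- (l * s)) * s powr (\<theta> - 1)) else 0);lborel) = ennreal (Gamma \<theta> * l powr - \<theta>)"
proof -
 let ?f = "%t. if 0 < t then t powr (\<theta> - 1) / exp t else 0 :: real"
 have "(?f has_integral Gamma \<theta>) UNIV"
 proof -
  have "((%t. if t : {0..} then t powr (\<theta> - 1) / exp t else 0) has_integral Gamma \<theta>) UNIV"
   using Gamma_integral_real[OF assms(1)] by (simp only: has_integral_restrict_UNIV)
  also have "(%t. if t : {0..} then t powr (\<theta> - 1) / exp t else 0) = ?f" by (auto simp: fun_eq_iff)
  finally show ?thesis .
 qed
 then have "(NI t. ennreal (?f t);lborel) = ennreal (Gamma \<theta>)"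
  by (intro nn_integral_has_integral_lborel) auto
 moreover have "(NI t. ennreal (?f t);lborel) = ennreal \<bar>l\<bar> * (NI s. ennreal (?f (0 + l * s));lborel)"
  using assms by (intro nn_integral_real_affine) auto
 moreover have "... = ennreal (l powr \<theta>) * (NI s. (if 0 < s then ennreal (exp (- (l * s)) * s powr (\<theta> - 1)) else 0);lborel)"
 proof -
  have "ennreal \<bar>l\<bar> * ennreal (?f (0 + l * s)) = ennreal (l powr \<theta>) * (if 0 < s then ennreal (exp (- (l * s)) * s powr (\<theta> - 1)) else 0)" for s
  proof (cases "0 < s")
   case True
   have "l powr \<theta> = l * l powr (\<theta> - 1)" using assms by (simp add: powr_mult_base)
   then show ?thesis using True assms by (simp add: ennreal_mult[symmetric] powr_mult exp_minus field_simps)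
  qed (use assms in \<open>simp add: zero_less_mult_iff\<close>)
  then show ?thesis by (subst (1 2) nn_integral_cmult[symmetric]) (auto simp del: ennreal_eq_0_iff)
 qed
 ultimately have "ennreal (l powr - \<theta>) * ennreal (Gamma \<theta>) = ennreal (l powr - \<theta>) * (ennreal (l powr \<theta>) * (NI s. (if 0 < s then ennreal (exp (- (l * s)) * s powr (\<theta> - 1)) else 0);lborel))" by simp
 then show ?thesis using assms
  by (simp add: mult.assoc[symmetric] ennreal_mult[symmetric] powr_minus mult.commute[of "Gamma \<theta>"] Gamma_real_pos less_imp_le)
qed


section \<open>Stick breaking of a Gamma-distributed mass\<close>

locale gem =
 fixes \<theta> :: real
 assumes \<theta>: "0 < \<theta>"
begin

definition bd :: "real measure" where "bd = density lborel (%y. ennreal (beta_density 1 \<theta> y))"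

abbreviation GEM :: "(nat => real) measure" where "GEM == \<Pi>\<^sub>M i\<in>UNIV. bd"

lemma sets_bd [simp, measurable_cong]: "sets bd = sets borel" by (simp add: bd_def)

lemma Beta_1: "Beta 1 \<theta> = 1 / \<theta>"
proof -
 have "\<theta> ~: \<int>\<^sub>\<le>\<^sub>0" using \<theta> by (auto elim!: nonpos_Ints_cases)
 moreover have "Gamma \<theta> ~= 0" using Gamma_real_pos[OF \<theta>] by linarith
 ultimately show ?thesis using \<theta> by (simp add: Beta_def Gamma_plus1 add.commute[of 1])
qed

lemma beta_density_eq: "beta_density 1 \<theta> y = (if 0 < y & y < 1 then \<theta> * (1 - y) powr (\<theta> - 1) else 0)"
 by (auto simp: beta_density_def Beta_1 indicator_def)

lemma nn_integral_bd: "f : bm borel ==>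
  (NI y. f y;bd) = (NI y. ennreal (if 0 < y & y < 1 then \<theta> * (1 - y) powr (\<theta> - 1) else 0) * f y;lborel)"
 unfolding bd_def by (subst nn_integral_density) (auto simp: beta_density_eq)

lemma prob_space_bd: "prob_space bd"
proof
 have "((%t. t powr (1 - 1) * (1 - t) powr (\<theta> - 1)) has_integral Beta 1 \<theta>) {0..1}"
  by (rule has_integral_Beta_real) (use \<theta> in auto)
 then have "((%t. (if t : {0..1} then t powr (1 - 1) * (1 - t) powr (\<theta> - 1) else 0) / Beta 1 \<theta>) has_integral Beta 1 \<theta> / Beta 1 \<theta>) UNIV"
  by (intro has_integral_divide) (simp only: has_integral_restrict_UNIV)
 then have "(beta_density 1 \<theta> has_integral Beta 1 \<theta> / Beta 1 \<theta>) UNIV"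
 proof (rule has_integral_spike[of "{0, 1}", rotated -1])
  show "beta_density 1 \<theta> t = (if t : {0..1} then t powr (1 - 1) * (1 - t) powr (\<theta> - 1) else 0) / Beta 1 \<theta>" if "t : UNIV - {0, 1}" for t
   using that by (auto simp: beta_density_def)
 qed simp
 moreover have "Beta 1 \<theta> ~= 0" using \<theta> by (simp add: Beta_1)
 ultimately have "(beta_density 1 \<theta> has_integral 1) UNIV" by simp
 moreover have [measurable]: "beta_density 1 \<theta> : bm borel" and "0 <= beta_density 1 \<theta> y" for y
  using \<theta> by (simp_all add: beta_density_eq[abs_def])
 ultimately have "(NI y. ennreal (beta_density 1 \<theta> y);lborel) = ennreal 1"
  by (intro nn_integral_has_integral_lborel)
 then show "emeasure bd (space bd) = 1" by (simp add: bd_def emeasure_density)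
qed

sublocale bd: prob_space bd by (rule prob_space_bd)

sublocale GEM: sequence_space bd by unfold_locales

lemma measurable_GEM_comp: "(%y. y i) : bm GEM"
 using measurable_component_singleton[of i UNIV "%_. bd"] by simp

lemma AE_GEM: "AE y in GEM. ALL i. 0 < y i & y i < 1"
proof -
 have "AE y in bd. 0 < y & y < 1" unfolding bd_def by (subst AE_density) (auto simp: beta_density_eq)
 then have "AE y in GEM. 0 < y i & y i < 1" for i by (rule AE_PiM_component[rotated 2]) (simp_all add: prob_space_bd)
 then show ?thesis by (simp add: AE_all_countable)
qed

text \<open>Expectation of the product of \<open>g\<close> over the sticks of a broken interval of
  length \<open>s\<close>; the infinite product is encoded through \<open>nln\<close> and
  \<open>en\<close>, which is faithful for \<open>g\<close> with values in [0, 1].\<close>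

definition Phi :: "(real => ennreal) => real => ennreal" where
 "Phi g s = (NI y. en (\<Sum>i. nln (g (s * stick_breaking y i)));GEM)"

lemma measurable_stick_breaking [measurable]: "(%y. stick_breaking y i) : bm GEM"
 unfolding stick_breaking_def using measurable_GEM_comp[measurable] by measurable

lemma Phi_le_1: "Phi g s <= 1"
proof -
 have "Phi g s <= (NI y. 1;GEM)" unfolding Phi_def by (intro nn_integral_mono en_le_1)
 then show ?thesis using GEM.emeasure_space_1 by simp
qed

lemma measurable_Phi [measurable]:
 assumes [measurable]: "g : bm borel"
 shows "Phi g : bm borel"
proof -
 have "(%x. en (\<Sum>i. nln (g (fst x * stick_breaking (snd x) i)))) : bm (borel ** GEM)"
 proof -
  have [measurable]: "(%x. stick_breaking (snd x) i) : bm (borel ** GEM)" for i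
   by (rule measurable_compose[OF measurable_snd measurable_stick_breaking])
  show ?thesis by measurable
 qed
 from GEM.borel_measurable_nn_integral_fst[OF this] show ?thesis by (simp add: Phi_def[abs_def])
qed

text \<open>Breaking off the first stick leaves a remaining interval that is broken by the same law,
  rescaled.\<close>

lemma Phi_rec:
 assumes g[measurable]: "g : bm borel" and g1: "!!x. g x <= 1"
 shows "Phi g s = (NI y. g (s * y) * Phi g (s * (1 - y));bd)"
proof -
 let ?f = "%y. en (\<Sum>i. nln (g (s * stick_breaking y i)))"
 have "Phi g s = (NI y. ?f y;distr (bd ** GEM) GEM (%(u, y). case_nat u y))"
  by (simp add: Phi_def GEM.PiM_iter)
 also have "... = (NI x. ?f (case x of (u, y) => case_nat u y);(bd ** GEM))"
  by (subst nn_integral_distr) auto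
 also have "... = (NI u. NI y. ?f (case_nat u y);GEM;bd)"
  by (subst GEM.nn_integral_fst[symmetric]) auto
 also have "... = (NI u. NI y. g (s * u) * en (\<Sum>i. nln (g (s * (1 - u) * stick_breaking y i)));GEM;bd)"
 proof (intro nn_integral_cong)
  fix u y
  let ?a = "%i. nln (g (s * stick_breaking (case_nat u y) i))"
  have "(\<Sum>i. ?a i) = (\<Sum>i. ?a (i + 1)) + (\<Sum>i<1. ?a i)"
   by (rule suminf_offset) simp
  then have "(\<Sum>i. ?a i) = nln (g (s * u)) + (\<Sum>i. nln (g (s * (1 - u) * stick_breaking y i)))"
   by (simp add: stick_breaking_Suc mult.assoc add.commute) (simp add: stick_breaking_def)
  then show "?f (case_nat u y) = g (s * u) * en (\<Sum>i. nln (g (s * (1 - u) * stick_breaking y i)))"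
   by (simp add: en_add en_nln g1)
 qed
 also have "... = (NI y. g (s * y) * Phi g (s * (1 - y));bd)"
  unfolding Phi_def by (intro nn_integral_cong nn_integral_cmult) measurable
 finally show ?thesis .
qed

text \<open>Up to normalisation, the functional \<open>Phi\<close> of a partition whose total mass
  has a Gamma law with rate \<open>l\<close>.\<close>

definition W :: "(real => ennreal) => real => ennreal" where
 "W g l = (NI s. (if 0 < s then ennreal (exp (- (l * s)) * s powr (\<theta> - 1)) * Phi g s else 0);lborel)"

text \<open>The first stick has density \<open>\<theta> * (1 - y) powr (\<theta> - 1)\<close>; under
  \<open>x = s * y\<close> the recursion becomes a convolution of \<open>g\<close> with
  \<open>s powr (\<theta> - 1) * Phi g s\<close>.\<close>

lemma Phi_conv:
 assumes g[measurable]: "g : bm borel" and g1: "!!x. g x <= 1" and s: "0 < s"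
 shows "ennreal (s powr \<theta>) * Phi g s =
  ennreal \<theta> * (NI x. (if 0 < x & x < s then g x * (ennreal ((s - x) powr (\<theta> - 1)) * Phi g (s - x)) else 0);lborel)"
proof -
 define h where "h x = (if 0 < x & x < s then g x * (ennreal ((s - x) powr (\<theta> - 1)) * Phi g (s - x)) else 0)" for x
 have [measurable]: "h : bm borel" unfolding h_def[abs_def] by measurable
 have "(NI x. h x;lborel) = ennreal \<bar>s\<bar> * (NI y. h (0 + s * y);lborel)"
  using s by (intro nn_integral_real_affine) auto
 then have "ennreal \<theta> * (NI x. h x;lborel) = (NI y. ennreal \<theta> * (ennreal s * h (s * y));lborel)"
  using s by (simp add: nn_integral_cmult)
 also have "... = (NI y. ennreal (s powr \<theta>) * (ennreal (if 0 < y & y < 1 then \<theta> * (1 - y) powr (\<theta> - 1) else 0) * (g (s * y) * Phi g (s * (1 - y))));lborel)"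
 proof (intro nn_integral_cong)
  fix y :: real
  show "ennreal \<theta> * (ennreal s * h (s * y)) = ennreal (s powr \<theta>) * (ennreal (if 0 < y & y < 1 then \<theta> * (1 - y) powr (\<theta> - 1) else 0) * (g (s * y) * Phi g (s * (1 - y))))"
  proof (cases "0 < y & y < 1")
   case True
   have "\<theta> * (s * (s * (1 - y)) powr (\<theta> - 1)) = s powr \<theta> * (\<theta> * (1 - y) powr (\<theta> - 1))"
    using s True powr_mult_base[of s "\<theta> - 1"] by (simp add: powr_mult mult_ac)
   then have e: "ennreal \<theta> * (ennreal s * ennreal ((s * (1 - y)) powr (\<theta> - 1))) = ennreal (s powr \<theta>) * ennreal (\<theta> * (1 - y) powr (\<theta> - 1))"
    using s \<theta> by (simp add: ennreal_mult[symmetric])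
   have "s - s * y = s * (1 - y)" by (simp add: algebra_simps)
   then have "h (s * y) = ennreal ((s * (1 - y)) powr (\<theta> - 1)) * (g (s * y) * Phi g (s * (1 - y)))"
    using True s by (simp add: h_def mult_ac)
   then have "ennreal \<theta> * (ennreal s * h (s * y)) = ennreal \<theta> * (ennreal s * ennreal ((s * (1 - y)) powr (\<theta> - 1))) * (g (s * y) * Phi g (s * (1 - y)))"
    by (simp only: mult.assoc)
   then show ?thesis unfolding e using True by (simp add: mult.assoc)
  next
   case False
   then have "~ (0 < s * y & s * y < s)" using s by (auto simp: zero_less_mult_iff)
   then show ?thesis using False by (simp only: h_def if_False) simp
  qed
 qed
 also have "... = ennreal (s powr \<theta>) * (NI y. ennreal (if 0 < y & y < 1 then \<theta> * (1 - y) powr (\<theta> - 1) else 0) * (g (s * y) * Phi g (s * (1 - y)));lborel)"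
  by (rule nn_integral_cmult) measurable
 also have "... = ennreal (s powr \<theta>) * Phi g s"
  by (subst Phi_rec[OF g g1], subst nn_integral_bd) auto
 finally show ?thesis by (simp add: h_def cong: if_cong)
qed

text \<open>Laplace transforms turn the convolution into a product. The left side is formally minus
  the derivative of \<open>W\<close> in \<open>l\<close>, so this is a linear differential
  equation.\<close>

lemma W_eq:
 assumes g[measurable]: "g : bm borel" and g1: "!!x. g x <= 1"
 shows "(NI s. (if 0 < s then ennreal (s * (exp (- (l * s)) * s powr (\<theta> - 1))) * Phi g s else 0);lborel)
  = ennreal \<theta> * (NI x. (if 0 < x then ennreal (exp (- (l * x))) * g x else 0);lborel) * W g l"
proof -
 let ?E = "%s. ennreal (exp (- (l * s)))"
 let ?k = "%u. if 0 < u then ennreal (exp (- (l * u)) * u powr (\<theta> - 1)) * Phi g u else 0"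
 let ?j = "%x. if 0 < x then ?E x * g x else 0"
 have "(NI s. (if 0 < s then ennreal (s * (exp (- (l * s)) * s powr (\<theta> - 1))) * Phi g s else 0);lborel)
   = (NI s. NI x. ennreal \<theta> * (?j x * ?k (s - x));lborel;lborel)"
 proof (rule nn_integral_cong)
  fix s :: real
  show "(if 0 < s then ennreal (s * (exp (- (l * s)) * s powr (\<theta> - 1))) * Phi g s else 0) = (NI x. ennreal \<theta> * (?j x * ?k (s - x));lborel)"
  proof (cases "0 < s")
   case True
   have sp: "s * (exp (- (l * s)) * s powr (\<theta> - 1)) = exp (- (l * s)) * s powr \<theta>"
    using powr_mult_base[of s "\<theta> - 1"] True by (simp add: mult_ac)
   have "ennreal (s * (exp (- (l * s)) * s powr (\<theta> - 1))) * Phi g s = ?E s * (ennreal (s powr \<theta>) * Phi g s)"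
    unfolding sp by (simp add: ennreal_mult mult.assoc)
   also have "... = (NI x. ?E s * (ennreal \<theta> * (if 0 < x & x < s then g x * (ennreal ((s - x) powr (\<theta> - 1)) * Phi g (s - x)) else 0));lborel)"
    unfolding Phi_conv[OF g g1 True] by (subst nn_integral_cmult, measurable)+
   also have "... = (NI x. ennreal \<theta> * (?j x * ?k (s - x));lborel)"
   proof (intro nn_integral_cong)
    fix x :: real
    have e: "?E s = ?E x * ?E (s - x)" by (simp add: ennreal_mult[symmetric] exp_add[symmetric] algebra_simps)
    show "?E s * (ennreal \<theta> * (if 0 < x & x < s then g x * (ennreal ((s - x) powr (\<theta> - 1)) * Phi g (s - x)) else 0)) = ennreal \<theta> * (?j x * ?k (s - x))"
     unfolding e by (simp add: ennreal_mult mult_ac)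
   qed
   finally show ?thesis using True by simp
  next
   case False
   have "?j x * ?k (s - x) = 0" for x using False by auto
   then show ?thesis using False by (simp only: mult_zero_right) simp
  qed
 qed
 also have "... = (NI x. NI s. ennreal \<theta> * (?j x * ?k (s - x));lborel;lborel)"
  by (rule lborel_pair.Fubini') measurable
 also have "... = (NI x. ennreal \<theta> * ?j x * W g l;lborel)"
 proof (rule nn_integral_cong)
  fix x :: real
  have "(NI s. ennreal \<theta> * (?j x * ?k (s - x));lborel) = (NI s. ennreal \<theta> * ?j x * ?k (s - x);lborel)" by (simp only: mult.assoc)
  also have "... = ennreal \<theta> * ?j x * (NI s. ?k (s - x);lborel)" by (rule nn_integral_cmult) measurable
  also have "(NI s. ?k (s - x);lborel) = W g l"
   unfolding W_def using nn_integral_real_affine[of ?k 1 "- x"] by (simp cong: if_cong)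
  finally show "(NI s. ennreal \<theta> * (?j x * ?k (s - x));lborel) = ennreal \<theta> * ?j x * W g l" .
 qed
 also have "... = (NI x. ennreal \<theta> * ?j x;lborel) * W g l" by (rule nn_integral_multc) measurable
 also have "(NI x. ennreal \<theta> * ?j x;lborel) = ennreal \<theta> * (NI x. ?j x;lborel)" by (rule nn_integral_cmult) measurable
 finally show ?thesis .
qed

end

context gem
begin

text \<open>No stick is longer than the whole, so every factor is evaluated below
  \<open>b\<close>.\<close>

lemma Phi_eq_1:
 assumes g: "!!x. x < b ==> g x = 1" and s: "0 < s" "s < b"
 shows "Phi g s = 1"
proof -
 have "Phi g s = (NI y. 1;GEM)"
  unfolding Phi_def
 proof (rule nn_integral_cong_AE)
  show "AE y in GEM. en (\<Sum>i. nln (g (s * stick_breaking y i))) = 1"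
   using AE_GEM
  proof eventually_elim
   case (elim y)
   have "stick_breaking y i <= 1" for i
    unfolding stick_breaking_def using elim by (intro mult_le_one prod_nonneg prod_le_1) (auto simp: less_imp_le)
   then have "s * stick_breaking y i <= s * 1" for i using s by (intro mult_left_mono) auto
   then have "s * stick_breaking y i < b" for i using s(2) by (metis le_less_trans mult_1_right)
   then have "nln (g (s * stick_breaking y i)) = 0" for i by (simp add: g nln_def)
   then show ?case by simp
  qed
 qed
 then show ?thesis using GEM.emeasure_space_1 by simp
qed

text \<open>When \<open>g\<close> is 1 near 0, the function \<open>\<theta> * (1 - g x) / x\<close>
  is bounded, and its Laplace transform \<open>R\<close> is finite and differentiable. The
  differential equations for \<open>w\<close> and \<open>R\<close> make
  \<open>w l * l powr \<theta> * exp (R l)\<close> constant; its value \<open>Gamma \<theta>\<close>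
  is read off as \<open>l\<close> tends to infinity.\<close>

lemma laplace_Phi_cutoff:
 assumes g[measurable]: "g : bm borel" and g1: "!!x. g x <= 1"
  and e: "0 < e" and gc: "!!x. x < e ==> g x = 1" and l: "0 < l"
 shows "W g l = ennreal (Gamma \<theta> * l powr - \<theta>) *
  en (ennreal \<theta> * (NI x. (if 0 < x then ennreal (exp (- (l * x)) / x) * (1 - g x) else 0);lborel))"
proof -
 define p where "p s = enn2real (Phi g s)" for s
 define r where "r x = enn2real (g x)" for x
 have [measurable]: "p : bm borel" "r : bm borel"
  unfolding p_def r_def using measurable_Phi[OF g] by measurable
 have p: "Phi g s = ennreal (p s)" "0 <= p s" "p s <= 1" for s
 proof -
  have "Phi g s < \<top>" using Phi_le_1[of g s] le_less_trans by fastforce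
  then show "Phi g s = ennreal (p s)" "0 <= p s" "p s <= 1"
   using Phi_le_1[of g s] by (simp_all add: p_def enn2real_leI)
 qed
 have r: "g x = ennreal (r x)" "0 <= r x" "r x <= 1" for x
 proof -
  have "g x < \<top>" using g1[of x] le_less_trans by fastforce
  then show "g x = ennreal (r x)" "0 <= r x" "r x <= 1"
   using g1[of x] by (simp_all add: r_def enn2real_leI)
 qed
 have p1: "p s = 1" if "0 < s" "s < e" for s using Phi_eq_1[of e g s] gc that by (simp add: p_def)
 have r1: "r x = 1" if "x < e" for x using gc[OF that] by (simp add: r_def)
 let ?gam = "%l s. if 0 < s then exp (- (l * s)) * s powr (\<theta> - 1) else 0"
 let ?ex = "%l x. if 0 < x then exp (- (l * x)) else 0 :: real"
 have gam: "integrable lborel (?gam l)" "(\<integral>s. ?gam l s \<partial>lborel) = Gamma \<theta> * l powr - \<theta>" if "0 < l" for l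
 proof -
  have "(NI s. ennreal (?gam l s);lborel) = ennreal (Gamma \<theta> * l powr - \<theta>)"
   using nn_integral_Gamma[OF \<theta> that] by (simp add: if_distrib[of ennreal] cong: if_cong)
  then have "has_bochner_integral lborel (?gam l) (Gamma \<theta> * l powr - \<theta>)"
   using \<theta> by (intro has_bochner_integral_nn_integral) (auto simp: Gamma_real_pos less_imp_le)
  then show "integrable lborel (?gam l)" "(\<integral>s. ?gam l s \<partial>lborel) = Gamma \<theta> * l powr - \<theta>"
   by (auto simp: has_bochner_integral_iff)
 qed
 have ex: "integrable lborel (?ex l)" "(\<integral>s. ?ex l s \<partial>lborel) = 1 / l" if "0 < l" for l
 proof -
  have "(NI s. ennreal (?ex l s);lborel) = (NI s. (if 0 < s then ennreal (exp (- (l * s)) * s powr (1 - 1)) else 0);lborel)"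
   by (intro nn_integral_cong) simp
  also have "... = ennreal (1 / l)" using nn_integral_Gamma[of 1 l] that by (simp add: powr_minus_divide)
  finally have "has_bochner_integral lborel (?ex l) (1 / l)"
   using that by (intro has_bochner_integral_nn_integral) auto
  then show "integrable lborel (?ex l)" "(\<integral>s. ?ex l s \<partial>lborel) = 1 / l"
   by (auto simp: has_bochner_integral_iff)
 qed
 define k where "k s = (if 0 < s then s powr (\<theta> - 1) * p s else 0)" for s
 define kR where "kR x = (if e <= x then \<theta> * (1 - r x) / x else 0)" for x
 have [measurable]: "k : bm borel" "kR : bm borel" unfolding k_def[abs_def] kR_def[abs_def] by measurable
 have kint: "integrable lborel (%x. exp (- (l * x)) * k x)" if "0 < l" for l
  by (rule Bochner_Integration.integrable_bound[OF gam(1)[OF that]], measurable)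
   (auto simp: k_def p abs_mult mult.assoc[symmetric] intro!: mult_left_le)
 have kRb: "0 <= kR x" "kR x <= \<theta> / e * (if 0 < x then 1 else 0)" for x
 proof -
  show "0 <= kR x" using \<theta> e r by (simp add: kR_def)
  have "\<theta> * (1 - r x) / x <= \<theta> * 1 / e" if "e <= x" using \<theta> e r[of x] that by (intro frac_le mult_left_mono) auto
  then show "kR x <= \<theta> / e * (if 0 < x then 1 else 0)" using e \<theta> by (simp add: kR_def)
 qed
 have kRb': "exp (- (l * x)) * kR x <= \<theta> / e * ?ex l x" for l x
  using mult_left_mono[OF kRb(2)[of x], of "exp (- (l * x))"] by (auto simp: mult.commute)
 have kRint: "integrable lborel (%x. exp (- (l * x)) * kR x)" if "0 < l" for l
 proof (rule Bochner_Integration.integrable_bound[OF integrable_mult_right[OF ex(1)[OF that], of "\<theta> / e"]])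
  have "norm (exp (- (l * x)) * kR x) <= norm (\<theta> / e * ?ex l x)" for x
   using kRb(1)[of x] order_trans[OF kRb'[of l x] abs_ge_self] by (simp only: real_norm_def abs_mult abs_exp_cancel abs_of_nonneg)
  then show "AE x in lborel. norm (exp (- (l * x)) * kR x) <= norm (\<theta> / e * ?ex l x)" by simp
 qed measurable
 define w where "w l = (\<integral>s. exp (- (l * s)) * k s \<partial>lborel)" for l
 define R where "R l = (\<integral>x. exp (- (l * x)) * kR x \<partial>lborel)" for l
 define G where "G l = (\<integral>x. ?ex l x * r x \<partial>lborel)" for l
 have Gint: "integrable lborel (%x. ?ex l x * r x)" if "0 < l" for l
  by (rule Bochner_Integration.integrable_bound[OF ex(1)[OF that]], measurable) (auto simp: abs_mult r mult_left_le)
 have Ww: "W g l = ennreal (w l)" if "0 < l" for l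
 proof -
  have "W g l = (NI s. ennreal (exp (- (l * s)) * k s);lborel)"
   unfolding W_def by (intro nn_integral_cong) (auto simp: k_def p ennreal_mult[symmetric])
  then show ?thesis unfolding w_def using kint[OF that] p by (simp add: nn_integral_eq_integral k_def)
 qed
 have w0: "0 <= w l" for l unfolding w_def by (intro integral_nonneg_AE) (auto simp: k_def p)
 have dw: "(w has_real_derivative - (\<theta> * G l * w l)) (at l)" if l: "0 < l" for l
 proof -
  have "(NI s. (if 0 < s then ennreal (s * (exp (- (l * s)) * s powr (\<theta> - 1))) * Phi g s else 0);lborel)
   = (NI s. ennreal (s * exp (- (l * s)) * k s);lborel)"
   by (intro nn_integral_cong) (auto simp: k_def p ennreal_mult[symmetric] mult_ac)
  moreover have "(NI x. (if 0 < x then ennreal (exp (- (l * x))) * g x else 0);lborel) = (NI x. ennreal (?ex l x * r x);lborel)"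
   by (intro nn_integral_cong) (auto simp: r ennreal_mult[symmetric])
  moreover have "... = ennreal (G l)" unfolding G_def using Gint[OF l] r by (intro nn_integral_eq_integral) auto
  ultimately have "(NI s. ennreal (s * exp (- (l * s)) * k s);lborel) = ennreal \<theta> * ennreal (G l) * ennreal (w l)"
   using W_eq[OF g g1, of l] Ww[OF l] by simp
  also have "... = ennreal (\<theta> * G l * w l)" using \<theta> w0 by (simp add: ennreal_mult'[symmetric] G_def integral_nonneg_AE r)
  finally have "(\<integral>s. s * exp (- (l * s)) * k s \<partial>lborel) = \<theta> * G l * w l"
   using \<theta> w0 by (intro integral_eq_nn_integral[THEN trans]) (auto simp: k_def p G_def intro!: mult_nonneg_nonneg integral_nonneg_AE simp: r)
  then show ?thesis using laplace_deriv[of k l] kint l unfolding w_def[abs_def] by (simp add: k_def)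
 qed
 have dR: "(R has_real_derivative - (\<theta> * (1 / l - G l))) (at l)" if l: "0 < l" for l
 proof -
  have "(\<integral>x. x * exp (- (l * x)) * kR x \<partial>lborel) = (\<integral>x. \<theta> * (?ex l x - ?ex l x * r x) \<partial>lborel)"
   using e r1 by (intro Bochner_Integration.integral_cong) (auto simp: kR_def field_simps not_le)
  also have "... = \<theta> * (1 / l - G l)" using ex[OF l] Gint[OF l] by (simp add: G_def)
  finally show ?thesis using laplace_deriv[of kR l] kRint l e unfolding R_def[abs_def] by (simp add: kR_def)
 qed
 have "EX c. \<forall>l\<in>{0<..}. w l * l powr \<theta> * exp (R l) = c"
 proof (rule has_field_derivative_zero_constant)
  fix l :: real assume "l : {0<..}"
  then have l: "0 < l" by simp
  have "((%l. w l * l powr \<theta> * exp (R l)) has_real_derivative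
   (- (\<theta> * G l * w l) * l powr \<theta> + w l * (\<theta> * l powr (\<theta> - 1))) * exp (R l) + w l * l powr \<theta> * (exp (R l) * - (\<theta> * (1 / l - G l)))) (at l)"
   using l by (auto intro!: derivative_eq_intros dw dR simp: algebra_simps)
  also have "(- (\<theta> * G l * w l) * l powr \<theta> + w l * (\<theta> * l powr (\<theta> - 1))) * exp (R l) + w l * l powr \<theta> * (exp (R l) * - (\<theta> * (1 / l - G l))) = 0"
   using l by (simp add: powr_diff field_simps)
  finally show "((%l. w l * l powr \<theta> * exp (R l)) has_real_derivative 0) (at l within {0<..})"
   by (rule has_field_derivative_at_within)
 qed simp
 then obtain c where c: "!!l. 0 < l ==> w l * l powr \<theta> * exp (R l) = c" by auto
 have wR: "w l * l powr \<theta> = c * exp (- R l)" if "0 < l" for l using c[OF that] by (simp add: exp_minus field_simps)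
 have R0: "0 <= R l" "0 < l ==> R l <= \<theta> / e * (1 / l)" for l
 proof -
  show "0 <= R l" unfolding R_def using kRb by (intro integral_nonneg_AE) auto
  assume l: "0 < l"
  have "R l <= (\<integral>x. \<theta> / e * ?ex l x \<partial>lborel)"
   unfolding R_def using kRint[OF l] ex[OF l] kRb' by (intro integral_mono) auto
  then show "R l <= \<theta> / e * (1 / l)" using ex[OF l] by (simp add: mult.commute)
 qed
 have "(R \<longlongrightarrow> 0) at_top"
 proof (rule tendsto_sandwich[of "%_. 0" _ _ "%l. \<theta> / e * (1 / l)"])
  show "((%l. \<theta> / e * (1 / l)) \<longlongrightarrow> 0) at_top" by real_asymp
 qed (use R0 in \<open>auto intro!: always_eventually eventually_mono[OF eventually_gt_at_top[of 0]]\<close>)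
 then have "((%l. c * exp (- R l)) \<longlongrightarrow> c * exp (- 0)) at_top" by (intro tendsto_intros)
 moreover have "((%l. c * exp (- R l)) \<longlongrightarrow> Gamma \<theta>) at_top"
 proof (rule tendsto_sandwich[of "%l. Gamma \<theta> - exp (- (l * e / 2)) * (Gamma \<theta> * 2 powr \<theta>)" _ _ "%_. Gamma \<theta>"])
  show "((%l. Gamma \<theta> - exp (- (l * e / 2)) * (Gamma \<theta> * 2 powr \<theta>)) \<longlongrightarrow> Gamma \<theta>) at_top" using e by real_asymp
  have b: "w l * l powr \<theta> <= Gamma \<theta> & Gamma \<theta> - exp (- (l * e / 2)) * (Gamma \<theta> * 2 powr \<theta>) <= w l * l powr \<theta>" if l: "0 < l" for l
  proof
   have "w l <= (\<integral>s. ?gam l s \<partial>lborel)"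
    unfolding w_def using kint[OF l] gam[OF l] by (intro integral_mono) (auto simp: k_def p mult_left_le)
   then have "w l * l powr \<theta> <= Gamma \<theta> * l powr - \<theta> * l powr \<theta>" using gam[OF l] by (intro mult_right_mono) auto
   then show "w l * l powr \<theta> <= Gamma \<theta>" using l by (simp add: powr_minus field_simps)
   \<comment> \<open>Below \<open>e\<close> the functional \<open>p\<close> equals 1. Beyond
     \<open>e\<close>, half of the exponent already provides the small factor exp(- l e /
     2).\<close>
   have "(\<integral>s. ?gam l s - exp (- (l * e / 2)) * ?gam (l / 2) s \<partial>lborel) <= w l"
    unfolding w_def
   proof (intro integral_mono kint l Bochner_Integration.integrable_diff integrable_mult_right gam)
    fix s
    show "?gam l s - exp (- (l * e / 2)) * ?gam (l / 2) s <= exp (- (l * s)) * k s"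
    proof (cases "0 < s & e <= s")
     case True
     then have "l * e <= l * s" using l by simp
     then have "exp (- (l * s)) <= exp (- (l * e / 2)) * exp (- (l / 2 * s))" by (simp add: exp_add[symmetric])
     then have "?gam l s <= exp (- (l * e / 2)) * ?gam (l / 2) s" using True by (simp add: mult.assoc[symmetric] mult_right_mono)
     moreover have "0 <= exp (- (l * s)) * k s" using p by (simp add: k_def)
     ultimately show ?thesis by linarith
    qed (auto simp: k_def p1)
   qed (use l in auto)
   then have "Gamma \<theta> * l powr - \<theta> - exp (- (l * e / 2)) * (Gamma \<theta> * (l / 2) powr - \<theta>) <= w l"
    using gam[of l] gam[of "l / 2"] l by simp
   then have *: "(Gamma \<theta> * l powr - \<theta> - exp (- (l * e / 2)) * (Gamma \<theta> * (l / 2) powr - \<theta>)) * l powr \<theta> <= w l * l powr \<theta>" by (intro mult_right_mono) auto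
   then show "Gamma \<theta> - exp (- (l * e / 2)) * (Gamma \<theta> * 2 powr \<theta>) <= w l * l powr \<theta>"
   proof -
    have "l powr - \<theta> * l powr \<theta> = 1" "(l / 2) powr - \<theta> * l powr \<theta> = 2 powr \<theta>"
     using l by (simp_all add: powr_minus powr_divide)
    with * show ?thesis by (simp add: left_diff_distrib mult.assoc)
   qed
  qed
  show "eventually (%l. Gamma \<theta> - exp (- (l * e / 2)) * (Gamma \<theta> * 2 powr \<theta>) <= c * exp (- R l)) at_top"
   "eventually (%l. c * exp (- R l) <= Gamma \<theta>) at_top"
   using b wR by (auto intro!: eventually_mono[OF eventually_gt_at_top[of 0]])
 qed simp
 ultimately have "c = Gamma \<theta>" using tendsto_unique[OF trivial_limit_at_top_linorder] by fastforce
 then have "w l = Gamma \<theta> * l powr - \<theta> * exp (- R l)" using wR[OF l] l by (simp add: powr_minus field_simps)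
 moreover have "ennreal \<theta> * (NI x. (if 0 < x then ennreal (exp (- (l * x)) / x) * (1 - g x) else 0);lborel) = ennreal (R l)"
 proof -
  have "ennreal \<theta> * (NI x. (if 0 < x then ennreal (exp (- (l * x)) / x) * (1 - g x) else 0);lborel)
   = (NI x. ennreal \<theta> * (if 0 < x then ennreal (exp (- (l * x)) / x) * (1 - g x) else 0);lborel)"
   by (rule nn_integral_cmult[symmetric]) measurable
  also have "... = (NI x. ennreal (exp (- (l * x)) * kR x);lborel)"
  proof (rule nn_integral_cong)
   fix x
   have "1 - g x = ennreal (1 - r x)" by (simp add: r ennreal_minus[symmetric])
   then show "ennreal \<theta> * (if 0 < x then ennreal (exp (- (l * x)) / x) * (1 - g x) else 0) = ennreal (exp (- (l * x)) * kR x)"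
    using e \<theta> r(3)[of x] r1[of x] by (auto simp: kR_def ennreal_mult[symmetric] mult_ac)
  qed
  also have "... = ennreal (R l)" unfolding R_def using kRint[OF l] kRb by (intro nn_integral_eq_integral) auto
  finally show ?thesis .
 qed
 ultimately show ?thesis using Ww[OF l] R0(1)[of l] \<theta> by (simp add: ennreal_mult Gamma_real_pos less_imp_le)
qed


text \<open>The cutoffs \<open>h n\<close>, equal to 1 below 1 / (n + 1), decrease to
  \<open>g\<close> at positive arguments. Both sides converge along them, even when the integral in
  the limiting exponent is infinite.\<close>

theorem laplace_Phi:
 assumes g[measurable]: "g : bm borel" and g1: "!!x. g x <= 1" and l: "0 < l"
 shows "W g l = ennreal (Gamma \<theta> * l powr - \<theta>) *
  en (ennreal \<theta> * (NI x. (if 0 < x then ennreal (exp (- (l * x)) / x) * (1 - g x) else 0);lborel))"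
proof -
 define h where "h n x = (if x < 1 / real (Suc n) then 1 else g x)" for n x
 have h[measurable]: "h n : bm borel" for n unfolding h_def[abs_def] by measurable
 have h1: "h n x <= 1" for n x by (simp add: h_def g1)
 have dec: "decseq (%n. h n x)" for x
 proof (rule decseq_SucI)
  fix n
  have "1 / real (Suc (Suc n)) <= 1 / real (Suc n)" by (rule frac_le) auto
  then show "h (Suc n) x <= h n x" unfolding h_def using g1 by (auto simp del: of_nat_Suc)
 qed
 have ev: "eventually (%n. h n x = g x) sequentially" if "0 < x" for x
 proof -
  obtain m where "inverse (real (Suc m)) < x" using reals_Archimedean[OF \<open>0 < x\<close>] by blast
  then have m: "1 / real (Suc m) < x" by (simp only: inverse_eq_divide)
  have "h n x = g x" if "m <= n" for n
   using that m frac_le[of 1 1 "real (Suc m)" "real (Suc n)"] by (simp add: h_def)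
  then show ?thesis unfolding eventually_sequentially by blast
 qed
 have SUP_h: "(SUP n. F (h n x)) = F (g x)" if "0 < x" "incseq (%n. F (h n x))" for x and F :: "ennreal => ennreal"
  using LIMSEQ_unique[OF LIMSEQ_SUP[OF that(2)] tendsto_eventually[of _ "F (g x)"]] eventually_mono[OF ev[OF that(1)]] by auto
 have nlnm: "nln y' <= nln y" if "y <= y'" "y' <= 1" for y y'
 proof (cases "y = 0")
  case False
  have "y' < \<top>" using that(2) le_less_trans by fastforce
  then have "0 < enn2real y" "enn2real y <= enn2real y'"
   using False that(1) by (auto simp: enn2real_positive_iff zero_less_iff_neq_zero enn2real_mono intro: le_less_trans)
  then show ?thesis using that False by (auto simp: nln_def intro!: ennreal_leI)
 qed (simp add: nln_def)
 have inc: "incseq (%n. nln (h n x))" "incseq (%n. 1 - h n x)" for x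
  using decseqD[OF dec[of x]] by (auto simp: incseq_def h1 intro!: nlnm ennreal_minus_mono)
 have Phi: "(%n. Phi (h n) s) \<longlonglongrightarrow> Phi g s" if s: "0 < s" for s
  unfolding Phi_def
 proof (rule nn_integral_dominated_convergence[where w="%_. 1"])
  show "AE y in GEM. (%n. en (\<Sum>i. nln (h n (s * stick_breaking y i)))) \<longlonglongrightarrow> en (\<Sum>i. nln (g (s * stick_breaking y i)))"
   using AE_GEM
  proof eventually_elim
   case (elim y)
   let ?x = "%i. s * stick_breaking y i"
   have "0 < ?x i" for i using stick_breaking_pos(1)[of y] elim s by simp
   then have "(\<Sum>i. nln (g (?x i))) = (\<Sum>i. SUP n. nln (h n (?x i)))" using SUP_h inc(1) by simp
   also have "... = (SUP n. \<Sum>i. nln (h n (?x i)))" by (rule ennreal_suminf_SUP_eq[OF inc(1)])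
   finally have eq: "(\<Sum>i. nln (g (?x i))) = (SUP n. \<Sum>i. nln (h n (?x i)))" .
   have ic: "incseq (%n. \<Sum>i. nln (h n (?x i)))"
    using incseqD[OF inc(1)] by (auto simp: incseq_def intro!: suminf_le)
   show ?case unfolding eq en_SUP[OF ic] using ic
    by (intro LIMSEQ_INF) (auto simp: incseq_def decseq_def intro: en_mono)
  qed
 qed (auto simp: en_le_1 GEM.emeasure_space_1)
 have "(%n. W (h n) l) \<longlonglongrightarrow> W g l"
  unfolding W_def
 proof (rule nn_integral_dominated_convergence[where w="%s. if 0 < s then ennreal (exp (- (l * s)) * s powr (\<theta> - 1)) else 0"])
  show "(NI s. (if 0 < s then ennreal (exp (- (l * s)) * s powr (\<theta> - 1)) else 0);lborel) < \<infinity>"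
   by (simp add: nn_integral_Gamma[OF \<theta> l])
  show "AE s in lborel. (%n. if 0 < s then ennreal (exp (- (l * s)) * s powr (\<theta> - 1)) * Phi (h n) s else 0)
    \<longlonglongrightarrow> (if 0 < s then ennreal (exp (- (l * s)) * s powr (\<theta> - 1)) * Phi g s else 0)"
   using Phi by (intro AE_I2) (auto intro!: ennreal_tendsto_cmult)
  show "AE s in lborel. (if 0 < s then ennreal (exp (- (l * s)) * s powr (\<theta> - 1)) * Phi (h n) s else 0)
    <= (if 0 < s then ennreal (exp (- (l * s)) * s powr (\<theta> - 1)) else 0)" for n
   using mult_left_mono[OF Phi_le_1] by (intro AE_I2) auto
 qed measurable
 let ?c = "ennreal (Gamma \<theta> * l powr - \<theta>)"
 let ?i = "%x. ennreal (exp (- (l * x)) / x)"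
 let ?T = "%g. ennreal \<theta> * (NI x. (if 0 < x then ?i x * (1 - g x) else 0);lborel)"
 have incT: "incseq (%n. ?T (h n))"
  using incseqD[OF inc(2)] by (auto simp: incseq_def intro!: mult_left_mono nn_integral_mono)
 have "(NI x. (if 0 < x then ?i x * (1 - g x) else 0);lborel) = (NI x. (SUP n. if 0 < x then ?i x * (1 - h n x) else 0);lborel)"
  using SUP_h[of _ "%y. 1 - y"] inc(2) by (intro nn_integral_cong) (auto simp: SUP_mult_left_ennreal[symmetric])
 also have "... = (SUP n. NI x. (if 0 < x then ?i x * (1 - h n x) else 0);lborel)"
  using incseqD[OF inc(2)] by (intro nn_integral_monotone_convergence_SUP) (auto simp: incseq_def le_fun_def intro!: mult_left_mono)
 finally have "?T g = (SUP n. ?T (h n))" by (simp add: SUP_mult_left_ennreal)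
 then have enT: "en (?T g) = (INF n. en (?T (h n)))" using en_SUP[OF incT] by simp
 have "(%n. en (?T (h n))) \<longlonglongrightarrow> en (?T g)"
  unfolding enT using incT by (intro LIMSEQ_INF) (auto simp: incseq_def decseq_def intro: en_mono)
 then have "(%n. ?c * en (?T (h n))) \<longlonglongrightarrow> ?c * en (?T g)" by (rule ennreal_tendsto_cmult[rotated]) simp
 moreover have "W (h n) l = ?c * en (?T (h n))" for n
  by (rule laplace_Phi_cutoff[OF h h1 _ _ l, of "1 / real (Suc n)"]) (auto simp: h_def)
 ultimately show ?thesis using LIMSEQ_unique \<open>(%n. W (h n) l) \<longlonglongrightarrow> W g l\<close> by simp
qed

end

section \<open>Moments, Frullani integrals and independence\<close>

lemma real_distribution_moments:
 assumes m: "real_distribution m" and e: "real_distribution e"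
  and AE: "AE x in m. 0 <= x & x <= 1" "AE x in e. 0 <= x & x <= 1"
  and mom: "!!n :: nat. (\<integral>x. x ^ n \<partial>m) = (\<integral>x. x ^ n \<partial>e)"
 shows "m = e"
proof (rule Levy_uniqueness[OF m e], rule ext)
 fix t :: real
 have b: "norm (char m t - (\<Sum>k\<le>n. ((\<i> * t) ^ k / fact k) * (\<integral>x. x ^ k \<partial>m))) <= 2 * \<bar>t\<bar> ^ n / fact n"
  if m: "real_distribution m" and AE: "AE x in m. 0 <= x & x <= 1" for m and n :: nat
 proof -
  interpret real_distribution m by fact
  have b: "AE x in m. norm (x ^ k) <= 1" for k :: nat
   using AE by eventually_elim (auto simp: power_abs intro: power_le_one)
  have int: "integrable m (%x. x ^ k)" for k :: nat
   by (rule integrable_const_bound[OF b]) simp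
  have "norm (char m t - (\<Sum>k\<le>n. ((\<i> * t) ^ k / fact k) * expectation (%x. x ^ k))) <= (2 * \<bar>t\<bar> ^ n / fact n) * expectation (%x. \<bar>x\<bar> ^ n)"
   by (rule char_approx1) (rule int)
  also have "expectation (%x. \<bar>x\<bar> ^ n) <= 1"
   using b[of n] int[of n] by (intro integral_le_const) (auto simp: power_abs[symmetric])
  then have "(2 * \<bar>t\<bar> ^ n / fact n) * expectation (%x. \<bar>x\<bar> ^ n) <= (2 * \<bar>t\<bar> ^ n / fact n) * 1"
   by (intro mult_left_mono) auto
  finally show ?thesis by simp
 qed
 \<comment> \<open>Both characteristic functions are compared with the same Taylor polynomial, built
   from the common moments; on [0, 1] each remainder is at most 2 |t|^n / n!.\<close>
 have "norm (char m t - char e t) <= 4 * (\<bar>t\<bar> ^ n / fact n)" for n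
 proof -
  let ?s = "\<Sum>k\<le>n. ((\<i> * t) ^ k / fact k) * (\<integral>x. x ^ k \<partial>e)"
  have "norm (char m t - char e t) <= norm (char m t - ?s) + norm (char e t - ?s)"
   using norm_triangle_ineq4[of "char m t - ?s" "char e t - ?s"] by simp
  also have "... <= 2 * \<bar>t\<bar> ^ n / fact n + 2 * \<bar>t\<bar> ^ n / fact n"
   using b[OF m AE(1), of n] b[OF e AE(2), of n] by (intro add_mono) (simp_all add: mom)
  finally show ?thesis by simp
 qed
 moreover have "(%n. 4 * (\<bar>t\<bar> ^ n / fact n)) \<longlonglongrightarrow> 4 * 0"
  using summable_LIMSEQ_zero[OF summable_exp[of "\<bar>t\<bar>"]] by (intro tendsto_mult_left) (simp add: divide_inverse mult.commute)
 ultimately have "norm (char m t - char e t) <= 0"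
  by (intro LIMSEQ_le_const[of "%n. 4 * (\<bar>t\<bar> ^ n / fact n)" 0 "norm (char m t - char e t)"]) auto
 then show "char m t = char e t" by simp
qed

text \<open>Reduced to probability measures by dividing by the common total mass, the zeroth moment;
  mass 0 is treated apart.\<close>

lemma finite_measure_moments:
 assumes u: "finite_measure u" "sets u = sets borel" "AE x in u. 0 <= x & x <= 1"
  and b: "finite_measure b" "sets b = sets borel" "AE x in b. 0 <= x & x <= 1"
  and mom: "!!n :: nat. (NI x. ennreal (x ^ n);u) = (NI x. ennreal (x ^ n);b)"
 shows "u = (b :: real measure)"
proof -
 have sp: "space u = UNIV" "space b = UNIV" using sets_eq_imp_space_eq[OF u(2)] sets_eq_imp_space_eq[OF b(2)] by simp_all
 have tot: "emeasure u UNIV = emeasure b UNIV" using mom[of 0] sp by simp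
 show ?thesis
 proof (cases "emeasure u UNIV = 0")
  case True
  show ?thesis
  proof (rule measure_eqI)
   fix A assume "A : sets u"
   have "emeasure u A <= emeasure u UNIV" "emeasure b A <= emeasure b UNIV"
    using emeasure_space[of u A] emeasure_space[of b A] sp by simp_all
   then show "emeasure u A = emeasure b A" using True tot by simp
  qed (simp add: u b)
 next
  case False
  define m where "m = measure u UNIV"
  have em: "emeasure u UNIV = ennreal m" "0 < m"
   using False finite_measure.emeasure_eq_measure[OF u(1), of UNIV] by (auto simp: m_def zero_less_measure_iff)
  let ?n = "%u. scale_measure (ennreal (1 / m)) u"
  have rd: "real_distribution (?n u')" if "sets u' = sets borel" "emeasure u' UNIV = ennreal m" for u'
  proof -
   have "space u' = UNIV" using sets_eq_imp_space_eq[OF that(1)] by simp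
   then have "prob_space (?n u')"
    using em(2) that by (intro prob_spaceI) (simp add: space_scale_measure ennreal_mult[symmetric])
   then show ?thesis using that(1)
    by (simp add: real_distribution_def real_distribution_axioms_def)
  qed
  have AE': "AE x in ?n u'. 0 <= x & x <= 1" if "AE x in u'. 0 <= x & x <= 1" for u'
  proof -
   from that obtain Z where "{x : space u'. ~ (0 <= x & x <= 1)} \<subseteq> Z" "emeasure u' Z = 0" "Z : sets u'" by (rule AE_E)
   then show ?thesis by (intro AE_I[of _ _ Z]) (auto simp: space_scale_measure)
  qed
  have mm: "(\<integral>x. x ^ k \<partial>?n u') = enn2real (ennreal (1 / m) * (NI x. ennreal (x ^ k);u'))"
   if "AE x in u'. 0 <= x & x <= 1" "sets u' = sets borel" for u' and k :: nat
  proof -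
   have bm: "(%x. x ^ k) : bm u'" "(%x. x ^ k) : bm (?n u')"
    using that(2) by (simp_all add: measurable_cong_sets[OF that(2) refl] measurable_cong_sets[of "?n u'" borel])
   have "(\<integral>x. x ^ k \<partial>?n u') = enn2real (NI x. ennreal (x ^ k);?n u')"
    using AE'[OF that(1)] bm by (intro integral_eq_nn_integral) (auto elim: eventually_mono)
   then show ?thesis using bm by (simp add: nn_integral_scale_measure)
  qed
  have "?n u = ?n b"
   using rd[of u] rd[of b] em tot AE'[OF u(3)] AE'[OF b(3)] u b mom
   by (intro real_distribution_moments) (auto simp: mm)
  then have "scale_measure (ennreal m) (?n u) = scale_measure (ennreal m) (?n b)" by simp
  then show ?thesis using em(2) by (simp add: scale_scale_measure ennreal_mult[symmetric])
 qed
qed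

text \<open>The integrand is the integral of exp(- v x) over \<open>v\<close> from \<open>r\<close>
  to \<open>r + b\<close>; exchanging the two integrals leaves that of 1 / v.\<close>

lemma frullani:
 assumes r: "0 < r" and b: "0 <= b"
 shows "(NI x. (if 0 < x then ennreal ((exp (- (r * x)) - exp (- ((r + b) * x))) / x) else 0);lborel) = ennreal (ln ((r + b) / r))"
proof -
 let ?f = "%x v. if 0 < x then ennreal (exp (- (v * x))) * indicator {r..r + b} v else 0 :: ennreal"
 have "(NI x. (if 0 < x then ennreal ((exp (- (r * x)) - exp (- ((r + b) * x))) / x) else 0);lborel) = (NI x. NI v. ?f x v;lborel;lborel)"
 proof (rule nn_integral_cong)
  fix x :: real
  show "(if 0 < x then ennreal ((exp (- (r * x)) - exp (- ((r + b) * x))) / x) else 0) = (NI v. ?f x v;lborel)"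
  proof (cases "0 < x")
   case True
   have "(NI v. ennreal (exp (- (v * x))) * indicator {r..r + b} v;lborel) = ennreal (- exp (- ((r + b) * x)) / x - - exp (- (r * x)) / x)"
    using True b by (intro nn_integral_FTC_Icc[where F="%v. - exp (- (v * x)) / x"]) (auto intro!: derivative_eq_intros)
   then show ?thesis using True by (simp add: diff_divide_distrib)
  qed simp
 qed
 also have "... = (NI v. NI x. ?f x v;lborel;lborel)"
  by (rule lborel_pair.Fubini') measurable
 also have "... = (NI v. ennreal (1 / v) * indicator {r..r + b} v;lborel)"
 proof (rule nn_integral_cong)
  fix v :: real
  show "(NI x. ?f x v;lborel) = ennreal (1 / v) * indicator {r..r + b} v"
  proof (cases "v : {r..r + b}")
   case True
   have "(NI x. ?f x v;lborel) = (NI s. (if 0 < s then ennreal (exp (- (v * s)) * s powr (1 - 1)) else 0);lborel)"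
    using True by (intro nn_integral_cong) simp
   also have "... = ennreal (1 / v)" using nn_integral_Gamma[of 1 v] True r by (simp add: powr_minus_divide)
   finally show ?thesis using True by simp
  qed (simp cong: if_cong)
 qed
 also have "... = ennreal (ln (r + b) - ln r)"
  using r b by (intro nn_integral_FTC_Icc) (auto intro!: derivative_eq_intros)
 finally show ?thesis using r b by (simp add: ln_div)
qed

text \<open>The multiplicity of a point is the number of indices mapped to it; what follows is an
  exchange of two counting integrals.\<close>

lemma collection_sum_union_of:
 "csum f (collection_union C (collection_of UNIV X)) = csum f C + (\<Sum>i. f (X i))"
proof -
 let ?g = "%(x, i). indicator {i. X i = x} i * f x"
 have of: "ennreal_of_enat (collection_of UNIV X x) = (NI i. indicator {i. X i = x} i;count_space UNIV)" for x
  by (simp add: collection_of_def ennreal_of_enat_enat emeasure_count_space)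
 have "csum f (collection_union C (collection_of UNIV X))
   = csum f C + (NI x. ennreal_of_enat (collection_of UNIV X x) * f x;count_space UNIV)"
  unfolding collection_sum_def collection_union_def
  by (subst nn_integral_add[symmetric]) (auto simp: ennreal_of_enat_plus distrib_right)
 also have "(NI x. ennreal_of_enat (collection_of UNIV X x) * f x;count_space UNIV)
   = (NI x. NI i. ?g (x, i);count_space UNIV;count_space UNIV)"
  unfolding of prod.case by (intro nn_integral_cong nn_integral_multc[symmetric]) simp
 also have "... = (NI i. NI x. ?g (x, i);count_space UNIV;count_space UNIV)"
  by (rule trans[OF nn_integral_fst_count_space nn_integral_snd_count_space[symmetric]])
 also have "... = (NI i. f (X i);count_space UNIV)"
 proof (rule nn_integral_cong)
  fix i
  have "(NI x. ?g (x, i);count_space UNIV) = (NI x. f (X i) * indicator {X i} x;count_space UNIV)"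
   by (intro nn_integral_cong) (auto simp: indicator_def)
  then show "(NI x. ?g (x, i);count_space UNIV) = f (X i)"
   by (simp add: nn_integral_cmult_indicator)
 qed
 finally show ?thesis by (simp add: nn_integral_count_space_nat)
qed

text \<open>The definition of conditional independence speaks of events only. Functions replace
  indicators one coordinate at a time: in the induction, the coordinates below \<open>j\<close>
  carry arbitrary functions and the others indicators.\<close>

lemma cond_indep_prod:
 assumes ci: "cond_indep_with_laws M A S Q X" and A: "A : M ->M (\<Pi>\<^sub>M i\<in>UNIV. borel)"
  and pos: "AE y in M. ALL i. 0 < A y i" and Qs: "!!a. sets (Q a) = sets S"
  and Qm: "!!F. F : bm S ==> (%a. if 0 < a then NI x. F x;Q a else 0) : bm borel"
  and F: "!!i. F i : bm S"
 shows "(NI y. (\<Prod>i<n. F i (X i y));M) = (NI y. (\<Prod>i<n. if 0 < A y i then NI x. F i x;Q (A y i) else 0);M)"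
proof -
 \<comment> \<open>Guarded by \<open>0 < a\<close>, because measurability in the parameter is
   available only with the guard; it costs nothing, as the entries of \<open>A\<close> are almost
   surely positive.\<close>
 let ?q = "%F a. if 0 < a then NI x. F x;Q a else 0"
 have Am[measurable]: "(%y. A y i) : bm M" for i
  using measurable_compose[OF A measurable_component_singleton[of i]] by simp
 have Xm[measurable]: "X i : M ->M S" for i using ci by (simp add: cond_indep_with_laws_def)
 have FX: "(%y. f (X i y)) : bm M" "(%y. ?q f (A y i)) : bm M"
  if "f : bm S" for f i
  using measurable_compose[OF Xm that] measurable_compose[OF Am Qm[OF that]] by simp_all
 have fQ: "f : bm (Q a)" if "f : bm S" for f a
  using that by (simp add: measurable_cong_sets[OF Qs refl])
 have "(NI y. (\<Prod>i<n. F i (X i y));M) = (NI y. (\<Prod>i<n. ?q (F i) (A y i));M)"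
  if "!!i. F i : bm S" "!!i. j <= i ==> \<exists>B\<in>sets S. F i = indicator B" for j F
  using that
 proof (induction j arbitrary: F)
  case 0
  then obtain B where B: "!!i. B i : sets S" "!!i. F i = indicator (B i)" by (metis le0)
  have "(NI y. (\<Prod>i<n. F i (X i y));M) = (NI y. indicator {y\<in>space M. A y : UNIV & (\<forall>i<n. X i y : B i)} y;M)"
  proof (rule nn_integral_cong)
   fix y assume "y : space M"
   show "(\<Prod>i<n. F i (X i y)) = indicator {y\<in>space M. A y : UNIV & (\<forall>i<n. X i y : B i)} y"
   proof (cases "\<forall>i<n. X i y : B i")
    case False
    then obtain i where "i < n" "X i y ~: B i" by blast
    then have "(\<Prod>i<n. F i (X i y)) = 0" by (intro prod_zero bexI[of _ i]) (auto simp: B)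
    then show ?thesis using False by simp
   qed (use \<open>y : space M\<close> in \<open>simp add: B\<close>)
  qed
  also have "... = emeasure M {y\<in>space M. A y : UNIV & (\<forall>i<n. X i y : B i)}"
  proof (rule nn_integral_indicator)
   have "{y\<in>space M. X i y : B i} : sets M" for i using measurable_sets[OF Xm B(1)[of i], of i] by (simp add: vimage_def Int_def conj_commute)
   then have "{y\<in>space M. \<forall>i<n. X i y : B i} : sets M" by (intro sets.sets_Collect_countable_All sets.sets_Collect_imp) auto
   then show "{y\<in>space M. A y : UNIV & (\<forall>i<n. X i y : B i)} : sets M" by (simp only: UNIV_I simp_thms)
  qed
  also have "... = (NI y. indicator UNIV (A y) * (\<Prod>i<n. emeasure (Q (A y i)) (B i));M)"
  proof -
   have "UNIV : sets (\<Pi>\<^sub>M i\<in>UNIV. (borel :: real measure))" using sets.top[of "\<Pi>\<^sub>M i\<in>UNIV. (borel :: real measure)"] by (simp add: space_PiM)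
   then show ?thesis using ci B(1) unfolding cond_indep_with_laws_def by blast
  qed
  also have "... = (NI y. (\<Prod>i<n. ?q (F i) (A y i));M)"
   using pos by (intro nn_integral_cong_AE, eventually_elim) (simp add: B Qs)
  finally show ?case .
 next
  case (Suc j)
  show ?case
  proof (cases "j < n")
   case False
   let ?G = "%i. if i = j then indicator {} else F i"
   have "(NI y. (\<Prod>i<n. ?G i (X i y));M) = (NI y. (\<Prod>i<n. ?q (?G i) (A y i));M)"
    using Suc.prems by (intro Suc.IH) (auto simp: le_Suc_eq Suc_le_eq intro!: bexI[of _ "{}"])
   moreover have "(\<Prod>i<n. ?G i (X i y)) = (\<Prod>i<n. F i (X i y))" "(\<Prod>i<n. ?q (?G i) (A y i)) = (\<Prod>i<n. ?q (F i) (A y i))" for y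
    using False by (intro prod.cong refl; simp; fail)+
   ultimately show ?thesis by simp
  next
   case True
   let ?I = "{..<n} - {j}"
   let ?w = "%y. \<Prod>i\<in>?I. F i (X i y)" and ?v = "%y. \<Prod>i\<in>?I. ?q (F i) (A y i)"
   have wv[measurable]: "?w : bm M" "?v : bm M"
    using FX[OF Suc.prems(1)] by (auto intro!: borel_measurable_prod_ennreal)
   have sp: "(\<Prod>i<n. h i) = h j * (\<Prod>i\<in>?I. h i)" for h :: "nat => ennreal"
    using True by (intro prod.remove) auto
   have "(NI y. f (X j y) * ?w y;M) = (NI y. ?q f (A y j) * ?v y;M)" if "f : bm S" for f
    using that
   proof (induction f rule: borel_measurable_induct)
    case (cong f g)
    have "f (X j y) = g (X j y)" if "y : space M" for y using cong(3) measurable_space[OF Xm that] by simp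
    moreover have "?q f a = ?q g a" for a
     using cong(3) by (auto intro!: nn_integral_cong simp: sets_eq_imp_space_eq[OF Qs])
    ultimately show ?case using cong(4) by (simp cong: nn_integral_cong)
   next
    case (set B)
    let ?G = "%i. if i = j then indicator B else F i"
    have "(NI y. (\<Prod>i<n. ?G i (X i y));M) = (NI y. (\<Prod>i<n. ?q (?G i) (A y i));M)"
     using Suc.prems set by (intro Suc.IH) (auto simp: le_Suc_eq Suc_le_eq)
    moreover have "(\<Prod>i\<in>?I. ?G i (X i y)) = ?w y" "(\<Prod>i\<in>?I. ?q (?G i) (A y i)) = ?v y" for y
     by (rule prod.cong[OF refl], simp)+
    ultimately show ?case unfolding sp by simp
   next
    case (mult f c)
    have "?q (%x. c * f x) a = c * ?q f a" for a using fQ[OF mult(2)] by (simp add: nn_integral_cmult)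
    then show ?case using mult(4) FX[OF mult(2)] by (simp only: mult.assoc) (simp add: nn_integral_cmult)
   next
    case (add f g)
    have "?q (%x. g x + f x) a = ?q g a + ?q f a" for a
     using fQ[OF add(1)] fQ[OF add(3)] by (simp add: nn_integral_add)
    then show ?case using add.IH FX[OF add(1)] FX[OF add(3)] by (simp only: distrib_right) (simp add: nn_integral_add)
   next
    case (seq U)
    have Sup: "(SUP i. U i) x = (SUP i. U i x)" for x by (simp add: image_image)
    have inc: "incseq (%i. U i x)" for x using \<open>incseq U\<close> by (auto simp: incseq_def le_fun_def)
    have q: "?q (SUP i. U i) a = (SUP i. ?q (U i) a)" for a
     using fQ[OF seq(1)] \<open>incseq U\<close> unfolding Sup by (simp add: nn_integral_monotone_convergence_SUP)
    have "(NI y. (SUP i. U i) (X j y) * ?w y;M) = (SUP i. NI y. U i (X j y) * ?w y;M)"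
     unfolding Sup SUP_mult_right_ennreal using FX[OF seq(1)] incseqD[OF inc]
     by (intro nn_integral_monotone_convergence_SUP) (auto simp: incseq_def le_fun_def intro!: mult_right_mono)
    also have "... = (SUP i. NI y. ?q (U i) (A y j) * ?v y;M)" using seq.IH by simp
    also have "... = (NI y. ?q (SUP i. U i) (A y j) * ?v y;M)"
     unfolding q SUP_mult_right_ennreal using FX[OF seq(1)] incseqD[OF inc]
     by (intro nn_integral_monotone_convergence_SUP[symmetric]) (auto simp: incseq_def le_fun_def intro!: mult_right_mono nn_integral_mono)
    finally show ?case .
   qed
   from this[OF Suc.prems(1)[of j]] show ?thesis unfolding sp .
  qed
 qed
 note claim = this
 let ?G = "%i. if i < n then F i else indicator {}"
 have "(NI y. (\<Prod>i<n. ?G i (X i y));M) = (NI y. (\<Prod>i<n. ?q (?G i) (A y i));M)"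
  by (rule claim[of ?G n]) (use F in \<open>auto intro!: bexI[of _ "{}"]\<close>)
 moreover have "(\<Prod>i<n. ?G i (X i y)) = (\<Prod>i<n. F i (X i y))" "(\<Prod>i<n. ?q (?G i) (A y i)) = (\<Prod>i<n. ?q (F i) (A y i))" for y
  by (rule prod.cong[OF refl], simp)+
 ultimately show ?thesis by simp
qed

text \<open>Events about functions of \<open>X\<close> and \<open>Y\<close> form subfamilies of the
  two independent families, so the composed variables are independent and their integrals
  multiply.\<close>

lemma independent_rvs_en:
 assumes "prob_space M" and ind: "independent_rvs M S X T Y"
  and f[measurable]: "f : bm S" and g[measurable]: "g : bm T"
 shows "(NI w. f (X w) * g (Y w);M) = (NI w. f (X w);M) * (NI w. g (Y w);M)"
proof -
 interpret prob_space M by fact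
 have X[measurable]: "X : M ->M S" and Y[measurable]: "Y : M ->M T"
  and iset: "indep_set {X -` A \<inter> space M | A. A : sets S} {Y -` B \<inter> space M | B. B : sets T}"
  using ind by (simp_all add: independent_rvs_def)
 let ?X = "%w. f (X w)" and ?Y = "%w. g (Y w)"
 let ?S = "%Z. {Z -` A \<inter> space M | A. A : sets (borel :: ennreal measure)}"
 have st: "Int_stable (?S Z)" for Z :: "_ => ennreal"
 proof (rule Int_stableI)
  fix a b assume "a : ?S Z" "b : ?S Z"
  then obtain A B where "a = Z -` A \<inter> space M" "b = Z -` B \<inter> space M" "A : sets borel" "B : sets borel" by auto
  then show "a \<inter> b : ?S Z" by (auto intro!: exI[of _ "A \<inter> B"])
 qed
 have sub: "{(%w. h (Z w)) -` A \<inter> space M | A. A : sets borel} \<subseteq> {Z -` A \<inter> space M | A. A : sets U}"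
  if "Z : M ->M U" "h : bm U" for Z :: "_ => 'z" and h :: "'z => ennreal" and U
 proof clarify
  fix A :: "ennreal set" assume "A : sets borel"
  then have "h -` A \<inter> space U : sets U" using that(2) by (rule measurable_sets[rotated])
  moreover have "(%w. h (Z w)) -` A \<inter> space M = Z -` (h -` A \<inter> space U) \<inter> space M"
   using measurable_space[OF that(1)] by auto
  ultimately show "EX B. (%w. h (Z w)) -` A \<inter> space M = Z -` B \<inter> space M & B : sets U" by blast
 qed
 have "indep_set (?S ?X) (?S ?Y)"
  using iset unfolding indep_set_def
  by (rule indep_sets_mono_sets) (use sub[OF X f] sub[OF Y g] in \<open>auto split: bool.split\<close>)
 then have "indep_var borel ?X borel ?Y" unfolding indep_var_eq using st by (auto intro!: indep_set_sigma_sets)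
 then have iv: "indep_vars (case_bool borel borel) (case_bool ?X ?Y) UNIV" by (simp add: indep_var_def)
 have "(%b. case_bool borel borel b) = (%_. borel :: ennreal measure)" by (auto split: bool.split)
 with iv have "indep_vars (%_. borel) (case_bool ?X ?Y) UNIV" by metis
 then have "(NI w. (\<Prod>b\<in>UNIV. case_bool ?X ?Y b w);M) = (\<Prod>b\<in>UNIV. NI w. case_bool ?X ?Y b w;M)"
  by (intro indep_vars_nn_integral) auto
 then show ?thesis by (simp add: UNIV_bool mult.commute)
qed

context gem
begin

lemma PD_nn_integral:
 assumes PD: "PD_partition \<theta> v M A" and v: "0 < v"
  and h: "h : bm (\<Pi>\<^sub>M i\<in>UNIV. borel)"
 shows "(NI w. h (A w);M) = (NI y. h (%i. v * ranked (stick_breaking y) i);GEM)"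
proof -
 let ?P = "\<Pi>\<^sub>M i\<in>(UNIV::nat set). (borel :: real measure)"
 have A: "A : M ->M ?P" and d: "distr M ?P A = distr (poisson_dirichlet \<theta>) ?P (%p i. v * p i)"
  using PD by (simp_all add: PD_partition_def)
 have pd: "poisson_dirichlet \<theta> = distr GEM ?P (%y. ranked (stick_breaking y))" by (simp add: poisson_dirichlet_def bd_def)
 have s: "stick_breaking : GEM ->M ?P" by (rule measurable_PiM_single') (simp_all add: space_PiM measurable_stick_breaking)
 have r: "(%y. ranked (stick_breaking y)) : GEM ->M ?P" by (rule measurable_compose[OF s measurable_ranked])
 have sc: "(%p i. v * p i) : ?P ->M ?P"
  by (rule measurable_PiM_single') (simp_all add: space_PiM borel_measurable_times measurable_component_singleton)
 have "(NI w. h (A w);M) = (NI p. h p;distr M ?P A)" using A h by (simp add: nn_integral_distr)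
 also have "... = (NI p. h (%i. v * p i);poisson_dirichlet \<theta>)" unfolding d
  using sc h by (intro nn_integral_distr) (simp_all add: pd)
 also have "... = (NI y. h (%i. v * ranked (stick_breaking y) i);GEM)" unfolding pd
  using r measurable_compose[OF sc h] by (simp add: nn_integral_distr)
 finally show ?thesis .
qed

lemma PD_pos:
 assumes PD: "PD_partition \<theta> r M A" and r: "0 < r"
 shows "AE w in M. ALL i. 0 < A w i"
proof -
 let ?P = "\<Pi>\<^sub>M i\<in>(UNIV::nat set). (borel :: real measure)"
 have A: "A : M ->M ?P" using PD by (simp add: PD_partition_def)
 have [measurable]: "(%p. p i) : bm ?P" for i by (rule measurable_component_singleton) simp
 let ?h = "%p. if ALL i. 0 < p i then 0 else 1 :: ennreal"
 have h: "?h : bm ?P" by measurable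
 have "(NI w. ?h (A w);M) = (NI y. 0;GEM)"
  unfolding PD_nn_integral[OF PD r h]
  by (rule nn_integral_cong_AE) (use AE_GEM in \<open>eventually_elim\<close>, use r in \<open>simp add: le_ranked_iff(3)[OF stick_breaking_pos(2) zero_less_one stick_breaking_pos(1)]\<close>)
 then show ?thesis using measurable_compose[OF A h] by (simp add: nn_integral_0_iff_AE split: if_splits)
qed

text \<open>A sum over the parts does not see their order, so the ranking can be undone and the
  sticks taken as they come.\<close>

lemma PD_Phi:
 assumes PD: "PD_partition \<theta> r M A" and r: "0 < r" and g[measurable]: "g : bm borel"
 shows "(NI w. en (\<Sum>i. nln (g (A w i)));M) = Phi g r"
proof -
 have [measurable]: "(%p. p i) : bm (\<Pi>\<^sub>M i\<in>(UNIV::nat set). (borel :: real measure))" for i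
  by (rule measurable_component_singleton) simp
 show ?thesis
  unfolding Phi_def
 proof (subst PD_nn_integral[OF PD r])
  show "(%p. en (\<Sum>i. nln (g (p i)))) : bm (\<Pi>\<^sub>M i\<in>UNIV. borel)" by measurable
  show "(NI y. en (\<Sum>i. nln (g (r * ranked (stick_breaking y) i)));GEM) = (NI y. en (\<Sum>i. nln (g (r * stick_breaking y i)));GEM)"
  proof (rule nn_integral_cong_AE, use AE_GEM in eventually_elim)
   case (elim y)
   have "(%x. nln (g (r * x))) : bm borel" by measurable
   from suminf_ranked[OF stick_breaking_pos(2) stick_breaking_pos(1) this, of y] elim
   show ?case by simp
  qed
 qed
qed

end


section \<open>The soup conditioned on its local time at \<open>z\<close>\<close>

locale thick_point = grid_excursions N D z + gem \<theta>
 for N :: nat and D :: "point set" and z :: point and \<theta> :: real +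
 fixes P :: "real => 'p measure" and E :: "real => 'p => (real \<times> path) collection"
 assumes ppp: "!!\<alpha>. 0 < \<alpha> ==> poisson_point_process (P \<alpha>) (E \<alpha>) (Xi_intensity N D z \<alpha>)"
begin

abbreviation "LS == loop_space N"
abbreviation "CS == collection_space (loop_space N)"
abbreviation "XiL a w == Xi_loop N z a (E a w)"

text \<open>By \<open>green_eq\<close> this is (log N)^2 / (2 pi G) with G the Green function at
  \<open>z\<close>: the rate of the Gamma law of the local time in units of
  \<open>cN\<close>.\<close>

definition rr :: real where "rr = cN * (4 - mE)"

lemma rr: "0 < rr" using cN mE by (simp add: rr_def)

lemma measurable_XiL: "0 < a ==> XiL a : P a ->M LS"
 using measurable_compose[OF _ measurable_Xi_loop[of a], of "E a" "P a"] ppp[of a]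
 by (simp add: poisson_point_process_def)

lemma Qn_P: "0 < a ==> k : bm LS ==> (NI w. k (XiL a w);P a) = Qn a k"
 using Qn_eq[OF ppp] by simp

lemma prob_space_P: "0 < a ==> prob_space (P a)"
 using ppp by (simp add: poisson_point_process_def)

text \<open>Laplace functional of a single excursion loop with parameter \<open>a\<close>; the
  default 1 keeps it a function into [0, 1] on the whole line.\<close>

definition gf :: "(loop => ennreal) => real => ennreal" where
 "gf f a = (if 0 < a then Qn a (%l. en (f l)) else 1)"

lemma gf:
 assumes f[measurable]: "f : bm LS"
 shows "gf f : bm borel" and "gf f a <= 1"
proof -
 have m: "(%l. en (f l)) : bm LS" by measurable
 have "gf f = (%a. if 0 < a then (if 0 < a then Qn a (%l. en (f l)) else 0) else 1)" by (auto simp: gf_def)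
 also have "... : bm borel" using measurable_Qn[OF m] by measurable
 finally show "gf f : bm borel" .
 show "gf f a <= 1"
 proof (cases "0 < a")
  case True
  have "Qn a (%l. en (f l)) <= (NI w. 1;P a)"
   unfolding Qn_P[OF True m, symmetric] by (intro nn_integral_mono en_le_1)
  then show ?thesis using True prob_space.emeasure_space_1[OF prob_space_P[OF True]] by (simp add: gf_def)
 qed (simp add: gf_def)
qed

text \<open>The local time of the excursion loop is almost surely the constant
  \<open>cN * a\<close>, so the tilt by \<open>b\<close> acts as the deterministic factor exp(- b
  a).\<close>

lemma Qn_tilt:
 assumes a: "0 < a" and b: "0 <= b" and f[measurable]: "f : bm LS"
 shows "Qn a (%l. 1 - en (f l + ennreal b * (ennreal (loop_local_time N z l) / ennreal cN)))
  = 1 - ennreal (exp (- (b * a))) * gf f a"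
proof -
 interpret P: prob_space "P a" by (rule prob_space_P[OF a])
 note [measurable] = measurable_loop_local_time measurable_XiL[OF a]
 let ?l = "%l. ennreal (loop_local_time N z l)"
 let ?k = "%l. 1 - en (f l + ennreal b * (?l l / ennreal cN))"
 have kk[measurable]: "(%l. if ?l l = ennreal (cN * a) then 0 else 1 :: ennreal) : bm LS"
  by (rule measurable_If[OF _ _ borel_measurable_eq[OF measurable_loop_local_time borel_measurable_const]]) auto
 have "Qn a (%l. if ?l l = ennreal (cN * a) then 0 else 1) = 0" by (rule Qn_llt[OF a kk]) simp
 then have "(NI w. (if ?l (XiL a w) = ennreal (cN * a) then 0 else 1);P a) = 0"
  by (subst Qn_P[OF a kk])
 then have AE: "AE w in P a. ?l (XiL a w) = ennreal (cN * a)"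
  by (subst (asm) nn_integral_0_iff_AE[OF measurable_compose[OF measurable_XiL[OF a] kk]]) (auto split: if_splits)
 have km: "?k : bm LS" by measurable
 have "Qn a ?k = (NI w. ?k (XiL a w);P a)" by (rule Qn_P[OF a km, symmetric])
 also have "... = (NI w. 1 - ennreal (exp (- (b * a))) * en (f (XiL a w));P a)"
 proof (rule nn_integral_cong_AE, use AE in eventually_elim)
  case (elim w)
  have "ennreal b * (ennreal (cN * a) / ennreal cN) = ennreal (b * a)"
   using cN a b by (simp add: divide_ennreal ennreal_mult[symmetric])
  then show ?case using elim a b by (simp add: en_add mult.commute)
 qed
 also have "... = (NI w. 1;P a) - (NI w. ennreal (exp (- (b * a))) * en (f (XiL a w));P a)"
 proof (rule nn_integral_diff)
  have e1: "ennreal (exp (- (b * a))) <= 1" using a b by (simp add: ennreal_le_1)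
  show le: "AE w in P a. ennreal (exp (- (b * a))) * en (f (XiL a w)) <= 1"
   using mult_mono[OF e1 en_le_1] by simp
  then have "(NI w. ennreal (exp (- (b * a))) * en (f (XiL a w));P a) <= (NI w. 1;P a)"
   by (rule nn_integral_mono_AE)
  then show "(NI w. ennreal (exp (- (b * a))) * en (f (XiL a w));P a) ~= \<infinity>"
   by (auto simp: P.emeasure_space_1 top_unique)
 qed measurable
 also have "... = 1 - ennreal (exp (- (b * a))) * gf f a"
 proof -
  have "(NI w. en (f (XiL a w));P a) = Qn a (%l. en (f l))" by (rule Qn_P[OF a]) measurable
  then show ?thesis using a by (simp add: P.emeasure_space_1 nn_integral_cmult gf_def)
 qed
 finally show ?thesis .
qed

text \<open>By \<open>soup_laplace\<close>, the Laplace functional of the soup in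
  \<open>D - {z}\<close>.\<close>

definition Lw :: "(loop => ennreal) => ennreal" where
 "Lw f = en (ennreal \<theta> * (NI l. 1 - en (f l);loop_measure N D'))"

lemma soup_laplace:
 assumes "loop_soup N \<theta> F M L" and f: "f : bm LS"
 shows "(NI w. en (csum f (L w));M) = en (ennreal \<theta> * (NI l. 1 - en (f l);loop_measure N F))"
proof -
 have m: "(%l. 1 - en (f l)) : bm (loop_measure N F)" "f : bm (scale_measure (ennreal \<theta>) (loop_measure N F))"
  using f by (simp_all add: measurable_cong_sets[OF sets_loop_measure refl] measurable_cong_sets[of "scale_measure (ennreal \<theta>) (loop_measure N F)" LS])
 show ?thesis using ppp_laplace[OF assms(1)[unfolded loop_soup_def] m(2)] m(1) by (simp add: nn_integral_scale_measure)
qed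

text \<open>Write 1 - exp(- b x) y as (1 - exp(- b x)) + exp(- b x) (1 - y). The first term yields a
  Frullani integral, the second changes the rate from \<open>rr\<close> to \<open>rr + b\<close>.
  Loops that avoid \<open>z\<close> do not feel the tilt.\<close>

lemma loop_measure_tilt:
 assumes b: "0 <= b" and f[measurable]: "f : bm LS"
 shows "(NI l. 1 - en (f l + ennreal b * (ennreal (loop_local_time N z l) / ennreal cN));loop_measure N D)
  = (NI l. 1 - en (f l);loop_measure N D') + ennreal (ln ((rr + b) / rr))
   + (NI x. (if 0 < x then ennreal (exp (- ((rr + b) * x)) / x) * (1 - gf f x) else 0);lborel)"
proof -
 note [measurable] = measurable_loop_local_time gf(1)[OF f]
 let ?l = "%l. ennreal (loop_local_time N z l)"
 let ?k = "%l. 1 - en (f l + ennreal b * (?l l / ennreal cN))"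
 have km: "?k : bm LS" by measurable
 have "(NI l. (if ?l l = 0 then 0 else 1);loop_measure N D') = 0"
  by (rule loop_measure_D'_llt) (measurable, simp add: ennreal_eq_0_iff)
 then have "AE l in loop_measure N D'. ?l l = 0"
  by (subst (asm) nn_integral_0_iff_AE) (measurable, auto split: if_splits)
 then have 1: "(NI l. ?k l;loop_measure N D') = (NI l. 1 - en (f l);loop_measure N D')"
  by (intro nn_integral_cong_AE) (auto elim!: eventually_mono)
 have 2: "(NI a. (if 0 < a then ennreal (exp (- (cN * (4 - mE) * a)) / a) * Qn a ?k else 0);lborel)
  = (NI x. (if 0 < x then ennreal ((exp (- (rr * x)) - exp (- ((rr + b) * x))) / x) else 0)
    + (if 0 < x then ennreal (exp (- ((rr + b) * x)) / x) * (1 - gf f x) else 0);lborel)"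
 proof (rule nn_integral_cong, goal_cases)
  case (1 x)
  show ?case
  proof (cases "0 < x")
   case True
   obtain y where y: "gf f x = ennreal y" "0 <= y" "y <= 1"
    using gf(2)[OF f, of x] by (cases "gf f x") (auto simp: ennreal_le_1 top_unique)
   have e: "exp (- (b * x)) * y <= 1 * 1" using y b True by (intro mult_mono) auto
   have ee: "exp (- (rr * x)) * exp (- (b * x)) = exp (- ((rr + b) * x))" by (simp add: exp_add[symmetric] algebra_simps)
   have "ennreal (exp (- (rr * x)) / x) * (1 - ennreal (exp (- (b * x))) * ennreal y) = ennreal (exp (- (rr * x)) / x * (1 - exp (- (b * x)) * y))"
    using y e True by (simp add: ennreal_mult[symmetric] ennreal_1[symmetric] ennreal_minus del: ennreal_1)
   also have "exp (- (rr * x)) / x * (1 - exp (- (b * x)) * y) = (exp (- (rr * x)) - exp (- ((rr + b) * x))) / x + exp (- ((rr + b) * x)) / x * (1 - y)"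
    unfolding ee[symmetric] using True by (simp add: field_simps)
   also have "ennreal ... = ennreal ((exp (- (rr * x)) - exp (- ((rr + b) * x))) / x) + ennreal (exp (- ((rr + b) * x)) / x) * (1 - gf f x)"
    using True y b by (subst ennreal_plus) (auto simp: ennreal_mult[symmetric] ennreal_1[symmetric] ennreal_minus y(1) mult_right_mono simp del: ennreal_1)
   finally show ?thesis using True Qn_tilt[OF True b f] by (simp add: rr_def y(1))
  qed simp
 qed
 have "... = ennreal (ln ((rr + b) / rr)) + (NI x. (if 0 < x then ennreal (exp (- ((rr + b) * x)) / x) * (1 - gf f x) else 0);lborel)"
  unfolding frullani[OF rr b, symmetric] by (intro nn_integral_add) measurable
 then show ?thesis unfolding loop_measure_Qn[OF km] 1 2 by (simp add: add.assoc)
qed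

text \<open>The Frullani term contributes the power \<open>\<theta>\<close> of
  \<open>rr / (rr + b)\<close>. Multiplied and divided by \<open>Gamma \<theta>\<close>, it contains
  exactly the prefactor of \<open>laplace_Phi\<close> at \<open>rr + b\<close>.\<close>

lemma soup_tilt:
 assumes soup: "loop_soup N \<theta> D M L" and b: "0 <= b" and f[measurable]: "f : bm LS"
 shows "(NI w. en (csum (%l. f l + ennreal b * (ennreal (loop_local_time N z l) / ennreal cN)) (L w));M)
  = Lw f * (ennreal (rr powr \<theta> / Gamma \<theta>) * W (gf f) (rr + b))"
proof -
 note [measurable] = measurable_loop_local_time
 have r\<beta>: "0 < rr + b" using rr b by simp
 have m: "(%l. f l + ennreal b * (ennreal (loop_local_time N z l) / ennreal cN)) : bm LS" by measurable
 have G: "Gamma \<theta> ~= 0" using Gamma_real_pos[OF \<theta>] by linarith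
 have l0: "0 <= ln ((rr + b) / rr)" using rr b by simp
 have "exp (- (\<theta> * ln ((rr + b) / rr))) = rr powr \<theta> * (rr + b) powr - \<theta>"
  using rr r\<beta> by (simp add: powr_def ln_div exp_add[symmetric] algebra_simps)
 also have "... = rr powr \<theta> / Gamma \<theta> * (Gamma \<theta> * (rr + b) powr - \<theta>)"
  using G by simp
 finally have c: "en (ennreal \<theta> * ennreal (ln ((rr + b) / rr))) = ennreal (rr powr \<theta> / Gamma \<theta>) * ennreal (Gamma \<theta> * (rr + b) powr - \<theta>)"
  using \<theta> l0 Gamma_real_pos[OF \<theta>] G by (subst (1 2) ennreal_mult[symmetric]) (simp_all add: less_imp_le)
 show ?thesis
  unfolding soup_laplace[OF soup m] loop_measure_tilt[OF b f] Lw_def laplace_Phi[OF gf[OF f] r\<beta>]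
  unfolding distrib_left en_add c by (simp add: mult_ac)
qed


text \<open>Local time at \<open>z\<close> in units of \<open>cN\<close>, so that the threshold
  becomes \<open>a\<close>.\<close>

definition Sz :: "loop collection => ennreal" where
 "Sz C = csum (%l. ennreal (loop_local_time N z l) / ennreal cN) C"

lemma measurable_Sz [measurable]: "Sz : bm CS"
 unfolding Sz_def using measurable_loop_local_time[measurable] by measurable

text \<open>The tilts with \<open>b = 0, 1, 2, ...\<close> are the moments of exp(-
  \<open>Sz\<close>) under the measure weighted by \<open>en (csum f (L y))\<close>. On [0, 1] they
  determine the measure, so the weighted law of \<open>Sz\<close> is known and can be restricted to
  an event.\<close>

lemma threshold_law:
 assumes soup: "loop_soup N \<theta> D M L" and a: "0 < a" and f[measurable]: "f : bm LS"
 shows "(NI y. (if ennreal a <= Sz (L y) then en (csum f (L y)) else 0);M)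
  = (NI s. (if a < s then ennreal (rr powr \<theta> / Gamma \<theta> * (exp (- (rr * s)) * s powr (\<theta> - 1))) * (Lw f * Phi (gf f) s) else 0);lborel)"
proof -
 let ?c = "rr powr \<theta> / Gamma \<theta>"
 have c0: "0 <= ?c" using Gamma_real_pos[OF \<theta>] by simp
 note [measurable] = measurable_Phi[OF gf(1)[OF f]]
 have pp: "poisson_point_process M L (scale_measure (ennreal \<theta>) (loop_measure N D))" using soup by (simp add: loop_soup_def)
 interpret M: prob_space M using pp by (simp add: poisson_point_process_def)
 have "collection_space (scale_measure (ennreal \<theta>) (loop_measure N D)) = CS"
  by (rule collection_space_cong) simp
 then have L[measurable]: "L : M ->M CS" using pp by (simp add: poisson_point_process_def)
 have eL[measurable]: "(%y. en (csum f (L y))) : bm M"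
  by (rule measurable_compose[OF measurable_compose[OF L measurable_collection_sum[OF f]] measurable_en])
 have SL[measurable]: "(%y. Sz (L y)) : bm M" by (rule measurable_compose[OF L measurable_Sz])
 define w where "w s = (if 0 < s then ennreal (?c * (exp (- (rr * s)) * s powr (\<theta> - 1))) * (Lw f * Phi (gf f) s) else 0)" for s
 have [measurable]: "w : bm borel" unfolding w_def[abs_def] by measurable
 define m1 where "m1 = distr (density M (%y. en (csum f (L y)))) borel (%y. enn2real (en (Sz (L y))))"
 define m2 where "m2 = distr (density lborel w) borel (%s. exp (- s))"
 have n1: "(NI x. h x;m1) = (NI y. en (csum f (L y)) * h (enn2real (en (Sz (L y))));M)"
  if [measurable]: "h : bm borel" for h
  unfolding m1_def by (subst nn_integral_distr, measurable, subst nn_integral_density, measurable)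
 have n2: "(NI x. h x;m2) = (NI s. w s * h (exp (- s));lborel)"
  if [measurable]: "h : bm borel" for h
  unfolding m2_def by (subst nn_integral_distr, measurable, subst nn_integral_density, measurable)
 have mom: "(NI x. ennreal (x ^ n);m1) = (NI x. ennreal (x ^ n);m2)" for n :: nat
 proof -
  let ?k = "%l. ennreal (loop_local_time N z l) / ennreal cN"
  have "en (csum f (L y)) * ennreal (enn2real (en (Sz (L y))) ^ n)
    = en (csum (%l. f l + ennreal (real n) * ?k l) (L y))" for y
   by (simp add: collection_sum_add collection_sum_cmult Sz_def[symmetric] en_add en_of_nat_mult ennreal_of_nat_eq_real_of_nat[symmetric] ennreal_power[symmetric] ennreal_enn2real)
  then have "(NI x. ennreal (x ^ n);m1) = Lw f * (ennreal ?c * W (gf f) (rr + real n))"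
   using soup_tilt[OF soup _ f, of "real n"] by (simp add: n1)
  also have "... = (NI s. Lw f * (ennreal ?c * (if 0 < s then ennreal (exp (- ((rr + real n) * s)) * s powr (\<theta> - 1)) * Phi (gf f) s else 0));lborel)"
   unfolding W_def by (subst nn_integral_cmult, measurable)+
  also have "... = (NI s. w s * ennreal (exp (- s) ^ n);lborel)"
  proof (rule nn_integral_cong)
   fix s
   have "exp (- ((rr + real n) * s)) = exp (- (rr * s)) * exp (- s) ^ n"
    by (simp add: exp_of_nat_mult[symmetric] exp_add[symmetric] algebra_simps)
   moreover have "Lw f * (ennreal c * (ennreal (u * p * v) * x)) = ennreal (c * (u * v)) * (Lw f * x) * ennreal p"
    if "0 <= c" "0 <= u" "0 <= v" "0 <= p" for c u v p x using that by (simp add: ennreal_mult mult_ac)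
   ultimately show "Lw f * (ennreal ?c * (if 0 < s then ennreal (exp (- ((rr + real n) * s)) * s powr (\<theta> - 1)) * Phi (gf f) s else 0)) = w s * ennreal (exp (- s) ^ n)"
    unfolding w_def using c0 by simp
  qed
  finally show ?thesis by (simp add: n2)
 qed
 have f1: "finite_measure m1"
 proof (rule finite_measureI)
  have "emeasure m1 (space m1) = (NI y. en (csum f (L y));M)" using n1[of "%_. 1"] by simp
  also have "... <= (NI y. 1;M)" by (intro nn_integral_mono en_le_1)
  finally show "emeasure m1 (space m1) ~= \<infinity>" by (auto simp: M.emeasure_space_1 top_unique)
 qed
 have f2: "finite_measure m2"
  using mom[of 0] finite_measure.emeasure_finite[OF f1, of "space m1"] by (intro finite_measureI) simp
 have "m1 = m2"
 proof (rule finite_measure_moments[OF f1 _ _ f2 _ _ mom])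
  show s1: "sets m1 = sets borel" and s2: "sets m2 = sets borel" by (simp_all add: m1_def m2_def)
  have "enn2real (en x) <= 1" for x using en_le_1[of x] by (intro enn2real_leI) auto
  then show "AE x in m1. 0 <= x & x <= 1" unfolding m1_def by (subst AE_distr_iff) auto
  have "(NI x. (if 0 <= x & x <= 1 then 0 else 1);m2) = (NI s. 0;(lborel :: real measure))"
   by (subst n2, measurable) (intro nn_integral_cong, simp add: w_def)
  then have z: "(NI x. (if 0 <= x & x <= 1 then 0 else 1);m2) = 0" by simp
  have "(%x. if 0 <= x & x <= 1 then 0 else 1 :: ennreal) : bm m2"
   unfolding measurable_cong_sets[OF s2 refl] by measurable
  from nn_integral_0_iff_AE[OF this, THEN iffD1, OF z] show "AE x in m2. 0 <= x & x <= 1"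
   by (rule eventually_mono) (simp split: if_splits)
 qed
 have le: "enn2real (en x) <= exp (- a) \<longleftrightarrow> ennreal a <= x" for x
  using a by (cases x) (auto simp: ennreal_le_iff)
 let ?h = "indicator {..exp (- a)} :: real => ennreal"
 have "(NI y. (if ennreal a <= Sz (L y) then en (csum f (L y)) else 0);M) = (NI x. ?h x;m1)"
  by (subst n1, simp) (intro nn_integral_cong, simp add: indicator_def le)
 also have "... = (NI s. w s * ?h (exp (- s));lborel)" unfolding \<open>m1 = m2\<close> by (rule n2) simp
 \<comment> \<open>The boundary value \<open>s = a\<close> is negligible for Lebesgue measure, which
   reconciles the weak inequality on the left with the strict one on the right.\<close>
 also have "... = (NI s. (if a < s then ennreal (?c * (exp (- (rr * s)) * s powr (\<theta> - 1))) * (Lw f * Phi (gf f) s) else 0);lborel)"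
  by (rule nn_integral_cong_AE, use AE_lborel_singleton[of a] in eventually_elim) (use a in \<open>auto simp: w_def indicator_def\<close>)
 finally show ?thesis .
qed


text \<open>The independent soup contributes \<open>Lw f\<close>. Given the partition, the other
  loops contribute the product of \<open>gf f\<close> over its parts, whose expectation is
  \<open>Phi (gf f) r\<close>.\<close>

lemma union_law:
 assumes r: "0 < r" and soup: "loop_soup N \<theta> D' M L" and PD: "PD_partition \<theta> r M A"
  and ci: "cond_indep_with_laws M A LS (%a. distr (P a) LS (XiL a)) X"
  and ind: "independent_rvs M CS L (\<Pi>\<^sub>M i\<in>UNIV. LS) (%w i. X i w)"
 shows "(%w. collection_union (L w) (collection_of UNIV (%i. X i w))) : M ->M CS" (is "?U : _")
  and "f : bm LS ==> (NI w. en (csum f (collection_union (L w) (collection_of UNIV (%i. X i w))));M) = Lw f * Phi (gf f) r"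
proof -
 interpret M: prob_space M using soup by (simp add: loop_soup_def poisson_point_process_def)
 have X[measurable]: "X i : M ->M LS" for i using ci by (simp add: cond_indep_with_laws_def)
 have L[measurable]: "L : M ->M CS" using ind by (simp add: independent_rvs_def)
 have A: "A : M ->M (\<Pi>\<^sub>M i\<in>UNIV. borel)" using PD by (simp add: PD_partition_def)
 have Am[measurable]: "(%w. A w i) : bm M" for i
  using measurable_compose[OF A measurable_component_singleton[of i]] by simp
 show "?U : M ->M CS"
 proof (rule measurable_collection_spaceI)
  fix w assume w: "w : space M"
  have "collection_of UNIV (%i. X i w) x = 0" if "x ~: range (%i. X i w)" for x
  proof -
   have "{i. X i w = x} = {}" using that by auto
   then show ?thesis by (simp add: collection_of_def zero_enat_def)
  qed
  then have sub: "{x. ?U w x ~= 0} \<subseteq> {x. L w x ~= 0} \<union> range (%i. X i w)"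
   by (auto simp: collection_union_def)
  have Lc: "countable {x. L w x ~= 0}" "{x. L w x ~= 0} \<subseteq> space LS"
   using measurable_space[OF L w] by (simp_all add: collections_def)
  have "range (%i. X i w) \<subseteq> space LS" using measurable_space[OF X w] by blast
  then have "{x. ?U w x ~= 0} \<subseteq> space LS" using sub Lc(2) by blast
  moreover have "countable {x. ?U w x ~= 0}" by (rule countable_subset[OF sub]) (simp add: Lc(1))
  ultimately show "?U w : collections LS" by (simp only: collections_def mem_Collect_eq)
 next
  fix B assume [measurable]: "B : sets LS"
  show "(%w. npoints (?U w) B) : bm M"
   unfolding npoints_def collection_sum_union_of
   using measurable_compose[OF L measurable_npoints[of B]] by (intro borel_measurable_add) (simp_all add: npoints_def, measurable)
 qed
 assume f[measurable]: "f : bm LS"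
 \<comment> \<open>Conditional independence concerns finitely many loops at a time; the whole series
   is reached as a decreasing limit of finite products.\<close>
 have INF: "(NI w. en (\<Sum>i. u i w);M) = (INF n. NI w. (\<Prod>i<n. en (u i w));M)"
  if [measurable]: "!!i. u i : bm M" for u :: "nat => _ => ennreal"
 proof -
  have inc: "incseq (%n. \<Sum>i<n. u i w)" for w by (auto simp: incseq_def intro!: sum_mono2)
  have "(NI w. en (\<Sum>i. u i w);M) = (NI w. (INF n. en (\<Sum>i<n. u i w));M)"
   by (simp add: suminf_eq_SUP en_SUP[OF inc])
  also have "... = (INF n. NI w. en (\<Sum>i<n. u i w);M)"
  proof (rule nn_integral_monotone_convergence_INF_decseq)
   show "decseq (%n w. en (\<Sum>i<n. u i w))" by (intro antimonoI le_funI en_mono incseqD[OF inc])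
   show "(NI w. en (\<Sum>i<0. u i w);M) < \<infinity>" by (simp add: M.emeasure_space_1)
  qed measurable
  finally show ?thesis by (simp add: en_sum)
 qed
 let ?F = "%l. en (f l)"
 have enf: "?F : bm LS" by measurable
 have Q: "(NI x. F x;distr (P a) LS (XiL a)) = Qn a F" if "0 < a" "F : bm LS" for F a
  using that measurable_XiL[of a] by (simp add: nn_integral_distr Qn_P)
 have ifQ: "(%a. if 0 < a then NI x. F x;distr (P a) LS (XiL a) else 0) = (%a. if 0 < a then Qn a F else 0)"
  if "F : bm LS" for F using Q that by auto
 have "(NI w. (\<Prod>i<n. ?F (X i w));M) = (NI w. (\<Prod>i<n. en (nln (gf f (A w i))));M)" for n
 proof -
  have "(NI w. (\<Prod>i<n. ?F (X i w));M) = (NI w. (\<Prod>i<n. if 0 < A w i then NI x. ?F x;distr (P (A w i)) LS (XiL (A w i)) else 0);M)"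
   using ifQ measurable_Qn by (intro cond_indep_prod[OF ci A PD_pos[OF PD r], where F="%_. ?F"]) (auto simp: enf)
  also have "... = (NI w. (\<Prod>i<n. en (nln (gf f (A w i))));M)"
   by (rule nn_integral_cong_AE, use PD_pos[OF PD r] in eventually_elim)
    (simp add: en_nln[OF gf(2)[OF f]] Q enf, simp add: gf_def)
  finally show ?thesis .
 qed
 moreover have "(%w. nln (gf f (A w i))) : bm M" for i
  using measurable_compose[OF measurable_compose[OF Am gf(1)[OF f]] measurable_nln] .
 ultimately have "(NI w. en (\<Sum>i. f (X i w));M) = (NI w. en (\<Sum>i. nln (gf f (A w i)));M)"
  by (simp add: INF)
 also have "... = Phi (gf f) r" by (rule PD_Phi[OF PD r gf(1)[OF f]])
 finally have 1: "(NI w. en (\<Sum>i. f (X i w));M) = Phi (gf f) r" .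
 have [measurable]: "(%x. f (x i)) : bm (\<Pi>\<^sub>M i\<in>(UNIV::nat set). LS)" for i
  by (rule measurable_compose[OF _ f]) (rule measurable_component_singleton, simp)
 have g: "(%x. en (\<Sum>i. f (x i))) : bm (\<Pi>\<^sub>M i\<in>(UNIV::nat set). LS)" by measurable
 have h: "(%C. en (csum f C)) : bm CS" by measurable
 have "(NI w. en (csum f (?U w));M) = (NI w. en (csum f (L w)) * en (\<Sum>i. f (X i w));M)"
  by (simp only: collection_sum_union_of en_add)
 also have "... = (NI w. en (csum f (L w));M) * (NI w. en (\<Sum>i. f (X i w));M)"
  by (rule independent_rvs_en[OF M.prob_space_axioms ind h g])
 finally show "(NI w. en (csum f (?U w));M) = Lw f * Phi (gf f) r"
  unfolding 1 soup_laplace[OF soup f] Lw_def .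
qed

text \<open>The spaces \<open>M' r\<close> are unrelated for different \<open>r\<close>, so
  measurability in \<open>r\<close> of the inner expectation is part of the claim. Both statements
  come from \<open>collection_law_determined\<close>, applied to the image laws
  \<open>\<kappa> r\<close> and the restricted law of the soup.\<close>

lemma mixture_law:
 assumes soup: "loop_soup N \<theta> D M L" and a: "0 < a"
  and K: "!!r. a < r ==> prob_space (M' r)" "!!r. a < r ==> U r : M' r ->M CS"
   "!!r f. a < r ==> f : bm LS ==> (NI w. en (csum f (U r w));M' r) = Lw f * Phi (gf f) r"
  and H: "H : bm CS"
 shows "(%r. if a < r then NI w. H (U r w);M' r else 0) : bm borel" (is "?T1")
  and "(NI w. (if ennreal a <= Sz (L w) then H (L w) else 0);M)
   = (NI r. (if a < r then ennreal (rr powr \<theta> / Gamma \<theta> * (exp (- (rr * r)) * r powr (\<theta> - 1))) * (NI w. H (U r w);M' r) else 0);lborel)" (is "?T2")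
proof -
 have pp: "poisson_point_process M L (scale_measure (ennreal \<theta>) (loop_measure N D))" using soup by (simp add: loop_soup_def)
 interpret M: prob_space M using pp by (simp add: poisson_point_process_def)
 have "collection_space (scale_measure (ennreal \<theta>) (loop_measure N D)) = CS"
  by (rule collection_space_cong) simp
 then have L[measurable]: "L : M ->M CS" using pp by (simp add: poisson_point_process_def)
 have SL[measurable]: "(%w. Sz (L w)) : bm M" by (rule measurable_compose[OF L measurable_Sz])
 let ?d = "%r. ennreal (rr powr \<theta> / Gamma \<theta> * (exp (- (rr * r)) * r powr (\<theta> - 1)))"
 define \<mu> where "\<mu> = distr (density M (%w. if ennreal a <= Sz (L w) then 1 else 0)) CS L"
 define R where "R = restrict_space (density lborel ?d) {a<..}"
 define \<kappa> where "\<kappa> r = distr (M' r) CS (U r)" for r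
 have spR: "r : space R \<longleftrightarrow> a < r" for r by (simp add: R_def space_restrict_space)
 have setsR: "h : bm R \<longleftrightarrow> (%r. if a < r then h r else 0) : bm borel" for h :: "real => ennreal"
 proof -
  have "sets R = sets (restrict_space borel {a<..})" unfolding R_def by (intro sets_restrict_space_cong) simp
  then have "(bm R :: (real => ennreal) set) = bm (restrict_space borel {a<..})" by (rule measurable_cong_sets) simp
  then have "h : bm R \<longleftrightarrow> h : bm (restrict_space borel {a<..})" by simp
  also have "... \<longleftrightarrow> (%r. h r * indicator {a<..} r) : bm borel"
   by (rule borel_measurable_restrict_space_iff_ennreal) simp
  also have "(%r. h r * indicator {a<..} r) = (%r. if a < r then h r else 0)" by (auto simp: indicator_def)
  finally show ?thesis .
 qed
 have intR: "(NI r. h r;R) = (NI r. (if a < r then ?d r * h r else 0);lborel)" if h: "h : bm R" for h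
 proof -
  have [measurable]: "(%r. if a < r then h r else 0) : bm borel" using h setsR by blast
  have "(NI r. h r;R) = (NI r. h r * indicator {a<..} r;density lborel ?d)"
   unfolding R_def by (rule nn_integral_restrict_space) simp
  also have "... = (NI r. (if a < r then h r else 0);density lborel ?d)"
   by (intro nn_integral_cong) (simp add: indicator_def)
  also have "... = (NI r. ?d r * (if a < r then h r else 0);lborel)" by (subst nn_integral_density) auto
  finally show ?thesis by (simp add: if_distrib[of "%x. _ * x"] cong: if_cong)
 qed
 have int\<mu>: "(NI C. h C;\<mu>) = (NI w. (if ennreal a <= Sz (L w) then h (L w) else 0);M)" if h: "h : bm CS" for h
 proof -
  have [measurable]: "(%w. h (L w)) : bm M" by (rule measurable_compose[OF L h])
  have "(NI C. h C;\<mu>) = (NI w. (if ennreal a <= Sz (L w) then 1 else 0) * h (L w);M)"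
   unfolding \<mu>_def using h L by (subst nn_integral_distr) (simp_all add: nn_integral_density)
  then show ?thesis by (simp add: if_distrib[of "%x. x * _"] cong: if_cong)
 qed
 have int\<kappa>: "(NI C. h C;\<kappa> r) = (NI w. h (U r w);M' r)" if "a < r" "h : bm CS" for r h
  unfolding \<kappa>_def using K(2)[OF that(1)] that(2) by (simp add: nn_integral_distr)
 have enm: "(%C. en (csum f C)) : bm CS" if "f : bm LS" for f using that by measurable
 have fin1: "finite_measure \<mu>"
 proof (rule finite_measureI)
  have "emeasure \<mu> (space \<mu>) = (NI w. (if ennreal a <= Sz (L w) then 1 else 0);M)" using int\<mu>[of "%_. 1"] by simp
  also have "... <= (NI w. 1;M)" by (intro nn_integral_mono) simp
  finally show "emeasure \<mu> (space \<mu>) ~= \<infinity>" by (auto simp: M.emeasure_space_1 top_unique)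
 qed
 have fin2: "finite_measure (\<kappa> r)" if "r : space R" for r
  unfolding \<kappa>_def using K that spR by (intro finite_measure.finite_measure_distr prob_space.axioms) auto
 have eq: "r : space R ==> (NI C. en (csum f C);\<kappa> r) = Lw f * Phi (gf f) r" if "f : bm LS" for f r
  using that spR K(3) int\<kappa>[OF _ enm] by simp
 have em: "(%r. NI C. en (csum f C);\<kappa> r) : bm R" if f: "f : bm LS" for f
 proof (subst measurable_cong[OF eq[OF f]])
  show "(%r. Lw f * Phi (gf f) r) : bm R"
   unfolding setsR using measurable_Phi[OF gf(1)[OF f], measurable] by measurable
 qed
 have eqm: "(NI C. en (csum f C);\<mu>) = (NI r. NI C. en (csum f C);\<kappa> r;R)" if f: "f : bm LS" for f
  unfolding int\<mu>[OF enm[OF f]] intR[OF em[OF f]] threshold_law[OF soup a f]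
  using eq[OF f] spR by (intro nn_integral_cong) simp
 have ss: "sets \<mu> = sets CS" "sets (\<kappa> r) = sets CS" for r by (simp_all add: \<mu>_def \<kappa>_def)
 have main: "(%r. NI C. H C;\<kappa> r) : bm R" "(NI C. H C;\<mu>) = (NI r. NI C. H C;\<kappa> r;R)"
  by (rule collection_law_determined[OF fin1 ss(1) fin2 ss(2) em eqm H]; assumption)+
 have eqH: "(%r. if a < r then NI C. H C;\<kappa> r else 0) = (%r. if a < r then NI w. H (U r w);M' r else 0)"
  using int\<kappa>[OF _ H] by auto
 show ?T1 using main(1) unfolding setsR eqH .
 show ?T2 unfolding int\<mu>[OF H, symmetric] main(2) intR[OF main(1)]
  by (intro nn_integral_cong) (simp add: int\<kappa>[OF _ H])
qed

end

section \<open>Signed functionals and the constants of the formula\<close>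

lemma LBINT_Ioi: "(LBINT x=ereal a..\<infinity>. f x) = (\<integral>x. (if a < x then f x else 0 :: real) \<partial>lborel)"
proof -
 have "indicator {a<..} x *\<^sub>R f x = (if a < x then f x else 0)" for x by simp
 then show ?thesis by (simp add: interval_lebesgue_integral_def set_lebesgue_integral_def einterval_def greaterThan_def)
qed

context thick_point
begin

text \<open>The mixture formula is about nonnegative functionals; it is applied to
  \<open>F + B\<close> and to the constant \<open>B\<close>, and the results are subtracted.\<close>

lemma mixture_law_real:
 fixes F :: "loop collection => real"
 assumes soup: "loop_soup N \<theta> D M L" and a: "0 < a"
  and K: "!!v. a < v ==> prob_space (M' v)" "!!v. a < v ==> U v : M' v ->M CS"
   "!!v f. a < v ==> f : bm LS ==> (NI w. en (csum f (U v w));M' v) = Lw f * Phi (gf f) v"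
  and F: "F : bm CS" and B: "!!C. C : collections LS ==> \<bar>F C\<bar> <= B"
 shows "(\<integral>w. F (L w) * (if ennreal a <= Sz (L w) then 1 else 0) \<partial>M)
  = (\<integral>v. (if a < v then rr powr \<theta> / Gamma \<theta> * (exp (- (rr * v)) * v powr (\<theta> - 1)) * (\<integral>w. F (U v w) \<partial>M' v) else 0) \<partial>lborel)"
proof -
 have pp: "poisson_point_process M L (scale_measure (ennreal \<theta>) (loop_measure N D))" using soup by (simp add: loop_soup_def)
 interpret M: prob_space M using pp by (simp add: poisson_point_process_def)
 have "collection_space (scale_measure (ennreal \<theta>) (loop_measure N D)) = CS"
  by (rule collection_space_cong) simp
 then have L[measurable]: "L : M ->M CS" using pp by (simp add: poisson_point_process_def)
 have SL[measurable]: "(%w. Sz (L w)) : bm M" by (rule measurable_compose[OF L measurable_Sz])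
 define d where "d v = rr powr \<theta> / Gamma \<theta> * (exp (- (rr * v)) * v powr (\<theta> - 1))" for v
 have [measurable]: "d : bm borel" unfolding d_def[abs_def] by measurable
 let ?l = "%G w. G (L w) * (if ennreal a <= Sz (L w) then 1 else 0) :: real"
 let ?r = "%G v. if a < v then d v * (\<integral>w. G (U v w) \<partial>M' v) else 0"
 have d0: "0 <= d v" for v using Gamma_real_pos[OF \<theta>] by (simp add: d_def)
 have L\<omega>: "w : space M ==> L w : collections LS" for w using measurable_space[OF L] by simp
 have U\<omega>: "a < v ==> w : space (M' v) ==> U v w : collections LS" for v w using measurable_space[OF K(2)] by simp
 have pos: "integrable lborel (?r G) & integrable M (?l G) & (\<integral>w. ?l G w \<partial>M) = (\<integral>v. ?r G v \<partial>lborel)"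
  if G[measurable]: "G : bm CS" and Gb: "!!C. C : collections LS ==> 0 <= G C & G C <= b" for G b
 proof -
  have Gm: "(%C. ennreal (G C)) : bm CS" by measurable
  have mix: "(%v. if a < v then NI w. ennreal (G (U v w));M' v else 0) : bm borel"
   "(NI w. (if ennreal a <= Sz (L w) then ennreal (G (L w)) else 0);M)
    = (NI v. (if a < v then ennreal (d v) * (NI w. ennreal (G (U v w));M' v) else 0);lborel)"
   unfolding d_def by (rule mixture_law[OF soup a K Gm]; assumption)+
  have lm: "?l G : bm M" using measurable_compose[OF L G] by measurable
  have inn: "ennreal (\<integral>w. G (U v w) \<partial>M' v) = (NI w. ennreal (G (U v w));M' v)" if v: "a < v" for v
  proof -
   interpret K: prob_space "M' v" by (rule K(1)[OF v])
   have "integrable (M' v) (%w. G (U v w))"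
    using Gb[OF U\<omega>[OF v]] measurable_compose[OF K(2)[OF v] G] by (intro K.integrable_const_bound[of _ b]) (auto intro: AE_I2)
   then show ?thesis using Gb[OF U\<omega>[OF v]] by (intro nn_integral_eq_integral[symmetric]) (auto intro: AE_I2)
  qed
  have G0: "0 <= (\<integral>w. G (U v w) \<partial>M' v)" if v: "a < v" for v
   using Gb[OF U\<omega>[OF v]] by (intro integral_nonneg_AE AE_I2) auto
  have rm: "?r G : bm lborel"
  proof -
   define J where "J v = (if a < v then NI w. ennreal (G (U v w));M' v else 0)" for v
   have [measurable]: "J : bm borel" using mix(1) unfolding J_def[abs_def] .
   have "?r G = (%v. d v * enn2real (J v))"
    using G0 by (auto simp: J_def inn[symmetric])
   also have "... : bm lborel" by measurable
   finally show ?thesis .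
  qed
  have r0: "0 <= ?r G v" for v using d0[of v] G0[of v] by simp
  have l0: "AE w in M. 0 <= ?l G w" using Gb[OF L\<omega>] by (intro AE_I2) auto
  have "(NI w. ennreal (?l G w);M) = (NI w. (if ennreal a <= Sz (L w) then ennreal (G (L w)) else 0);M)"
   by (intro nn_integral_cong) simp
  also have "... = (NI v. ennreal (?r G v);lborel)"
   unfolding mix(2) using d0 G0 by (intro nn_integral_cong) (simp add: inn[symmetric] ennreal_mult)
  finally have eq: "(NI w. ennreal (?l G w);M) = (NI v. ennreal (?r G v);lborel)" .
  have li: "integrable M (?l G)"
   using Gb[OF L\<omega>] lm by (intro M.integrable_const_bound[of _ "\<bar>b\<bar>"] AE_I2) (force simp: abs_mult)+
  have "(NI w. ennreal (?l G w);M) < \<infinity>" using nn_integral_eq_integral[OF li l0] by simp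
  then have "integrable lborel (?r G)" using rm r0 unfolding eq by (intro integrableI_nonneg) auto
  moreover have "(\<integral>w. ?l G w \<partial>M) = (\<integral>v. ?r G v \<partial>lborel)"
   using integral_eq_nn_integral[OF lm l0] integral_eq_nn_integral[OF rm] r0 by (simp add: eq)
  ultimately show ?thesis using li by blast
 qed
 have FB: "0 <= F C + B & F C + B <= B + B" "0 <= B & B <= B" if "C : collections LS" for C
  using B[OF that] by auto
 note p1 = pos[of "%C. F C + B", OF _ FB(1)] and p2 = pos[of "%_. B", OF _ FB(2)]
 have "(\<integral>w. ?l F w \<partial>M) = (\<integral>w. ?l (%C. F C + B) w - ?l (%_. B) w \<partial>M)" by (simp add: algebra_simps)
 also have "... = (\<integral>v. ?r (%C. F C + B) v \<partial>lborel) - (\<integral>v. ?r (%_. B) v \<partial>lborel)"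
  using p1 p2 F by (subst Bochner_Integration.integral_diff) auto
 also have "... = (\<integral>v. ?r (%C. F C + B) v - ?r (%_. B) v \<partial>lborel)"
  using p1 p2 F by (subst Bochner_Integration.integral_diff) auto
 also have "... = (\<integral>v. ?r F v \<partial>lborel)"
 proof (rule Bochner_Integration.integral_cong[OF refl])
  fix v :: real
  have "(\<integral>w. F (U v w) + B \<partial>M' v) = (\<integral>w. F (U v w) \<partial>M' v) + B" if v: "a < v"
  proof -
   interpret K: prob_space "M' v" by (rule K(1)[OF v])
   have "integrable (M' v) (%w. F (U v w))"
    using B[OF U\<omega>[OF v]] measurable_compose[OF K(2)[OF v] F] by (intro K.integrable_const_bound[of _ B]) (auto intro: AE_I2)
   then show ?thesis by (simp add: K.prob_space)
  qed
  moreover have "(\<integral>w. B \<partial>M' v) = B" if "a < v" using prob_space.prob_space[OF K(1)[OF that]] by simp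
  ultimately show "?r (%C. F C + B) v - ?r (%_. B) v = ?r F v" by (auto simp: algebra_simps)
 qed
 finally show ?thesis unfolding d_def .
qed

lemma Sz_le: "ennreal a <= Sz C \<longleftrightarrow> ennreal (a * (ln (real N))\<^sup>2 / (2 * pi)) <= csum (%l. ennreal (loop_local_time N z l)) C"
 if "0 < a"
proof -
 have "ennreal cN * Sz C = csum (%l. ennreal cN * (ennreal (loop_local_time N z l) / ennreal cN)) C"
  by (simp add: Sz_def collection_sum_cmult)
 also have "... = csum (%l. ennreal (loop_local_time N z l)) C"
  using cN by (simp add: ennreal_times_divide mult.commute[of "ennreal cN"] ennreal_mult_divide_eq)
 finally have "csum (%l. ennreal (loop_local_time N z l)) C = ennreal cN * Sz C" ..
 moreover have "ennreal (a * (ln (real N))\<^sup>2 / (2 * pi)) = ennreal cN * ennreal a"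
  using cN that by (simp add: cN_def ennreal_mult[symmetric] mult.commute)
 ultimately show ?thesis using cN by (simp add: ennreal_mult_le_mult_iff)
qed

lemma measure_thick_points:
 "measure (thick_points_measure N \<theta> a D C) {z} = ln (real N) powr (1 - \<theta>) / real N powr (2 - a) * (if ennreal a <= Sz C then 1 else 0)"
 if "0 < a"
proof -
 let ?w = "%z. ln (real N) powr (1 - \<theta>) / real N powr (2 - a) *
   (if csum (%l. ennreal (loop_local_time N z l)) C \<ge> ennreal (a * (ln (real N))\<^sup>2 / (2 * pi)) then 1 else 0)"
 have "emeasure (thick_points_measure N \<theta> a D C) {z} = (NI x. ennreal (?w x) * indicator {z} x;count_space D)"
  unfolding thick_points_measure_def point_measure_def using z by (subst emeasure_density) auto
 also have "... = ennreal (?w z)" using z by (subst nn_integral_indicator_singleton) auto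
 finally show ?thesis using Sz_le[OF that] by (simp add: measure_def)
qed

lemma qN_rr: "qN N D z * ln (real N) = rr" and qN_pos: "0 < qN N D z"
 using N mE by (simp_all add: qN_def green_eq rr_def cN_def power2_eq_square)

text \<open>The constant \<open>c0\<close> cancels:
  \<open>c0 powr r * CR N z D powr r = N powr r * exp (- (rr * r))\<close>. The exponents
  \<open>1 - \<theta>\<close> and \<open>\<theta>\<close> of log N, the latter from
  \<open>rr = qN N D z * ln N\<close>, leave a single factor log N.\<close>

lemma weight_eq:
 assumes "0 < r"
 shows "ln (real N) powr (1 - \<theta>) / real N powr (2 - a) * (rr powr \<theta> / Gamma \<theta> * (exp (- (rr * r)) * r powr (\<theta> - 1)))
  = qN N D z powr \<theta> * ln (real N) / ((real N)\<^sup>2 * Gamma \<theta>) *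
   (r powr (\<theta> - 1) * (c0 powr r / real N powr (r - a)) * CR N z D powr r)"
proof -
 have Np: "0 < real N" and ln: "0 < ln (real N)" using N by auto
 have c0: "0 < c0" by (simp add: c0_def)
 have "rr = (ln (real N))\<^sup>2 / (2 * pi * green N D z z)"
  using mE by (simp add: green_eq rr_def cN_def)
 then have CR: "CR N z D = real N / c0 * exp (- rr)" by (simp add: CR_def)
 have "c0 powr r * CR N z D powr r = real N powr r * exp (- (rr * r))"
  using c0 Np unfolding CR by (simp add: powr_mult powr_divide exp_powr_real mult.commute)
 then have 1: "c0 powr r / real N powr (r - a) * CR N z D powr r = real N powr a * exp (- (rr * r))"
  using Np by (simp add: powr_diff field_simps)
 have 2: "rr powr \<theta> = qN N D z powr \<theta> * ln (real N) powr \<theta>"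
  unfolding qN_rr[symmetric] using qN_pos ln by (simp add: powr_mult)
 have 3: "ln (real N) powr (1 - \<theta>) * ln (real N) powr \<theta> = ln (real N)" using ln by (simp add: powr_add[symmetric])
 have 4: "real N powr (2 - a) = (real N)\<^sup>2 / real N powr a" using Np by (simp add: powr_diff)
 have "ln (real N) powr (1 - \<theta>) / real N powr (2 - a) * (rr powr \<theta> / Gamma \<theta> * (exp (- (rr * r)) * r powr (\<theta> - 1)))
  = (ln (real N) powr (1 - \<theta>) * ln (real N) powr \<theta>) * qN N D z powr \<theta> / ((real N)\<^sup>2 * Gamma \<theta>) * (r powr (\<theta> - 1) * (real N powr a * exp (- (rr * r))))"
  unfolding 2 4 using Np by simp
 then show ?thesis unfolding 3 1[symmetric] by (simp add: mult_ac)
qed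

end

theorem proposition10p1:
  fixes N :: nat and \<theta> a :: real and D :: "point set" and z :: point
    and F :: "loop collection \<Rightarrow> real"
    and M :: "'w measure" and L :: "'w \<Rightarrow> loop collection"
    and P :: "real \<Rightarrow> 'p measure" and Exc :: "real \<Rightarrow> 'p \<Rightarrow> (real \<times> path) collection"
    and M' :: "real \<Rightarrow> 'v measure" and L' :: "real \<Rightarrow> 'v \<Rightarrow> loop collection"
    and A :: "real \<Rightarrow> 'v \<Rightarrow> nat \<Rightarrow> real" and X :: "real \<Rightarrow> nat \<Rightarrow> 'v \<Rightarrow> loop"
  assumes "N \<ge> 2" and "\<theta> > 0" and "a > 0"
    and "D \<subseteq> grid N" and "D \<noteq> {}" and "grid N - D \<noteq> {}" and "z \<in> D"
    and "F \<in> borel_measurable (collection_space (loop_space N))"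
    and "bounded (F ` space (collection_space (loop_space N)))"
    and "admissible N z F"
    and "loop_soup N \<theta> D M L"
    and "\<And>\<alpha>. \<alpha> > 0 \<Longrightarrow> poisson_point_process (P \<alpha>) (Exc \<alpha>) (Xi_intensity N D z \<alpha>)"
    and "\<And>\<rho>. \<rho> > a \<Longrightarrow> loop_soup N \<theta> (D - {z}) (M' \<rho>) (L' \<rho>)"
    and "\<And>\<rho>. \<rho> > a \<Longrightarrow> PD_partition \<theta> \<rho> (M' \<rho>) (A \<rho>)"
    and "\<And>\<rho>. \<rho> > a \<Longrightarrow> cond_indep_with_laws (M' \<rho>) (A \<rho>) (loop_space N)
           (\<lambda>\<alpha>. distr (P \<alpha>) (loop_space N) (\<lambda>\<omega>. Xi_loop N z \<alpha> (Exc \<alpha> \<omega>))) (X \<rho>)"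
    and "\<And>\<rho>. \<rho> > a \<Longrightarrow> independent_rvs (M' \<rho>) (collection_space (loop_space N)) (L' \<rho>)
           (\<Pi>\<^sub>M i\<in>UNIV. loop_space N) (\<lambda>\<omega> i. X \<rho> i \<omega>)"
  shows "(\<integral>\<omega>. F (L \<omega>) * measure (thick_points_measure N \<theta> a D (L \<omega>)) {z} \<partial>M)
       = qN N D z powr \<theta> * ln (real N) / ((real N)\<^sup>2 * Gamma \<theta>) *
         (LBINT \<rho>=a..\<infinity>. \<rho> powr (\<theta> - 1) * (c0 powr \<rho> / real N powr (\<rho> - a)) * CR N z D powr \<rho> *
            (\<integral>\<omega>. F (collection_union (L' \<rho> \<omega>) (collection_of UNIV (\<lambda>i. X \<rho> i \<omega>))) \<partial>M' \<rho>))"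
proof -
 interpret thick_point N D z \<theta> P Exc
  by unfold_locales (use assms in simp_all)
 define U where "U r v = collection_union (L' r v) (collection_of UNIV (%i. X r i v))" for r v
 have a: "0 < a" by fact
 have K: "prob_space (M' r)" "U r : M' r ->M CS"
  "f : bm LS ==> (NI v. en (csum f (U r v));M' r) = Lw f * Phi (gf f) r"
  if r: "a < r" for r f
 proof -
  have "0 < r" using a r by simp
  note union = union_law[OF this assms(13)[OF r] assms(14)[OF r] assms(15)[OF r] assms(16)[OF r], folded U_def]
  show "prob_space (M' r)" using assms(13)[OF r] by (simp add: loop_soup_def poisson_point_process_def)
  show "U r : M' r ->M CS" using union(1) by (simp add: U_def[abs_def])
  show "f : bm LS ==> (NI v. en (csum f (U r v));M' r) = Lw f * Phi (gf f) r" by (rule union(2))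
 qed
 obtain B where B: "!!C. C : collections LS ==> \<bar>F C\<bar> <= B"
  using assms(9) unfolding bounded_iff by auto
 let ?w = "ln (real N) powr (1 - \<theta>) / real N powr (2 - a)"
 let ?q = "qN N D z powr \<theta> * ln (real N) / ((real N)\<^sup>2 * Gamma \<theta>)"
 let ?d = "%r. rr powr \<theta> / Gamma \<theta> * (exp (- (rr * r)) * r powr (\<theta> - 1))"
 let ?e = "%r. r powr (\<theta> - 1) * (c0 powr r / real N powr (r - a)) * CR N z D powr r"
 have "(\<integral>v. F (L v) * measure (thick_points_measure N \<theta> a D (L v)) {z} \<partial>M)
   = (\<integral>v. ?w * (F (L v) * (if ennreal a <= Sz (L v) then 1 else 0)) \<partial>M)"
  by (simp add: measure_thick_points[OF a] mult_ac)
 also have "... = ?w * (\<integral>r. (if a < r then ?d r * (\<integral>v. F (U r v) \<partial>M' r) else 0) \<partial>lborel)"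
  by (subst integral_mult_right_zero, rule arg_cong[where f="%x. ?w * x"], rule mixture_law_real[OF assms(11) a K assms(8) B])
 also have "... = (\<integral>r. ?q * (if a < r then ?e r * (\<integral>v. F (U r v) \<partial>M' r) else 0) \<partial>lborel)"
 proof (subst integral_mult_right_zero[symmetric], rule Bochner_Integration.integral_cong[OF refl])
  fix r :: real
  show "?w * (if a < r then ?d r * (\<integral>v. F (U r v) \<partial>M' r) else 0) = ?q * (if a < r then ?e r * (\<integral>v. F (U r v) \<partial>M' r) else 0)"
  proof (cases "a < r")
   case True
   have "?w * ?d r = ?q * ?e r" by (rule weight_eq) (use True a in simp)
   then have "?w * (?d r * x) = ?q * (?e r * x)" for x by (simp only: mult.assoc[symmetric])
   then show ?thesis by (simp only: True if_True)
  qed simp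
 qed
 also have "... = ?q * (LBINT r=a..\<infinity>. ?e r * (\<integral>v. F (U r v) \<partial>M' r))"
  unfolding LBINT_Ioi by (rule integral_mult_right_zero)
 finally show ?thesis unfolding U_def .
qed

end
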